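(* Let $S$ be a smooth simply connected surface. Consider a complex metric $g$ on $S$, with induced Levi-Civita connection $\nabla$ and curvature $K_g$, and a $g$-self-adjoint bundle homomorphism $\Psi\colon \mathbb{C}TS\to\mathbb{C}TS$. The couple $(g,\Psi)$ satisfies 1) $d^{\nabla}\Psi\equiv 0$; 2) $K_g=-1+\det(\Psi)$ if and only if there exists an isometric immersion $\sigma\colon (S,g)\to SL(2,\mathbb{C})$ whose corresponding shape operator is $\Psi$. Such an immersion $\sigma$ is unique up to post-composition with elements of $\mathrm{Isom}_0(SL(2,\mathbb{C}))\cong (SL(2,\mathbb{C})\times SL(2,\mathbb{C}))/\{\pm(I_2,I_2)\}$.
   Context: $SL(2,\mathbb{C})$ carries the holomorphic Riemannian metric $\langle\cdot,\cdot\rangle$ (a holomorphically varying non-degenerate $\mathbb{C}$-bilinear symmetric form on the tangent spaces) given by $\langle AV,AW\rangle_A=\tfrac12\mathrm{tr}(VW)$ for $A\in SL(2,\mathbb C)$, $V,W\in\mathfrak{sl}(2,\mathbb{C})$, i.e. $\frac18$ of the Killing form; it has constant sectional curvature $-1$. $D$ is its Levi-Civita connection and $\mathbb J$ the complex structure of $SL(2,\mathbb C)$. $\mathrm{Isom}_0(SL(2,\mathbb C))$ is the identity component of its isometry group; the class of $(A,B)$ acts by $C\mapsto ACB^{-1}$. $\mathbb{C}TS=TS\otimes_{\mathbb R}\mathbb{C}$. A complex metric on $S$ is a smooth choice, for each $p\in S$, of a non-degenerate symmetric $\mathbb{C}$-bilinear form $g_p$ on $\mathbb{C}T_pS$. Its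 Levi-Civita connection $\nabla$ is the unique connection on $\mathbb{C}TS$ ($\mathbb C$-linear, with derivatives along sections of $\mathbb{C}TS$) which is torsion free and compatible with $g$. With $R(X,Y)Z=\nabla_X\nabla_YZ-\nabla_Y\nabla_XZ-\nabla_{[X,Y]}Z$, the curvature is $K_g=\dfrac{-g(R(X,Y)X,Y)}{g(X,X)g(Y,Y)-g(X,Y)^2}$ for any basis $X,Y$ of $\mathbb{C}T_pS$. Also $(d^\nabla\Psi)(X,Y)=\nabla_X(\Psi(Y))-\nabla_Y(\Psi(X))-\Psi([X,Y])$. The differential of an immersion $\sigma\colon S\to SL(2,\mathbb{C})$ is extended to $\mathbb{C}TS$ by $\sigma_*(X+iY)=\sigma_*X+\mathbb{J}\sigma_*Y$ for real $X,Y$. The immersion $\sigma\colon(S,g)\to SL(2,\mathbb{C})$ is isometric if $\langle\sigma_*X,\sigma_*Y\rangle=g(X,Y)$ for all $X,Y\in\mathbb{C}TS$. In that case $\mathbb{C}TS$ is identified with a subbundle of $\sigma^*T\,SL(2,\mathbb{C})$. A local normal vector field $\nu$ is a local section of $\sigma^*T\,SL(2,\mathbb{C})$ orthogonal to $\mathbb{C}TS$ with $\langle\nu,\nu\rangle=1$; there are two opposite choices. The shape operator is $\Psi=\overline\nabla\nu$, where $\overline\nabla=\sigma^*D$ (extended $\mathbb{C}$-linearly to derivatives along $\mathbb{C}TS$); equivalently $g(\Psi X,Y)=-\langle\overline\nabla_XY,\nu\rangle$. Like $\nu$, the shape operator is defined up to a sign.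
   Formalization: Uniqueness is stated for immersions whose unit normals are chosen so that both induce the same complex area form on S; without this it fails when Ψ is not zero, since composing with matrix inversion preserves g and Ψ but is not in the identity component. *)

theory Defs
  imports "HOL-Analysis.Analysis"
begin

section \<open>Smooth maps and smooth surfaces\<close>

primrec Ck_on :: "nat \<Rightarrow> ('e::euclidean_space \<Rightarrow> 'b::real_normed_vector) \<Rightarrow> 'e set \<Rightarrow> bool" where
  "Ck_on 0 f U \<longleftrightarrow> continuous_on U f"
| "Ck_on (Suc k) f U \<longleftrightarrow>
     f differentiable_on U \<and> (\<forall>v. Ck_on k (\<lambda>x. frechet_derivative f (at x) v) U)"

text \<open>Only used for open \<^term>\<open>U\<close>.\<close>

definition smooth_on :: "('e::euclidean_space \<Rightarrow> 'b::real_normed_vector) \<Rightarrow> 'e set \<Rightarrow> bool" where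
  "smooth_on f U \<longleftrightarrow> (\<forall>k. Ck_on k f U)"

type_synonym 'a atlas = "('a set \<times> ('a \<Rightarrow> real^2)) set"

text \<open>A surface is a subset \<^term>\<open>S\<close> of a topological space, with the subspace topology; every
  space is of this form, with \<^term>\<open>S = UNIV\<close>. Connectedness is not part of the definition.\<close>

definition smooth_surface :: "'a::topological_space set \<Rightarrow> 'a atlas \<Rightarrow> bool" where
  "smooth_surface S \<A> \<longleftrightarrow>
     Hausdorff_space (top_of_set S) \<and> second_countable (top_of_set S) \<and>
     (\<Union>(U, \<phi>)\<in>\<A>. U) = S \<and>
     (\<forall>(U, \<phi>)\<in>\<A>. openin (top_of_set S) U \<and> open (\<phi> ` U) \<and> (\<exists>\<psi>. homeomorphism U (\<phi> ` U) \<phi> \<psi>)) \<and>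
     (\<forall>(U, \<phi>)\<in>\<A>. \<forall>(V, \<psi>)\<in>\<A>. smooth_on (\<psi> \<circ> inv_into U \<phi>) (\<phi> ` (U \<inter> V)))"

text \<open>Functions, vector fields and tensors on an open subset of the surface are represented by total
  functions whose values outside that subset are irrelevant.\<close>

definition smooth_fun ::
    "'a::topological_space set \<Rightarrow> 'a atlas \<Rightarrow> 'a set \<Rightarrow> ('a \<Rightarrow> 'b::real_normed_vector) \<Rightarrow> bool" where
  "smooth_fun S \<A> U f \<longleftrightarrow>
     openin (top_of_set S) U \<and> (\<forall>(V, \<phi>)\<in>\<A>. smooth_on (f \<circ> inv_into V \<phi>) (\<phi> ` (U \<inter> V)))"

definition smooth_near ::
    "'a::topological_space set \<Rightarrow> 'a atlas \<Rightarrow> 'a \<Rightarrow> ('a \<Rightarrow> 'b::real_normed_vector) \<Rightarrow> bool" where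
  "smooth_near S \<A> p f \<longleftrightarrow> (\<exists>U. p \<in> U \<and> smooth_fun S \<A> U f)"


section \<open>The complexified tangent bundle\<close>

text \<open>Tangent vectors at \<^term>\<open>p\<close> are the derivations of the germs of smooth functions at \<^term>\<open>p\<close>.
  The value 0 on functions that are not smooth near \<^term>\<open>p\<close> makes the representing
  function unique. That the value depends only on the germ follows from the product rule.\<close>

type_synonym 'a rvec = "('a \<Rightarrow> real) \<Rightarrow> real"
type_synonym 'a cvec = "('a \<Rightarrow> complex) \<Rightarrow> complex"

definition tangent_space :: "'a::topological_space set \<Rightarrow> 'a atlas \<Rightarrow> 'a \<Rightarrow> 'a rvec set" where
  "tangent_space S \<A> p = {X.
     (\<forall>f. \<not> smooth_near S \<A> p f \<longrightarrow> X f = 0) \<and>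
     (\<forall>c f. smooth_near S \<A> p f \<longrightarrow> X (\<lambda>q. c * f q) = c * X f) \<and>
     (\<forall>f h. smooth_near S \<A> p f \<and> smooth_near S \<A> p h \<longrightarrow>
        X (\<lambda>q. f q + h q) = X f + X h \<and> X (\<lambda>q. f q * h q) = X f * h p + f p * X h)}"

text \<open>The vector $X + iY$, for real tangent vectors \<^term>\<open>X\<close> and \<^term>\<open>Y\<close>, as the complex-linear
  derivation of complex-valued germs that it induces.\<close>

definition cplx_vec ::
    "'a::topological_space set \<Rightarrow> 'a atlas \<Rightarrow> 'a \<Rightarrow> 'a rvec \<Rightarrow> 'a rvec \<Rightarrow> 'a cvec" where
  "cplx_vec S \<A> p X Y = (\<lambda>f. if smooth_near S \<A> p f
     then (of_real (X (Re \<circ> f)) + \<i> * of_real (X (Im \<circ> f)))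
          + \<i> * (of_real (Y (Re \<circ> f)) + \<i> * of_real (Y (Im \<circ> f)))
     else 0)"

abbreviation real_vec :: "'a::topological_space set \<Rightarrow> 'a atlas \<Rightarrow> 'a \<Rightarrow> 'a rvec \<Rightarrow> 'a cvec" where
  "real_vec S \<A> p X \<equiv> cplx_vec S \<A> p X (\<lambda>_. 0)"

definition ctangent_space :: "'a::topological_space set \<Rightarrow> 'a atlas \<Rightarrow> 'a \<Rightarrow> 'a cvec set" where
  "ctangent_space S \<A> p =
     {cplx_vec S \<A> p X Y | X Y. X \<in> tangent_space S \<A> p \<and> Y \<in> tangent_space S \<A> p}"

definition vzero :: "'a cvec" where "vzero = (\<lambda>f. 0)"
definition vadd :: "'a cvec \<Rightarrow> 'a cvec \<Rightarrow> 'a cvec" where "vadd v w = (\<lambda>f. v f + w f)"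
definition vsub :: "'a cvec \<Rightarrow> 'a cvec \<Rightarrow> 'a cvec" where "vsub v w = (\<lambda>f. v f - w f)"
definition vscale :: "complex \<Rightarrow> 'a cvec \<Rightarrow> 'a cvec" where "vscale c v = (\<lambda>f. c * v f)"

definition cbasis :: "'a cvec set \<Rightarrow> 'a cvec \<Rightarrow> 'a cvec \<Rightarrow> bool" where
  "cbasis V v w \<longleftrightarrow> v \<in> V \<and> w \<in> V \<and>
     (\<forall>u\<in>V. \<exists>!c. u = vadd (vscale (fst c) v) (vscale (snd c) w))"

definition cfield ::
    "'a::topological_space set \<Rightarrow> 'a atlas \<Rightarrow> 'a set \<Rightarrow> ('a \<Rightarrow> 'a cvec) \<Rightarrow> bool" where
  "cfield S \<A> U X \<longleftrightarrow> openin (top_of_set S) U \<and> (\<forall>p\<in>U. X p \<in> ctangent_space S \<A> p) \<and>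
     (\<forall>W f. W \<subseteq> U \<and> smooth_fun S \<A> W f \<longrightarrow> smooth_fun S \<A> W (\<lambda>p. X p f))"

definition lie_bracket ::
    "'a::topological_space set \<Rightarrow> 'a atlas \<Rightarrow> ('a \<Rightarrow> 'a cvec) \<Rightarrow> ('a \<Rightarrow> 'a cvec) \<Rightarrow> 'a \<Rightarrow> 'a cvec" where
  "lie_bracket S \<A> X Y p = (\<lambda>f. if smooth_near S \<A> p f
     then X p (\<lambda>q. Y q f) - Y p (\<lambda>q. X q f) else 0)"

definition clinear_on :: "'a cvec set \<Rightarrow> ('a cvec \<Rightarrow> complex) \<Rightarrow> bool" where
  "clinear_on V h \<longleftrightarrow> (\<forall>v\<in>V. \<forall>w\<in>V. h (vadd v w) = h v + h w) \<and>
     (\<forall>c. \<forall>v\<in>V. h (vscale c v) = c * h v)"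

definition cendo_on :: "'a cvec set \<Rightarrow> ('a cvec \<Rightarrow> 'a cvec) \<Rightarrow> bool" where
  "cendo_on V L \<longleftrightarrow> (\<forall>v\<in>V. L v \<in> V) \<and>
     (\<forall>v\<in>V. \<forall>w\<in>V. L (vadd v w) = vadd (L v) (L w)) \<and>
     (\<forall>c. \<forall>v\<in>V. L (vscale c v) = vscale c (L v))"

definition endo_det :: "'a cvec set \<Rightarrow> ('a cvec \<Rightarrow> 'a cvec) \<Rightarrow> complex" where
  "endo_det V L = (THE d. \<forall>v w. \<forall>M :: complex^2^2. cbasis V v w \<and>
     L v = vadd (vscale (M$1$1) v) (vscale (M$2$1) w) \<and>
     L w = vadd (vscale (M$1$2) v) (vscale (M$2$2) w) \<longrightarrow> d = det M)"


section \<open>Complex metrics, Levi-Civita connection, curvature\<close>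

type_synonym 'a cmetric = "'a \<Rightarrow> 'a cvec \<Rightarrow> 'a cvec \<Rightarrow> complex"

definition complex_metric ::
    "'a::topological_space set \<Rightarrow> 'a atlas \<Rightarrow> 'a cmetric \<Rightarrow> bool" where
  "complex_metric S \<A> g \<longleftrightarrow>
     (\<forall>p\<in>S. \<forall>v\<in>ctangent_space S \<A> p.
        clinear_on (ctangent_space S \<A> p) (g p v) \<and>
        (\<forall>w\<in>ctangent_space S \<A> p. g p v w = g p w v) \<and>
        ((\<forall>w\<in>ctangent_space S \<A> p. g p v w = 0) \<longrightarrow> v = vzero)) \<and>
     (\<forall>U X Y. cfield S \<A> U X \<and> cfield S \<A> U Y \<longrightarrow> smooth_fun S \<A> U (\<lambda>p. g p (X p) (Y p)))"

definition bundle_endo ::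
    "'a::topological_space set \<Rightarrow> 'a atlas \<Rightarrow> ('a \<Rightarrow> 'a cvec \<Rightarrow> 'a cvec) \<Rightarrow> bool" where
  "bundle_endo S \<A> \<Psi> \<longleftrightarrow>
     (\<forall>p\<in>S. cendo_on (ctangent_space S \<A> p) (\<Psi> p)) \<and>
     (\<forall>U X. cfield S \<A> U X \<longrightarrow> cfield S \<A> U (\<lambda>p. \<Psi> p (X p)))"

definition self_adjoint ::
    "'a::topological_space set \<Rightarrow> 'a atlas \<Rightarrow> 'a cmetric \<Rightarrow> ('a \<Rightarrow> 'a cvec \<Rightarrow> 'a cvec) \<Rightarrow> bool" where
  "self_adjoint S \<A> g \<Psi> \<longleftrightarrow>
     (\<forall>p\<in>S. \<forall>v\<in>ctangent_space S \<A> p. \<forall>w\<in>ctangent_space S \<A> p. g p (\<Psi> p v) w = g p v (\<Psi> p w))"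

text \<open>A connection acts on local sections: \<^term>\<open>nabla Y p v\<close> is the derivative at \<^term>\<open>p\<close>, in the
  direction \<^term>\<open>v\<close>, of the section \<^term>\<open>Y\<close> defined near \<^term>\<open>p\<close>.
  The locality clause says that the operators on different open sets are compatible with
  restriction.\<close>

type_synonym 'a cconn = "('a \<Rightarrow> 'a cvec) \<Rightarrow> 'a \<Rightarrow> 'a cvec \<Rightarrow> 'a cvec"

definition cconnection :: "'a::topological_space set \<Rightarrow> 'a atlas \<Rightarrow> 'a cconn \<Rightarrow> bool" where
  "cconnection S \<A> nabla \<longleftrightarrow>
     (\<forall>U Y. cfield S \<A> U Y \<longrightarrow>
        (\<forall>p\<in>U. cendo_on (ctangent_space S \<A> p) (nabla Y p)) \<and>
        (\<forall>X. cfield S \<A> U X \<longrightarrow> cfield S \<A> U (\<lambda>p. nabla Y p (X p))) \<and>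
        (\<forall>Z. cfield S \<A> U Z \<and> (\<forall>q\<in>U. Z q = Y q) \<longrightarrow>
           (\<forall>p\<in>U. \<forall>v\<in>ctangent_space S \<A> p. nabla Z p v = nabla Y p v)) \<and>
        (\<forall>Z. cfield S \<A> U Z \<longrightarrow>
           (\<forall>p\<in>U. \<forall>v\<in>ctangent_space S \<A> p.
              nabla (\<lambda>q. vadd (Y q) (Z q)) p v = vadd (nabla Y p v) (nabla Z p v))) \<and>
        (\<forall>f. smooth_fun S \<A> U f \<longrightarrow>
           (\<forall>p\<in>U. \<forall>v\<in>ctangent_space S \<A> p.
              nabla (\<lambda>q. vscale (f q) (Y q)) p v =
              vadd (vscale (v f) (Y p)) (vscale (f p) (nabla Y p v)))))"

definition levi_civita ::
    "'a::topological_space set \<Rightarrow> 'a atlas \<Rightarrow> 'a cmetric \<Rightarrow> 'a cconn \<Rightarrow> bool" where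
  "levi_civita S \<A> g nabla \<longleftrightarrow> cconnection S \<A> nabla \<and>
     (\<forall>U X Y. cfield S \<A> U X \<and> cfield S \<A> U Y \<longrightarrow>
        (\<forall>p\<in>U. vsub (nabla Y p (X p)) (nabla X p (Y p)) = lie_bracket S \<A> X Y p)) \<and>
     (\<forall>U Y Z. cfield S \<A> U Y \<and> cfield S \<A> U Z \<longrightarrow>
        (\<forall>p\<in>U. \<forall>v\<in>ctangent_space S \<A> p.
           v (\<lambda>q. g q (Y q) (Z q)) = g p (nabla Y p v) (Z p) + g p (Y p) (nabla Z p v)))"

definition curv ::
    "'a::topological_space set \<Rightarrow> 'a atlas \<Rightarrow> 'a cconn \<Rightarrow>
     ('a \<Rightarrow> 'a cvec) \<Rightarrow> ('a \<Rightarrow> 'a cvec) \<Rightarrow> ('a \<Rightarrow> 'a cvec) \<Rightarrow> 'a \<Rightarrow> 'a cvec" where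
  "curv S \<A> nabla X Y Z p =
     vsub (vsub (nabla (\<lambda>q. nabla Z q (Y q)) p (X p)) (nabla (\<lambda>q. nabla Z q (X q)) p (Y p)))
       (nabla Z p (lie_bracket S \<A> X Y p))"

definition gauss_curvature ::
    "'a::topological_space set \<Rightarrow> 'a atlas \<Rightarrow> 'a cmetric \<Rightarrow> 'a cconn \<Rightarrow> 'a \<Rightarrow> complex" where
  "gauss_curvature S \<A> g nabla p = (THE k. \<forall>U X Y.
     p \<in> U \<and> cfield S \<A> U X \<and> cfield S \<A> U Y \<and> cbasis (ctangent_space S \<A> p) (X p) (Y p) \<longrightarrow>
     k = - g p (curv S \<A> nabla X Y X p) (Y p) /
         (g p (X p) (X p) * g p (Y p) (Y p) - (g p (X p) (Y p))\<^sup>2))"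

definition d_nabla ::
    "'a::topological_space set \<Rightarrow> 'a atlas \<Rightarrow> 'a cconn \<Rightarrow> ('a \<Rightarrow> 'a cvec \<Rightarrow> 'a cvec) \<Rightarrow>
     ('a \<Rightarrow> 'a cvec) \<Rightarrow> ('a \<Rightarrow> 'a cvec) \<Rightarrow> 'a \<Rightarrow> 'a cvec" where
  "d_nabla S \<A> nabla \<Psi> X Y p =
     vsub (vsub (nabla (\<lambda>q. \<Psi> q (Y q)) p (X p)) (nabla (\<lambda>q. \<Psi> q (X q)) p (Y p)))
       (\<Psi> p (lie_bracket S \<A> X Y p))"


section \<open>The group $SL(2,C)$ with its holomorphic Riemannian metric\<close>

type_synonym cmat = "complex^2^2"

definition SL2 :: "cmat set" where "SL2 = {A. det A = 1}"

definition SL2_tangent :: "cmat \<Rightarrow> cmat set" where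
  "SL2_tangent A = {A ** V | V. trace V = 0}"

definition SL2_metric :: "cmat \<Rightarrow> cmat \<Rightarrow> cmat \<Rightarrow> complex" where
  "SL2_metric A X Y = trace ((matrix_inv A ** X) ** (matrix_inv A ** Y)) / 2"

definition SL2_smooth :: "cmat set \<Rightarrow> (cmat \<Rightarrow> 'b::real_normed_vector) \<Rightarrow> bool" where
  "SL2_smooth W F \<longleftrightarrow> openin (top_of_set SL2) W \<and>
     (\<forall>A\<in>W. \<exists>N G. open N \<and> A \<in> N \<and> smooth_on G N \<and> (\<forall>B\<in>N \<inter> W. G B = F B))"

text \<open>The differential of \<^term>\<open>F\<close> along the submanifold; it is only meaningful for
  \<^term>\<open>v \<in> SL2_tangent A\<close>, where the derivative within the submanifold is unique.\<close>

definition SL2_diff :: "(cmat \<Rightarrow> 'b::real_normed_vector) \<Rightarrow> cmat \<Rightarrow> cmat \<Rightarrow> 'b" where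
  "SL2_diff F A v = frechet_derivative F (at A within SL2) v"

definition SL2_field :: "cmat set \<Rightarrow> (cmat \<Rightarrow> cmat) \<Rightarrow> bool" where
  "SL2_field W Y \<longleftrightarrow> SL2_smooth W Y \<and> (\<forall>A\<in>W. Y A \<in> SL2_tangent A)"

text \<open>An affine connection on the real manifold underlying $SL(2,C)$, acting on smooth local
  vector fields; \<^term>\<open>D Y A v\<close> is the derivative of \<^term>\<open>Y\<close> at \<^term>\<open>A\<close> in the direction
  \<^term>\<open>v\<close>.\<close>

type_synonym SL2_conn = "(cmat \<Rightarrow> cmat) \<Rightarrow> cmat \<Rightarrow> cmat \<Rightarrow> cmat"

definition SL2_connection :: "SL2_conn \<Rightarrow> bool" where
  "SL2_connection D \<longleftrightarrow>
     (\<forall>W Y. SL2_field W Y \<longrightarrow>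
        (\<forall>A\<in>W. \<forall>v\<in>SL2_tangent A. D Y A v \<in> SL2_tangent A \<and>
           (\<forall>w\<in>SL2_tangent A. D Y A (v + w) = D Y A v + D Y A w) \<and>
           (\<forall>c::real. D Y A (c *\<^sub>R v) = c *\<^sub>R D Y A v)) \<and>
        (\<forall>X. SL2_field W X \<longrightarrow> SL2_field W (\<lambda>A. D Y A (X A))) \<and>
        (\<forall>Z. SL2_field W Z \<and> (\<forall>B\<in>W. Z B = Y B) \<longrightarrow>
           (\<forall>A\<in>W. \<forall>v\<in>SL2_tangent A. D Z A v = D Y A v)) \<and>
        (\<forall>Z. SL2_field W Z \<longrightarrow>
           (\<forall>A\<in>W. \<forall>v\<in>SL2_tangent A. D (\<lambda>B. Y B + Z B) A v = D Y A v + D Z A v)) \<and>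
        (\<forall>f :: cmat \<Rightarrow> real. SL2_smooth W f \<longrightarrow>
           (\<forall>A\<in>W. \<forall>v\<in>SL2_tangent A.
              D (\<lambda>B. f B *\<^sub>R Y B) A v = SL2_diff f A v *\<^sub>R Y A + f A *\<^sub>R D Y A v)))"

text \<open>The Lie bracket of vector fields tangent to a submanifold of a vector space is the difference
  of the derivatives of the vector-valued maps.\<close>

definition SL2_levi_civita :: "SL2_conn \<Rightarrow> bool" where
  "SL2_levi_civita D \<longleftrightarrow> SL2_connection D \<and>
     (\<forall>W X Y. SL2_field W X \<and> SL2_field W Y \<longrightarrow>
        (\<forall>A\<in>W. D Y A (X A) - D X A (Y A) = SL2_diff Y A (X A) - SL2_diff X A (Y A))) \<and>
     (\<forall>W Y Z. SL2_field W Y \<and> SL2_field W Z \<longrightarrow>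
        (\<forall>A\<in>W. \<forall>v\<in>SL2_tangent A.
           SL2_diff (\<lambda>B. SL2_metric B (Y B) (Z B)) A v =
           SL2_metric A (D Y A v) (Z A) + SL2_metric A (Y A) (D Z A v)))"

definition SL2_isometry :: "(cmat \<Rightarrow> cmat) \<Rightarrow> bool" where
  "SL2_isometry F \<longleftrightarrow> bij_betw F SL2 SL2 \<and> SL2_smooth SL2 F \<and> SL2_smooth SL2 (inv_into SL2 F) \<and>
     (\<forall>A\<in>SL2. \<forall>v\<in>SL2_tangent A. \<forall>w\<in>SL2_tangent A.
        SL2_metric (F A) (SL2_diff F A v) (SL2_diff F A w) = SL2_metric A v w)"

text \<open>The identity component of the isometry group. The group is a Lie group in the compact-open
  topology, so this is the path component of the identity; a path of maps is a homotopy because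
  \<^term>\<open>SL2\<close> is locally compact.\<close>

definition Isom0_SL2 :: "(cmat \<Rightarrow> cmat) set" where
  "Isom0_SL2 = {F. homotopic_with SL2_isometry (top_of_set SL2) (top_of_set SL2) id F}"

definition SL2_action :: "cmat \<Rightarrow> cmat \<Rightarrow> cmat \<Rightarrow> cmat" where
  "SL2_action A B C = A ** C ** matrix_inv B"


section \<open>Isometric immersions and shape operators\<close>

text \<open>The differential of \<^term>\<open>\<sigma>\<close>, applied to each matrix entry. As a complex tangent vector is a
  complex-linear derivation and the complex structure of the target multiplies matrices by
  \<^term>\<open>\<i>\<close>, this is the extension sending $X + iY$ to the image of $X$ plus \<^term>\<open>\<i>\<close> times the
  image of $Y$.\<close>

definition pushforward :: "('a \<Rightarrow> cmat) \<Rightarrow> 'a cvec \<Rightarrow> cmat" where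
  "pushforward \<sigma> v = (\<chi> i j. v (\<lambda>q. \<sigma> q $ i $ j))"

definition immersion ::
    "'a::topological_space set \<Rightarrow> 'a atlas \<Rightarrow> ('a \<Rightarrow> cmat) \<Rightarrow> bool" where
  "immersion S \<A> \<sigma> \<longleftrightarrow> \<sigma> ` S \<subseteq> SL2 \<and> smooth_fun S \<A> S \<sigma> \<and>
     (\<forall>p\<in>S. inj_on (\<lambda>X. pushforward \<sigma> (real_vec S \<A> p X)) (tangent_space S \<A> p))"

definition isometric_immersion ::
    "'a::topological_space set \<Rightarrow> 'a atlas \<Rightarrow> 'a cmetric \<Rightarrow> ('a \<Rightarrow> cmat) \<Rightarrow> bool" where
  "isometric_immersion S \<A> g \<sigma> \<longleftrightarrow> immersion S \<A> \<sigma> \<and>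
     (\<forall>p\<in>S. \<forall>v\<in>ctangent_space S \<A> p. \<forall>w\<in>ctangent_space S \<A> p.
        SL2_metric (\<sigma> p) (pushforward \<sigma> v) (pushforward \<sigma> w) = g p v w)"

definition field_along ::
    "'a::topological_space set \<Rightarrow> 'a atlas \<Rightarrow> ('a \<Rightarrow> cmat) \<Rightarrow> 'a set \<Rightarrow> ('a \<Rightarrow> cmat) \<Rightarrow> bool" where
  "field_along S \<A> \<sigma> U s \<longleftrightarrow> smooth_fun S \<A> U s \<and> (\<forall>p\<in>U. s p \<in> SL2_tangent (\<sigma> p))"

text \<open>The pull-back of \<^term>\<open>D\<close> by \<^term>\<open>\<sigma>\<close>, extended complex-linearly to derivatives along the
  complexified tangent bundle. Left multiplication by \<^term>\<open>mat c\<close> is scaling by \<^term>\<open>c\<close>. The last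
  clause, for real tangent vectors \<^term>\<open>X\<close>, is the property defining the pull-back.\<close>

type_synonym 'a conn_along = "('a \<Rightarrow> cmat) \<Rightarrow> 'a \<Rightarrow> 'a cvec \<Rightarrow> cmat"

definition pullback_connection ::
    "'a::topological_space set \<Rightarrow> 'a atlas \<Rightarrow> SL2_conn \<Rightarrow> ('a \<Rightarrow> cmat) \<Rightarrow> 'a conn_along \<Rightarrow> bool" where
  "pullback_connection S \<A> D \<sigma> Db \<longleftrightarrow>
     (\<forall>U s. field_along S \<A> \<sigma> U s \<longrightarrow>
        (\<forall>p\<in>U. \<forall>v\<in>ctangent_space S \<A> p. Db s p v \<in> SL2_tangent (\<sigma> p) \<and>
           (\<forall>w\<in>ctangent_space S \<A> p. Db s p (vadd v w) = Db s p v + Db s p w) \<and>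
           (\<forall>c. Db s p (vscale c v) = mat c ** Db s p v)) \<and>
        (\<forall>X. cfield S \<A> U X \<longrightarrow> field_along S \<A> \<sigma> U (\<lambda>p. Db s p (X p))) \<and>
        (\<forall>t. field_along S \<A> \<sigma> U t \<and> (\<forall>q\<in>U. t q = s q) \<longrightarrow>
           (\<forall>p\<in>U. \<forall>v\<in>ctangent_space S \<A> p. Db t p v = Db s p v)) \<and>
        (\<forall>t. field_along S \<A> \<sigma> U t \<longrightarrow>
           (\<forall>p\<in>U. \<forall>v\<in>ctangent_space S \<A> p. Db (\<lambda>q. s q + t q) p v = Db s p v + Db t p v)) \<and>
        (\<forall>f. smooth_fun S \<A> U f \<longrightarrow>
           (\<forall>p\<in>U. \<forall>v\<in>ctangent_space S \<A> p.
              Db (\<lambda>q. mat (f q) ** s q) p v = mat (v f) ** s p + mat (f p) ** Db s p v))) \<and>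
     (\<forall>U W Y. openin (top_of_set S) U \<and> \<sigma> ` U \<subseteq> W \<and> SL2_field W Y \<longrightarrow>
        (\<forall>p\<in>U. \<forall>X\<in>tangent_space S \<A> p.
           Db (Y \<circ> \<sigma>) p (real_vec S \<A> p X) = D Y (\<sigma> p) (pushforward \<sigma> (real_vec S \<A> p X))))"

definition unit_normal ::
    "'a::topological_space set \<Rightarrow> 'a atlas \<Rightarrow> ('a \<Rightarrow> cmat) \<Rightarrow> 'a set \<Rightarrow> ('a \<Rightarrow> cmat) \<Rightarrow> bool" where
  "unit_normal S \<A> \<sigma> U \<nu> \<longleftrightarrow> field_along S \<A> \<sigma> U \<nu> \<and>
     (\<forall>p\<in>U. SL2_metric (\<sigma> p) (\<nu> p) (\<nu> p) = 1 \<and>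
        (\<forall>v\<in>ctangent_space S \<A> p. SL2_metric (\<sigma> p) (pushforward \<sigma> v) (\<nu> p) = 0))"

text \<open>On a simply connected surface a normal field can be chosen globally. The two choices of
  \<^term>\<open>\<nu>\<close> give opposite shape operators.\<close>

definition shape_operator ::
    "'a::topological_space set \<Rightarrow> 'a atlas \<Rightarrow> SL2_conn \<Rightarrow> ('a \<Rightarrow> cmat) \<Rightarrow> ('a \<Rightarrow> cmat) \<Rightarrow>
     ('a \<Rightarrow> 'a cvec \<Rightarrow> 'a cvec) \<Rightarrow> bool" where
  "shape_operator S \<A> D \<sigma> \<nu> \<Psi> \<longleftrightarrow> unit_normal S \<A> \<sigma> S \<nu> \<and>
     (\<exists>Db. pullback_connection S \<A> D \<sigma> Db \<and>
        (\<forall>p\<in>S. \<forall>v\<in>ctangent_space S \<A> p. pushforward \<sigma> (\<Psi> p v) = Db \<nu> p v))"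

text \<open>The complex volume form of \<^const>\<open>SL2_metric\<close>: $tr(UVW)$ is alternating on traceless 2 by 2
  matrices, and the Pauli matrices, which are orthonormal, have volume 1. It is invariant under
  \<^const>\<open>SL2_action\<close>; matrix inversion is an isometry that reverses its sign.\<close>

definition SL2_volume :: "cmat \<Rightarrow> cmat \<Rightarrow> cmat \<Rightarrow> cmat \<Rightarrow> complex" where
  "SL2_volume A X Y Z =
     trace ((matrix_inv A ** X) ** (matrix_inv A ** Y) ** (matrix_inv A ** Z)) / (2 * \<i>)"

text \<open>The sign choices of the normals of two immersions correspond to each other when they induce the
  same complex area form on the surface. Without this, congruence of two immersions with equal data
  would only hold up to orientation-reversing isometries: composing an immersion with matrix
  inversion changes neither the induced metric nor, for the image of the normal field, the shape
  operator.\<close>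

definition corresponding_normals ::
    "'a::topological_space set \<Rightarrow> 'a atlas \<Rightarrow> ('a \<Rightarrow> cmat) \<Rightarrow> ('a \<Rightarrow> cmat) \<Rightarrow>
     ('a \<Rightarrow> cmat) \<Rightarrow> ('a \<Rightarrow> cmat) \<Rightarrow> bool" where
  "corresponding_normals S \<A> \<sigma> \<nu> \<sigma>' \<nu>' \<longleftrightarrow>
     (\<forall>p\<in>S. \<forall>v\<in>ctangent_space S \<A> p. \<forall>w\<in>ctangent_space S \<A> p.
        SL2_volume (\<sigma> p) (pushforward \<sigma> v) (pushforward \<sigma> w) (\<nu> p) =
        SL2_volume (\<sigma>' p) (pushforward \<sigma>' v) (pushforward \<sigma>' w) (\<nu>' p))"

end

theory Submission
  imports Defs
begin

text \<open>The group $SL(2,C)$ is the quadric $\langle A,A\rangle = -1$ in the space of matrices with the complex bilinear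
  form polarizing $-\det$, so its Levi-Civita connection is the orthogonal projection of the flat
  one. In a chart, an immersion $\sigma$ with normal $\nu$ and the prescribed metric and shape operator is therefore
  the same as a solution $(\sigma, \sigma_1, \sigma_2, \nu)$ of a linear system with a prescribed Gram matrix. The system
  preserves the Gram relations and is flat exactly when the Gauss and Codazzi equations hold. Hence every
  initial frame at a point extends uniquely to a convex chart domain, and, as the surface is simply
  connected, to the whole surface.

  For uniqueness, the frames of two solutions at one point are moved to the identity by left translation.
  Two orthonormal frames of traceless matrices with the same volume are conjugate, like any two triples of
  Pauli matrices, so that an element of the group acting from both sides matches the two frames; by
  uniqueness for the linear system it matches the two immersions everywhere.\<close>

section \<open>Calculus of smooth maps\<close>

text \<open>All geometric objects enter through axioms: tangent vectors as derivations,
  \<open>nabla\<close>, \<open>D\<close> and the pull-back connection as operators on local fields,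
  curvature and determinant as definite descriptions. Each has to be computed in a chart before any
  analysis. Hadamard's lemma does this for derivations. For connections the recurring device is that
  a trilinear expression, symmetric in one pair of slots and skew in an overlapping pair, vanishes:
  it identifies \<open>D\<close> with the projected flat derivative, and the tangential part of the
  second derivatives of an immersion with the Christoffel symbols of \<open>nabla\<close>. After
  that, both directions of the equivalence are statements about \<open>gsol\<close>. The metric is
  complex, so there is no signature: every nondegenerate form is a sum of two squares, which is why
  an adapted frame exists at a first point. The \<open>- 1\<close> in the Gauss equation is the
  contribution of the position vector \<open>\<sigma>\<close>, itself a normal of the quadric with
  square \<open>- 1\<close>. Continuation over the surface is done on first-order jets, because a
  frame refers to a chart while a jet does not.\<close>

lemma Ck_on_cong:
  assumes "open U" "\<And>x. x \<in> U \<Longrightarrow> f x = g x" "Ck_on k f U"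
  shows "Ck_on k g U"
  using assms(2,3)
proof (induction k arbitrary: f g)
  case 0
  then show ?case using continuous_on_cong by fastforce
next
  case (Suc k)
  have d: "f differentiable (at x)" if "x \<in> U" for x
    using Suc.prems(2) that assms(1) by (simp add: differentiable_on_eq_differentiable_at)
  have fd: "frechet_derivative f (at x) = frechet_derivative g (at x)" if "x \<in> U" for x
    using frechet_derivative_transform_within_open[OF d assms(1)] that Suc.prems(1) by metis
  have "g differentiable_on U"
    using Suc.prems by (simp add: differentiable_on_def) (metis differentiable_transform_within zero_less_one)
  moreover have "Ck_on k (\<lambda>x. frechet_derivative g (at x) v) U" for v
    using Suc.IH[of "\<lambda>x. frechet_derivative f (at x) v"] Suc.prems(2) fd by simp
  ultimately show ?case by simp
qed

lemma Ck_on_subset: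
  assumes "V \<subseteq> U" "Ck_on k f U"
  shows "Ck_on k f V"
  using assms(2)
proof (induction k arbitrary: f)
  case 0
  then show ?case using assms(1) continuous_on_subset by auto
next
  case (Suc k)
  then show ?case using assms(1) differentiable_on_subset by auto
qed

text \<open>\<open>Ck_on\<close> is defined through the chosen \<open>frechet_derivative\<close>. On
  an open set the derivative is unique, so any explicit formula for it may be used in
  inductions.\<close>

lemma Ck_on_SucI:
  assumes "open U" "\<And>x. x \<in> U \<Longrightarrow> (f has_derivative f' x) (at x)"
    "\<And>v. Ck_on k (\<lambda>x. f' x v) U"
  shows "Ck_on (Suc k) f U"
proof -
  have "f differentiable_on U"
    using assms(1,2) by (auto simp: differentiable_on_eq_differentiable_at differentiable_def)
  moreover have "f' x = frechet_derivative f (at x)" if "x \<in> U" for x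
    using frechet_derivative_at assms(2) that by blast
  then have "Ck_on k (\<lambda>x. frechet_derivative f (at x) v) U" for v
    using Ck_on_cong[OF assms(1) _ assms(3)[of v]] by simp
  ultimately show ?thesis by simp
qed

lemma Ck_on_SucD:
  assumes "open U" "Ck_on (Suc k) f U" "x \<in> U"
  shows "(f has_derivative frechet_derivative f (at x)) (at x)"
  using assms by (simp add: differentiable_on_eq_differentiable_at frechet_derivative_works)

lemma Ck_on_Suc_imp:
  assumes "Ck_on (Suc k) f U"
  shows "Ck_on k f U"
  using assms
proof (induction k arbitrary: f)
  case 0
  then show ?case using differentiable_imp_continuous_on by auto
next
  case (Suc k)
  then show ?case by (metis Ck_on.simps(2))
qed

lemma Ck_on_local:
  assumes "open U" "\<And>x. x \<in> U \<Longrightarrow> \<exists>N. open N \<and> x \<in> N \<and> Ck_on k f N"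
  shows "Ck_on k f U"
  using assms(2)
proof (induction k arbitrary: f)
  case 0
  have "isCont f x" if "x \<in> U" for x
    using 0[OF that] by (auto simp: continuous_on_eq_continuous_at)
  then show ?case using continuous_at_imp_continuous_on by auto
next
  case (Suc k)
  have "f differentiable (at x)" if "x \<in> U" for x
    using Suc.prems[OF that] by (auto simp: differentiable_on_eq_differentiable_at)
  then have "f differentiable_on U"
    by (simp add: assms(1) differentiable_on_eq_differentiable_at)
  moreover have "Ck_on k (\<lambda>x. frechet_derivative f (at x) v) U" for v
  proof (rule Suc.IH)
    fix x assume "x \<in> U"
    then obtain N where "open N" "x \<in> N" "Ck_on (Suc k) f N" using Suc.prems by blast
    then show "\<exists>N. open N \<and> x \<in> N \<and> Ck_on k (\<lambda>x. frechet_derivative f (at x) v) N" by auto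
  qed
  ultimately show ?case by simp
qed

lemma Ck_on_const: "Ck_on k (\<lambda>x. c) U"
proof (induction k arbitrary: c)
  case (Suc k)
  have "frechet_derivative (\<lambda>x. c) (at x) = (\<lambda>h. 0)" for x :: 'a and c :: 'b
    using frechet_derivative_at[OF has_derivative_const] by metis
  then show ?case using Suc by simp
qed simp

lemma Ck_on_bounded_linear:
  assumes "open U" "bounded_linear L" "Ck_on k f U"
  shows "Ck_on k (\<lambda>x. L (f x)) U"
  using assms(3)
proof (induction k arbitrary: f)
  case 0
  then show ?case using assms(2) bounded_linear.continuous_on by auto
next
  case (Suc k)
  show ?case
  proof (rule Ck_on_SucI[OF assms(1)])
    show "((\<lambda>x. L (f x)) has_derivative (\<lambda>h. L (frechet_derivative f (at x) h))) (at x)" if "x \<in> U" for x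
      using bounded_linear.has_derivative[OF assms(2) Ck_on_SucD[OF assms(1) Suc.prems that]] .
    show "Ck_on k (\<lambda>x. L (frechet_derivative f (at x) v)) U" for v
      using Suc by simp
  qed
qed

lemma Ck_on_add:
  assumes "open U" "Ck_on k f U" "Ck_on k g U"
  shows "Ck_on k (\<lambda>x. f x + g x) U"
  using assms(2,3)
proof (induction k arbitrary: f g)
  case 0
  then show ?case by (simp add: continuous_on_add)
next
  case (Suc k)
  show ?case
  proof (rule Ck_on_SucI[OF assms(1)])
    show "((\<lambda>x. f x + g x) has_derivative
        (\<lambda>h. frechet_derivative f (at x) h + frechet_derivative g (at x) h)) (at x)" if "x \<in> U" for x
      using Suc.prems that assms(1) by (intro has_derivative_add Ck_on_SucD)
    show "Ck_on k (\<lambda>x. frechet_derivative f (at x) v + frechet_derivative g (at x) v) U" for v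
      using Suc by simp
  qed
qed

lemma Ck_on_bilinear:
  assumes "open U" "bounded_bilinear pr" "Ck_on k f U" "Ck_on k g U"
  shows "Ck_on k (\<lambda>x. pr (f x) (g x)) U"
  using assms(3,4)
proof (induction k arbitrary: f g)
  case 0
  then show ?case using bounded_bilinear.continuous_on[OF assms(2)] by auto
next
  case (Suc k)
  show ?case
  proof (rule Ck_on_SucI[OF assms(1)])
    show "((\<lambda>x. pr (f x) (g x)) has_derivative
        (\<lambda>h. pr (f x) (frechet_derivative g (at x) h) + pr (frechet_derivative f (at x) h) (g x))) (at x)"
      if "x \<in> U" for x
      using Suc.prems that assms(1) by (intro bounded_bilinear.FDERIV[OF assms(2)] Ck_on_SucD)
    show "Ck_on k (\<lambda>x. pr (f x) (frechet_derivative g (at x) v) + pr (frechet_derivative f (at x) v) (g x)) U" for v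
      using Suc Ck_on_Suc_imp[OF Suc.prems(1)] Ck_on_Suc_imp[OF Suc.prems(2)]
      by (intro Ck_on_add[OF assms(1)]) auto
  qed
qed

lemma Ck_on_sum:
  assumes "open U" "\<And>i. i \<in> I \<Longrightarrow> Ck_on k (f i) U"
  shows "Ck_on k (\<lambda>x. \<Sum>i\<in>I. f i x) U"
  using assms(2)
proof (induction I rule: infinite_finite_induct)
  case (insert i I)
  then have "Ck_on k (\<lambda>x. f i x + (\<Sum>i\<in>I. f i x)) U"
    by (intro Ck_on_add[OF assms(1)]) auto
  then show ?case using insert by simp
qed (simp_all add: Ck_on_const)

text \<open>The chain rule, expanded over the basis, gives components of the derivative of
  \<open>f\<close> times partial derivatives of \<open>g\<close> composed with the same
  \<open>f\<close>. Hence the induction keeps \<open>f\<close> fixed and \<open>g\<close>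
  arbitrary.\<close>

lemma Ck_on_compose:
  fixes g :: "'b::euclidean_space \<Rightarrow> 'c::real_normed_vector"
  assumes "open U" "open V" "Ck_on k f U" "f ` U \<subseteq> V" "Ck_on k g V"
  shows "Ck_on k (g \<circ> f) U"
  using assms(3,5)
proof (induction k arbitrary: g)
  case 0
  then have "continuous_on (f ` U) g" using assms(4) continuous_on_subset by auto
  then show ?case using continuous_on_compose[of U f g] 0(1) by simp
next
  case (Suc k)
  show ?case
  proof (rule Ck_on_SucI[OF assms(1)])
    fix x assume x: "x \<in> U"
    let ?Df = "frechet_derivative f (at x)" and ?Dg = "frechet_derivative g (at (f x))"
    have g: "(g has_derivative ?Dg) (at (f x))"
      using Ck_on_SucD[OF assms(2) Suc.prems(2)] x assms(4) by auto
    have "(g \<circ> f has_derivative ?Dg \<circ> ?Df) (at x)"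
      using g Ck_on_SucD[OF assms(1) Suc.prems(1) x] by (rule diff_chain_at[rotated])
    moreover have *: "?Dg w = (\<Sum>b\<in>Basis. (w \<bullet> b) *\<^sub>R ?Dg b)" for w
    proof -
      have "?Dg w = ?Dg (\<Sum>b\<in>Basis. (w \<bullet> b) *\<^sub>R b)" by (simp add: euclidean_representation)
      then show ?thesis
        using has_derivative_linear[OF g] by (simp add: linear_sum linear_scale)
    qed
    have "?Dg \<circ> ?Df = (\<lambda>h. \<Sum>b\<in>Basis. (?Df h \<bullet> b) *\<^sub>R ?Dg b)"
      by (rule ext) (subst o_apply, rule *)
    ultimately show "(g \<circ> f has_derivative (\<lambda>h. \<Sum>b\<in>Basis. (?Df h \<bullet> b) *\<^sub>R ?Dg b)) (at x)" by simp
  next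
    fix v
    have "Ck_on k (\<lambda>x. frechet_derivative f (at x) v \<bullet> b) U" for b
      using Suc.prems(1) Ck_on_bounded_linear[OF assms(1) bounded_linear_inner_left] by auto
    moreover have "Ck_on k ((\<lambda>y. frechet_derivative g (at y) b) \<circ> f) U" for b
      using Suc.IH[OF Ck_on_Suc_imp[OF Suc.prems(1)], of "\<lambda>y. frechet_derivative g (at y) b"] Suc.prems(2) by (simp add: o_def)
    ultimately show "Ck_on k (\<lambda>x. \<Sum>b\<in>Basis. (frechet_derivative f (at x) v \<bullet> b) *\<^sub>R frechet_derivative g (at (f x)) b) U"
      by (intro Ck_on_sum[OF assms(1)] Ck_on_bilinear[OF assms(1) bounded_bilinear_scaleR]) (auto simp: o_def)
  qed
qed

lemma smooth_on_cong: "open U \<Longrightarrow> (\<And>x. x \<in> U \<Longrightarrow> f x = g x) \<Longrightarrow> smooth_on f U \<Longrightarrow> smooth_on g U"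
  unfolding smooth_on_def using Ck_on_cong[of U f g] by simp

lemma smooth_on_subset: "smooth_on f U \<Longrightarrow> V \<subseteq> U \<Longrightarrow> smooth_on f V"
  unfolding smooth_on_def by (intro allI) (rule Ck_on_subset, assumption, simp)

lemma smooth_on_local:
  "open U \<Longrightarrow> (\<And>x. x \<in> U \<Longrightarrow> \<exists>N. open N \<and> x \<in> N \<and> smooth_on f N) \<Longrightarrow> smooth_on f U"
  unfolding smooth_on_def by (intro allI) (rule Ck_on_local; meson)

lemma smooth_on_const [simp]: "smooth_on (\<lambda>x. c) U"
  unfolding smooth_on_def by (intro allI) (rule Ck_on_const; simp)

lemma smooth_on_linear_compose:
  "open U \<Longrightarrow> bounded_linear L \<Longrightarrow> smooth_on f U \<Longrightarrow> smooth_on (\<lambda>x. L (f x)) U"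
  unfolding smooth_on_def by (intro allI) (rule Ck_on_bounded_linear; simp)

lemma smooth_on_add: "open U \<Longrightarrow> smooth_on f U \<Longrightarrow> smooth_on g U \<Longrightarrow> smooth_on (\<lambda>x. f x + g x) U"
  unfolding smooth_on_def by (intro allI) (rule Ck_on_add; simp)

lemma smooth_on_bilinear:
  "open U \<Longrightarrow> bounded_bilinear pr \<Longrightarrow> smooth_on f U \<Longrightarrow> smooth_on g U \<Longrightarrow> smooth_on (\<lambda>x. pr (f x) (g x)) U"
  unfolding smooth_on_def by (intro allI) (rule Ck_on_bilinear; simp)

lemma smooth_on_sum:
  "open U \<Longrightarrow> (\<And>i. i \<in> I \<Longrightarrow> smooth_on (f i) U) \<Longrightarrow> smooth_on (\<lambda>x. \<Sum>i\<in>I. f i x) U"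
  unfolding smooth_on_def by (intro allI) (rule Ck_on_sum; simp)

lemma smooth_on_compose:
  fixes g :: "'b::euclidean_space \<Rightarrow> 'c::real_normed_vector"
  shows "open U \<Longrightarrow> open V \<Longrightarrow> smooth_on f U \<Longrightarrow> f ` U \<subseteq> V \<Longrightarrow> smooth_on g V \<Longrightarrow> smooth_on (g \<circ> f) U"
  unfolding smooth_on_def using Ck_on_compose[of U V _ f g] by simp

lemma smooth_on_imp_Ck_Suc: "smooth_on f U \<Longrightarrow> Ck_on (Suc k) f U"
  unfolding smooth_on_def by blast

lemma smooth_on_has_derivative:
  "open U \<Longrightarrow> smooth_on f U \<Longrightarrow> x \<in> U \<Longrightarrow> (f has_derivative frechet_derivative f (at x)) (at x)"
  by (rule Ck_on_SucD[OF _ smooth_on_imp_Ck_Suc])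

lemma smooth_on_derivative:
  "smooth_on f U \<Longrightarrow> smooth_on (\<lambda>x. frechet_derivative f (at x) v) U"
  using smooth_on_imp_Ck_Suc[of f U] unfolding smooth_on_def[of "\<lambda>x. frechet_derivative f (at x) v"] by auto

lemma smooth_on_continuous: "smooth_on f U \<Longrightarrow> continuous_on U f"
  using Ck_on.simps(1)[of f U] by (simp add: smooth_on_def del: Ck_on.simps)

lemma smooth_on_bounded_linear: "open U \<Longrightarrow> bounded_linear L \<Longrightarrow> smooth_on L U"
proof -
  assume U: "open U" and L: "bounded_linear L"
  have "Ck_on k L U" for k
  proof (cases k)
    case 0
    then show ?thesis using L by (simp add: linear_continuous_on)
  next
    case (Suc k')
    show ?thesis unfolding Suc
      by (rule Ck_on_SucI[OF U bounded_linear_imp_has_derivative[OF L]]) (rule Ck_on_const)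
  qed
  then show ?thesis by (simp add: smooth_on_def)
qed

lemma smooth_on_mult:
  fixes f g :: "_ \<Rightarrow> 'b::real_normed_algebra"
  shows "open U \<Longrightarrow> smooth_on f U \<Longrightarrow> smooth_on g U \<Longrightarrow> smooth_on (\<lambda>x. f x * g x) U"
  by (rule smooth_on_bilinear[OF _ bounded_bilinear_mult])

lemma smooth_on_minus: "open U \<Longrightarrow> smooth_on f U \<Longrightarrow> smooth_on (\<lambda>x. - f x) U"
  by (rule smooth_on_linear_compose[OF _ bounded_linear_minus[OF bounded_linear_ident]])

lemma smooth_on_diff: "open U \<Longrightarrow> smooth_on f U \<Longrightarrow> smooth_on g U \<Longrightarrow> smooth_on (\<lambda>x. f x - g x) U"
  using smooth_on_add[OF _ _ smooth_on_minus, of U f g] by simp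

lemma smooth_on_nth: "open U \<Longrightarrow> smooth_on f U \<Longrightarrow> smooth_on (\<lambda>x. f x $ i) U"
  by (rule smooth_on_linear_compose[OF _ bounded_linear_vec_nth])

lemma bounded_linear_axis: "bounded_linear (\<lambda>y::'b::real_normed_vector. (axis i y :: 'b^'n))"
proof (rule bounded_linear_intro[where K = 1])
  show "norm (axis i y :: 'b^'n) \<le> norm y * 1" for y :: 'b
    by (simp add: norm_vec_def axis_def L2_set_def if_distrib if_distribR sum.delta cong: if_cong)
qed (auto simp: axis_def vec_eq_iff)

lemma has_derivative_vecI:
  fixes f :: "'a::real_normed_vector \<Rightarrow> 'b::real_normed_vector^'n"
  assumes "\<And>i. ((\<lambda>x. f x $ i) has_derivative (\<lambda>h. f' h $ i)) F"
  shows "(f has_derivative f') F"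
proof -
  have "((\<lambda>x. \<Sum>i\<in>UNIV. (axis i (f x $ i) :: 'b^'n)) has_derivative (\<lambda>h. \<Sum>i\<in>UNIV. axis i (f' h $ i))) F"
    by (intro has_derivative_sum bounded_linear.has_derivative[OF bounded_linear_axis] assms)
  moreover have "(\<Sum>i\<in>UNIV. axis i (y $ i)) = y" for y :: "'b^'n"
    by (simp add: vec_eq_iff axis_def if_distrib cong: if_cong)
  ultimately show ?thesis by simp
qed

lemma smooth_on_vec:
  fixes f :: "'e::euclidean_space \<Rightarrow> 'b::real_normed_vector^'n"
  assumes U: "open U" and f: "\<And>i. smooth_on (\<lambda>x. f x $ i) U"
  shows "smooth_on f U"
proof -
  have "(\<lambda>x. \<Sum>i\<in>UNIV. axis i (f x $ i)) = f"
    by (auto simp: vec_eq_iff axis_def sum.delta if_distrib cong: if_cong)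
  moreover have "smooth_on (\<lambda>x. \<Sum>i\<in>UNIV. axis i (f x $ i) :: 'b^'n) U"
    by (rule smooth_on_sum[OF U]) (rule smooth_on_linear_compose[OF U bounded_linear_axis f])
  ultimately show ?thesis by simp
qed

text \<open>The derivative is uniformly continuous on a compact neighbourhood of \<open>K\<close>,
  and the mean value inequality turns this into a remainder estimate with one \<open>d\<close> for
  all points of \<open>K\<close>. It is applied with \<open>K\<close> a whole segment.\<close>

lemma uniform_derivative_on_compact:
  fixes f :: "'a::euclidean_space \<Rightarrow> 'b::real_normed_vector"
  assumes B: "open B" and f': "\<And>x. x \<in> B \<Longrightarrow> (f has_derivative f' x) (at x)"
    and cont: "\<And>v. continuous_on B (\<lambda>x. f' x v)"
    and K: "compact K" "K \<subseteq> B" and e: "0 < e"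
  shows "\<exists>d>0. \<forall>x\<in>K. \<forall>h. norm h < d \<longrightarrow> norm (f (x + h) - f x - f' x h) \<le> e * norm h"
proof -
  obtain r where r: "0 < r" "(\<Union>x\<in>K. cball x r) \<subseteq> B"
    using compact_subset_open_imp_cball_epsilon_subset[OF K(1) B K(2)] by blast
  define K' where "K' = (\<Union>x\<in>K. cball x r)"
  have K': "compact K'" unfolding K'_def
    using compact_minkowski_sum_cball[OF K(1)] by simp
  \<comment> \<open>An operator norm is at most the sum of the norms on the basis vectors, so this
    much variation is allowed in each of the basis directions.\<close>
  define c where "c = e / (real DIM('a))"
  have c: "c > 0" using e by (simp add: c_def)
  have "\<exists>d>0. \<forall>x\<in>K'. \<forall>y\<in>K'. dist y x < d \<longrightarrow> dist (f' y b) (f' x b) < c" for b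
  proof -
    have "uniformly_continuous_on K' (\<lambda>x. f' x b)"
      using K' cont[of b] r(2) K'_def compact_uniformly_continuous continuous_on_subset by blast
    then show ?thesis using c unfolding uniformly_continuous_on_def by blast
  qed
  then obtain d where d: "\<And>b. d b > 0"
    "\<And>b x y. x \<in> K' \<Longrightarrow> y \<in> K' \<Longrightarrow> dist y x < d b \<Longrightarrow> dist (f' y b) (f' x b) < c" by metis
  \<comment> \<open>Small enough for uniform continuity in every basis direction, and at most
    \<open>r\<close> so that balls of this radius around \<open>K\<close> stay in
    \<open>K'\<close>.\<close>
  define D where "D = Min (insert r (d ` Basis))"
  have D: "0 < D" "D \<le> r" "\<And>b. b \<in> Basis \<Longrightarrow> D \<le> d b"
    unfolding D_def using d(1) r(1) by (simp_all add: Min_gr_iff min.coboundedI2)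
  have "norm (f (x + h) - f x - f' x h) \<le> e * norm h" if x: "x \<in> K" and h: "norm h < D" for x h
  proof -
    let ?S = "ball x D"
    have sub: "?S \<subseteq> K'" proof
      fix y assume "y \<in> ?S"
      then have "y \<in> cball x r" using D(2) by simp
      then show "y \<in> K'" unfolding K'_def using x by blast
    qed
    then have subB: "?S \<subseteq> B" using r(2) K'_def by auto
    have "norm (f (x + h) - f x - f' x ((x + h) - x)) \<le> norm ((x + h) - x) * e"
    proof (rule differentiable_bound_linearization[where S = ?S])
      fix t :: real assume "t \<in> {0..1}"
      then have "norm (t *\<^sub>R h) < D" using h
        by (smt (verit, best) atLeastAtMost_iff mult_left_le_one_le norm_ge_zero norm_scaleR)
      then show "x + t *\<^sub>R (x + h - x) \<in> ?S" by (simp add: dist_norm)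
    next
      fix y assume "y \<in> ?S"
      then show "(f has_derivative f' y) (at y within ?S)"
        using f' subB has_derivative_at_withinI by blast
    next
      fix y assume y: "y \<in> ?S"
      have lin: "linear (f' y)" "linear (f' x)"
        using f'[of y] f'[of x] has_derivative_linear y subB D(1) x K(2) by blast+
      show "onorm (f' y - f' x) \<le> e"
      proof (rule onorm_le)
        fix v
        have *: "f' z v = (\<Sum>b\<in>Basis. (v \<bullet> b) *\<^sub>R f' z b)" if "linear (f' z)" for z
        proof -
          have "f' z v = f' z (\<Sum>b\<in>Basis. (v \<bullet> b) *\<^sub>R b)" by (simp add: euclidean_representation)
          then show ?thesis using that by (simp add: linear_sum linear_scale)
        qed
        have "(f' y - f' x) v = (\<Sum>b\<in>Basis. (v \<bullet> b) *\<^sub>R (f' y b - f' x b))"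
          using *[OF lin(1)] *[OF lin(2)] by (simp add: sum_subtractf scaleR_diff_right)
        also have "norm \<dots> \<le> (\<Sum>b\<in>(Basis::'a set). norm v * c)"
        proof (rule sum_norm_le)
          fix b :: 'a assume b: "b \<in> Basis"
          have "dist y x < d b" using D(3)[OF b] y by (simp add: dist_commute)
          then have "norm (f' y b - f' x b) \<le> c"
            using d(2)[of x y b] sub y D(1) centre_in_ball[of x D] by (metis dist_norm less_imp_le subsetD)
          then show "norm ((v \<bullet> b) *\<^sub>R (f' y b - f' x b)) \<le> norm v * c"
            using Basis_le_norm[OF b, of v] by (simp add: mult_mono)
        qed
        also have "\<dots> = e * norm v" by (simp add: c_def)
        finally show "norm ((f' y - f' x) v) \<le> e * norm v" .
      qed
    qed (use D in auto)
    then show ?thesis by (simp add: mult.commute)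
  qed
  then show ?thesis using D(1) by blast
qed

section \<open>Flat linear systems\<close>

text \<open>The square of the norm is differentiable everywhere, unlike the norm. The weight
  \<open>exp (- c * s)\<close> makes the square plus \<open>\<epsilon>\<^sup>2\<close>
  nonincreasing: in \<open>c = 2 * M + 1\<close> the part \<open>2 * M\<close> absorbs the linear
  term and the 1 absorbs \<open>2 * norm (E s) * \<epsilon>\<close> by the inequality of
  means.\<close>

lemma gronwall_unit_interval:
  fixes E :: "real \<Rightarrow> 'e::real_inner"
  assumes der: "\<And>t. t \<in> {0..1} \<Longrightarrow> (E has_vector_derivative E' t) (at t within {0..1})"
    and bd: "\<And>t. t \<in> {0..1} \<Longrightarrow> norm (E' t) \<le> M * norm (E t) + \<epsilon>"
    and M: "0 \<le> M" and e: "0 \<le> \<epsilon>" and t: "t \<in> {0..1}"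
  shows "norm (E t) \<le> exp (2 * M + 1) * (norm (E 0) + \<epsilon>)"
proof -
  define c where "c = 2 * M + 1"
  define f where "f s = exp (- c * s) * (E s \<bullet> E s + \<epsilon>\<^sup>2)" for s
  have c1: "1 \<le> c" using M by (simp add: c_def)
  have df: "(f has_derivative (\<lambda>h. h * (exp (- c * s) * (2 * (E s \<bullet> E' s)) - c * exp (- c * s) * (E s \<bullet> E s + \<epsilon>\<^sup>2)))) (at s within {0..t})"
    if s: "0 \<le> s" "s \<le> t" for s
  proof -
    have "(E has_derivative (\<lambda>h. h *\<^sub>R E' s)) (at s within {0..t})"
      using der[of s] s t has_derivative_subset[of E _ s "{0..1}" "{0..t}"]
      by (auto simp: has_vector_derivative_def)
    then show ?thesis unfolding f_def
      by (auto intro!: derivative_eq_intros simp: algebra_simps inner_commute)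
  qed
  obtain s where s: "s \<in> {0..t}" and
    eq: "f t - f 0 = (t - 0) * (exp (- c * s) * (2 * (E s \<bullet> E' s)) - c * exp (- c * s) * (E s \<bullet> E s + \<epsilon>\<^sup>2))"
    using mvt_very_simple[of 0 t f "\<lambda>s h. h * (exp (- c * s) * (2 * (E s \<bullet> E' s)) - c * exp (- c * s) * (E s \<bullet> E s + \<epsilon>\<^sup>2))"] df t
    by auto
  have s01: "s \<in> {0..1}" using s t by auto
  have "E s \<bullet> E' s \<le> norm (E s) * norm (E' s)" by (rule norm_cauchy_schwarz)
  also have "\<dots> \<le> norm (E s) * (M * norm (E s) + \<epsilon>)"
    using bd[OF s01] by (simp add: mult_left_mono)
  finally have "2 * (E s \<bullet> E' s) \<le> 2 * M * (norm (E s))\<^sup>2 + 2 * norm (E s) * \<epsilon>"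
    by (simp add: power2_eq_square algebra_simps)
  also have "\<dots> \<le> c * (norm (E s))\<^sup>2 + \<epsilon>\<^sup>2"
    using sum_squares_bound[of "norm (E s)" \<epsilon>] by (simp add: c_def algebra_simps)
  also have "\<dots> \<le> c * (E s \<bullet> E s + \<epsilon>\<^sup>2)"
    using mult_right_mono[OF c1, of "\<epsilon>\<^sup>2"] by (simp add: power2_norm_eq_inner algebra_simps)
  finally have "exp (- c * s) * (2 * (E s \<bullet> E' s)) \<le> exp (- c * s) * (c * (E s \<bullet> E s + \<epsilon>\<^sup>2))"
    by (rule mult_left_mono) simp
  then have "f t - f 0 \<le> 0" unfolding eq using t by (intro mult_nonneg_nonpos) (auto simp: mult_ac)
  then have 1: "exp (- c * t) * ((norm (E t))\<^sup>2 + \<epsilon>\<^sup>2) \<le> (norm (E 0))\<^sup>2 + \<epsilon>\<^sup>2"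
    by (simp add: f_def power2_norm_eq_inner)
  have "(norm (E t))\<^sup>2 \<le> (norm (E t))\<^sup>2 + \<epsilon>\<^sup>2" by simp
  also have "\<dots> = exp (c * t) * (exp (- c * t) * ((norm (E t))\<^sup>2 + \<epsilon>\<^sup>2))"
    by (simp add: mult.assoc[symmetric] exp_add[symmetric])
  also have "\<dots> \<le> exp (c * t) * ((norm (E 0))\<^sup>2 + \<epsilon>\<^sup>2)"
    using 1 by (rule mult_left_mono) simp
  \<comment> \<open>The exponent is enlarged from \<open>c * t\<close> to \<open>c + c\<close> so
    that the right-hand side is a perfect square.\<close>
  also have "\<dots> \<le> (exp c)\<^sup>2 * (norm (E 0) + \<epsilon>)\<^sup>2"
  proof (rule mult_mono)
    have "c * t \<le> c + c" using t c1 by (smt (verit) atLeastAtMost_iff mult_left_le)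
    then show "exp (c * t) \<le> (exp c)\<^sup>2" by (simp add: power2_eq_square exp_add[symmetric])
    show "(norm (E 0))\<^sup>2 + \<epsilon>\<^sup>2 \<le> (norm (E 0) + \<epsilon>)\<^sup>2" using e by (simp add: power2_sum)
  qed auto
  finally have "(norm (E t))\<^sup>2 \<le> (exp c * (norm (E 0) + \<epsilon>))\<^sup>2" by (simp add: power_mult_distrib)
  then show ?thesis unfolding c_def
    by (rule power2_le_imp_le) (use e in auto)
qed

text \<open>Picard iteration, written as the series of the iterated integrals \<open>X n\<close>.
  Against the weight \<open>exp (2 * M * t)\<close> each integration contracts by 1/2, so the series
  converges on the whole interval and no patching of short intervals is needed.\<close>

lemma linear_ode_unit_interval:
  fixes act :: "'m::real_normed_vector \<Rightarrow> 'e::euclidean_space \<Rightarrow> 'e"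
  assumes act: "bounded_bilinear act" and B: "continuous_on {0..1} B"
  shows "\<exists>G. G 0 = x0 \<and> (\<forall>t\<in>{0..1}. (G has_vector_derivative act (B t) (G t)) (at t within {0..1}))"
proof -
  interpret act: bounded_bilinear act by (rule act)
  obtain K where K: "\<And>a b. norm (act a b) \<le> norm a * norm b * K" "0 < K"
    using act.pos_bounded by blast
  have "bounded (B ` {0..1})"
    using B compact_Icc compact_continuous_image compact_imp_bounded by blast
  then obtain N where N: "0 < N" "\<And>t. t \<in> {0..1} \<Longrightarrow> norm (B t) \<le> N"
    unfolding bounded_pos by auto
  define M where "M = N * K"
  have M: "0 < M" using K(2) N(1) by (simp add: M_def)
  have bd: "norm (act (B t) x) \<le> M * norm x" if "t \<in> {0..1}" for t x
  proof -
    have "norm (act (B t) x) \<le> norm (B t) * norm x * K" by (rule K(1))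
    also have "\<dots> \<le> N * norm x * K"
      using N(2)[OF that] K(2) by (intro mult_right_mono) auto
    finally show ?thesis by (simp add: M_def mult_ac)
  qed
  define X :: "nat \<Rightarrow> real \<Rightarrow> 'e"
    where "X = rec_nat (\<lambda>t. x0) (\<lambda>n x t. integral {0..t} (\<lambda>s. act (B s) (x s)))"
  have X0: "X 0 = (\<lambda>t. x0)" and XS: "X (Suc n) = (\<lambda>t. integral {0..t} (\<lambda>s. act (B s) (X n s)))" for n
    by (simp_all add: X_def)
  have dS: "(X (Suc n) has_vector_derivative act (B t) (X n t)) (at t within {0..1})"
    if "continuous_on {0..1} (X n)" "t \<in> {0..1}" for n t
    unfolding XS using that act.continuous_on[OF B that(1)]
    by (intro integral_has_vector_derivative) auto
  have cont: "continuous_on {0..1} (X n)" for n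
  proof (induction n)
    case 0
    then show ?case by (simp add: X0)
  next
    case (Suc n)
    then show ?case using dS
      by (meson continuous_on_eq_continuous_within has_vector_derivative_continuous)
  qed
  have bX: "norm (X n t) \<le> norm x0 * (1/2)^n * exp (2 * M * t)" if "t \<in> {0..1}" for n t
    using that
  proof (induction n arbitrary: t)
    case 0
    then show ?case using M by (simp add: X0 mult_le_cancel_left1)
  next
    case (Suc n)
    \<comment> \<open>The derivative of \<open>\<phi>\<close> is \<open>M\<close> times the bound
      for \<open>X n\<close>, because the factor \<open>2 * M\<close> from the exponential meets the
      extra 1/2.\<close>
    define \<phi> where "\<phi> s = norm x0 * (1/2)^(Suc n) * exp (2 * M * s)" for s
    show ?case
    proof (cases "t = 0")
      case True
      then show ?thesis by (simp add: XS)
    next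
      case False
      then have t: "0 < t" "t \<le> 1" using Suc.prems by auto
      have "norm (X (Suc n) t - X (Suc n) 0) \<le> \<phi> t - \<phi> 0"
      proof (rule differentiable_bound_general[OF t(1)])
        show "continuous_on {0..t} (X (Suc n))" using cont t by (meson atLeastatMost_subset_iff continuous_on_subset order_refl)
        show "continuous_on {0..t} \<phi>" unfolding \<phi>_def by (intro continuous_intros)
        fix s assume s: "0 < s" "s < t"
        show "(X (Suc n) has_vector_derivative act (B s) (X n s)) (at s)"
          using dS[OF cont, of s n] s t at_within_Icc_at[of 0 s 1] by simp
        show "(\<phi> has_vector_derivative M * (norm x0 * (1/2)^n * exp (2 * M * s))) (at s)"
          unfolding \<phi>_def
          by (auto intro!: derivative_eq_intros simp: has_real_derivative_iff_has_vector_derivative[symmetric])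
        have "norm (act (B s) (X n s)) \<le> M * norm (X n s)" using bd s t by simp
        also have "\<dots> \<le> M * (norm x0 * (1/2)^n * exp (2 * M * s))"
          using Suc.IH[of s] s t M by (intro mult_left_mono) auto
        finally show "norm (act (B s) (X n s)) \<le> M * (norm x0 * (1/2)^n * exp (2 * M * s))" .
      qed
      moreover have "X (Suc n) 0 = 0" by (simp add: XS)
      moreover have "0 \<le> \<phi> 0" by (simp add: \<phi>_def)
      ultimately have "norm (X (Suc n) t) \<le> \<phi> t" by simp
      then show ?thesis unfolding \<phi>_def .
    qed
  qed
  define C where "C = norm x0 * exp (2 * M)"
  have bX': "norm (X n t) \<le> C * (1/2)^n" if "t \<in> {0..1}" for n t
  proof -
    have "exp (2 * M * t) \<le> exp (2 * M)" using that M by simp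
    then have "norm x0 * (1/2)^n * exp (2 * M * t) \<le> norm x0 * (1/2)^n * exp (2 * M)"
      by (intro mult_left_mono) auto
    then show ?thesis using bX[OF that, of n] by (simp add: C_def mult_ac)
  qed
  have summ: "summable (\<lambda>n. C * (1/2)^n)" by (intro summable_mult summable_geometric) simp
  define F where "F t = (\<Sum>n. X n t)" for t
  have sums: "(\<lambda>n. X n t) sums F t" if "t \<in> {0..1}" for t
    unfolding F_def using summable_comparison_test'[OF summ bX'[OF that]] summable_sums by blast
  have unif: "uniform_limit {0..1} (\<lambda>n t. \<Sum>i<n. X i t) F sequentially"
    unfolding F_def using bX' summ by (intro Weierstrass_m_test) auto
  define X' where "X' n t h = (case n of 0 \<Rightarrow> 0 | Suc m \<Rightarrow> h *\<^sub>R act (B t) (X m t))" for n t and h :: real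
  have X'0: "X' 0 t = (\<lambda>h. 0)" and X'S: "X' (Suc n) t = (\<lambda>h. h *\<^sub>R act (B t) (X n t))" for n t
    by (simp_all add: X'_def fun_eq_iff)
  \<comment> \<open>The constant term \<open>X 0\<close> has derivative 0, so the differentiated
    partial sums lag by one term. In the limit this shift is the differential equation.\<close>
  have sumX': "(\<Sum>i<Suc n. X' i t h) = h *\<^sub>R act (B t) (\<Sum>i<n. X i t)" for n t h
    by (induction n) (simp_all add: X'_def act.sum_right act.add_right act.zero_right algebra_simps)
  have "\<exists>g. \<forall>t\<in>{0..1}. (\<lambda>n. X n t) sums g t \<and>
      (g has_derivative (\<lambda>h. h *\<^sub>R act (B t) (F t))) (at t within {0..1})"
  proof (rule has_derivative_series[where f' = X' and x = 0])
    fix n t assume "t \<in> {0..1::real}"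
    then show "(X n has_derivative X' n t) (at t within {0..1})"
      using dS[OF cont] by (cases n) (auto simp: X'0 X'S X0 has_vector_derivative_def)
  next
    fix e :: real assume e: "0 < e"
    have "\<forall>\<^sub>F n in sequentially. \<forall>t\<in>{0..1}. dist (\<Sum>i<n. X i t) (F t) < e / M"
      using unif e M unfolding uniform_limit_iff by simp
    then have "\<forall>\<^sub>F n in sequentially. \<forall>t\<in>{0..1}. \<forall>h. norm ((\<Sum>i<Suc n. X' i t h) - h *\<^sub>R act (B t) (F t)) \<le> e * norm h"
    proof eventually_elim
      case (elim n)
      show ?case
      proof (intro ballI allI)
        fix t h :: real assume t: "t \<in> {0..1}"
        have "norm ((\<Sum>i<Suc n. X' i t h) - h *\<^sub>R act (B t) (F t)) = \<bar>h\<bar> * norm (act (B t) ((\<Sum>i<n. X i t) - F t))"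
          by (simp only: sumX' scaleR_diff_right[symmetric] act.diff_right[symmetric] norm_scaleR)
        also have "\<dots> \<le> \<bar>h\<bar> * (M * norm ((\<Sum>i<n. X i t) - F t))"
          using bd[OF t] by (intro mult_left_mono) auto
        also have "\<dots> \<le> \<bar>h\<bar> * (M * (e / M))"
          using elim t M by (intro mult_left_mono) (auto simp: dist_norm less_imp_le)
        finally show "norm ((\<Sum>i<Suc n. X' i t h) - h *\<^sub>R act (B t) (F t)) \<le> e * norm h"
          using M by (simp add: mult_ac)
      qed
    qed
    then show "\<forall>\<^sub>F n in sequentially. \<forall>t\<in>{0..1}. \<forall>h. norm ((\<Sum>i<n. X' i t h) - h *\<^sub>R act (B t) (F t)) \<le> e * norm h"
      by (subst eventually_sequentially_Suc[symmetric])
  next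
    show "(\<lambda>n. X n 0) sums F 0" using sums by simp
  qed auto
  then obtain g where g: "\<And>t. t \<in> {0..1} \<Longrightarrow> (\<lambda>n. X n t) sums g t"
     "\<And>t. t \<in> {0..1} \<Longrightarrow> (g has_derivative (\<lambda>h. h *\<^sub>R act (B t) (F t))) (at t within {0..1})" by blast
  have gF: "g t = F t" if "t \<in> {0..1}" for t using g(1)[OF that] sums[OF that] sums_unique2 by blast
  have "g 0 = x0"
  proof -
    have "(\<lambda>n. X n 0) sums (\<Sum>n\<in>{0}. X n 0)"
      by (rule sums_finite) (auto simp: XS gr0_conv_Suc)
    then show ?thesis using g(1)[of 0] sums_unique2 by (fastforce simp: X0)
  qed
  then show ?thesis using g(2) gF by (intro exI[of _ g]) (auto simp: has_vector_derivative_def)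
qed

lemma bounded_bilinear_segment_bound:
  assumes act: "bounded_bilinear act" and B: "continuous_on {0..1::real} B"
  shows "\<exists>M\<ge>0. \<forall>t\<in>{0..1}. \<forall>x. norm (act (B t) x) \<le> M * norm x"
proof -
  obtain K where K: "\<And>a b. norm (act a b) \<le> norm a * norm b * K" "0 < K"
    using bounded_bilinear.pos_bounded[OF act] by blast
  have "bounded (B ` {0..1})"
    using B compact_Icc compact_continuous_image compact_imp_bounded by blast
  then obtain N where N: "0 < N" "\<And>t. t \<in> {0..1} \<Longrightarrow> norm (B t) \<le> N"
    unfolding bounded_pos by auto
  have "norm (act (B t) x) \<le> N * K * norm x" if "t \<in> {0..1}" for t x
  proof -
    have "norm (act (B t) x) \<le> norm (B t) * norm x * K" by (rule K(1))
    also have "\<dots> \<le> N * norm x * K"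
      using N(2)[OF that] K(2) by (intro mult_right_mono) auto
    finally show ?thesis by (simp add: mult_ac)
  qed
  then show ?thesis using N(1) K(2) by (intro exI[of _ "N * K"]) auto
qed

text \<open>On the segment from \<open>q\<close> the system is a linear ordinary equation with
  initial value 0, and Gronwall's inequality with \<open>\<epsilon> = 0\<close> applies. It serves
  both for the difference of two frames and for the error of the Gram relations.\<close>

lemma linear_system_zero:
  fixes act :: "'m::real_normed_vector \<Rightarrow> 'e::euclidean_space \<Rightarrow> 'e"
    and om :: "'z::euclidean_space \<Rightarrow> 'z \<Rightarrow> 'm"
  assumes act: "bounded_bilinear act" and U: "convex U" "q \<in> U" "z \<in> U"
    and cont: "\<And>w. continuous_on U (\<lambda>z. om z w)"
    and u: "\<And>z. z \<in> U \<Longrightarrow> (u has_derivative (\<lambda>w. act (om z w) (u z))) (at z)"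
    and q: "u q = 0"
  shows "u z = 0"
proof -
  define y where "y t = q + t *\<^sub>R (z - q)" for t
  have y: "y t \<in> U" if "t \<in> {0..1}" for t
    using convexD_alt[OF U(1,2,3), of t] that by (simp add: y_def algebra_simps)
  have cy: "continuous_on {0..1} (\<lambda>t. om (y t) (z - q))"
    using y by (intro continuous_on_compose2[OF cont]) (auto simp: y_def intro!: continuous_intros)
  obtain M where M: "0 \<le> M" "\<And>t x. t \<in> {0..1} \<Longrightarrow> norm (act (om (y t) (z - q)) x) \<le> M * norm x"
    using bounded_bilinear_segment_bound[OF act cy] by blast
  have dy: "((\<lambda>t. u (y t)) has_vector_derivative act (om (y t) (z - q)) (u (y t))) (at t within {0..1})"
    if "t \<in> {0..1}" for t
  proof -
    have "(y has_vector_derivative (z - q)) (at t within {0..1})"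
      unfolding y_def by (auto intro!: derivative_eq_intros)
    then show ?thesis
      using vector_derivative_diff_chain_within[of y "z - q" t "{0..1}" u] u[OF y[OF that]] has_derivative_at_withinI
      by (fastforce simp: o_def)
  qed
  have "norm (u (y 1)) \<le> exp (2 * M + 1) * (norm (u (y 0)) + 0)"
    using gronwall_unit_interval[OF dy, of M 0 1] M by auto
  then show ?thesis by (simp add: y_def q)
qed

text \<open>The solution is built along the segments from \<^term>\<open>q\<close>. Along such a segment the flatness equation
  turns the error of the expected linearization of the solution into a solution of a linear
  equation with an inhomogeneity of higher order, which Gronwall's inequality controls.\<close>

lemma linear_flat_system:
  fixes act :: "'m::real_normed_vector \<Rightarrow> 'e::euclidean_space \<Rightarrow> 'e"
    and om :: "'z::euclidean_space \<Rightarrow> 'z \<Rightarrow> 'm"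
  assumes act: "bounded_bilinear act" and U: "open U" "convex U" "q \<in> U"
    and lin: "\<And>z. z \<in> U \<Longrightarrow> linear (om z)"
    and der: "\<And>z w. z \<in> U \<Longrightarrow> ((\<lambda>x. om x w) has_derivative omd z w) (at z)"
    and cont: "\<And>w h. continuous_on U (\<lambda>z. omd z w h)"
    and flat: "\<And>z w h x. z \<in> U \<Longrightarrow> act (omd z w h) x - act (omd z h w) x =
      act (om z h) (act (om z w) x) - act (om z w) (act (om z h) x)"
  shows "\<exists>F. F q = x0 \<and> (\<forall>z\<in>U. (F has_derivative (\<lambda>w. act (om z w) (F z))) (at z))"
proof -
  interpret act: bounded_bilinear act by (rule act)
  obtain K where K: "\<And>a b. norm (act a b) \<le> norm a * norm b * K" "0 < K"
    using act.pos_bounded by blast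
  have contom: "continuous_on U (\<lambda>x. om x w)" for w
    by (intro continuous_at_imp_continuous_on ballI) (rule has_derivative_continuous[OF der])
  define y where "y z t = q + t *\<^sub>R (z - q)" for z :: 'z and t :: real
  have yU: "y z t \<in> U" if "t \<in> {0..1}" "z \<in> U" for z t
    using convexD_alt[OF U(2,3) that(2), of t] that by (simp add: y_def algebra_simps)
  have cony: "continuous_on A (y z)" for A z unfolding y_def by (intro continuous_intros)
  have cB: "continuous_on {0..1} (\<lambda>t. om (y z t) (z - q))" if "z \<in> U" for z
    using yU[OF _ that] by (intro continuous_on_compose2[OF contom]) (auto intro: cony)
  have "\<forall>z. \<exists>G. z \<in> U \<longrightarrow> G 0 = x0 \<and>
    (\<forall>t\<in>{0..1}. (G has_vector_derivative act (om (y z t) (z - q)) (G t)) (at t within {0..1}))"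
    using linear_ode_unit_interval[OF act cB] by blast
  then obtain G where G0: "\<And>z. z \<in> U \<Longrightarrow> G z 0 = x0"
    and dG: "\<And>z t. z \<in> U \<Longrightarrow> t \<in> {0..1} \<Longrightarrow>
        (G z has_vector_derivative act (om (y z t) (z - q)) (G z t)) (at t within {0..1})"
    by metis
  define F where "F z = G z 1" for z
  have Fq: "F q = x0"
  proof -
    have "((\<lambda>t. G q t - x0) has_vector_derivative 0) (at t within {0..1})" if "t \<in> {0..1}" for t
      using dG[OF U(3) that] linear_0[OF lin[OF yU[OF that U(3)]]]
      by (auto intro!: derivative_eq_intros simp: act.zero_left)
    from gronwall_unit_interval[OF this, of 0 0 1] show ?thesis using G0[OF U(3)] by (simp add: F_def)
  qed
  have rep: "om z v = (\<Sum>b\<in>Basis. (v \<bullet> b) *\<^sub>R om z b)" if "z \<in> U" for z v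
  proof -
    have "om z v = om z (\<Sum>b\<in>Basis. (v \<bullet> b) *\<^sub>R b)" by (simp add: euclidean_representation)
    then show ?thesis by (simp add: linear_sum[OF lin[OF that]] linear_scale[OF lin[OF that]])
  qed
  have drep: "omd z v h = (\<Sum>b\<in>Basis. (v \<bullet> b) *\<^sub>R omd z b h)" if "z \<in> U" for z v h
  proof -
    have "((\<lambda>x. \<Sum>b\<in>Basis. (v \<bullet> b) *\<^sub>R om x b) has_derivative (\<lambda>h. \<Sum>b\<in>Basis. (v \<bullet> b) *\<^sub>R omd z b h)) (at z)"
      by (intro has_derivative_sum has_derivative_scaleR_right der[OF that])
    then have "((\<lambda>x. om x v) has_derivative (\<lambda>h. \<Sum>b\<in>Basis. (v \<bullet> b) *\<^sub>R omd z b h)) (at z)"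
      by (rule has_derivative_transform_within_open[OF _ U(1) that]) (simp only: rep[symmetric])
    from has_derivative_unique[OF der[OF that] this] show ?thesis by (rule fun_cong)
  qed
  \<comment> \<open>The coefficient along the segment to \<open>z + h\<close> depends on
    \<open>h\<close> through the base point and through the direction. As a map on pairs it is
    linearized in both at once, uniformly along the segment.\<close>
  define om2 where "om2 p = om (fst p) (snd p)" for p :: "'z \<times> 'z"
  define dom2 where "dom2 p k = omd (fst p) (snd p) (fst k) + om (fst p) (snd k)" for p k :: "'z \<times> 'z"
  have dom2: "(om2 has_derivative dom2 p) (at p)" if "p \<in> U \<times> UNIV" for p
  proof -
    have p: "fst p \<in> U" using that by auto
    have "((\<lambda>x. \<Sum>b\<in>Basis. (snd x \<bullet> b) *\<^sub>R om (fst x) b) has_derivative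
       (\<lambda>k. \<Sum>b\<in>Basis. (snd p \<bullet> b) *\<^sub>R omd (fst p) b (fst k) + (snd k \<bullet> b) *\<^sub>R om (fst p) b)) (at p)"
    proof (intro has_derivative_sum has_derivative_scaleR)
      show "((\<lambda>x. snd x \<bullet> b) has_derivative (\<lambda>k. snd k \<bullet> b)) (at p)" for b
        by (auto intro!: derivative_eq_intros)
      show "((\<lambda>x. om (fst x) b) has_derivative (\<lambda>k. omd (fst p) b (fst k))) (at p)" for b
        using diff_chain_at[OF has_derivative_fst[OF has_derivative_ident] der[OF p]] by (simp add: o_def)
    qed
    moreover have "(\<lambda>k. \<Sum>b\<in>Basis. (snd p \<bullet> b) *\<^sub>R omd (fst p) b (fst k) + (snd k \<bullet> b) *\<^sub>R om (fst p) b) = dom2 p"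
      unfolding dom2_def by (rule ext) (simp add: sum.distrib drep[OF p, of "snd p"] rep[OF p, of "snd _"])
    ultimately show ?thesis
      using has_derivative_transform_within_open[of _ "dom2 p" p UNIV "U \<times> UNIV" om2] that U(1)
      by (auto simp: om2_def rep[symmetric] open_Times)
  qed
  have cdom2: "continuous_on (U \<times> UNIV) (\<lambda>p. dom2 p k)" for k
  proof -
    have "continuous_on (U \<times> UNIV) (\<lambda>p. (\<Sum>b\<in>Basis. (snd p \<bullet> b) *\<^sub>R omd (fst p) b (fst k)) + om (fst p) (snd k))"
      by (intro continuous_intros continuous_on_compose2[OF cont] continuous_on_compose2[OF contom]) auto
    then show ?thesis
      by (rule continuous_on_eq) (auto simp: dom2_def drep[of _ "snd _"] simp flip: drep)
  qed
  have "(F has_derivative (\<lambda>w. act (om z w) (F z))) (at z)" if z: "z \<in> U" for z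
  proof -
    define w where "w = z - q"
    have cK: "compact ((\<lambda>t. (y z t, w)) ` {0..1})"
      by (intro compact_continuous_image continuous_intros cony) auto
    have subK: "(\<lambda>t. (y z t, w)) ` {0..1} \<subseteq> U \<times> UNIV" using yU z by auto
    obtain r where r: "0 < r" "ball z r \<subseteq> U" using U(1) z open_contains_ball by blast
    have cdo: "continuous_on {0..1} (\<lambda>t. omd (y z t) w b)" for b
      using yU[OF _ z] by (intro continuous_on_compose2[OF cont]) (auto intro: cony)
    have com: "continuous_on {0..1} (\<lambda>t. om (y z t) b)" for b
      using yU[OF _ z] by (intro continuous_on_compose2[OF contom]) (auto intro: cony)
    \<comment> \<open>One continuous function dominating all coefficients that occur, so that a
      single constant \<open>L\<close> bounds them along the segment.\<close>
    define \<Theta> where "\<Theta> t = norm (om (y z t) w) + (\<Sum>b\<in>Basis. norm (om (y z t) b) + norm (omd (y z t) w b))" for t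
    have "continuous_on {0..1} \<Theta>" unfolding \<Theta>_def by (intro continuous_intros com cdo)
    then have "bounded (\<Theta> ` {0..1})" using compact_Icc compact_continuous_image compact_imp_bounded by blast
    then obtain L where L: "0 < L" "\<And>t. t \<in> {0..1} \<Longrightarrow> \<Theta> t \<le> L"
    proof -
      obtain b where "0 < b" "\<forall>x\<in>\<Theta> ` {0..1}. norm x \<le> b"
        using \<open>bounded (\<Theta> ` {0..1})\<close> unfolding bounded_pos by blast
      then show ?thesis using that[of b] by (force simp: abs_le_iff)
    qed
    have LA: "norm (om (y z t) w) \<le> L" if "t \<in> {0..1}" for t
      using L(2)[OF that] sum_nonneg[of "Basis::'z set" "\<lambda>b. norm (om (y z t) b) + norm (omd (y z t) w b)"]
      unfolding \<Theta>_def by simp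
    \<comment> \<open>The first-order variation in \<open>h\<close> of the coefficient along the
      segment: the direction changes by \<open>h\<close>, the point at parameter \<open>t\<close> by
      \<open>t *\<^sub>R h\<close>.\<close>
    define l where "l h t = om (y z t) h + omd (y z t) w (t *\<^sub>R h)" for h t
    have Ll: "norm (l h t) \<le> L * norm h" if t: "t \<in> {0..1}" for h t
    proof -
      have lo: "linear (om (y z t))" and ld: "linear (omd (y z t) w)"
        using lin der yU t z has_derivative_linear by blast+
      have "l h t = om (y z t) (\<Sum>b\<in>Basis. (h \<bullet> b) *\<^sub>R b) + t *\<^sub>R omd (y z t) w (\<Sum>b\<in>Basis. (h \<bullet> b) *\<^sub>R b)"
        by (simp add: l_def euclidean_representation linear_scale[OF ld])
      also have "\<dots> = (\<Sum>b\<in>Basis. (h \<bullet> b) *\<^sub>R (om (y z t) b + t *\<^sub>R omd (y z t) w b))"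
        by (simp add: linear_sum[OF lo] linear_sum[OF ld] linear_scale[OF lo] linear_scale[OF ld]
            scaleR_sum_right sum.distrib scaleR_add_right mult.commute)
      also have "norm \<dots> \<le> (\<Sum>b\<in>Basis. norm h * (norm (om (y z t) b) + norm (omd (y z t) w b)))"
      proof (rule sum_norm_le)
        fix b :: 'z assume b: "b \<in> Basis"
        have "norm (om (y z t) b + t *\<^sub>R omd (y z t) w b) \<le> norm (om (y z t) b) + norm (omd (y z t) w b)"
          using norm_triangle_ineq[of "om (y z t) b" "t *\<^sub>R omd (y z t) w b"] t
            mult_left_le_one_le[of "norm (omd (y z t) w b)" t] by auto
        then show "norm ((h \<bullet> b) *\<^sub>R (om (y z t) b + t *\<^sub>R omd (y z t) w b))
            \<le> norm h * (norm (om (y z t) b) + norm (omd (y z t) w b))"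
          using Basis_le_norm[OF b, of h] by (simp add: mult_mono)
      qed
      also have "\<dots> \<le> L * norm h"
        using mult_left_mono[OF order_trans[OF _ L(2)[OF t]] norm_ge_zero[of h],
            of "\<Sum>b\<in>Basis. norm (om (y z t) b) + norm (omd (y z t) w b)"]
        unfolding \<Theta>_def sum_distrib_left[symmetric] by (simp add: mult.commute)
      finally show ?thesis .
    qed
    \<comment> \<open>Three applications of Gronwall's inequality: \<open>R\<close> will bound the
      solution over \<open>z + h\<close>, \<open>c1 * norm h\<close> its distance from the solution
      over \<open>z\<close>, and \<open>c2 * e * norm h\<close> the remainder.\<close>
    define R where "R = exp (2 * (K * (2 * L + 2)) + 1) * norm x0"
    define c1 where "c1 = exp (2 * (K * L) + 1) * (K * (L + 2) * R)"
    have R: "0 \<le> R" by (simp add: R_def)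
    have c1: "0 \<le> c1" using K(2) L(1) R by (simp add: c1_def)
    define c2 where "c2 = exp (2 * (K * L) + 1) * (2 * K * R + K * L * c1)"
    have c2: "0 \<le> c2" using K(2) L(1) R c1 by (simp add: c2_def)
    have main: "\<exists>d>0. \<forall>h. norm h < d \<longrightarrow> norm (F (z + h) - F z - act (om z h) (F z)) \<le> c2 * e * norm h"
      if e: "0 < e" "e \<le> 1" for e
    proof -
      have oU: "open (U \<times> (UNIV :: 'z set))" using U(1) by (simp add: open_Times)
      obtain d0 where d0': "0 < d0" "\<forall>x\<in>(\<lambda>t. (y z t, w)) ` {0..1}. \<forall>k. norm k < d0 \<longrightarrow>
          norm (om2 (x + k) - om2 x - dom2 x k) \<le> e * norm k"
        using uniform_derivative_on_compact[OF oU dom2 cdom2 cK subK e(1)] by blast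
      note d0 = d0'(1) d0'(2)[rule_format]
      \<comment> \<open>\<open>d0 / 2\<close> because the pair \<open>(t *\<^sub>R h, h)\<close> has
        norm at most \<open>2 * norm h\<close>; \<open>r\<close> keeps \<open>z + h\<close> in
        \<open>U\<close>; \<open>e\<close> turns a product of two terms of order
        \<open>norm h\<close> into one of order \<open>e * norm h\<close>.\<close>
      define d where "d = min (min (d0 / 2) r) e"
      have d: "0 < d" "d \<le> d0 / 2" "d \<le> r" "d \<le> e" using d0(1) r(1) e by (auto simp: d_def)
      have "norm (F (z + h) - F z - act (om z h) (F z)) \<le> c2 * e * norm h" if h: "norm h < d" for h
      proof -
        have zh: "z + h \<in> U" using r(2) h d(3) by (auto simp: dist_norm subset_iff)
        define B where "B t = om (y (z + h) t) (z + h - q)" for t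
        define A where "A t = om (y z t) w" for t
        define \<rho> where "\<rho> t = B t - A t - l h t" for t
        have \<rho>: "norm (\<rho> t) \<le> e * (2 * norm h)" if t: "t \<in> {0..1}" for t
        proof -
          have nk: "norm (t *\<^sub>R h, h) \<le> 2 * norm h"
            using norm_Pair_le[of "t *\<^sub>R h" h] t mult_left_le_one_le[of "norm h" t] by auto
          have yh: "y (z + h) t = y z t + t *\<^sub>R h" by (simp add: y_def algebra_simps)
          have "norm (om2 ((y z t, w) + (t *\<^sub>R h, h)) - om2 (y z t, w) - dom2 (y z t, w) (t *\<^sub>R h, h)) \<le> e * norm (t *\<^sub>R h, h)"
            using d0(2)[of "(y z t, w)" "(t *\<^sub>R h, h)"] t h d(2) nk by auto
          also have "\<dots> \<le> e * (2 * norm h)" using nk e by (intro mult_left_mono) auto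
          also have "om2 ((y z t, w) + (t *\<^sub>R h, h)) - om2 (y z t, w) - dom2 (y z t, w) (t *\<^sub>R h, h) = \<rho> t"
            unfolding om2_def dom2_def \<rho>_def B_def A_def l_def yh w_def by (simp add: algebra_simps)
          finally show ?thesis .
        qed
        have BA: "norm (B t - A t) \<le> (L + 2) * norm h" if t: "t \<in> {0..1}" for t
        proof -
          have "norm (B t - A t) \<le> norm (\<rho> t) + norm (l h t)"
            using norm_triangle_ineq[of "\<rho> t" "l h t"] by (simp add: \<rho>_def)
          also have "\<dots> \<le> 2 * norm h + L * norm h"
            using \<rho>[OF t] Ll[OF t, of h] e mult_right_mono[OF e(2), of "2 * norm h"] by simp
          finally show ?thesis by (simp add: algebra_simps)
        qed
        have hle: "norm h \<le> 1" using h d(4) e(2) by simp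
        have Bb: "norm (B t) \<le> 2 * L + 2" if t: "t \<in> {0..1}" for t
        proof -
          have "norm (B t) \<le> norm (B t - A t) + norm (A t)" using norm_triangle_sub by (metis add.commute)
          also have "\<dots> \<le> (L + 2) * norm h + L" using BA[OF t] LA[OF t] by (simp add: A_def)
          also have "\<dots> \<le> (L + 2) * 1 + L" using hle L(1) by (intro add_right_mono mult_left_mono) auto
          finally show ?thesis by simp
        qed
        have dGh: "(G (z + h) has_vector_derivative act (B t) (G (z + h) t)) (at t within {0..1})"
          if "t \<in> {0..1}" for t using dG[OF zh that] by (simp add: B_def)
        have dGz: "(G z has_vector_derivative act (A t) (G z t)) (at t within {0..1})"
          if "t \<in> {0..1}" for t using dG[OF z that] by (simp add: A_def w_def)
        have Gh: "norm (G (z + h) t) \<le> R" if t: "t \<in> {0..1}" for t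
        proof -
          have "norm (act (B s) (G (z + h) s)) \<le> K * (2 * L + 2) * norm (G (z + h) s) + 0" if s: "s \<in> {0..1}" for s
          proof -
            have "norm (act (B s) (G (z + h) s)) \<le> norm (B s) * norm (G (z + h) s) * K" by (rule K(1))
            also have "\<dots> \<le> (2 * L + 2) * norm (G (z + h) s) * K"
              using Bb[OF s] K(2) by (intro mult_right_mono) auto
            finally show ?thesis by (simp add: mult_ac)
          qed
          from gronwall_unit_interval[OF dGh this _ _ t] K(2) L(1) show ?thesis
            by (simp add: R_def G0[OF zh])
        qed
        define \<Delta> where "\<Delta> t = G (z + h) t - G z t" for t
        have \<Delta>: "norm (\<Delta> t) \<le> c1 * norm h" if t: "t \<in> {0..1}" for t
        proof -
          have d\<Delta>: "(\<Delta> has_vector_derivative act (A s) (\<Delta> s) + act (B s - A s) (G (z + h) s)) (at s within {0..1})"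
            if s: "s \<in> {0..1}" for s
            using has_vector_derivative_diff[OF dGh[OF s] dGz[OF s]]
            unfolding \<Delta>_def by (simp add: act.diff_left act.diff_right)
          have "norm (act (A s) (\<Delta> s) + act (B s - A s) (G (z + h) s)) \<le> K * L * norm (\<Delta> s) + K * (L + 2) * R * norm h"
            if s: "s \<in> {0..1}" for s
          proof (rule norm_triangle_mono)
            have "norm (act (A s) (\<Delta> s)) \<le> norm (A s) * norm (\<Delta> s) * K" by (rule K(1))
            also have "\<dots> \<le> L * norm (\<Delta> s) * K"
              using LA[OF s] K(2) by (intro mult_right_mono) (auto simp: A_def)
            finally show "norm (act (A s) (\<Delta> s)) \<le> K * L * norm (\<Delta> s)" by (simp add: mult_ac)
            have "norm (act (B s - A s) (G (z + h) s)) \<le> norm (B s - A s) * norm (G (z + h) s) * K" by (rule K(1))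
            also have "\<dots> \<le> ((L + 2) * norm h) * R * K"
              using BA[OF s] Gh[OF s] K(2) L(1) by (intro mult_right_mono mult_mono) auto
            finally show "norm (act (B s - A s) (G (z + h) s)) \<le> K * (L + 2) * R * norm h" by (simp add: mult_ac)
          qed
          from gronwall_unit_interval[OF d\<Delta> this _ _ t] K(2) L(1) R show ?thesis
            by (simp add: c1_def \<Delta>_def G0 z zh mult_ac)
        qed
        \<comment> \<open>The endpoint of the segment moves by \<open>h\<close>, its point at
          parameter \<open>t\<close> by \<open>t *\<^sub>R h\<close>; hence the factor
          \<open>t\<close> in the expected change. At \<open>t = 1\<close> this is the remainder of
          the derivative claimed at \<open>z\<close>.\<close>
        define E where "E t = \<Delta> t - t *\<^sub>R act (om (y z t) h) (G z t)" for t
        have dE: "(E has_vector_derivative act (A t) (E t) + (act (\<rho> t) (G (z + h) t) + act (l h t) (\<Delta> t))) (at t within {0..1})"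
          if t: "t \<in> {0..1}" for t
        proof -
          have yt: "y z t \<in> U" using yU t z by blast
          have ld: "linear (omd (y z t) w)" using der[OF yt] has_derivative_linear by blast
          have dy: "(y z has_vector_derivative w) (at t within {0..1})"
            unfolding y_def w_def by (auto intro!: derivative_eq_intros)
          have domh: "((\<lambda>s. om (y z s) h) has_vector_derivative omd (y z t) h w) (at t within {0..1})"
            using vector_derivative_diff_chain_within[OF dy, of "\<lambda>x. om x h" "omd (y z t) h"]
              has_derivative_at_withinI[OF der[OF yt]] by (simp add: o_def)
          have "((\<lambda>s. s *\<^sub>R act (om (y z s) h) (G z s)) has_vector_derivative
             (t *\<^sub>R (act (om (y z t) h) (act (A t) (G z t)) + act (omd (y z t) h w) (G z t))
               + 1 *\<^sub>R act (om (y z t) h) (G z t))) (at t within {0..1})"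
            by (intro has_vector_derivative_scaleR act.has_vector_derivative domh dGz[OF t]) (auto intro!: derivative_eq_intros)
          then have *: "(E has_vector_derivative (act (B t) (G (z + h) t) - act (A t) (G z t)) -
              (t *\<^sub>R (act (om (y z t) h) (act (A t) (G z t)) + act (omd (y z t) h w) (G z t))
               + 1 *\<^sub>R act (om (y z t) h) (G z t))) (at t within {0..1})"
            unfolding E_def \<Delta>_def
            by (intro has_vector_derivative_diff dGh[OF t] dGz[OF t])
          \<comment> \<open>Flatness trades the derivative of the coefficient along the segment for
            its derivative in the direction \<open>h\<close>, which then cancels against the second
            summand of \<open>l h t\<close>.\<close>
          have fl: "act (om (y z t) h) (act (A t) (G z t)) + act (omd (y z t) h w) (G z t) =
             act (A t) (act (om (y z t) h) (G z t)) + act (omd (y z t) w h) (G z t)"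
            using flat[OF yt, of w h "G z t"] by (simp add: A_def algebra_simps)
          have "(act (B t) (G (z + h) t) - act (A t) (G z t)) -
              (t *\<^sub>R (act (om (y z t) h) (act (A t) (G z t)) + act (omd (y z t) h w) (G z t))
               + 1 *\<^sub>R act (om (y z t) h) (G z t)) =
             act (A t) (E t) + (act (\<rho> t) (G (z + h) t) + act (l h t) (\<Delta> t))"
            unfolding fl
            by (simp add: E_def \<Delta>_def \<rho>_def l_def act.add_left act.add_right act.diff_left act.diff_right
                act.scaleR_left act.scaleR_right linear_scale[OF ld] algebra_simps)
          then show ?thesis using * by simp
        qed
        have bE: "norm (act (A t) (E t) + (act (\<rho> t) (G (z + h) t) + act (l h t) (\<Delta> t)))
           \<le> K * L * norm (E t) + (2 * K * R + K * L * c1) * (e * norm h)" if t: "t \<in> {0..1}" for t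
        proof (rule norm_triangle_mono)
          have "norm (act (A t) (E t)) \<le> norm (A t) * norm (E t) * K" by (rule K(1))
          also have "\<dots> \<le> L * norm (E t) * K"
            using LA[OF t] K(2) by (intro mult_right_mono) (auto simp: A_def)
          finally show "norm (act (A t) (E t)) \<le> K * L * norm (E t)" by (simp add: mult_ac)
          have "norm (act (\<rho> t) (G (z + h) t)) \<le> norm (\<rho> t) * norm (G (z + h) t) * K" by (rule K(1))
          also have "\<dots> \<le> (e * (2 * norm h)) * R * K"
            using \<rho>[OF t] Gh[OF t] K(2) e by (intro mult_right_mono mult_mono) auto
          finally have 1: "norm (act (\<rho> t) (G (z + h) t)) \<le> 2 * K * R * (e * norm h)" by (simp add: mult_ac)
          have "norm (act (l h t) (\<Delta> t)) \<le> norm (l h t) * norm (\<Delta> t) * K" by (rule K(1))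
          also have "\<dots> \<le> (L * norm h) * (c1 * norm h) * K"
            using Ll[OF t] \<Delta>[OF t] K(2) L(1) by (intro mult_right_mono mult_mono) auto
          also have "\<dots> \<le> (L * norm h) * (c1 * e) * K"
            using h d(4) K(2) L(1) c1 by (intro mult_right_mono mult_left_mono) auto
          finally have 2: "norm (act (l h t) (\<Delta> t)) \<le> K * L * c1 * (e * norm h)" by (simp add: mult_ac)
          show "norm (act (\<rho> t) (G (z + h) t) + act (l h t) (\<Delta> t)) \<le> (2 * K * R + K * L * c1) * (e * norm h)"
            using norm_triangle_mono[OF 1 2] by (simp add: algebra_simps)
        qed
        have "norm (E 1) \<le> exp (2 * (K * L) + 1) * (norm (E 0) + (2 * K * R + K * L * c1) * (e * norm h))"
          using K(2) L(1) R c1 e by (intro gronwall_unit_interval[OF dE bE]) auto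
        then have "norm (E 1) \<le> c2 * e * norm h" by (simp add: E_def \<Delta>_def G0 z zh c2_def mult_ac)
        moreover have "E 1 = F (z + h) - F z - act (om z h) (F z)"
          by (simp add: E_def \<Delta>_def F_def y_def)
        ultimately show ?thesis by simp
      qed
      then show ?thesis using d(1) by blast
    qed
    show ?thesis
      unfolding has_derivative_at_alt
    proof (intro conjI allI impI)
      have "linear (\<lambda>w. act (om z w) (F z))"
        using lin[OF z] by (intro linearI) (simp_all add: linear_add linear_scale act.add_left act.scaleR_left)
      then show "bounded_linear (\<lambda>w. act (om z w) (F z))" by (simp add: linear_conv_bounded_linear)
      fix e :: real assume e: "0 < e"
      \<comment> \<open>The denominator is \<open>c2 + 1\<close> because \<open>c2\<close> may be
        0.\<close>
      define e' where "e' = min 1 (e / (c2 + 1))"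
      have e': "0 < e'" "e' \<le> 1" using e c2 by (auto simp: e'_def)
      have "c2 * e' \<le> c2 * (e / (c2 + 1))" using c2 by (intro mult_left_mono) (auto simp: e'_def)
      also have "\<dots> \<le> e" using c2 e by (simp add: field_simps)
      finally have le: "c2 * e' \<le> e" .
      obtain d where d: "0 < d" "\<And>h. norm h < d \<Longrightarrow> norm (F (z + h) - F z - act (om z h) (F z)) \<le> c2 * e' * norm h"
        using main[OF e'] by blast
      have "norm (F x - F z - act (om z (x - z)) (F z)) \<le> e * norm (x - z)" if "norm (x - z) < d" for x
        using d(2)[OF that] mult_right_mono[OF le norm_ge_zero[of "x - z"]] by simp
      then show "\<exists>d>0. \<forall>y. norm (y - z) < d \<longrightarrow> norm (F y - F z - act (om z (y - z)) (F z)) \<le> e * norm (y - z)"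
        using d(1) by blast
    qed
  qed
  then show ?thesis using Fq by blast
qed

section \<open>Continuation of local solutions over simply connected spaces\<close>

text \<open>In \<open>simply_connected\<close> any two loops are freely homotopic. For two constant
  loops, the track of the parameter 0 during the homotopy joins the two points.\<close>

lemma simply_connected_path_connected:
  fixes S :: "'a::topological_space set"
  assumes "simply_connected S"
  shows "path_connected S"
  unfolding path_connected_def
proof (intro ballI)
  fix a b assume ab: "a \<in> S" "b \<in> S"
  have "homotopic_loops S (\<lambda>t. a) (\<lambda>t. b)"
    by (rule assms[unfolded simply_connected_def, THEN spec, THEN spec, THEN mp])
      (use ab in \<open>auto simp: path_def path_image_def pathstart_def pathfinish_def\<close>)
  then obtain h where h: "continuous_on ({0..1::real} \<times> {0..1::real}) h" "h \<in> ({0..1} \<times> {0..1}) \<rightarrow> S"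
     "\<forall>x\<in>{0..1}. h (0, x) = a" "\<forall>x\<in>{0..1}. h (1, x) = b"
    unfolding homotopic_loops image_subset_iff_funcset by blast
  have hS: "h ` ({0..1} \<times> {0..1}) \<subseteq> S" using h(2) by (simp add: image_subset_iff_funcset)
  have "path (\<lambda>s. h (s, 0))"
    unfolding path_def by (rule continuous_on_compose2[OF h(1)]) (auto intro!: continuous_intros)
  moreover have "path_image (\<lambda>s. h (s, 0)) \<subseteq> S" using hS by (auto simp: path_image_def)
  ultimately show "\<exists>\<gamma>. path \<gamma> \<and> path_image \<gamma> \<subseteq> S \<and> pathstart \<gamma> = a \<and> pathfinish \<gamma> = b"
    using h(3,4) by (intro exI[of _ "\<lambda>s. h (s, 0)"]) (simp add: pathstart_def pathfinish_def)
qed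

text \<open>A covering of the base in disguise: the fibre over \<^term>\<open>q\<close> is \<^term>\<open>Bf q\<close>, its sheets over a
  member of the cover are the graphs of the local solutions.\<close>

locale monodromy =
  fixes S :: "'a::topological_space set" and \<U> :: "'a set set"
    and sols :: "'a set \<Rightarrow> ('a \<Rightarrow> 'b) set" and Bf :: "'a \<Rightarrow> 'b set"
  assumes cover: "p \<in> S \<Longrightarrow> \<exists>U\<in>\<U>. p \<in> U"
    and opn: "U \<in> \<U> \<Longrightarrow> openin (top_of_set S) U"
    and conn: "U \<in> \<U> \<Longrightarrow> path_connected U"
    and agree: "U \<in> \<U> \<Longrightarrow> V \<in> \<U> \<Longrightarrow> f \<in> sols U \<Longrightarrow> h \<in> sols V \<Longrightarrow> q \<in> U \<Longrightarrow> q \<in> V \<Longrightarrow> f q = h q \<Longrightarrow>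
      \<exists>N. openin (top_of_set S) N \<and> q \<in> N \<and> (\<forall>x\<in>N. f x = h x)"
    and ex: "U \<in> \<U> \<Longrightarrow> q \<in> U \<Longrightarrow> b \<in> Bf q \<Longrightarrow> \<exists>f\<in>sols U. f q = b"
    and val: "U \<in> \<U> \<Longrightarrow> f \<in> sols U \<Longrightarrow> q \<in> U \<Longrightarrow> f q \<in> Bf q"
    and unique: "U \<in> \<U> \<Longrightarrow> f \<in> sols U \<Longrightarrow> h \<in> sols U \<Longrightarrow> q \<in> U \<Longrightarrow> f q = h q \<Longrightarrow> x \<in> U \<Longrightarrow> f x = h x"
begin

text \<open>A continuous lift to the covering, phrased without a topology on the total space:
  locally \<open>L\<close> follows one sheet. The parameter set is left general because intervals
  and squares are both lifted.\<close>

definition lift :: "'k::topological_space set \<Rightarrow> ('k \<Rightarrow> 'a) \<Rightarrow> ('k \<Rightarrow> 'b) \<Rightarrow> bool" where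
  "lift K \<gamma> L \<longleftrightarrow> (\<forall>k\<in>K. \<exists>U\<in>\<U>. \<exists>f\<in>sols U. \<exists>T. open T \<and> k \<in> T \<and>
     (\<forall>x\<in>K \<inter> T. \<gamma> x \<in> U \<and> L x = f (\<gamma> x)))"

text \<open>The prescribed value may sit over any point of \<open>K\<close>; this freedom is what
  allows pieces to be glued in either order.\<close>

definition liftable :: "'k::topological_space set \<Rightarrow> ('k \<Rightarrow> 'a) \<Rightarrow> bool" where
  "liftable K \<gamma> \<longleftrightarrow> (\<forall>k\<in>K. \<forall>b\<in>Bf (\<gamma> k). \<exists>L. lift K \<gamma> L \<and> L k = b)"

lemma liftE:
  assumes "lift K \<gamma> L" "k \<in> K"
  obtains U f T where "U \<in> \<U>" "f \<in> sols U" "open T" "k \<in> T" "\<And>x. x \<in> K \<Longrightarrow> x \<in> T \<Longrightarrow> \<gamma> x \<in> U \<and> L x = f (\<gamma> x)"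
  using bspec[OF assms(1)[unfolded lift_def] assms(2)] that by auto

lemma liftI:
  assumes "\<And>k. k \<in> K \<Longrightarrow> \<exists>U\<in>\<U>. \<exists>f\<in>sols U. \<exists>T. open T \<and> k \<in> T \<and> (\<forall>x\<in>K \<inter> T. \<gamma> x \<in> U \<and> L x = f (\<gamma> x))"
  shows "lift K \<gamma> L"
  using assms unfolding lift_def by simp

lemma lift_val:
  assumes "lift K \<gamma> L" "k \<in> K"
  shows "L k \<in> Bf (\<gamma> k)"
  using liftE[OF assms] assms(2) val by metis

lemma lift_subset:
  assumes "lift K \<gamma> L" "K' \<subseteq> K"
  shows "lift K' \<gamma> L"
proof (rule liftI)
  fix k assume "k \<in> K'"
  then have "k \<in> K" using assms(2) by auto
  obtain U f T where "U \<in> \<U>" "f \<in> sols U" "open T" "k \<in> T"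
    "\<And>x. x \<in> K \<Longrightarrow> x \<in> T \<Longrightarrow> \<gamma> x \<in> U \<and> L x = f (\<gamma> x)" by (rule liftE[OF assms(1) \<open>k \<in> K\<close>]) (rule that)
  then show "\<exists>U\<in>\<U>. \<exists>f\<in>sols U. \<exists>T. open T \<and> k \<in> T \<and> (\<forall>x\<in>K' \<inter> T. \<gamma> x \<in> U \<and> L x = f (\<gamma> x))"
    using assms(2) by (intro bexI[of _ U] bexI[of _ f] exI[of _ T]) auto
qed

lemma lift_cong:
  assumes "lift K \<gamma> L" "\<And>k. k \<in> K \<Longrightarrow> \<gamma> k = \<gamma>' k \<and> L k = L' k"
  shows "lift K \<gamma>' L'"
proof (rule liftI)
  fix k assume "k \<in> K"
  obtain U f T where "U \<in> \<U>" "f \<in> sols U" "open T" "k \<in> T"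
    "\<And>x. x \<in> K \<Longrightarrow> x \<in> T \<Longrightarrow> \<gamma> x \<in> U \<and> L x = f (\<gamma> x)" by (rule liftE[OF assms(1) \<open>k \<in> K\<close>]) (rule that)
  then show "\<exists>U\<in>\<U>. \<exists>f\<in>sols U. \<exists>T. open T \<and> k \<in> T \<and> (\<forall>x\<in>K \<inter> T. \<gamma>' x \<in> U \<and> L' x = f (\<gamma>' x))"
    using assms(2) by (intro bexI[of _ U] bexI[of _ f] exI[of _ T]) auto
qed

lemma lift_compose:
  assumes L: "lift K \<gamma> L" and c: "continuous_on K' \<kappa>" "\<kappa> ` K' \<subseteq> K"
  shows "lift K' (\<gamma> \<circ> \<kappa>) (L \<circ> \<kappa>)"
  unfolding lift_def
proof
  fix k assume k: "k \<in> K'"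
  then obtain U f T where *: "U \<in> \<U>" "f \<in> sols U" "open T" "\<kappa> k \<in> T" "\<And>x. x \<in> K \<Longrightarrow> x \<in> T \<Longrightarrow> \<gamma> x \<in> U \<and> L x = f (\<gamma> x)"
  proof -
    have "\<kappa> k \<in> K" using c(2) k by blast
    from bspec[OF L[unfolded lift_def] this] show ?thesis using that by auto
  qed
  obtain A where A: "open A" "A \<inter> K' = \<kappa> -` T \<inter> K'"
    using c(1) *(3) unfolding continuous_on_open_invariant by blast
  have "k \<in> A" using A(2) k *(4) by blast
  moreover have "(\<gamma> \<circ> \<kappa>) x \<in> U \<and> (L \<circ> \<kappa>) x = f ((\<gamma> \<circ> \<kappa>) x)" if "x \<in> K' \<inter> A" for x
    using that A(2) c(2) *(5)[of "\<kappa> x"] by auto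
  ultimately show "\<exists>U\<in>\<U>. \<exists>f\<in>sols U. \<exists>T. open T \<and> k \<in> T \<and> (\<forall>x\<in>K' \<inter> T. (\<gamma> \<circ> \<kappa>) x \<in> U \<and> (L \<circ> \<kappa>) x = f ((\<gamma> \<circ> \<kappa>) x))"
    using *(1,2) A(1) by blast
qed

lemma preimage_nbhd:
  assumes "continuous_on K \<gamma>" "\<gamma> ` K \<subseteq> S" "openin (top_of_set S) N" "k \<in> K" "\<gamma> k \<in> N"
  shows "\<exists>T. open T \<and> k \<in> T \<and> (\<forall>x\<in>K \<inter> T. \<gamma> x \<in> N)"
proof -
  obtain N' where N': "open N'" "N = S \<inter> N'" using assms(3) openin_open by blast
  obtain A where A: "open A" "A \<inter> K = \<gamma> -` N' \<inter> K"
    using assms(1) N'(1) unfolding continuous_on_open_invariant by blast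
  have "k \<in> A" "\<forall>x\<in>K \<inter> A. \<gamma> x \<in> N" using A(2) N'(2) assms(2,4,5) by blast+
  then show ?thesis using A(1) by blast
qed

text \<open>Agreement and disagreement are both open conditions: near a point the second lift is
  moved, by \<open>ex\<close> and \<open>agree\<close>, to a sheet over the same open set as the
  first, and by \<open>unique\<close> two such sheets coincide everywhere or nowhere.\<close>

lemma lift_unique:
  assumes K: "connected K" and c: "continuous_on K \<gamma>" "\<gamma> ` K \<subseteq> S"
    and L: "lift K \<gamma> L" "lift K \<gamma> L'" and k0: "k0 \<in> K" "L k0 = L' k0" and k: "k \<in> K"
  shows "L k = L' k"
proof -
  have loc: "\<exists>T. open T \<and> k \<in> T \<and> (\<forall>x\<in>K \<inter> T. (L x = L' x) = (L k = L' k))" if k: "k \<in> K" for k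
  proof -
    obtain U f T where 1: "U \<in> \<U>" "f \<in> sols U" "open T" "k \<in> T" "\<forall>x\<in>K \<inter> T. \<gamma> x \<in> U \<and> L x = f (\<gamma> x)"
      using L(1) k unfolding lift_def by blast
    obtain U' f' T' where 2: "U' \<in> \<U>" "f' \<in> sols U'" "open T'" "k \<in> T'" "\<forall>x\<in>K \<inter> T'. \<gamma> x \<in> U' \<and> L' x = f' (\<gamma> x)"
      using L(2) k unfolding lift_def by blast
    have gk: "\<gamma> k \<in> U" "\<gamma> k \<in> U'" using 1 2 k by auto
    obtain f'' where f'': "f'' \<in> sols U" "f'' (\<gamma> k) = f' (\<gamma> k)"
      using ex[OF 1(1) gk(1) val[OF 2(1,2) gk(2)]] by blast
    obtain N where N: "openin (top_of_set S) N" "\<gamma> k \<in> N" "\<forall>x\<in>N. f'' x = f' x"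
      using agree[OF 1(1) 2(1) f''(1) 2(2) gk f''(2)] by blast
    obtain T'' where T'': "open T''" "k \<in> T''" "\<forall>x\<in>K \<inter> T''. \<gamma> x \<in> N"
      using preimage_nbhd[OF c N(1) k N(2)] by blast
    have "(L x = L' x) = (L k = L' k)" if x: "x \<in> K \<inter> (T \<inter> T' \<inter> T'')" for x
    proof -
      have "L x = f (\<gamma> x)" "L' x = f'' (\<gamma> x)" "L k = f (\<gamma> k)" "L' k = f'' (\<gamma> k)" "\<gamma> x \<in> U"
        using x k 1 2 N T'' f'' by auto
      then show ?thesis using unique[OF 1(1,2) f''(1)] gk(1) by metis
    qed
    then show ?thesis using 1(3,4) 2(3,4) T''(1,2) by (intro exI[of _ "T \<inter> T' \<inter> T''"]) auto
  qed
  define A where "A = \<Union>{T. open T \<and> (\<forall>x\<in>K \<inter> T. L x = L' x)}"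
  define B where "B = \<Union>{T. open T \<and> (\<forall>x\<in>K \<inter> T. L x \<noteq> L' x)}"
  have "K \<subseteq> A \<union> B"
  proof
    fix x assume x: "x \<in> K"
    obtain T where T: "open T" "x \<in> T" "\<forall>y\<in>K \<inter> T. (L y = L' y) = (L x = L' x)" using loc[OF x] by blast
    show "x \<in> A \<union> B"
    proof (cases "L x = L' x")
      case True
      then have "T \<subseteq> A" using T unfolding A_def by auto
      then show ?thesis using T(2) by blast
    next
      case False
      then have "T \<subseteq> B" using T unfolding B_def by auto
      then show ?thesis using T(2) by blast
    qed
  qed
  moreover have "A \<inter> B \<inter> K = {}" unfolding A_def B_def by auto
  moreover have "open A" "open B" unfolding A_def B_def by auto
  ultimately have "A \<inter> K = {} \<or> B \<inter> K = {}" using connectedD[OF K, of A B] by blast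
  moreover have "k0 \<in> A"
    using \<open>K \<subseteq> A \<union> B\<close> k0 unfolding B_def by auto
  ultimately have "k \<in> A" using \<open>K \<subseteq> A \<union> B\<close> k k0(1) by blast
  then show ?thesis using k unfolding A_def by auto
qed

lemma lift_const: "b \<in> Bf p \<Longrightarrow> p \<in> S \<Longrightarrow> lift K (\<lambda>_. p) (\<lambda>_. b)"
proof -
  assume "b \<in> Bf p" "p \<in> S"
  then obtain U f where "U \<in> \<U>" "p \<in> U" "f \<in> sols U" "f p = b" using cover ex by metis
  then show ?thesis by (intro liftI bexI[of _ U] bexI[of _ f] exI[of _ UNIV]) auto
qed

lemma lift_local: "U \<in> \<U> \<Longrightarrow> f \<in> sols U \<Longrightarrow> \<gamma> ` K \<subseteq> U \<Longrightarrow> lift K \<gamma> (f \<circ> \<gamma>)"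
  unfolding lift_def by (intro ballI bexI[of _ U] bexI[of _ f] exI[of _ UNIV]) auto

lemma liftable_local:
  assumes "U \<in> \<U>" "\<gamma> ` K \<subseteq> U"
  shows "liftable K \<gamma>"
  unfolding liftable_def
proof (intro ballI)
  fix k b assume "k \<in> K" "b \<in> Bf (\<gamma> k)"
  then obtain f where "f \<in> sols U" "f (\<gamma> k) = b" using ex assms by blast
  then show "\<exists>L. lift K \<gamma> L \<and> L k = b" using lift_local[OF assms(1) _ assms(2)] by (metis o_apply)
qed

text \<open>Only a point of both pieces needs an argument: there the two sheets have the same value
  and agree nearby. At any other point the closed piece not containing it is removed from the
  neighbourhood.\<close>

lemma lift_glue:
  assumes cl: "closed K1" "closed K2"
    and c: "continuous_on (K1 \<union> K2) \<gamma>" "\<gamma> ` (K1 \<union> K2) \<subseteq> S"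
    and L: "lift K1 \<gamma> L1" "lift K2 \<gamma> L2" and eq: "\<And>x. x \<in> K1 \<inter> K2 \<Longrightarrow> L1 x = L2 x"
  shows "lift (K1 \<union> K2) \<gamma> (\<lambda>x. if x \<in> K1 then L1 x else L2 x)" (is "lift _ _ ?L")
  unfolding lift_def
proof
  fix k assume k: "k \<in> K1 \<union> K2"
  consider "k \<in> K1" "k \<in> K2" | "k \<in> K1" "k \<notin> K2" | "k \<notin> K1" "k \<in> K2" using k by blast
  then show "\<exists>U\<in>\<U>. \<exists>f\<in>sols U. \<exists>T. open T \<and> k \<in> T \<and> (\<forall>x\<in>(K1 \<union> K2) \<inter> T. \<gamma> x \<in> U \<and> ?L x = f (\<gamma> x))"
  proof cases
    case 1
    obtain U f T where 1: "U \<in> \<U>" "f \<in> sols U" "open T" "k \<in> T" "\<forall>x\<in>K1 \<inter> T. \<gamma> x \<in> U \<and> L1 x = f (\<gamma> x)"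
      using L(1) \<open>k \<in> K1\<close> unfolding lift_def by blast
    obtain U' f' T' where 2: "U' \<in> \<U>" "f' \<in> sols U'" "open T'" "k \<in> T'" "\<forall>x\<in>K2 \<inter> T'. \<gamma> x \<in> U' \<and> L2 x = f' (\<gamma> x)"
      using L(2) \<open>k \<in> K2\<close> unfolding lift_def by blast
    have gk: "\<gamma> k \<in> U" "\<gamma> k \<in> U'" "f (\<gamma> k) = f' (\<gamma> k)"
      using 1 2 \<open>k \<in> K1\<close> \<open>k \<in> K2\<close> eq[of k] by auto
    obtain N where N: "openin (top_of_set S) N" "\<gamma> k \<in> N" "\<forall>x\<in>N. f x = f' x"
      using agree[OF 1(1) 2(1) 1(2) 2(2) gk] by blast
    obtain T'' where T'': "open T''" "k \<in> T''" "\<forall>x\<in>(K1 \<union> K2) \<inter> T''. \<gamma> x \<in> N"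
      using preimage_nbhd[OF c N(1) k N(2)] by blast
    obtain T3 where T3: "open T3" "k \<in> T3" "\<forall>x\<in>(K1 \<union> K2) \<inter> T3. \<gamma> x \<in> U"
      using preimage_nbhd[OF c opn[OF 1(1)] k gk(1)] by blast
    have "\<gamma> x \<in> U \<and> ?L x = f (\<gamma> x)" if "x \<in> (K1 \<union> K2) \<inter> (T \<inter> T' \<inter> T'' \<inter> T3)" for x
      using that 1(5) 2(5) T''(3) T3(3) N(3) by auto
    moreover have "open (T \<inter> T' \<inter> T'' \<inter> T3)" "k \<in> T \<inter> T' \<inter> T'' \<inter> T3"
      using 1 2 T'' T3 by auto
    ultimately show ?thesis using 1(1,2) by blast
  next
    case 2
    obtain U f T where 1: "U \<in> \<U>" "f \<in> sols U" "open T" "k \<in> T" "\<forall>x\<in>K1 \<inter> T. \<gamma> x \<in> U \<and> L1 x = f (\<gamma> x)"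
      using L(1) \<open>k \<in> K1\<close> unfolding lift_def by blast
    have "\<gamma> x \<in> U \<and> ?L x = f (\<gamma> x)" if "x \<in> (K1 \<union> K2) \<inter> (T - K2)" for x using that 1(5) by auto
    moreover have "open (T - K2)" "k \<in> T - K2" using 1 2 cl by auto
    ultimately show ?thesis using 1(1,2) by blast
  next
    case 3
    obtain U f T where 1: "U \<in> \<U>" "f \<in> sols U" "open T" "k \<in> T" "\<forall>x\<in>K2 \<inter> T. \<gamma> x \<in> U \<and> L2 x = f (\<gamma> x)"
      using L(2) \<open>k \<in> K2\<close> unfolding lift_def by blast
    have "\<gamma> x \<in> U \<and> ?L x = f (\<gamma> x)" if "x \<in> (K1 \<union> K2) \<inter> (T - K1)" for x using that 1(5) by auto
    moreover have "open (T - K1)" "k \<in> T - K1" using 1 3 cl by auto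
    ultimately show ?thesis using 1(1,2) by blast
  qed
qed

text \<open>The second lift is chosen to match the first at one point of the intersection; as the
  intersection is connected, \<open>lift_unique\<close> makes them match on all of it.\<close>

lemma liftable_glue:
  assumes cl: "closed K1" "closed K2" and I: "connected (K1 \<inter> K2)" "K1 \<inter> K2 \<noteq> {}"
    and c: "continuous_on (K1 \<union> K2) \<gamma>" "\<gamma> ` (K1 \<union> K2) \<subseteq> S"
    and g: "liftable K1 \<gamma>" "liftable K2 \<gamma>"
  shows "liftable (K1 \<union> K2) \<gamma>"
proof -
  have half: "\<exists>L. lift (K1 \<union> K2) \<gamma> L \<and> L k = b"
    if cl: "closed K1" "closed K2" and I: "connected (K1 \<inter> K2)" "K1 \<inter> K2 \<noteq> {}"
    and c: "continuous_on (K1 \<union> K2) \<gamma>" "\<gamma> ` (K1 \<union> K2) \<subseteq> S"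
    and g: "liftable K1 \<gamma>" "liftable K2 \<gamma>" and k: "k \<in> K1" and b: "b \<in> Bf (\<gamma> k)" for K1 K2 k b
  proof -
    obtain m where m: "m \<in> K1" "m \<in> K2" using I(2) by blast
    obtain L1 where L1: "lift K1 \<gamma> L1" "L1 k = b" using g(1) k b unfolding liftable_def by blast
    obtain L2 where L2: "lift K2 \<gamma> L2" "L2 m = L1 m"
      using g(2) lift_val[OF L1(1) m(1)] m(2) unfolding liftable_def by blast
    have "L1 x = L2 x" if "x \<in> K1 \<inter> K2" for x
    proof (rule lift_unique[OF I(1), of \<gamma> L1 L2 m x])
      show "continuous_on (K1 \<inter> K2) \<gamma>" using c(1) continuous_on_subset by blast
      show "\<gamma> ` (K1 \<inter> K2) \<subseteq> S" using c(2) by blast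
      show "lift (K1 \<inter> K2) \<gamma> L1" "lift (K1 \<inter> K2) \<gamma> L2"
        using L1(1) L2(1) lift_subset by blast+
    qed (use m L2 that in auto)
    then have "lift (K1 \<union> K2) \<gamma> (\<lambda>x. if x \<in> K1 then L1 x else L2 x)" by (rule lift_glue[OF cl c L1(1) L2(1)])
    then show ?thesis using k L1(2) by (intro exI[of _ "\<lambda>x. if x \<in> K1 then L1 x else L2 x"]) simp
  qed
  show ?thesis
    unfolding liftable_def
  proof (intro ballI)
    fix k b assume k: "k \<in> K1 \<union> K2" and b: "b \<in> Bf (\<gamma> k)"
    show "\<exists>L. lift (K1 \<union> K2) \<gamma> L \<and> L k = b"
    proof (cases "k \<in> K1")
      case True
      then show ?thesis by (rule half[OF cl I c g _ b])
    next
      case False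
      then have "k \<in> K2" using k by blast
      then show ?thesis
        using half[of K2 K1 k b] cl I c g b by (simp add: Un_commute Int_commute)
    qed
  qed
qed

text \<open>Bisection takes the place of a Lebesgue number: in the first coordinate, and within its
  local step in the second. Neighbouring rectangles are glued along a common edge, which is
  connected.\<close>

lemma liftable_rectangle:
  fixes h :: "real \<times> real \<Rightarrow> 'a"
  assumes h: "continuous_on UNIV h" "range h \<subseteq> S" and ab: "a \<le> b" and cd: "c \<le> d"
  shows "liftable ({a..b} \<times> {c..d}) h"
  using ab
proof (induction rule: Bolzano)
  case (trans a b e)
  have "{a..e} \<times> {c..d} = {a..b} \<times> {c..d} \<union> {b..e} \<times> {c..d}"
    using trans(3,4) by auto
  moreover have "({a..b} \<times> {c..d}) \<inter> ({b..e} \<times> {c..d}) = {b} \<times> {c..d}"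
    using trans(3,4) by auto
  moreover have "connected ({b} \<times> {c..d})" by (intro convex_connected convex_Times) auto
  ultimately show ?case
    using liftable_glue[of "{a..b} \<times> {c..d}" "{b..e} \<times> {c..d}" h] trans(1,2) cd h
      continuous_on_subset[OF h(1)] by (auto simp: closed_Times image_subset_iff)
next
  case (local x)
  \<comment> \<open>The width must serve for the full height of the strip, so the quantifiers over
    \<open>a\<close> and \<open>b\<close> belong to the property that is bisected
    vertically.\<close>
  have "\<exists>\<delta>>0. \<forall>a b. a \<le> x \<and> x \<le> b \<and> b - a < \<delta> \<longrightarrow> liftable ({a..b} \<times> {c..d}) h"
    using cd
  proof (induction rule: Bolzano)
    case (trans c d e)
    obtain \<delta>1 where 1: "\<delta>1 > 0" "\<And>a b. a \<le> x \<and> x \<le> b \<and> b - a < \<delta>1 \<Longrightarrow> liftable ({a..b} \<times> {c..d}) h"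
      using trans(1) by blast
    obtain \<delta>2 where 2: "\<delta>2 > 0" "\<And>a b. a \<le> x \<and> x \<le> b \<and> b - a < \<delta>2 \<Longrightarrow> liftable ({a..b} \<times> {d..e}) h"
      using trans(2) by blast
    have "liftable ({a..b} \<times> {c..e}) h" if "a \<le> x \<and> x \<le> b \<and> b - a < min \<delta>1 \<delta>2" for a b
    proof -
      have "{a..b} \<times> {c..e} = {a..b} \<times> {c..d} \<union> {a..b} \<times> {d..e}"
        using trans(3,4) by auto
      moreover have "({a..b} \<times> {c..d}) \<inter> ({a..b} \<times> {d..e}) = {a..b} \<times> {d}"
        using trans(3,4) by auto
      moreover have "connected ({a..b} \<times> {d})" by (intro convex_connected convex_Times) auto
      moreover have "{a..b} \<times> {d} \<noteq> {}" using that by auto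
      ultimately show ?thesis
        using liftable_glue[of "{a..b} \<times> {c..d}" "{a..b} \<times> {d..e}" h] 1(2)[of a b] 2(2)[of a b] that h
          continuous_on_subset[OF h(1)] by (auto simp: closed_Times image_subset_iff)
    qed
    then show ?case using 1(1) 2(1) by (intro exI[of _ "min \<delta>1 \<delta>2"]) auto
  next
    case (local y)
    obtain U where U: "U \<in> \<U>" "h (x, y) \<in> U" using cover[OF subsetD[OF h(2) rangeI]] by blast
    obtain T where T: "open T" "(x, y) \<in> T" "\<forall>p\<in>UNIV \<inter> T. h p \<in> U"
      using preimage_nbhd[OF h opn[OF U(1)] _ U(2)] by blast
    obtain A B where AB: "open A" "open B" "(x, y) \<in> A \<times> B" "A \<times> B \<subseteq> T"
      using open_prod_elim[OF T(1,2)] by auto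
    have xy: "x \<in> A" "y \<in> B" using AB(3) by auto
    obtain r1 where r1: "0 < r1" "ball x r1 \<subseteq> A" using AB(1) xy(1) openE by blast
    obtain r2 where r2: "0 < r2" "ball y r2 \<subseteq> B" using AB(2) xy(2) openE by blast
    have "liftable ({a..b} \<times> {c..d}) h"
      if "c \<le> y \<and> y \<le> d \<and> d - c < r2" "a \<le> x \<and> x \<le> b \<and> b - a < r1" for a b c d
    proof (rule liftable_local[OF U(1)])
      have "{a..b} \<subseteq> ball x r1" "{c..d} \<subseteq> ball y r2" using that by (auto simp: dist_real_def)
      then have "{a..b} \<times> {c..d} \<subseteq> T" using r1 r2 AB(4) by blast
      then show "h ` ({a..b} \<times> {c..d}) \<subseteq> U" using T(3) by blast
    qed
    then show ?case using r1(1) r2(1) by blast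
  qed
  then show ?case .
qed

text \<open>Clamping both coordinates to \<open>{0..1}\<close> extends the map to the plane, where
  \<open>liftable_rectangle\<close> has no boundary cases.\<close>

lemma liftable_unit_square:
  fixes h :: "real \<times> real \<Rightarrow> 'a"
  assumes h: "continuous_on ({0..1} \<times> {0..1}) h" "h ` ({0..1} \<times> {0..1}) \<subseteq> S"
    and b: "b \<in> Bf (h (0, 0))"
  shows "\<exists>L. lift ({0..1} \<times> {0..1}) h L \<and> L (0, 0) = b"
proof -
  define cl where "cl p = (max 0 (min 1 (fst p)), max 0 (min 1 (snd p)))" for p :: "real \<times> real"
  have cl: "cl p \<in> {0..1} \<times> {0..1}" for p by (simp add: cl_def)
  have "continuous_on UNIV (h \<circ> cl)"
    unfolding o_def
    by (rule continuous_on_compose2[OF h(1)]) (use cl in \<open>auto simp: cl_def intro!: continuous_intros\<close>)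
  moreover have "range (h \<circ> cl) \<subseteq> S" using h(2) cl by auto
  ultimately have lf: "liftable ({0..1} \<times> {0..1}) (h \<circ> cl)" by (intro liftable_rectangle) auto
  have clid: "cl p = p" if "p \<in> {0..1} \<times> {0..1}" for p using that by (auto simp: cl_def)
  have "b \<in> Bf ((h \<circ> cl) (0, 0))" using b by (simp add: cl_def)
  then obtain L where "lift ({0..1} \<times> {0..1}) (h \<circ> cl) L" "L (0, 0) = b"
    using bspec[OF lf[unfolded liftable_def], of "(0, 0)"] by auto
  moreover from this(1) have "lift ({0..1} \<times> {0..1}) h L" by (rule lift_cong) (use clid in auto)
  ultimately show ?thesis by blast
qed

text \<open>A path is treated as a square that is constant in the first parameter.\<close>

lemma path_lift_exists:
  assumes "path \<gamma>" "path_image \<gamma> \<subseteq> S" "b \<in> Bf (pathstart \<gamma>)"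
  shows "\<exists>L. lift {0..1} \<gamma> L \<and> L 0 = b"
proof -
  have "continuous_on ({0..1} \<times> {0..1}) (\<gamma> \<circ> snd)"
    unfolding o_def by (rule continuous_on_compose2[OF assms(1)[unfolded path_def]]) (auto intro!: continuous_intros)
  moreover have "(\<gamma> \<circ> snd) ` ({0..1} \<times> {0..1}) \<subseteq> S" using assms(2) by (auto simp: path_image_def)
  ultimately obtain L where L: "lift ({0..1} \<times> {0..1}) (\<gamma> \<circ> snd) L" "L (0 :: real, 0) = b"
    using liftable_unit_square[of "\<gamma> \<circ> snd" b] assms(3) by (auto simp: pathstart_def)
  have "lift {0..1} ((\<gamma> \<circ> snd) \<circ> (\<lambda>t. (0 :: real, t))) (L \<circ> (\<lambda>t. (0, t)))"
    by (rule lift_compose[OF L(1)]) (auto intro!: continuous_intros)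
  then show ?thesis using L(2) by (intro exI[of _ "L \<circ> (\<lambda>t. (0, t))"]) (auto simp: o_def)
qed

lemma path_lift_unique:
  assumes "path \<gamma>" "path_image \<gamma> \<subseteq> S" "lift {0..1} \<gamma> L" "lift {0..1} \<gamma> L'" "t0 \<in> {0..1}" "L t0 = L' t0" "t \<in> {0..1}"
  shows "L t = L' t"
  using lift_unique[of "{0..1}" \<gamma> L L' t0 t] assms by (auto simp: path_def path_image_def)

text \<open>The contraction of the loop is lifted as a square. Over the constant loop the lift is
  constant, so the lifts along the top and the bottom edge have a common end there. Both edges trace
  the same path, hence the lifts also agree at the other end, over the given loop.\<close>

lemma loop_lift_closed:
  assumes S: "simply_connected S" and l: "path l" "path_image l \<subseteq> S" "pathstart l = p0" "pathfinish l = p0"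
    and L: "lift {0..1} l L"
  shows "L 1 = L 0"
proof -
  have p0: "p0 \<in> S" using l by (metis path_image_def pathstart_def pathstart_in_path_image subsetD)
  define cp where "cp = (\<lambda>t::real. p0)"
  have "path cp" "path_image cp \<subseteq> S" "pathstart cp = p0" "pathfinish cp = p0"
    using p0 by (auto simp: cp_def path_def path_image_def pathstart_def pathfinish_def)
  then have "homotopic_loops S l cp" using S l unfolding simply_connected_def by simp
  then obtain h where h: "continuous_on ({0..1::real} \<times> {0..1::real}) h" "h \<in> ({0..1} \<times> {0..1}) \<rightarrow> S"
     "\<forall>x\<in>{0..1}. h (0, x) = l x" "\<forall>x\<in>{0..1}. h (1, x) = cp x"
     "\<forall>t\<in>{0..1}. pathfinish (h \<circ> Pair t) = pathstart (h \<circ> Pair t)"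
    unfolding homotopic_loops image_subset_iff_funcset by blast
  have h2: "h ` ({0..1} \<times> {0..1}) \<subseteq> S" using h(2) by (simp add: image_subset_iff_funcset)
  have h3: "\<And>x. x \<in> {0..1} \<Longrightarrow> h (0, x) = l x" "\<And>x. x \<in> {0..1} \<Longrightarrow> h (1, x) = p0"
     "\<And>t. t \<in> {0..1} \<Longrightarrow> h (t, 1) = h (t, 0)"
    using h(3-5) by (auto simp: cp_def pathstart_def pathfinish_def)
  note h = h(1) h2 h3
  have b: "L 0 \<in> Bf p0" using lift_val[OF L, of 0] l(3) by (simp add: pathstart_def)
  obtain M where M: "lift ({0..1} \<times> {0..1}) h M" "M (0, 0) = L 0"
    using liftable_unit_square[OF h(1,2), of "L 0"] b h(3)[of 0] l(3) by (auto simp: pathstart_def)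
  have left: "lift {0..1} l (\<lambda>t. M (0, t))"
    by (rule lift_cong[OF lift_compose[OF M(1), of "{0..1}" "\<lambda>t. (0, t)"]]) (use h(3) in \<open>auto intro!: continuous_intros\<close>)
  have right: "lift {0..1} cp (\<lambda>t. M (1, t))"
    by (rule lift_cong[OF lift_compose[OF M(1), of "{0..1}" "\<lambda>t. (1, t)"]]) (use h(4) in \<open>auto intro!: continuous_intros simp: cp_def\<close>)
  have bot: "lift {0..1} (\<lambda>s. h (s, 0)) (\<lambda>s. M (s, 0))"
    by (rule lift_cong[OF lift_compose[OF M(1), of "{0..1}" "\<lambda>s. (s, 0)"]]) (auto intro!: continuous_intros)
  have top: "lift {0..1} (\<lambda>s. h (s, 0)) (\<lambda>s. M (s, 1))"
    by (rule lift_cong[OF lift_compose[OF M(1), of "{0..1}" "\<lambda>s. (s, 1)"]]) (use h(5) in \<open>auto intro!: continuous_intros\<close>)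
  have "M (1, 0) \<in> Bf p0" using lift_val[OF right, of 0] by (simp add: cp_def)
  then have "lift {0..1::real} cp (\<lambda>t. M (1, 0))" unfolding cp_def using lift_const p0 by blast
  then have "M (1, 1) = M (1, 0)"
    using path_lift_unique[OF _ _ right, of "\<lambda>t. M (1, 0)" 0 1] \<open>path cp\<close> \<open>path_image cp \<subseteq> S\<close> by auto
  moreover have "path (\<lambda>s. h (s, 0))" "path_image (\<lambda>s. h (s, 0)) \<subseteq> S"
    using h(2) by (auto simp: path_def path_image_def intro!: continuous_on_compose2[OF h(1)] continuous_intros)
  ultimately have "M (0, 1) = M (0, 0)"
    using path_lift_unique[OF _ _ top bot, of 1 0] by auto
  moreover have "M (0, t) = L t" if "t \<in> {0..1}" for t
    using path_lift_unique[OF l(1,2) left L, of 0 t] M(2) that by auto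
  ultimately show ?thesis by simp
qed

lemma lift_first_half:
  "lift {0..1} (\<gamma> +++ \<eta>) L \<Longrightarrow> pathfinish \<gamma> = pathstart \<eta> \<Longrightarrow> lift {0..1} \<gamma> (\<lambda>t. L (t / 2))"
  by (rule lift_cong[OF lift_compose[of "{0..1}" "\<gamma> +++ \<eta>" L "{0..1}" "\<lambda>t. t / 2"]])
    (auto simp: joinpaths_def intro!: continuous_intros)

lemma lift_second_half:
  "lift {0..1} (\<gamma> +++ \<eta>) L \<Longrightarrow> pathfinish \<gamma> = pathstart \<eta> \<Longrightarrow> lift {0..1} \<eta> (\<lambda>t. L (1 / 2 + t / 2))"
  by (rule lift_cong[OF lift_compose[of "{0..1}" "\<gamma> +++ \<eta>" L "{0..1}" "\<lambda>t. 1 / 2 + t / 2"]])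
    (auto simp: joinpaths_def pathstart_def pathfinish_def field_simps intro!: continuous_intros)

text \<open>The loop out along \<open>\<gamma>1\<close> and back along \<open>\<gamma>2\<close> has
  a closed lift, whose value at 1/2 is the end value of both given lifts.\<close>

lemma lift_end_unique:
  assumes S: "simply_connected S"
    and g1: "path \<gamma>1" "path_image \<gamma>1 \<subseteq> S" "lift {0..1} \<gamma>1 L1"
    and g2: "path \<gamma>2" "path_image \<gamma>2 \<subseteq> S" "lift {0..1} \<gamma>2 L2"
    and ends: "pathstart \<gamma>1 = pathstart \<gamma>2" "pathfinish \<gamma>1 = pathfinish \<gamma>2" "L1 0 = L2 0"
  shows "L1 1 = L2 1"
proof -
  define l where "l = \<gamma>1 +++ reversepath \<gamma>2"
  have l: "path l" "path_image l \<subseteq> S" "pathstart l = pathstart \<gamma>1" "pathfinish l = pathstart \<gamma>1"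
    using g1 g2 ends by (auto simp: l_def path_image_join)
  have b: "L1 0 \<in> Bf (pathstart l)" using lift_val[OF g1(3), of 0] l(3) by (simp add: pathstart_def)
  obtain L where L: "lift {0..1} l L" "L 0 = L1 0" using path_lift_exists[OF l(1,2) b] by blast
  have L10: "L 1 = L 0" by (rule loop_lift_closed[OF S l L(1)])
  have fin: "pathfinish \<gamma>1 = pathstart (reversepath \<gamma>2)" using ends by simp
  have "L (1 / 2) = L1 1"
    using path_lift_unique[OF g1(1,2) lift_first_half[OF L(1)[unfolded l_def] fin] g1(3), of 0 1] L(2) by simp
  moreover have "lift {0..1} \<gamma>2 (\<lambda>t. L (1 / 2 + (1 - t) / 2))"
    by (rule lift_cong[OF lift_compose[OF lift_second_half[OF L(1)[unfolded l_def] fin], of "{0..1}" "\<lambda>t. 1 - t"]])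
      (auto simp: reversepath_def intro!: continuous_intros)
  then have "L (1 / 2) = L2 1"
    using path_lift_unique[OF g2(1,2) _ g2(3), of "\<lambda>t. L (1 / 2 + (1 - t) / 2)" 0 1] L(2) L10 ends(3) by simp
  ultimately show ?thesis by simp
qed

text \<open>The value at \<open>p\<close> is found by continuation along any path from
  \<open>p0\<close>; \<open>lift_end_unique\<close> makes it independent of the path. Over a member
  of the cover a path to one of its points is prolonged inside the member, where the continuation
  stays on one sheet.\<close>

theorem global_solution:
  assumes S: "simply_connected S" and p0: "p0 \<in> S" and b0: "b0 \<in> Bf p0"
  shows "\<exists>F. F p0 = b0 \<and> (\<forall>U\<in>\<U>. U \<noteq> {} \<longrightarrow> (\<exists>f\<in>sols U. \<forall>x\<in>U. F x = f x))"
proof -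
  define reach where "reach p b \<longleftrightarrow> (\<exists>\<gamma> L. path \<gamma> \<and> path_image \<gamma> \<subseteq> S \<and> pathstart \<gamma> = p0 \<and> pathfinish \<gamma> = p \<and>
     lift {0..1} \<gamma> L \<and> L 0 = b0 \<and> L 1 = b)" for p b
  have uniq: "b = b'" if "reach p b" "reach p b'" for p b b'
    using that lift_end_unique[OF S] unfolding reach_def by metis
  define F where "F p = (THE b. reach p b)" for p
  have F: "F p = b" if "reach p b" for p b unfolding F_def using uniq that by blast
  have ex_reach: "\<exists>b. reach p b" if p: "p \<in> S" for p
  proof -
    obtain \<gamma> where \<gamma>: "path \<gamma>" "path_image \<gamma> \<subseteq> S" "pathstart \<gamma> = p0" "pathfinish \<gamma> = p"
      using simply_connected_path_connected[OF S] p0 p unfolding path_connected_def by blast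
    then show ?thesis using path_lift_exists[OF \<gamma>(1,2)] b0 unfolding reach_def by metis
  qed
  have "reach p0 b0"
    unfolding reach_def using lift_const[OF b0 p0] p0
    by (intro exI[of _ "\<lambda>t. p0"] exI[of _ "\<lambda>t. b0"]) (auto simp: path_def path_image_def pathstart_def pathfinish_def)
  then have "F p0 = b0" by (rule F)
  moreover have "\<exists>f\<in>sols U. \<forall>x\<in>U. F x = f x" if U: "U \<in> \<U>" "U \<noteq> {}" for U
  proof -
    have US: "U \<subseteq> S" using opn[OF U(1)] openin_imp_subset by blast
    obtain x where x: "x \<in> U" using U(2) by blast
    then obtain \<gamma> L where \<gamma>: "path \<gamma>" "path_image \<gamma> \<subseteq> S" "pathstart \<gamma> = p0" "pathfinish \<gamma> = x"
      "lift {0..1} \<gamma> L" "L 0 = b0"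
    proof -
      obtain b where "reach x b" using ex_reach[of x] US x by blast
      then show ?thesis unfolding reach_def using that by (elim exE conjE)
    qed
    have "L 1 \<in> Bf x" using lift_val[OF \<gamma>(5), of 1] \<gamma>(4) by (simp add: pathfinish_def)
    then obtain f where f: "f \<in> sols U" "f x = L 1" using ex[OF U(1) x] by blast
    have "F y = f y" if y: "y \<in> U" for y
    proof -
      obtain \<eta> where \<eta>: "path \<eta>" "path_image \<eta> \<subseteq> U" "pathstart \<eta> = x" "pathfinish \<eta> = y"
        using conn[OF U(1)] x y unfolding path_connected_def by blast
      have j: "path (\<gamma> +++ \<eta>)" "path_image (\<gamma> +++ \<eta>) \<subseteq> S" "pathstart (\<gamma> +++ \<eta>) = p0" "pathfinish (\<gamma> +++ \<eta>) = y"
        using \<gamma> \<eta> US by (auto simp: path_image_join)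
      obtain M where M: "lift {0..1} (\<gamma> +++ \<eta>) M" "M 0 = b0" using path_lift_exists[OF j(1,2)] j(3) b0 by metis
      have je: "pathfinish \<gamma> = pathstart \<eta>" using \<gamma> \<eta> by simp
      have "M (1 / 2) = L 1"
        using path_lift_unique[OF \<gamma>(1,2) lift_first_half[OF M(1) je] \<gamma>(5), of 0 1] M(2) \<gamma>(6) by simp
      moreover have "lift {0..1} \<eta> (f \<circ> \<eta>)"
        using lift_local[OF U(1) f(1)] \<eta>(2) by (simp add: path_image_def)
      moreover have "path_image \<eta> \<subseteq> S" using \<eta>(2) US by blast
      ultimately have "M 1 = f y"
        using path_lift_unique[OF \<eta>(1) _ lift_second_half[OF M(1) je], of "f \<circ> \<eta>" 0 1] f(2) \<eta>(3,4)
        by (simp add: pathstart_def pathfinish_def)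
      then have "reach y (f y)" unfolding reach_def using j M by blast
      then show ?thesis by (rule F)
    qed
    then show ?thesis using f(1) by blast
  qed
  ultimately show ?thesis by blast
qed

end

section \<open>Surfaces and their tangent spaces\<close>

lemma sum_Basis_real2: "(\<Sum>b\<in>(Basis :: (real^2) set). f b) = f (axis 1 1) + f (axis 2 1)"
proof -
  have 1: "(Basis :: (real^2) set) = {axis 1 1, axis 2 1}"
    by (auto simp: Basis_vec_def UNIV_2)
  have 2: "axis 1 1 \<noteq> (axis 2 1 :: real^2)" by (simp add: axis_eq_axis)
  show ?thesis unfolding 1 using 2 by (subst sum.insert) auto
qed

text \<open>Differentiation under the integral. The power of \<open>t\<close> is a parameter because
  the chain rule contributes one more factor \<open>t\<close>, so the derivative is again of the
  same form.\<close>

lemma smooth_segment_integral_derivative: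
  fixes F :: "'e::euclidean_space \<Rightarrow> real"
  assumes F: "smooth_on F (ball a r)" and x: "x \<in> ball a r"
  shows "((\<lambda>x. integral {0..1} (\<lambda>t. t ^ m * F (a + t *\<^sub>R (x - a)))) has_derivative
     (\<lambda>v. integral {0..1} (\<lambda>t. t ^ Suc m * frechet_derivative F (at (a + t *\<^sub>R (x - a))) v))) (at x)"
proof -
  let ?B = "ball a r"
  have seg: "a + t *\<^sub>R (x - a) \<in> ?B" if "t \<in> {0..1}" "x \<in> ?B" for t x
  proof -
    have "norm (t *\<^sub>R (x - a)) \<le> norm (x - a)" using that by (simp add: mult_left_le_one_le)
    then show ?thesis using that(2) by (simp add: dist_norm norm_minus_commute)
  qed
  define D where "D y v = frechet_derivative F (at y) v" for y v
  have dF: "(F has_derivative D y) (at y)" if "y \<in> ?B" for y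
    unfolding D_def using smooth_on_has_derivative[OF open_ball F that] by simp
  have cD: "continuous_on ?B (\<lambda>y. D y v)" for v
    unfolding D_def using smooth_on_continuous[OF smooth_on_derivative[OF F]] .
  have rep: "D y v = (\<Sum>b\<in>Basis. D y b * (v \<bullet> b))" if "y \<in> ?B" for y v
  proof -
    have l: "linear (D y)" using dF[OF that] has_derivative_linear by blast
    have "D y v = D y (\<Sum>b\<in>Basis. (v \<bullet> b) *\<^sub>R b)" by (simp add: euclidean_representation)
    then show ?thesis by (simp add: linear_sum[OF l] linear_scale[OF l] mult.commute)
  qed
  \<comment> \<open>\<open>leibniz_rule\<close> needs the derivative as a bounded linear function
    that is jointly continuous, so it is assembled from its values on the basis.\<close>
  define fx where "fx x t = (\<Sum>b\<in>Basis. (t ^ Suc m * D (a + t *\<^sub>R (x - a)) b) *\<^sub>R blinfun_inner_left b)" for x and t :: real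
  have fx: "blinfun_apply (fx x t) v = t ^ Suc m * D (a + t *\<^sub>R (x - a)) v" if "t \<in> {0..1}" "x \<in> ?B" for x t v
    unfolding fx_def rep[OF seg[OF that], of v]
    by (simp add: blinfun.sum_left blinfun.scaleR_left sum_distrib_left mult.assoc)
  have "((\<lambda>x. integral (cbox 0 1) (\<lambda>t. t ^ m * F (a + t *\<^sub>R (x - a)))) has_derivative integral (cbox 0 1) (fx x)) (at x within ?B)"
  proof (rule leibniz_rule[OF _ _ _ x convex_ball])
    fix x t assume xt: "x \<in> ?B" "t \<in> cbox 0 (1::real)"
    then have t: "t \<in> {0..1}" by simp
    have "((\<lambda>x. a + t *\<^sub>R (x - a)) has_derivative (\<lambda>v. t *\<^sub>R v)) (at x within ?B)"
      by (auto intro!: derivative_eq_intros)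
    then have "((\<lambda>x. F (a + t *\<^sub>R (x - a))) has_derivative (\<lambda>v. D (a + t *\<^sub>R (x - a)) (t *\<^sub>R v))) (at x within ?B)"
      by (rule has_derivative_compose[where g = F and f = "\<lambda>x. a + t *\<^sub>R (x - a)", OF _ dF[OF seg[OF t xt(1)]]])
    then have "((\<lambda>x. t ^ m * F (a + t *\<^sub>R (x - a))) has_derivative (\<lambda>v. t ^ m * D (a + t *\<^sub>R (x - a)) (t *\<^sub>R v))) (at x within ?B)"
      by (rule has_derivative_mult_right)
    moreover have "t ^ m * D (a + t *\<^sub>R (x - a)) (t *\<^sub>R v) = blinfun_apply (fx x t) v" for v
      using linear_scale[OF has_derivative_linear[OF dF[OF seg[OF t xt(1)]]]] by (simp add: fx[OF t xt(1)])
    ultimately show "((\<lambda>x. t ^ m * F (a + t *\<^sub>R (x - a))) has_derivative blinfun_apply (fx x t)) (at x within ?B)"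
      by simp
  next
    fix x assume x: "x \<in> ?B"
    have "continuous_on (cbox 0 1) (\<lambda>t. t ^ m * F (a + t *\<^sub>R (x - a)))"
      using seg[OF _ x]
      by (intro continuous_on_mult continuous_on_compose2[OF smooth_on_continuous[OF F]]) (auto intro!: continuous_intros)
    then show "(\<lambda>t. t ^ m * F (a + t *\<^sub>R (x - a))) integrable_on cbox 0 1" by (rule integrable_continuous)
  next
    show "continuous_on (?B \<times> cbox 0 1) (\<lambda>(x, t). fx x t)"
      unfolding fx_def split_beta
      using seg by (intro continuous_on_sum continuous_on_scaleR continuous_on_mult continuous_on_compose2[OF cD])
        (auto intro!: continuous_intros)
  qed
  then have *: "((\<lambda>x. integral (cbox 0 1) (\<lambda>t. t ^ m * F (a + t *\<^sub>R (x - a)))) has_derivative integral (cbox 0 1) (fx x)) (at x)"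
    using at_within_open[OF x open_ball] by simp
  have "continuous_on (cbox 0 1) (fx x)"
    unfolding fx_def
    using seg[OF _ x] by (intro continuous_on_sum continuous_on_scaleR continuous_on_mult continuous_on_compose2[OF cD])
        (auto intro!: continuous_intros)
  then have int: "fx x integrable_on cbox 0 1" by (rule integrable_continuous)
  have ap: "blinfun_apply (integral (cbox 0 1) (fx x)) = (\<lambda>v. integral {0..1} (\<lambda>t. t ^ Suc m * D (a + t *\<^sub>R (x - a)) v))"
    by (rule ext, unfold blinfun_apply_integral[OF int]) (use fx[OF _ x] in \<open>auto intro!: integral_cong\<close>)
  show ?thesis using *[unfolded ap] unfolding D_def by simp
qed

lemma smooth_segment_integral:
  fixes F :: "'e::euclidean_space \<Rightarrow> real"
  assumes "smooth_on F (ball a r)"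
  shows "smooth_on (\<lambda>x. integral {0..1} (\<lambda>t. t ^ m * F (a + t *\<^sub>R (x - a)))) (ball a r)"
proof -
  have "Ck_on k (\<lambda>x. integral {0..1} (\<lambda>t. t ^ m * F (a + t *\<^sub>R (x - a)))) (ball a r)" for k
    using assms
  proof (induction k arbitrary: F m)
    case 0
    then show ?case
      using has_derivative_continuous[OF smooth_segment_integral_derivative[OF 0]]
      by (simp add: continuous_at_imp_continuous_on)
  next
    case (Suc k)
    show ?case
      by (rule Ck_on_SucI[OF open_ball smooth_segment_integral_derivative[OF Suc.prems]])
        (assumption, rule Suc.IH[OF smooth_on_derivative[OF Suc.prems]])
  qed
  then show ?thesis by (simp add: smooth_on_def)
qed

text \<open>The fundamental theorem of calculus along segments from \<open>a\<close>. The point is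
  that the coefficients are smooth again, so that a derivation can be applied to the expansion by
  the product rule.\<close>

lemma hadamard:
  fixes F :: "'e::euclidean_space \<Rightarrow> real"
  assumes F: "smooth_on F (ball a r)" and r: "0 < r"
  shows "\<exists>h. (\<forall>b. smooth_on (h b) (ball a r)) \<and> (\<forall>b. h b a = frechet_derivative F (at a) b) \<and>
     (\<forall>x\<in>ball a r. F x = F a + (\<Sum>b\<in>Basis. ((x - a) \<bullet> b) * h b x))"
proof -
  define h where "h b x = integral {0..1} (\<lambda>t. t ^ 0 * frechet_derivative F (at (a + t *\<^sub>R (x - a))) b)" for b x
  have "smooth_on (h b) (ball a r)" for b
    unfolding h_def by (rule smooth_segment_integral[OF smooth_on_derivative[OF F]])
  moreover have "h b a = frechet_derivative F (at a) b" for b by (simp add: h_def)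
  moreover have "F x = F a + (\<Sum>b\<in>Basis. ((x - a) \<bullet> b) * h b x)" if x: "x \<in> ball a r" for x
  proof -
    define y where "y t = a + t *\<^sub>R (x - a)" for t :: real
    have seg: "y t \<in> ball a r" if "t \<in> {0..1}" for t
    proof -
      have "norm (t *\<^sub>R (x - a)) \<le> norm (x - a)" using that by (simp add: mult_left_le_one_le)
      then show ?thesis using x by (simp add: y_def dist_norm norm_minus_commute)
    qed
    have "((\<lambda>t. F (y t)) has_vector_derivative frechet_derivative F (at (y t)) (x - a)) (at t within {0..1})"
      if "t \<in> {0..1}" for t
    proof -
      have "(y has_vector_derivative (x - a)) (at t within {0..1})"
        unfolding y_def by (auto intro!: derivative_eq_intros)
      then show ?thesis
        using vector_derivative_diff_chain_within[of y "x - a" t "{0..1}" F]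
          has_derivative_at_withinI[OF smooth_on_has_derivative[OF open_ball F seg[OF that]]] by (simp add: o_def)
    qed
    then have 1: "((\<lambda>t. frechet_derivative F (at (y t)) (x - a)) has_integral F (y 1) - F (y 0)) {0..1}"
      by (intro fundamental_theorem_of_calculus) auto
    have int: "(\<lambda>t. frechet_derivative F (at (y t)) b) integrable_on {0..1}" for b
    proof (rule integrable_continuous_interval)
      show "continuous_on {0..1} (\<lambda>t. frechet_derivative F (at (y t)) b)"
        using seg by (intro continuous_on_compose2[OF smooth_on_continuous[OF smooth_on_derivative[OF F]]])
          (auto simp: y_def intro!: continuous_intros)
    qed
    have "((\<lambda>t. \<Sum>b\<in>Basis. ((x - a) \<bullet> b) * frechet_derivative F (at (y t)) b) has_integral
        (\<Sum>b\<in>Basis. ((x - a) \<bullet> b) * h b x)) {0..1}"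
    proof (intro has_integral_sum has_integral_mult_right)
      show "((\<lambda>t. frechet_derivative F (at (y t)) b) has_integral h b x) {0..1}" for b
        using integrable_integral[OF int[of b]] by (simp add: h_def y_def)
    qed auto
    moreover have "(\<Sum>b\<in>Basis. ((x - a) \<bullet> b) * frechet_derivative F (at (y t)) b) = frechet_derivative F (at (y t)) (x - a)"
      if "t \<in> {0..1}" for t
    proof -
      have l: "linear (frechet_derivative F (at (y t)))"
        using smooth_on_has_derivative[OF open_ball F seg[OF that]] has_derivative_linear by blast
      have "frechet_derivative F (at (y t)) (x - a) = frechet_derivative F (at (y t)) (\<Sum>b\<in>Basis. ((x - a) \<bullet> b) *\<^sub>R b)"
        by (simp add: euclidean_representation)
      then show ?thesis by (simp add: linear_sum[OF l] linear_scale[OF l])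
    qed
    ultimately have "((\<lambda>t. frechet_derivative F (at (y t)) (x - a)) has_integral (\<Sum>b\<in>Basis. ((x - a) \<bullet> b) * h b x)) {0..1}"
      by (rule has_integral_eq[rotated])
    then have "F (y 1) - F (y 0) = (\<Sum>b\<in>Basis. ((x - a) \<bullet> b) * h b x)" by (rule has_integral_unique[OF 1])
    then show ?thesis by (simp add: y_def)
  qed
  ultimately show ?thesis by (intro exI[of _ h]) simp
qed

section \<open>Smooth functions on a surface\<close>

locale surface =
  fixes S :: "'a::topological_space set" and \<A> :: "'a atlas"
  assumes smooth_surface: "smooth_surface S \<A>"
begin

lemma atlas_cover: "p \<in> S \<Longrightarrow> \<exists>V \<phi>. (V, \<phi>) \<in> \<A> \<and> p \<in> V"
  using smooth_surface unfolding smooth_surface_def by blast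

lemma chart_openin: "(V, \<phi>) \<in> \<A> \<Longrightarrow> openin (top_of_set S) V"
  using smooth_surface unfolding smooth_surface_def by blast

lemma chart_open_range: "(V, \<phi>) \<in> \<A> \<Longrightarrow> open (\<phi> ` V)"
  using smooth_surface unfolding smooth_surface_def by blast

text \<open>A surface only provides some inverse of a chart, while smoothness is expressed with
  \<open>inv_into\<close>; on the image of the chart the two coincide.\<close>

lemma chart_homeomorphism:
  assumes "(V, \<phi>) \<in> \<A>"
  shows "inj_on \<phi> V" "homeomorphism V (\<phi> ` V) \<phi> (inv_into V \<phi>)"
proof -
  obtain \<psi> where h: "homeomorphism V (\<phi> ` V) \<phi> \<psi>"
    using smooth_surface assms unfolding smooth_surface_def by fast
  then have "\<And>x. x \<in> V \<Longrightarrow> \<psi> (\<phi> x) = x" by (simp add: homeomorphism_def)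
  then show i: "inj_on \<phi> V" by (rule inj_on_inverseI)
  have "\<psi> z = inv_into V \<phi> z" if "z \<in> \<phi> ` V" for z
    using that h i by (auto simp: homeomorphism_def)
  then show "homeomorphism V (\<phi> ` V) \<phi> (inv_into V \<phi>)"
    using h homeomorphism_cong[of V "\<phi> ` V" \<phi> \<psi> V "\<phi> ` V" \<phi> "inv_into V \<phi>"] by simp
qed

lemma chart_transition:
  assumes "(V, \<phi>) \<in> \<A>" "(V', \<phi>') \<in> \<A>"
  shows "smooth_on (\<phi>' \<circ> inv_into V \<phi>) (\<phi> ` (V \<inter> V'))"
  using smooth_surface assms unfolding smooth_surface_def by fast

lemma open_chart_image:
  assumes "(V, \<phi>) \<in> \<A>" "openin (top_of_set S) U"
  shows "open (\<phi> ` (U \<inter> V))"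
proof -
  note h = chart_homeomorphism[OF assms(1)]
  obtain T where T: "open T" "U = S \<inter> T" using assms(2) openin_open by blast
  have VS: "V \<subseteq> S" using chart_openin[OF assms(1)] openin_imp_subset by blast
  have "\<phi> ` (U \<inter> V) = inv_into V \<phi> -` T \<inter> \<phi> ` V"
    using h VS T(2) by auto
  moreover have "continuous_on (\<phi> ` V) (inv_into V \<phi>)" using h(2) by (simp add: homeomorphism_def)
  ultimately show ?thesis
    using continuous_on_open_vimage[OF chart_open_range[OF assms(1)], THEN iffD1, rule_format, OF _ T(1)] by metis
qed

lemma openin_chart_preimage:
  assumes "(V, \<phi>) \<in> \<A>" "open W" "W \<subseteq> \<phi> ` V"
  shows "openin (top_of_set S) (inv_into V \<phi> ` W)"
proof -
  note h = chart_homeomorphism[OF assms(1)]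
  have "inv_into V \<phi> ` W = V \<inter> \<phi> -` W"
  proof
    show "inv_into V \<phi> ` W \<subseteq> V \<inter> \<phi> -` W"
      using assms(3) by (auto simp: f_inv_into_f inv_into_into subset_iff)
    show "V \<inter> \<phi> -` W \<subseteq> inv_into V \<phi> ` W"
      using h(1) by (force simp: image_iff)
  qed
  moreover have "openin (top_of_set V) (V \<inter> \<phi> -` W)"
    using h(2) assms(2) continuous_openin_preimage_gen[of V \<phi> W] by (simp add: homeomorphism_def)
  ultimately show ?thesis using openin_trans chart_openin[OF assms(1)] by metis
qed

lemma smooth_fun_openin: "smooth_fun S \<A> U f \<Longrightarrow> openin (top_of_set S) U"
  by (simp add: smooth_fun_def)

lemma smooth_fun_chart:
  "smooth_fun S \<A> U f \<Longrightarrow> (V, \<phi>) \<in> \<A> \<Longrightarrow> smooth_on (f \<circ> inv_into V \<phi>) (\<phi> ` (U \<inter> V))"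
  unfolding smooth_fun_def by fast

lemma smooth_funI:
  "openin (top_of_set S) U \<Longrightarrow> (\<And>V \<phi>. (V, \<phi>) \<in> \<A> \<Longrightarrow> smooth_on (f \<circ> inv_into V \<phi>) (\<phi> ` (U \<inter> V)))
    \<Longrightarrow> smooth_fun S \<A> U f"
  unfolding smooth_fun_def by fast

text \<open>One chart suffices, because the transition maps are smooth.\<close>

lemma smooth_fun_chartI:
  assumes V: "(V, \<phi>) \<in> \<A>" and U: "openin (top_of_set S) U" "U \<subseteq> V"
    and f: "smooth_on (f \<circ> inv_into V \<phi>) (\<phi> ` U)"
  shows "smooth_fun S \<A> U f"
proof (rule smooth_funI[OF U(1)])
  fix V' \<phi>' assume V': "(V', \<phi>') \<in> \<A>"
  note h = chart_homeomorphism[OF V] and h' = chart_homeomorphism[OF V']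
  have o: "open (\<phi>' ` (U \<inter> V'))" by (rule open_chart_image[OF V' U(1)])
  have o2: "open (\<phi> ` U)" using open_chart_image[OF V U(1)] U(2) by (simp add: Int_absorb2)
  have "smooth_on (\<phi> \<circ> inv_into V' \<phi>') (\<phi>' ` (U \<inter> V'))"
    using chart_transition[OF V' V] by (rule smooth_on_subset) (use U(2) in auto)
  moreover have "(\<phi> \<circ> inv_into V' \<phi>') ` (\<phi>' ` (U \<inter> V')) \<subseteq> \<phi> ` U"
    using h'(1) by auto
  ultimately have "smooth_on ((f \<circ> inv_into V \<phi>) \<circ> (\<phi> \<circ> inv_into V' \<phi>')) (\<phi>' ` (U \<inter> V'))"
    by (rule smooth_on_compose[OF o o2 _ _ f])
  then show "smooth_on (f \<circ> inv_into V' \<phi>') (\<phi>' ` (U \<inter> V'))"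
    by (rule smooth_on_cong[OF o, rotated]) (use h(1) h'(1) U(2) in \<open>auto simp: subset_iff\<close>)
qed

lemma smooth_fun_subset:
  assumes "smooth_fun S \<A> U f" "openin (top_of_set S) U'" "U' \<subseteq> U"
  shows "smooth_fun S \<A> U' f"
  using assms(2)
proof (rule smooth_funI)
  fix V \<phi> assume "(V, \<phi>) \<in> \<A>"
  from smooth_fun_chart[OF assms(1) this] show "smooth_on (f \<circ> inv_into V \<phi>) (\<phi> ` (U' \<inter> V))"
    by (rule smooth_on_subset) (use assms(3) in auto)
qed

lemma smooth_fun_cong:
  assumes "smooth_fun S \<A> U f" "\<And>q. q \<in> U \<Longrightarrow> f q = h q"
  shows "smooth_fun S \<A> U h"
proof (rule smooth_funI[OF smooth_fun_openin[OF assms(1)]])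
  fix V \<phi> assume V: "(V, \<phi>) \<in> \<A>"
  from smooth_fun_chart[OF assms(1) V] show "smooth_on (h \<circ> inv_into V \<phi>) (\<phi> ` (U \<inter> V))"
    by (rule smooth_on_cong[OF open_chart_image[OF V smooth_fun_openin[OF assms(1)]], rotated])
      (use assms(2) chart_homeomorphism(1)[OF V] in auto)
qed

lemma smooth_fun_local:
  assumes "openin (top_of_set S) U" "\<And>p. p \<in> U \<Longrightarrow> \<exists>N. p \<in> N \<and> smooth_fun S \<A> N f"
  shows "smooth_fun S \<A> U f"
proof (rule smooth_funI[OF assms(1)])
  fix V \<phi> assume V: "(V, \<phi>) \<in> \<A>"
  show "smooth_on (f \<circ> inv_into V \<phi>) (\<phi> ` (U \<inter> V))"
  proof (rule smooth_on_local[OF open_chart_image[OF V assms(1)]])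
    fix z assume "z \<in> \<phi> ` (U \<inter> V)"
    then obtain p where p: "p \<in> U" "p \<in> V" "z = \<phi> p" by blast
    obtain N where N: "p \<in> N" "smooth_fun S \<A> N f" using assms(2)[OF p(1)] by blast
    have "open (\<phi> ` (N \<inter> V))" by (rule open_chart_image[OF V smooth_fun_openin[OF N(2)]])
    moreover have "z \<in> \<phi> ` (N \<inter> V)" using N p by blast
    ultimately show "\<exists>N. open N \<and> z \<in> N \<and> smooth_on (f \<circ> inv_into V \<phi>) N"
      using smooth_fun_chart[OF N(2) V] by blast
  qed
qed

lemma smooth_fun_map:
  assumes "smooth_fun S \<A> U f"
    and "\<And>(W :: (real^2) set) h. open W \<Longrightarrow> smooth_on h W \<Longrightarrow> smooth_on (\<lambda>z. F (h z)) W"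
  shows "smooth_fun S \<A> U (\<lambda>q. F (f q))"
proof (rule smooth_funI[OF smooth_fun_openin[OF assms(1)]])
  fix V \<phi> assume V: "(V, \<phi>) \<in> \<A>"
  show "smooth_on ((\<lambda>q. F (f q)) \<circ> inv_into V \<phi>) (\<phi> ` (U \<inter> V))"
    using assms(2)[OF open_chart_image[OF V smooth_fun_openin[OF assms(1)]] smooth_fun_chart[OF assms(1) V]]
    by (simp add: o_def)
qed

lemma smooth_fun_map2:
  assumes "smooth_fun S \<A> U f" "smooth_fun S \<A> U g"
    and "\<And>(W :: (real^2) set) h k. open W \<Longrightarrow> smooth_on h W \<Longrightarrow> smooth_on k W \<Longrightarrow> smooth_on (\<lambda>z. F (h z) (k z)) W"
  shows "smooth_fun S \<A> U (\<lambda>q. F (f q) (g q))"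
proof (rule smooth_funI[OF smooth_fun_openin[OF assms(1)]])
  fix V \<phi> assume V: "(V, \<phi>) \<in> \<A>"
  show "smooth_on ((\<lambda>q. F (f q) (g q)) \<circ> inv_into V \<phi>) (\<phi> ` (U \<inter> V))"
    using assms(3)[OF open_chart_image[OF V smooth_fun_openin[OF assms(1)]]
        smooth_fun_chart[OF assms(1) V] smooth_fun_chart[OF assms(2) V]]
    by (simp add: o_def)
qed

lemma smooth_fun_const: "openin (top_of_set S) U \<Longrightarrow> smooth_fun S \<A> U (\<lambda>q. c)"
  by (rule smooth_funI) (simp_all add: o_def)

lemma smooth_fun_linear: "smooth_fun S \<A> U f \<Longrightarrow> bounded_linear L \<Longrightarrow> smooth_fun S \<A> U (\<lambda>q. L (f q))"
  by (rule smooth_fun_map) (auto intro: smooth_on_linear_compose)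

lemma smooth_fun_bilinear:
  "smooth_fun S \<A> U f \<Longrightarrow> smooth_fun S \<A> U g \<Longrightarrow> bounded_bilinear pr \<Longrightarrow> smooth_fun S \<A> U (\<lambda>q. pr (f q) (g q))"
  by (rule smooth_fun_map2) (auto intro: smooth_on_bilinear)

lemma smooth_fun_add: "smooth_fun S \<A> U f \<Longrightarrow> smooth_fun S \<A> U g \<Longrightarrow> smooth_fun S \<A> U (\<lambda>q. f q + g q)"
  by (rule smooth_fun_map2) (auto intro: smooth_on_add)

lemma smooth_fun_diff: "smooth_fun S \<A> U f \<Longrightarrow> smooth_fun S \<A> U g \<Longrightarrow> smooth_fun S \<A> U (\<lambda>q. f q - g q)"
  by (rule smooth_fun_map2) (auto intro: smooth_on_diff)

lemma smooth_fun_minus: "smooth_fun S \<A> U f \<Longrightarrow> smooth_fun S \<A> U (\<lambda>q. - f q)"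
  by (rule smooth_fun_map) (auto intro: smooth_on_minus)

lemma smooth_fun_mult:
  fixes f g :: "'a \<Rightarrow> 'b::real_normed_algebra"
  shows "smooth_fun S \<A> U f \<Longrightarrow> smooth_fun S \<A> U g \<Longrightarrow> smooth_fun S \<A> U (\<lambda>q. f q * g q)"
  by (rule smooth_fun_map2) (auto intro: smooth_on_mult)

lemma smooth_fun_nth: "smooth_fun S \<A> U f \<Longrightarrow> smooth_fun S \<A> U (\<lambda>q. f q $ i)"
  by (rule smooth_fun_linear[OF _ bounded_linear_vec_nth])

lemma smooth_fun_vec:
  fixes f :: "'a \<Rightarrow> 'b::real_normed_vector^'n"
  assumes "\<And>i. smooth_fun S \<A> U (\<lambda>q. f q $ i)"
  shows "smooth_fun S \<A> U f"
proof (rule smooth_funI[OF smooth_fun_openin[OF assms]])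
  fix V \<phi> assume V: "(V, \<phi>) \<in> \<A>"
  show "smooth_on (f \<circ> inv_into V \<phi>) (\<phi> ` (U \<inter> V))"
    using smooth_fun_chart[OF assms V]
    by (intro smooth_on_vec open_chart_image[OF V smooth_fun_openin[OF assms]]) (simp add: o_def)
qed

lemma smooth_fun_compose:
  fixes f :: "'a \<Rightarrow> 'b::euclidean_space"
  assumes "smooth_fun S \<A> U f" "open N" "f ` U \<subseteq> N" "smooth_on G N"
  shows "smooth_fun S \<A> U (\<lambda>q. G (f q))"
proof (rule smooth_funI[OF smooth_fun_openin[OF assms(1)]])
  fix V \<phi> assume V: "(V, \<phi>) \<in> \<A>"
  have "smooth_on (G \<circ> (f \<circ> inv_into V \<phi>)) (\<phi> ` (U \<inter> V))"
    by (rule smooth_on_compose[OF open_chart_image[OF V smooth_fun_openin[OF assms(1)]] assms(2)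
          smooth_fun_chart[OF assms(1) V] _ assms(4)])
      (use assms(3) chart_homeomorphism(1)[OF V] in auto)
  then show "smooth_on ((\<lambda>q. G (f q)) \<circ> inv_into V \<phi>) (\<phi> ` (U \<inter> V))" by (simp add: o_def)
qed

end

section \<open>Germs and derivations\<close>

context surface
begin

lemma smooth_nearI: "smooth_fun S \<A> U f \<Longrightarrow> p \<in> U \<Longrightarrow> smooth_near S \<A> p f"
  unfolding smooth_near_def by (intro exI[of _ U]) simp

lemma smooth_near_in: "smooth_near S \<A> p f \<Longrightarrow> p \<in> S"
  unfolding smooth_near_def using smooth_fun_openin openin_imp_subset by fastforce

lemma smooth_near_both:
  assumes "smooth_near S \<A> p f" "smooth_near S \<A> p h"
  shows "\<exists>U. p \<in> U \<and> smooth_fun S \<A> U f \<and> smooth_fun S \<A> U h"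
proof -
  obtain U where U: "p \<in> U" "smooth_fun S \<A> U f" using assms(1) unfolding smooth_near_def by (elim exE conjE)
  obtain U' where U': "p \<in> U'" "smooth_fun S \<A> U' h" using assms(2) unfolding smooth_near_def by (elim exE conjE)
  have o: "openin (top_of_set S) (U \<inter> U')"
    by (rule openin_Int[OF smooth_fun_openin[OF U(2)] smooth_fun_openin[OF U'(2)]])
  have "smooth_fun S \<A> (U \<inter> U') f" by (rule smooth_fun_subset[OF U(2) o]) simp
  moreover have "smooth_fun S \<A> (U \<inter> U') h" by (rule smooth_fun_subset[OF U'(2) o]) simp
  ultimately show ?thesis using U(1) U'(1) by blast
qed

lemma smooth_near_const: "p \<in> S \<Longrightarrow> smooth_near S \<A> p (\<lambda>q. c)"
  by (rule smooth_nearI[OF smooth_fun_const[of S]]) auto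

lemma smooth_near_linear:
  assumes "smooth_near S \<A> p f" "bounded_linear L"
  shows "smooth_near S \<A> p (\<lambda>q. L (f q))"
proof -
  obtain U where U: "p \<in> U" "smooth_fun S \<A> U f" using assms(1) unfolding smooth_near_def by (elim exE conjE)
  show ?thesis by (rule smooth_nearI[OF smooth_fun_linear[OF U(2) assms(2)] U(1)])
qed

lemma smooth_near_add:
  assumes "smooth_near S \<A> p f" "smooth_near S \<A> p h"
  shows "smooth_near S \<A> p (\<lambda>q. f q + h q)"
proof -
  obtain U where "p \<in> U" "smooth_fun S \<A> U f" "smooth_fun S \<A> U h" using smooth_near_both[OF assms] by blast
  then show ?thesis by (intro smooth_nearI[OF smooth_fun_add])
qed

lemma smooth_near_mult:
  fixes f h :: "'a \<Rightarrow> 'b::real_normed_algebra"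
  assumes "smooth_near S \<A> p f" "smooth_near S \<A> p h"
  shows "smooth_near S \<A> p (\<lambda>q. f q * h q)"
proof -
  obtain U where "p \<in> U" "smooth_fun S \<A> U f" "smooth_fun S \<A> U h" using smooth_near_both[OF assms] by blast
  then show ?thesis by (intro smooth_nearI[OF smooth_fun_mult])
qed

lemma tangent_not_smooth: "X \<in> tangent_space S \<A> p \<Longrightarrow> \<not> smooth_near S \<A> p f \<Longrightarrow> X f = 0"
  unfolding tangent_space_def by simp

lemma tangent_scale: "X \<in> tangent_space S \<A> p \<Longrightarrow> smooth_near S \<A> p f \<Longrightarrow> X (\<lambda>q. c * f q) = c * X f"
  unfolding tangent_space_def by simp

lemma tangent_add:
  "X \<in> tangent_space S \<A> p \<Longrightarrow> smooth_near S \<A> p f \<Longrightarrow> smooth_near S \<A> p h \<Longrightarrow> X (\<lambda>q. f q + h q) = X f + X h"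
  unfolding tangent_space_def by simp

lemma tangent_mult:
  "X \<in> tangent_space S \<A> p \<Longrightarrow> smooth_near S \<A> p f \<Longrightarrow> smooth_near S \<A> p h \<Longrightarrow> X (\<lambda>q. f q * h q) = X f * h p + f p * X h"
  unfolding tangent_space_def by simp

lemma tangent_const:
  assumes X: "X \<in> tangent_space S \<A> p" and p: "p \<in> S"
  shows "X (\<lambda>q. c) = 0"
proof -
  have s: "smooth_near S \<A> p (\<lambda>q. 1 :: real)" by (rule smooth_near_const[OF p])
  have "X (\<lambda>q. 1) = 0" using tangent_mult[OF X s s] by simp
  then show ?thesis using tangent_scale[OF X s, of c] by simp
qed

text \<open>Multiplication by the indicator function of the neighbourhood makes the two functions equal
  everywhere.\<close>

lemma tangent_germ:
  assumes X: "X \<in> tangent_space S \<A> p" and f: "smooth_fun S \<A> N f" and p: "p \<in> N"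
    and eq: "\<And>q. q \<in> N \<Longrightarrow> f q = h q"
  shows "X f = X h"
proof -
  define b where "b q = (if q \<in> N then 1 else 0 :: real)" for q
  have N: "openin (top_of_set S) N" by (rule smooth_fun_openin[OF f])
  have pS: "p \<in> S" using N p openin_imp_subset by blast
  have b: "smooth_near S \<A> p b"
    by (rule smooth_nearI[OF smooth_fun_cong[OF smooth_fun_const[OF N, of 1]] p]) (simp add: b_def)
  have f': "smooth_near S \<A> p f" by (rule smooth_nearI[OF f p])
  have h': "smooth_near S \<A> p h" by (rule smooth_nearI[OF smooth_fun_cong[OF f eq] p])
  have bb: "(\<lambda>q. b q * b q) = b" by (auto simp: b_def)
  have bp: "b p = 1" using p by (simp add: b_def)
  have "X b = 0" using tangent_mult[OF X b b] by (simp add: bb bp)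
  moreover have "(\<lambda>q. f q * b q) = (\<lambda>q. h q * b q)" using eq by (auto simp: b_def)
  ultimately show ?thesis using tangent_mult[OF X f' b] tangent_mult[OF X h' b] bp by simp
qed

end

section \<open>Tangent vectors and vector fields in a chart\<close>

locale surface_chart = surface S \<A> for S :: "'a::topological_space set" and \<A> :: "'a atlas" +
  fixes V :: "'a set" and \<phi> :: "'a \<Rightarrow> real^2"
  assumes chart: "(V, \<phi>) \<in> \<A>"
begin

lemma V_openin: "openin (top_of_set S) V" by (rule chart_openin[OF chart])
lemma V_subset: "V \<subseteq> S" using V_openin openin_imp_subset by blast
lemma inj_\<phi>: "inj_on \<phi> V" by (rule chart_homeomorphism(1)[OF chart])
lemma \<psi>\<phi>: "p \<in> V \<Longrightarrow> inv_into V \<phi> (\<phi> p) = p" using inj_\<phi> by simp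

lemma open_image: "openin (top_of_set S) U \<Longrightarrow> U \<subseteq> V \<Longrightarrow> open (\<phi> ` U)"
  using open_chart_image[OF chart, of U] by (simp add: Int_absorb2)

lemma smooth_fun_on_chart: "smooth_fun S \<A> U f \<Longrightarrow> U \<subseteq> V \<Longrightarrow> smooth_on (f \<circ> inv_into V \<phi>) (\<phi> ` U)"
  using smooth_fun_chart[OF _ chart, of U f] by (simp add: Int_absorb2)

lemma smooth_fun_\<phi>: "smooth_fun S \<A> V \<phi>"
proof (rule smooth_fun_chartI[OF chart V_openin order_refl])
  have "smooth_on (\<lambda>z. z) (\<phi> ` V)" by (rule smooth_on_bounded_linear[OF chart_open_range[OF chart] bounded_linear_ident])
  then show "smooth_on (\<phi> \<circ> inv_into V \<phi>) (\<phi> ` V)"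
    by (rule smooth_on_cong[OF chart_open_range[OF chart], rotated]) (simp add: f_inv_into_f)
qed

lemma smooth_fun_of_chart:
  assumes "open W" "W \<subseteq> \<phi> ` V" "smooth_on F W"
  shows "smooth_fun S \<A> (inv_into V \<phi> ` W) (\<lambda>q. F (\<phi> q))"
proof (rule smooth_fun_chartI[OF chart openin_chart_preimage[OF chart assms(1,2)]])
  show "inv_into V \<phi> ` W \<subseteq> V" using assms(2) by (auto simp: inv_into_into subset_iff)
  have im: "\<phi> ` inv_into V \<phi> ` W = W" using assms(2) by (force simp: image_iff f_inv_into_f subset_iff)
  show "smooth_on ((\<lambda>q. F (\<phi> q)) \<circ> inv_into V \<phi>) (\<phi> ` inv_into V \<phi> ` W)"
    unfolding im by (rule smooth_on_cong[OF assms(1) _ assms(3)]) (use assms(2) in \<open>auto simp: f_inv_into_f subset_iff\<close>)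
qed

lemma smooth_near_chart:
  assumes "smooth_near S \<A> p f" "p \<in> V"
  shows "\<exists>U. p \<in> U \<and> U \<subseteq> V \<and> smooth_fun S \<A> U f"
proof -
  obtain U where U: "p \<in> U" "smooth_fun S \<A> U f" using assms(1) unfolding smooth_near_def by (elim exE conjE)
  have "smooth_fun S \<A> (U \<inter> V) f"
    by (rule smooth_fun_subset[OF U(2)]) (auto intro: openin_Int smooth_fun_openin[OF U(2)] V_openin)
  then show ?thesis using U(1) assms(2) by blast
qed

definition pd :: "2 \<Rightarrow> ('a \<Rightarrow> 'b::real_normed_vector) \<Rightarrow> 'a \<Rightarrow> 'b" where
  "pd i f p = frechet_derivative (f \<circ> inv_into V \<phi>) (at (\<phi> p)) (axis i 1)"

lemma has_pd:
  assumes "smooth_near S \<A> p f" "p \<in> V"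
  shows "((f \<circ> inv_into V \<phi>) has_derivative (\<lambda>w. w $ 1 *\<^sub>R pd 1 f p + w $ 2 *\<^sub>R pd 2 f p)) (at (\<phi> p))"
proof -
  obtain U where U: "p \<in> U" "U \<subseteq> V" "smooth_fun S \<A> U f" using smooth_near_chart[OF assms] by blast
  let ?D = "frechet_derivative (f \<circ> inv_into V \<phi>) (at (\<phi> p))"
  have d: "((f \<circ> inv_into V \<phi>) has_derivative ?D) (at (\<phi> p))"
    by (rule smooth_on_has_derivative[OF open_image[OF smooth_fun_openin[OF U(3)] U(2)] smooth_fun_on_chart[OF U(3,2)]])
      (use U(1) in simp)
  have l: "linear ?D" by (rule has_derivative_linear[OF d])
  have "?D w = w $ 1 *\<^sub>R pd 1 f p + w $ 2 *\<^sub>R pd 2 f p" for w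
  proof -
    have "w = w $ 1 *\<^sub>R axis 1 1 + w $ 2 *\<^sub>R axis 2 1"
      by (simp add: vec_eq_iff forall_2 axis_def)
    then have "?D w = ?D (w $ 1 *\<^sub>R axis 1 1 + w $ 2 *\<^sub>R axis 2 1)" by simp
    then show ?thesis by (simp add: linear_add[OF l] linear_scale[OF l] pd_def)
  qed
  then have "?D = (\<lambda>w. w $ 1 *\<^sub>R pd 1 f p + w $ 2 *\<^sub>R pd 2 f p)" by (rule ext)
  then show ?thesis using d by simp
qed

lemma pdI: "((f \<circ> inv_into V \<phi>) has_derivative F') (at (\<phi> p)) \<Longrightarrow> pd i f p = F' (axis i 1)"
  unfolding pd_def using frechet_derivative_at by metis

lemma has_pd_differentiable:
  "smooth_near S \<A> p f \<Longrightarrow> p \<in> V \<Longrightarrow> ((\<lambda>z. f (inv_into V \<phi> z)) has_derivative (frechet_derivative (f \<circ> inv_into V \<phi>) (at (\<phi> p)))) (at (\<phi> p))"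
  using has_pd[of p f] frechet_derivative_at[OF has_pd[of p f]] by (simp add: o_def)

lemma pd_linear:
  assumes "smooth_near S \<A> p f" "p \<in> V" "bounded_linear L"
  shows "pd i (\<lambda>q. L (f q)) p = L (pd i f p)"
proof -
  have "((\<lambda>q. L (f q)) \<circ> inv_into V \<phi> has_derivative (\<lambda>w. L (frechet_derivative (f \<circ> inv_into V \<phi>) (at (\<phi> p)) w))) (at (\<phi> p))"
    using bounded_linear.has_derivative[OF assms(3) has_pd_differentiable[OF assms(1,2)]] by (simp add: o_def)
  from pdI[OF this] show ?thesis by (simp add: pd_def)
qed

lemma pd_bilinear:
  assumes "smooth_near S \<A> p f" "smooth_near S \<A> p h" "p \<in> V" "bounded_bilinear pr"
  shows "pd i (\<lambda>q. pr (f q) (h q)) p = pr (pd i f p) (h p) + pr (f p) (pd i h p)"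
  using pdI[of "\<lambda>q. pr (f q) (h q)" _ p i]
    bounded_bilinear.FDERIV[OF assms(4) has_pd_differentiable[OF assms(1,3)] has_pd_differentiable[OF assms(2,3)]]
  by (simp add: o_def pd_def \<psi>\<phi>[OF assms(3)] add.commute)

lemma pd_mult:
  fixes f h :: "'a \<Rightarrow> 'b::real_normed_algebra"
  shows "smooth_near S \<A> p f \<Longrightarrow> smooth_near S \<A> p h \<Longrightarrow> p \<in> V \<Longrightarrow> pd i (\<lambda>q. f q * h q) p = pd i f p * h p + f p * pd i h p"
  by (rule pd_bilinear[OF _ _ _ bounded_bilinear_mult])

lemma pd_add:
  "smooth_near S \<A> p f \<Longrightarrow> smooth_near S \<A> p h \<Longrightarrow> p \<in> V \<Longrightarrow> pd i (\<lambda>q. f q + h q) p = pd i f p + pd i h p"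
  using pdI[of "\<lambda>q. f q + h q" _ p i] has_derivative_add[OF has_pd_differentiable[of p f] has_pd_differentiable[of p h]]
  by (simp add: o_def pd_def)

lemma pd_diff:
  "smooth_near S \<A> p f \<Longrightarrow> smooth_near S \<A> p h \<Longrightarrow> p \<in> V \<Longrightarrow> pd i (\<lambda>q. f q - h q) p = pd i f p - pd i h p"
  using pdI[of "\<lambda>q. f q - h q" _ p i] has_derivative_diff[OF has_pd_differentiable[of p f] has_pd_differentiable[of p h]]
  by (simp add: o_def pd_def)

lemma pd_const: "pd i (\<lambda>q. c) p = 0"
  using pdI[of "\<lambda>q. c" "\<lambda>w. 0" p i] has_derivative_const[of c] by (simp add: o_def)

lemma pd_cong:
  assumes "smooth_fun S \<A> U f" "p \<in> U" "p \<in> V" "\<And>q. q \<in> U \<Longrightarrow> f q = h q"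
  shows "pd i f p = pd i h p"
proof -
  have "((f \<circ> inv_into V \<phi>) has_derivative frechet_derivative (f \<circ> inv_into V \<phi>) (at (\<phi> p))) (at (\<phi> p))"
    using has_pd_differentiable[OF smooth_nearI[OF assms(1,2)] assms(3)] by (simp add: o_def)
  then have "((h \<circ> inv_into V \<phi>) has_derivative frechet_derivative (f \<circ> inv_into V \<phi>) (at (\<phi> p))) (at (\<phi> p))"
    by (rule has_derivative_transform_within_open[OF _ open_chart_image[OF chart smooth_fun_openin[OF assms(1)]]])
      (use assms inj_\<phi> in auto)
  then show ?thesis using pdI[of h _ p i] by (simp add: pd_def)
qed

lemma pd_coord: "p \<in> V \<Longrightarrow> pd i (\<lambda>q. \<phi> q $ j) p = (if i = j then 1 else 0)"
proof -
  assume p: "p \<in> V"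
  have "((\<lambda>z. z $ j) has_derivative (\<lambda>w. w $ j)) (at (\<phi> p))"
    by (rule bounded_linear_imp_has_derivative[OF bounded_linear_vec_nth])
  then have "(((\<lambda>q. \<phi> q $ j) \<circ> inv_into V \<phi>) has_derivative (\<lambda>w. w $ j)) (at (\<phi> p))"
    by (rule has_derivative_transform_within_open[OF _ chart_open_range[OF chart]])
      (use p in \<open>auto simp: f_inv_into_f\<close>)
  then show ?thesis using pdI[of "\<lambda>q. \<phi> q $ j" _ p i] by (simp add: axis_def)
qed

lemma smooth_fun_pd:
  assumes "smooth_fun S \<A> U f" "U \<subseteq> V"
  shows "smooth_fun S \<A> U (pd i f)"
proof (rule smooth_fun_chartI[OF chart smooth_fun_openin[OF assms(1)] assms(2)])
  show "smooth_on (pd i f \<circ> inv_into V \<phi>) (\<phi> ` U)"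
    by (rule smooth_on_cong[OF open_image[OF smooth_fun_openin[OF assms(1)] assms(2)] _
        smooth_on_derivative[OF smooth_fun_on_chart[OF assms], of "axis i 1"]])
      (use assms(2) in \<open>auto simp: pd_def \<psi>\<phi> subset_iff\<close>)
qed

lemma smooth_near_\<phi>: "p \<in> V \<Longrightarrow> smooth_near S \<A> p (\<lambda>q. \<phi> q $ i)"
  by (rule smooth_nearI[OF smooth_fun_nth[OF smooth_fun_\<phi>]])

text \<open>By \<open>hadamard\<close>, \<open>f\<close> is near \<open>p\<close> a constant plus
  coordinate functions vanishing at \<open>p\<close> times smooth factors. The product rule leaves
  only the values of these factors at \<open>p\<close>, which are the partial derivatives of
  \<open>f\<close>.\<close>

lemma tangent_expansion:
  assumes X: "X \<in> tangent_space S \<A> p" and p: "p \<in> V" and f: "smooth_near S \<A> p f"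
  shows "X f = X (\<lambda>q. \<phi> q $ 1) * pd 1 f p + X (\<lambda>q. \<phi> q $ 2) * pd 2 f p"
proof -
  have pS: "p \<in> S" using p V_subset by blast
  obtain U where U: "p \<in> U" "U \<subseteq> V" "smooth_fun S \<A> U f" using smooth_near_chart[OF f p] by blast
  have oU: "open (\<phi> ` U)" by (rule open_image[OF smooth_fun_openin[OF U(3)] U(2)])
  obtain r where r: "0 < r" "ball (\<phi> p) r \<subseteq> \<phi> ` U" using openE[OF oU imageI[OF U(1)]] by blast
  have bV: "ball (\<phi> p) r \<subseteq> \<phi> ` V" using r(2) U(2) by blast
  have "smooth_on (f \<circ> inv_into V \<phi>) (ball (\<phi> p) r)"
    using smooth_fun_on_chart[OF U(3,2)] r(2) by (rule smooth_on_subset)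
  from hadamard[OF this r(1)] obtain h where h: "\<And>b. smooth_on (h b) (ball (\<phi> p) r)"
    "\<And>b. h b (\<phi> p) = frechet_derivative (f \<circ> inv_into V \<phi>) (at (\<phi> p)) b"
    "\<And>x. x \<in> ball (\<phi> p) r \<Longrightarrow> (f \<circ> inv_into V \<phi>) x = (f \<circ> inv_into V \<phi>) (\<phi> p) + (\<Sum>b\<in>Basis. ((x - \<phi> p) \<bullet> b) * h b x)"
    by blast
  define N where "N = inv_into V \<phi> ` ball (\<phi> p) r"
  have pN: "p \<in> N" unfolding N_def using \<psi>\<phi>[OF p] r(1) by (metis centre_in_ball imageI)
  have NV: "N \<subseteq> V" unfolding N_def using bV by (auto simp: inv_into_into subset_iff)
  have oN: "openin (top_of_set S) N" unfolding N_def by (rule openin_chart_preimage[OF chart open_ball bV])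
  define k where "k i q = h (axis i 1) (\<phi> q)" for i q
  define c where "c i q = \<phi> q $ i + (- \<phi> p $ i)" for i q
  have k: "smooth_fun S \<A> N (k i)" for i
    unfolding N_def k_def by (rule smooth_fun_of_chart[OF open_ball bV h(1)])
  have c: "smooth_fun S \<A> N (c i)" for i
    unfolding c_def
    by (rule smooth_fun_add[OF smooth_fun_nth[OF smooth_fun_subset[OF smooth_fun_\<phi> oN NV]] smooth_fun_const[OF oN]])
  have kn: "smooth_near S \<A> p (k i)" and cn: "smooth_near S \<A> p (c i)" for i
    using smooth_nearI[OF k pN] smooth_nearI[OF c pN] by auto
  have fN: "smooth_fun S \<A> N f"
  proof (rule smooth_fun_subset[OF U(3) oN])
    show "N \<subseteq> U" unfolding N_def using r(2) U(2) \<psi>\<phi> by fastforce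
  qed
  have "X f = X (\<lambda>q. f p + (c 1 q * k 1 q + c 2 q * k 2 q))"
  proof (rule tangent_germ[OF X fN pN])
    fix q assume "q \<in> N"
    then obtain x where x: "x \<in> ball (\<phi> p) r" "q = inv_into V \<phi> x" unfolding N_def by blast
    then have "\<phi> q = x" using bV by (auto simp: f_inv_into_f subset_iff)
    then show "f q = f p + (c 1 q * k 1 q + c 2 q * k 2 q)"
      using h(3)[OF x(1)] x(2) by (simp add: sum_Basis_real2 inner_axis c_def k_def \<psi>\<phi>[OF p])
  qed
  also have "\<dots> = X (\<lambda>q. f p) + (X (\<lambda>q. c 1 q * k 1 q) + X (\<lambda>q. c 2 q * k 2 q))"
    by (simp add: tangent_add[OF X] smooth_near_add smooth_near_mult smooth_near_const pS kn cn)
  also have "\<dots> = X (c 1) * k 1 p + X (c 2) * k 2 p"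
    by (simp add: tangent_const[OF X pS] tangent_mult[OF X] kn cn) (simp add: c_def)
  finally have eq: "X f = X (c 1) * k 1 p + X (c 2) * k 2 p" .
  have cX: "X (c i) = X (\<lambda>q. \<phi> q $ i)" for i
    unfolding c_def tangent_add[OF X smooth_near_\<phi>[OF p] smooth_near_const[OF pS]] tangent_const[OF X pS] by simp
  have "k i p = pd i f p" for i by (simp add: k_def h(2) pd_def)
  then show ?thesis using eq by (simp only: cX)
qed

definition rv :: "'a \<Rightarrow> real^2 \<Rightarrow> 'a rvec" where
  "rv p x = (\<lambda>f. if smooth_near S \<A> p f then x $ 1 * pd 1 f p + x $ 2 * pd 2 f p else 0)"

lemma rv_tangent: "p \<in> V \<Longrightarrow> rv p x \<in> tangent_space S \<A> p"
proof -
  assume p: "p \<in> V"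
  have pS: "p \<in> S" using p V_subset by blast
  show ?thesis
    unfolding tangent_space_def mem_Collect_eq
  proof (intro conjI allI impI)
    fix f :: "'a \<Rightarrow> real" assume "\<not> smooth_near S \<A> p f"
    then show "rv p x f = 0" by (simp add: rv_def)
  next
    fix c :: real and f :: "'a \<Rightarrow> real" assume f: "smooth_near S \<A> p f"
    have c: "smooth_near S \<A> p (\<lambda>q. c)" by (rule smooth_near_const[OF pS])
    show "rv p x (\<lambda>q. c * f q) = c * rv p x f"
      using f c p by (simp add: rv_def smooth_near_mult pd_mult pd_const algebra_simps)
  next
    fix f h :: "'a \<Rightarrow> real" assume fh: "smooth_near S \<A> p f \<and> smooth_near S \<A> p h"
    then show "rv p x (\<lambda>q. f q + h q) = rv p x f + rv p x h"
      using p by (simp add: rv_def smooth_near_add pd_add algebra_simps)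
    show "rv p x (\<lambda>q. f q * h q) = rv p x f * h p + f p * rv p x h"
      using p fh by (simp add: rv_def smooth_near_mult pd_mult algebra_simps)
  qed
qed

text \<open>The complex vector with coefficients \<open>a\<close> in the coordinate frame. The
  default 0 is that of \<open>cplx_vec\<close>, so equality with members of
  \<open>ctangent_space\<close> is equality of functions.\<close>

definition dv :: "'a \<Rightarrow> complex^2 \<Rightarrow> 'a cvec" where
  "dv p a = (\<lambda>f. if smooth_near S \<A> p f then a $ 1 * pd 1 f p + a $ 2 * pd 2 f p else 0)"

lemma cplx_vec_rv:
  assumes p: "p \<in> V"
  shows "cplx_vec S \<A> p (rv p x) (rv p y) = dv p (\<chi> i. Complex (x $ i) (y $ i))"
proof
  fix f :: "'a \<Rightarrow> complex"
  show "cplx_vec S \<A> p (rv p x) (rv p y) f = dv p (\<chi> i. Complex (x $ i) (y $ i)) f"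
  proof (cases "smooth_near S \<A> p f")
    case True
    have "smooth_near S \<A> p (\<lambda>q. Re (f q))" "smooth_near S \<A> p (\<lambda>q. Im (f q))"
      using smooth_near_linear[OF True] bounded_linear_Re bounded_linear_Im by auto
    then show ?thesis
      using True p by (simp add: cplx_vec_def rv_def dv_def o_def pd_linear[OF True p bounded_linear_Re]
          pd_linear[OF True p bounded_linear_Im] complex_eq_iff algebra_simps)
  qed (simp add: cplx_vec_def dv_def)
qed

lemma tangent_eq_rv:
  assumes "X \<in> tangent_space S \<A> p" "p \<in> V"
  shows "X = rv p (\<chi> i. X (\<lambda>q. \<phi> q $ i))"
  using tangent_expansion[OF assms] tangent_not_smooth[OF assms(1)] by (auto simp: rv_def fun_eq_iff)

lemma ctangent_eq:
  assumes p: "p \<in> V"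
  shows "ctangent_space S \<A> p = range (dv p)"
proof
  show "ctangent_space S \<A> p \<subseteq> range (dv p)"
  proof
    fix v assume "v \<in> ctangent_space S \<A> p"
    then obtain X Y where XY: "v = cplx_vec S \<A> p X Y" "X \<in> tangent_space S \<A> p" "Y \<in> tangent_space S \<A> p"
      unfolding ctangent_space_def by blast
    then have "v = cplx_vec S \<A> p (rv p (\<chi> i. X (\<lambda>q. \<phi> q $ i))) (rv p (\<chi> i. Y (\<lambda>q. \<phi> q $ i)))"
      using tangent_eq_rv[OF _ p] by metis
    then show "v \<in> range (dv p)" unfolding cplx_vec_rv[OF p] by blast
  qed
  show "range (dv p) \<subseteq> ctangent_space S \<A> p"
  proof
    fix v assume "v \<in> range (dv p)"
    then obtain a where "v = dv p a" by blast
    then have "v = cplx_vec S \<A> p (rv p (\<chi> i. Re (a $ i))) (rv p (\<chi> i. Im (a $ i)))"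
      by (simp add: cplx_vec_rv[OF p])
    then show "v \<in> ctangent_space S \<A> p"
      unfolding ctangent_space_def using rv_tangent[OF p] by blast
  qed
qed

lemma dv_ctangent: "p \<in> V \<Longrightarrow> dv p a \<in> ctangent_space S \<A> p"
  by (simp add: ctangent_eq)

lemma dv_apply: "smooth_near S \<A> p f \<Longrightarrow> dv p a f = a $ 1 * pd 1 f p + a $ 2 * pd 2 f p"
  by (simp add: dv_def)

definition crd :: "'a cvec \<Rightarrow> complex^2" where
  "crd v = (\<chi> i. v (\<lambda>q. of_real (\<phi> q $ i)))"

lemma smooth_fun_coord: "smooth_fun S \<A> V (\<lambda>q. of_real (\<phi> q $ i) :: complex)"
  by (rule smooth_fun_linear[OF smooth_fun_nth[OF smooth_fun_\<phi>] bounded_linear_of_real])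

lemma crd_dv: "p \<in> V \<Longrightarrow> crd (dv p a) = a"
proof -
  assume p: "p \<in> V"
  have s: "smooth_near S \<A> p (\<lambda>q. of_real (\<phi> q $ i) :: complex)" for i
    by (rule smooth_nearI[OF smooth_fun_coord p])
  have "pd i (\<lambda>q. of_real (\<phi> q $ j) :: complex) p = (if i = j then 1 else 0)" for i j
    using pd_linear[OF smooth_near_\<phi>[OF p] p bounded_linear_of_real, of i j] pd_coord[OF p, of i j] by (cases "i = j") auto
  then show ?thesis by (simp add: crd_def vec_eq_iff dv_apply[OF s] forall_2)
qed

lemma dv_crd: "p \<in> V \<Longrightarrow> v \<in> ctangent_space S \<A> p \<Longrightarrow> dv p (crd v) = v"
  using crd_dv[of p] by (auto simp: ctangent_eq)

lemma dv_inj: "p \<in> V \<Longrightarrow> dv p a = dv p b \<longleftrightarrow> a = b"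
  using crd_dv by metis

lemma vadd_dv: "vadd (dv p a) (dv p b) = dv p (a + b)"
  by (auto simp: vadd_def dv_def algebra_simps)
lemma vsub_dv: "vsub (dv p a) (dv p b) = dv p (a - b)"
  by (auto simp: vsub_def dv_def algebra_simps)
lemma vscale_dv: "vscale c (dv p a) = dv p (c *s a)"
  by (auto simp: vscale_def dv_def algebra_simps)
lemma vzero_dv: "vzero = dv p 0"
  by (auto simp: vzero_def dv_def)

text \<open>Testing a field on the coordinate functions is enough. Together with
  \<open>cfield_dv\<close> this identifies smooth fields inside the chart with smooth coefficient
  maps.\<close>

lemma cfield_crd:
  assumes "cfield S \<A> U X" "U \<subseteq> V"
  shows "smooth_fun S \<A> U (\<lambda>q. crd (X q))" "\<And>q. q \<in> U \<Longrightarrow> X q = dv q (crd (X q))"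
proof -
  have oU: "openin (top_of_set S) U" and XU: "\<And>q. q \<in> U \<Longrightarrow> X q \<in> ctangent_space S \<A> q"
    and sm: "\<And>W f. W \<subseteq> U \<Longrightarrow> smooth_fun S \<A> W f \<Longrightarrow> smooth_fun S \<A> W (\<lambda>p. X p f)"
    using assms(1) unfolding cfield_def by auto
  show "smooth_fun S \<A> U (\<lambda>q. crd (X q))"
    by (rule smooth_fun_vec) (simp add: crd_def sm[OF order_refl smooth_fun_subset[OF smooth_fun_coord oU assms(2)]])
  show "X q = dv q (crd (X q))" if "q \<in> U" for q
    using dv_crd[OF _ XU[OF that]] that assms(2) by auto
qed

lemma cfield_dv:
  assumes a: "smooth_fun S \<A> U a" and U: "U \<subseteq> V"
  shows "cfield S \<A> U (\<lambda>q. dv q (a q))"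
  unfolding cfield_def
proof (intro conjI ballI allI impI)
  show "openin (top_of_set S) U" by (rule smooth_fun_openin[OF a])
  show "dv q (a q) \<in> ctangent_space S \<A> q" if "q \<in> U" for q using that U dv_ctangent by blast
  fix W and f :: "'a \<Rightarrow> complex" assume W: "W \<subseteq> U \<and> smooth_fun S \<A> W f"
  have oW: "openin (top_of_set S) W" using W smooth_fun_openin by blast
  have "smooth_fun S \<A> W (\<lambda>q. a q $ 1 * pd 1 f q + a q $ 2 * pd 2 f q)"
    using W U smooth_fun_nth[OF smooth_fun_subset[OF a oW]]
    by (intro smooth_fun_add smooth_fun_mult smooth_fun_pd) auto
  then show "smooth_fun S \<A> W (\<lambda>p. dv p (a p) f)"
    by (rule smooth_fun_cong) (use W in \<open>auto simp: dv_apply smooth_nearI\<close>)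
qed

end

section \<open>Chart-free rules for complex tangent vectors\<close>

context surface
begin

lemma chart_at:
  assumes "p \<in> S"
  obtains V \<phi> where "surface_chart S \<A> V \<phi>" "p \<in> V"
proof -
  obtain V \<phi> where "(V, \<phi>) \<in> \<A>" "p \<in> V" using atlas_cover[OF assms] by blast
  then show ?thesis using that surface_axioms by (simp add: surface_chart_def surface_chart_axioms_def)
qed

lemma ctangent_const:
  assumes "p \<in> S" "v \<in> ctangent_space S \<A> p"
  shows "v (\<lambda>q. c) = 0"
proof -
  obtain V \<phi> where "surface_chart S \<A> V \<phi>" and p: "p \<in> V" using chart_at[OF assms(1)] .
  then interpret surface_chart S \<A> V \<phi> by simp
  show ?thesis using assms(2) ctangent_eq[OF p] by (auto simp: dv_def pd_const)
qed

lemma ctangent_add: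
  assumes "p \<in> S" "v \<in> ctangent_space S \<A> p" "smooth_near S \<A> p f" "smooth_near S \<A> p h"
  shows "v (\<lambda>q. f q + h q) = v f + v h"
proof -
  obtain V \<phi> where "surface_chart S \<A> V \<phi>" and p: "p \<in> V" using chart_at[OF assms(1)] .
  then interpret surface_chart S \<A> V \<phi> by simp
  show ?thesis using assms ctangent_eq[OF p] p
    by (auto simp: dv_apply smooth_near_add pd_add algebra_simps)
qed

lemma ctangent_mult:
  assumes "p \<in> S" "v \<in> ctangent_space S \<A> p" "smooth_near S \<A> p f" "smooth_near S \<A> p h"
  shows "v (\<lambda>q. f q * h q) = v f * h p + f p * v h"
proof -
  obtain V \<phi> where "surface_chart S \<A> V \<phi>" and p: "p \<in> V" using chart_at[OF assms(1)] .
  then interpret surface_chart S \<A> V \<phi> by simp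
  show ?thesis using assms ctangent_eq[OF p] p
    by (auto simp: dv_apply smooth_near_mult pd_mult algebra_simps)
qed

lemma ctangent_germ:
  assumes "v \<in> ctangent_space S \<A> p" "smooth_fun S \<A> N f" "p \<in> N" "\<And>q. q \<in> N \<Longrightarrow> f q = h q"
  shows "v f = v h"
proof -
  have pS: "p \<in> S" using smooth_near_in[OF smooth_nearI[OF assms(2,3)]] .
  obtain V \<phi> where "surface_chart S \<A> V \<phi>" and p: "p \<in> V" using chart_at[OF pS] .
  then interpret surface_chart S \<A> V \<phi> by simp
  have "smooth_near S \<A> p f" "smooth_near S \<A> p h"
    by (rule smooth_nearI[OF assms(2,3)]) (rule smooth_nearI[OF smooth_fun_cong[OF assms(2,4)] assms(3)])
  then show ?thesis using assms(1) ctangent_eq[OF p] pd_cong[OF assms(2,3) p assms(4)]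
    by (auto simp: dv_apply)
qed

lemma real_vec_ctangent: "X \<in> tangent_space S \<A> p \<Longrightarrow> p \<in> S \<Longrightarrow> real_vec S \<A> p X \<in> ctangent_space S \<A> p"
proof -
  assume X: "X \<in> tangent_space S \<A> p" and pS: "p \<in> S"
  obtain V \<phi> where "surface_chart S \<A> V \<phi>" and p: "p \<in> V" using chart_at[OF pS] .
  then interpret surface_chart S \<A> V \<phi> by simp
  have "rv p 0 = (\<lambda>_. 0)" by (simp add: rv_def fun_eq_iff)
  then have "(\<lambda>_. 0) \<in> tangent_space S \<A> p" using rv_tangent[OF p, of 0] by simp
  then show ?thesis unfolding ctangent_space_def using X by blast
qed

lemma real_vec_inj:
  assumes "X \<in> tangent_space S \<A> p" "Y \<in> tangent_space S \<A> p" "real_vec S \<A> p X = real_vec S \<A> p Y"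
  shows "X = Y"
proof
  fix f :: "'a \<Rightarrow> real"
  show "X f = Y f"
  proof (cases "smooth_near S \<A> p f")
    case True
    have s: "smooth_near S \<A> p (\<lambda>q. complex_of_real (f q))"
      by (rule smooth_near_linear[OF True bounded_linear_of_real])
    have "real_vec S \<A> p X (\<lambda>q. complex_of_real (f q)) = real_vec S \<A> p Y (\<lambda>q. complex_of_real (f q))"
      using assms(3) by simp
    then show ?thesis using s by (simp add: cplx_vec_def o_def complex_eq_iff)
  next
    case False
    then show ?thesis using tangent_not_smooth[OF assms(1)] tangent_not_smooth[OF assms(2)] by simp
  qed
qed

lemma cplx_vec_real:
  assumes "X \<in> tangent_space S \<A> p" "Y \<in> tangent_space S \<A> p"
  shows "cplx_vec S \<A> p X Y = vadd (real_vec S \<A> p X) (vscale \<i> (real_vec S \<A> p Y))"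
  by (auto simp: cplx_vec_def vadd_def vscale_def fun_eq_iff)

end

section \<open>The geometry of $SL(2,C)$\<close>

text \<open>The polarization of $-\det$. The group is the quadric \<^term>\<open>bb A A = - 1\<close> in the space of matrices, its
  tangent space at \<^term>\<open>A\<close> is the orthogonal complement of \<^term>\<open>A\<close>, and its metric is the restriction of
  \<^term>\<open>bb\<close>.\<close>

definition bb :: "cmat \<Rightarrow> cmat \<Rightarrow> complex" where
  "bb X Y = - (X$1$1 * Y$2$2 + X$2$2 * Y$1$1 - X$1$2 * Y$2$1 - X$2$1 * Y$1$2) / 2"

definition m2 :: "complex \<Rightarrow> complex \<Rightarrow> complex \<Rightarrow> complex \<Rightarrow> cmat" where
  "m2 a b c d = vector [vector [a, b], vector [c, d]]"

definition adj2 :: "cmat \<Rightarrow> cmat" where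
  "adj2 A = m2 (A$2$2) (- A$1$2) (- A$2$1) (A$1$1)"

lemma m2_nth [simp]: "m2 a b c d $ 1 $ 1 = a" "m2 a b c d $ 1 $ 2 = b" "m2 a b c d $ 2 $ 1 = c" "m2 a b c d $ 2 $ 2 = d"
  by (simp_all add: m2_def)

lemma adj2_nth [simp]: "adj2 A $ 1 $ 1 = A$2$2" "adj2 A $ 1 $ 2 = - A$1$2" "adj2 A $ 2 $ 1 = - A$2$1" "adj2 A $ 2 $ 2 = A$1$1"
  by (simp_all add: adj2_def)

lemma mm_nth: "(A ** B) $ i $ j = A$i$1 * B$1$j + A$i$2 * B$2$j" for A B :: cmat
  by (simp add: matrix_matrix_mult_def sum_2)

lemma mat_nth: "(mat c :: cmat) $ 1 $ 1 = c" "(mat c :: cmat) $ 1 $ 2 = 0" "(mat c :: cmat) $ 2 $ 1 = 0" "(mat c :: cmat) $ 2 $ 2 = c"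
  by (simp_all add: mat_def)

lemma mat_mult_nth: "(mat c ** X) $ i $ j = c * X$i$j" for X :: cmat
  using exhaust_2[of i] by (auto simp: mm_nth mat_nth)

lemma cmat_eq_iff: "A = B \<longleftrightarrow> A$1$1 = B$1$1 \<and> A$1$2 = B$1$2 \<and> A$2$1 = B$2$1 \<and> A$2$2 = B$2$2" for A B :: cmat
  by (auto simp: vec_eq_iff forall_2)

lemma trace_2: "trace A = A$1$1 + A$2$2" for A :: cmat
  by (simp add: trace_def sum_2)

lemma bb_sym: "bb X Y = bb Y X"
  by (simp add: bb_def algebra_simps)

lemma bb_add: "bb (X + Y) Z = bb X Z + bb Y Z" "bb Z (X + Y) = bb Z X + bb Z Y"
  by (simp_all add: bb_def field_simps)

lemma bb_diff: "bb (X - Y) Z = bb X Z - bb Y Z" "bb Z (X - Y) = bb Z X - bb Z Y"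
  by (simp_all add: bb_def field_simps)

lemma bb_scale: "bb (mat c ** X) Y = c * bb X Y" "bb Y (mat c ** X) = c * bb Y X"
  by (simp_all add: bb_def mat_mult_nth field_simps)

lemma bb_zero: "bb 0 X = 0" "bb X 0 = 0"
  by (simp_all add: bb_def)

lemma bb_scaleR: "bb (r *\<^sub>R X) Y = r *\<^sub>R bb X Y" "bb Y (r *\<^sub>R X) = r *\<^sub>R bb Y X"
  unfolding bb_def vector_scaleR_component by (simp_all add: scaleR_conv_of_real field_simps)

lemma bounded_bilinear_bb: "bounded_bilinear bb"
  unfolding bilinear_conv_bounded_bilinear[symmetric] bilinear_def
  by (intro conjI allI linearI) (simp_all add: bb_add bb_scaleR)

lemma bounded_bilinear_mm: "bounded_bilinear (\<lambda>(A :: cmat) (B :: cmat). A ** B)"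
  unfolding bilinear_conv_bounded_bilinear[symmetric] bilinear_def
  by (intro conjI allI linearI) (simp_all add: cmat_eq_iff mm_nth algebra_simps)

lemma bounded_linear_adj2: "bounded_linear adj2"
  unfolding linear_conv_bounded_linear[symmetric]
  by (intro linearI) (simp_all add: cmat_eq_iff)

lemma bb_self: "bb A A = - det A"
  by (simp add: bb_def det_2 field_simps)

lemma SL2_iff: "A \<in> SL2 \<longleftrightarrow> bb A A = - 1"
  by (simp add: SL2_def bb_self)

lemma adj2_inverse: "A ** adj2 A = mat (det A)" "adj2 A ** A = mat (det A)"
  by (simp_all add: cmat_eq_iff mm_nth mat_nth det_2 algebra_simps)

text \<open>\<open>matrix_inv\<close> is defined by choice. On the group it is the adjugate, which
  is linear and hence smooth.\<close>

lemma SL2_matrix_inv: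
  assumes "A \<in> SL2"
  shows "matrix_inv A = adj2 A"
proof -
  have 1: "A ** adj2 A = mat 1" "adj2 A ** A = mat 1" using assms adj2_inverse[of A] by (simp_all add: SL2_def)
  have "\<exists>B. A ** B = mat 1 \<and> B ** A = mat 1" using 1 by blast
  then have "A ** matrix_inv A = mat 1 \<and> matrix_inv A ** A = mat 1"
    unfolding matrix_inv_def by (rule someI_ex)
  then have "matrix_inv A = matrix_inv A ** (A ** adj2 A)" "(matrix_inv A ** A) ** adj2 A = adj2 A"
    using 1 by simp_all
  then show ?thesis by (simp add: matrix_mul_assoc)
qed

lemma SL2_inv_mult: "A \<in> SL2 \<Longrightarrow> matrix_inv A ** (A ** V) = V" "A \<in> SL2 \<Longrightarrow> A ** (matrix_inv A ** V) = V"
  using adj2_inverse[of A] by (simp_all add: SL2_matrix_inv matrix_mul_assoc SL2_def)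

lemma adj2_SL2: "A \<in> SL2 \<Longrightarrow> adj2 A \<in> SL2"
  by (simp add: SL2_def det_2 algebra_simps)

lemma SL2_mult: "A \<in> SL2 \<Longrightarrow> B \<in> SL2 \<Longrightarrow> A ** B \<in> SL2"
  by (simp add: SL2_def det_mul)

lemma mat1_SL2: "mat 1 \<in> SL2"
  by (simp add: SL2_def)

lemma bb_mult_left: "bb (A ** X) (A ** Y) = det A * bb X Y"
  by (simp add: bb_def mm_nth det_2 field_simps)

lemma bb_mult_right: "bb (X ** A) (Y ** A) = det A * bb X Y"
  by (simp add: bb_def mm_nth det_2 field_simps)

lemma bb_traceless: "trace V = 0 \<Longrightarrow> trace W = 0 \<Longrightarrow> bb V W = trace (V ** W) / 2"
proof -
  assume "trace V = 0" "trace W = 0"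
  then have "V$2$2 = - V$1$1" "W$2$2 = - W$1$1" by (simp_all add: trace_2 add_eq_0_iff)
  then show ?thesis by (simp add: bb_def trace_2 mm_nth field_simps)
qed

lemma bb_trace: "bb (A ** V) A = - det A * trace V / 2"
  by (simp add: bb_def mm_nth trace_2 det_2 field_simps)

lemma tangent_iff:
  assumes "A \<in> SL2"
  shows "X \<in> SL2_tangent A \<longleftrightarrow> bb X A = 0"
proof
  assume "X \<in> SL2_tangent A"
  then show "bb X A = 0" by (auto simp: SL2_tangent_def bb_trace)
next
  assume "bb X A = 0"
  moreover have X: "X = A ** (matrix_inv A ** X)" by (simp only: SL2_inv_mult(2)[OF assms])
  ultimately have "trace (matrix_inv A ** X) = 0" using bb_trace[of A "matrix_inv A ** X"] assms by (simp add: SL2_def)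
  then show "X \<in> SL2_tangent A" unfolding SL2_tangent_def using X by blast
qed

lemma SL2_metric_bb:
  assumes A: "A \<in> SL2" and "bb X A = 0" "bb Y A = 0"
  shows "SL2_metric A X Y = bb X Y"
proof -
  have "X \<in> SL2_tangent A" "Y \<in> SL2_tangent A" using assms tangent_iff[OF A] by simp_all
  then obtain V W where VW: "X = A ** V" "trace V = 0" "Y = A ** W" "trace W = 0"
    unfolding SL2_tangent_def by blast
  show ?thesis using A
    by (simp add: SL2_metric_def VW SL2_inv_mult bb_mult_left bb_traceless SL2_def)
qed

lemma SL2_metric_tangent:
  "A \<in> SL2 \<Longrightarrow> X \<in> SL2_tangent A \<Longrightarrow> Y \<in> SL2_tangent A \<Longrightarrow> SL2_metric A X Y = bb X Y"
  by (simp add: SL2_metric_bb tangent_iff)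

lemma bb_nondegenerate:
  assumes "\<And>Z. bb X Z = 0"
  shows "X = 0"
  using assms[of "m2 1 0 0 0"] assms[of "m2 0 1 0 0"] assms[of "m2 0 0 1 0"] assms[of "m2 0 0 0 1"]
  by (simp add: bb_def cmat_eq_iff)

lemma bb_nondegenerate_tangent:
  assumes A: "A \<in> SL2" and X: "bb X A = 0" and XZ: "\<And>Z. Z \<in> SL2_tangent A \<Longrightarrow> bb X Z = 0"
  shows "X = 0"
proof (rule bb_nondegenerate)
  fix Z
  \<comment> \<open>The orthogonal projection of \<open>Z\<close> to the tangent space; the sign is
    plus because \<open>bb A A = - 1\<close>.\<close>
  have "bb (Z + mat (bb Z A) ** A) A = 0" using A by (simp add: bb_add bb_scale SL2_iff)
  then have "bb X (Z + mat (bb Z A) ** A) = 0" using XZ tangent_iff[OF A] by blast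
  then show "bb X Z = 0" using X by (simp add: bb_add bb_scale)
qed

section \<open>Differentiation along the group\<close>

text \<open>The tangent space of the group at \<^term>\<open>A\<close> is spanned by the vectors \<^term>\<open>A ** N\<close> with \<^term>\<open>N\<close>
  nilpotent, and for these the line \<^term>\<open>A + t *\<^sub>R (A ** N)\<close> stays in the group.\<close>

lemma SL2_derivative_unique:
  assumes A: "A \<in> SL2" and F: "(F has_derivative F1) (at A within SL2)" "(F has_derivative F2) (at A within SL2)"
    and v: "v \<in> SL2_tangent A"
  shows "F1 v = F2 v"
proof -
  have nil: "F1 (A ** N) = F2 (A ** N)" if N: "trace N = 0" "det N = 0" for N
  proof -
    define c where "c t = A + t *\<^sub>R (A ** N)" for t :: real
    have "det (mat 1 + t *\<^sub>R N) = 1" for t :: real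
    proof -
      have "det (mat 1 + t *\<^sub>R N) = 1 + of_real t * trace N + (of_real t)\<^sup>2 * det N"
        unfolding det_2 trace_2 vector_add_component vector_scaleR_component mat_nth
        by (simp add: scaleR_conv_of_real power2_eq_square algebra_simps)
      then show ?thesis using N by simp
    qed
    moreover have "c t = A ** (mat 1 + t *\<^sub>R N)" for t
      by (simp add: c_def cmat_eq_iff mm_nth mat_nth algebra_simps)
    ultimately have c: "range c \<subseteq> SL2" using A by (auto simp: SL2_def det_mul)
    have dc: "(c has_derivative (\<lambda>t. t *\<^sub>R (A ** N))) (at 0)"
      unfolding c_def by (auto intro!: derivative_eq_intros)
    have c0: "c 0 = A" by (simp add: c_def)
    have "((\<lambda>t. F (c t)) has_derivative (\<lambda>t. F1 (t *\<^sub>R (A ** N)))) (at 0)"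
      "((\<lambda>t. F (c t)) has_derivative (\<lambda>t. F2 (t *\<^sub>R (A ** N)))) (at 0)"
      using has_derivative_in_compose[OF dc, of F F1] has_derivative_in_compose[OF dc, of F F2]
        has_derivative_subset[OF F(1) c] has_derivative_subset[OF F(2) c] by (simp_all add: c0)
    then have "(\<lambda>t. F1 (t *\<^sub>R (A ** N))) = (\<lambda>t. F2 (t *\<^sub>R (A ** N)))" by (rule has_derivative_unique)
    then show ?thesis by (metis scaleR_one)
  qed
  obtain V where V: "v = A ** V" "trace V = 0" using v by (auto simp: SL2_tangent_def)
  define a where "a = V$1$1"
  \<comment> \<open>Three nilpotent summands: the first has the diagonal of \<open>V\<close>, with
    trace and determinant 0, and the other two correct the off-diagonal entries.\<close>
  have "V = m2 a (- a) a (- a) + (m2 0 (V$1$2 + a) 0 0 + m2 0 0 (V$2$1 - a) 0)"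
    using V(2) by (simp add: cmat_eq_iff a_def trace_2 add_eq_0_iff)
  then have v': "v = A ** m2 a (- a) a (- a) + (A ** m2 0 (V$1$2 + a) 0 0 + A ** m2 0 0 (V$2$1 - a) 0)"
    using V(1) by (metis matrix_add_ldistrib)
  have l: "linear F1" "linear F2" using F has_derivative_linear by blast+
  show ?thesis unfolding v' linear_add[OF l(1)] linear_add[OF l(2)]
    by (simp add: nil trace_2 det_2)
qed

text \<open>A derivative within \<open>SL2\<close> is not unique as a map on all matrices and
  \<open>frechet_derivative\<close> chooses one; on tangent vectors the choice is
  immaterial.\<close>

lemma SL2_diffI:
  assumes "A \<in> SL2" "(F has_derivative F') (at A within SL2)" "v \<in> SL2_tangent A"
  shows "SL2_diff F A v = F' v"
proof -
  have "(F has_derivative frechet_derivative F (at A within SL2)) (at A within SL2)"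
    using assms(2) by (metis differentiableI frechet_derivative_works)
  then show ?thesis unfolding SL2_diff_def using SL2_derivative_unique[OF assms(1) _ assms(2,3)] by blast
qed

lemma SL2_has_derivative_transform:
  assumes "(F has_derivative F') (at A within SL2)" "openin (top_of_set SL2) W" "A \<in> W" "\<And>B. B \<in> W \<Longrightarrow> F B = G B"
  shows "(G has_derivative F') (at A within SL2)"
proof -
  obtain T where T: "open T" "W = SL2 \<inter> T" using assms(2) openin_open by blast
  have "\<forall>\<^sub>F x in at A within SL2. F x = G x"
    unfolding eventually_at_topological using T assms(3,4) by auto
  then show ?thesis
    using has_derivative_transform_eventually[OF assms(1)] assms(3,4) T(2) by auto
qed

lemma SL2_smooth_extension:
  assumes "SL2_smooth W F" "A \<in> W"
  obtains N G where "open N" "A \<in> N" "smooth_on G N" "\<And>B. B \<in> N \<Longrightarrow> B \<in> W \<Longrightarrow> G B = F B"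
proof -
  obtain N G where NG: "open N" "A \<in> N" "smooth_on G N" "\<forall>B\<in>N \<inter> W. G B = F B"
    using assms unfolding SL2_smooth_def by blast
  show ?thesis by (rule that[OF NG(1-3)]) (use NG(4) in blast)
qed

lemma SL2_smooth_derivative:
  assumes F: "SL2_smooth W F" and A: "A \<in> W"
  shows "\<exists>F'. (F has_derivative F') (at A within SL2)"
proof -
  have oW: "openin (top_of_set SL2) W" using F by (simp add: SL2_smooth_def)
  obtain N G where N: "open N" "A \<in> N" "smooth_on G N" "\<And>B. B \<in> N \<Longrightarrow> B \<in> W \<Longrightarrow> G B = F B"
    by (rule SL2_smooth_extension[OF F A]) (rule that)
  have "(G has_derivative frechet_derivative G (at A)) (at A within SL2)"
    by (rule has_derivative_at_withinI[OF smooth_on_has_derivative[OF N(1,3,2)]])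
  moreover have "openin (top_of_set SL2) (W \<inter> N)" using oW N(1) by (rule openin_Int_open)
  ultimately show ?thesis using SL2_has_derivative_transform[of G _ A "W \<inter> N" F] A N by blast
qed

lemma SL2_fieldD:
  assumes "SL2_field W Y" "A \<in> W"
  shows "A \<in> SL2" "Y A \<in> SL2_tangent A" "(Y has_derivative frechet_derivative Y (at A within SL2)) (at A within SL2)"
proof -
  have "SL2_smooth W Y" using assms by (simp add: SL2_field_def)
  then show "(Y has_derivative frechet_derivative Y (at A within SL2)) (at A within SL2)"
    using SL2_smooth_derivative[OF _ assms(2)] by (metis differentiableI frechet_derivative_works)
  show "A \<in> SL2" using assms openin_imp_subset unfolding SL2_field_def SL2_smooth_def by blast
  show "Y A \<in> SL2_tangent A" using assms by (simp add: SL2_field_def)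
qed

lemma bounded_linear_mult_left: "bounded_linear (\<lambda>B :: cmat. B ** (V :: cmat))" "bounded_linear (\<lambda>B :: cmat. (V :: cmat) ** B)"
  using bounded_bilinear.bounded_linear_left[OF bounded_bilinear_mm] bounded_bilinear.bounded_linear_right[OF bounded_bilinear_mm]
  by auto

lemma SL2_smooth_linear: "openin (top_of_set SL2) W \<Longrightarrow> bounded_linear F \<Longrightarrow> SL2_smooth W F"
  unfolding SL2_smooth_def using smooth_on_bounded_linear[OF open_UNIV] by (metis UNIV_I open_UNIV)

lemma left_invariant_field:
  assumes "openin (top_of_set SL2) W" "trace V = 0"
  shows "SL2_field W (\<lambda>B. B ** V)"
  unfolding SL2_field_def using SL2_smooth_linear[OF assms(1) bounded_linear_mult_left(1)] assms(2)
  by (auto simp: SL2_tangent_def)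

text \<open>The derivative along the group of the tangency relation
  \<open>bb (Y B) B = 0\<close>.\<close>

lemma SL2_field_diff_tangent:
  assumes Y: "SL2_field W Y" and A: "A \<in> W" and v: "v \<in> SL2_tangent A"
  shows "bb (SL2_diff Y A v) A + bb (Y A) v = 0"
proof -
  note YA = SL2_fieldD[OF Y A]
  have oW: "openin (top_of_set SL2) W" using Y by (simp add: SL2_field_def SL2_smooth_def)
  have "((\<lambda>B. bb (Y B) B) has_derivative (\<lambda>h. bb (Y A) h + bb (frechet_derivative Y (at A within SL2) h) A)) (at A within SL2)"
    by (rule bounded_bilinear.FDERIV[OF bounded_bilinear_bb YA(3) has_derivative_ident])
  then have "((\<lambda>B. 0) has_derivative (\<lambda>h. bb (Y A) h + bb (frechet_derivative Y (at A within SL2) h) A)) (at A within SL2)"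
    by (rule SL2_has_derivative_transform[OF _ oW A]) (use SL2_fieldD(1,2)[OF Y] tangent_iff in auto)
  from SL2_derivative_unique[OF YA(1) this has_derivative_const v]
  show ?thesis by (simp add: SL2_diff_def add.commute)
qed

text \<open>\<open>D\<close> is known only by its axioms. Let \<open>T\<close> be its deviation from
  the projected flat derivative: vanishing torsion makes \<open>T\<close> symmetric, and
  compatibility with the metric makes it skew, in overlapping pairs of slots; so it pairs to 0 with
  every tangent vector.\<close>

lemma SL2_levi_civita_explicit:
  assumes D: "SL2_levi_civita D" and Y: "SL2_field W Y" and A: "A \<in> W" and v: "v \<in> SL2_tangent A"
  shows "D Y A v = SL2_diff Y A v - mat (bb v (Y A)) ** A"
proof -
  have oW: "openin (top_of_set SL2) W" using Y by (simp add: SL2_field_def SL2_smooth_def)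
  have AS: "A \<in> SL2" by (rule SL2_fieldD(1)[OF Y A])
  have conn: "SL2_connection D" using D by (simp add: SL2_levi_civita_def)
  have tan: "D Z A w \<in> SL2_tangent A" if "SL2_field W Z" "w \<in> SL2_tangent A" for Z w
    using conn that A unfolding SL2_connection_def by fast
  have tor: "D Z A (X A) - D X A (Z A) = SL2_diff Z A (X A) - SL2_diff X A (Z A)"
    if "SL2_field W X" "SL2_field W Z" for X Z
    using D that A unfolding SL2_levi_civita_def by simp
  have met: "SL2_diff (\<lambda>B. SL2_metric B (X B) (Z B)) A w =
           SL2_metric A (D X A w) (Z A) + SL2_metric A (X A) (D Z A w)"
    if "SL2_field W X" "SL2_field W Z" "w \<in> SL2_tangent A" for X Z w
    using D that A unfolding SL2_levi_civita_def by simp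
  define T where "T Z w = D Z A w - (SL2_diff Z A w - mat (bb w (Z A)) ** A)" for Z w
  have Tsym: "T Z (X A) = T X (Z A)" if "SL2_field W X" "SL2_field W Z" for X Z
    using tor[OF that] bb_sym[of "X A" "Z A"] by (simp add: T_def algebra_simps)
  have TA: "bb (T Z w) A = 0" if Z: "SL2_field W Z" and w: "w \<in> SL2_tangent A" for Z w
    using tan[OF that] SL2_field_diff_tangent[OF Z A w] AS
    by (simp add: T_def bb_diff bb_scale tangent_iff SL2_iff bb_sym[of w] add_eq_0_iff2)
  have Tskew: "bb (T X w) (Z A) = - bb (T Z w) (X A)"
    if X: "SL2_field W X" and Z: "SL2_field W Z" and w: "w \<in> SL2_tangent A" for X Z w
  proof -
    note XA = SL2_fieldD[OF X A] and ZA = SL2_fieldD[OF Z A]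
    have "((\<lambda>B. bb (X B) (Z B)) has_derivative (\<lambda>h. bb (X A) (frechet_derivative Z (at A within SL2) h) +
        bb (frechet_derivative X (at A within SL2) h) (Z A))) (at A within SL2)"
      by (rule bounded_bilinear.FDERIV[OF bounded_bilinear_bb XA(3) ZA(3)])
    then have "((\<lambda>B. SL2_metric B (X B) (Z B)) has_derivative (\<lambda>h. bb (X A) (frechet_derivative Z (at A within SL2) h) +
        bb (frechet_derivative X (at A within SL2) h) (Z A))) (at A within SL2)"
      by (rule SL2_has_derivative_transform[OF _ oW A])
        (use SL2_fieldD[OF X] SL2_fieldD[OF Z] SL2_metric_tangent in auto)
    then have "SL2_diff (\<lambda>B. SL2_metric B (X B) (Z B)) A w = bb (X A) (SL2_diff Z A w) + bb (SL2_diff X A w) (Z A)"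
      unfolding SL2_diff_def[of Z] SL2_diff_def[of X] by (rule SL2_diffI[OF AS _ w])
    then have "bb (X A) (SL2_diff Z A w) + bb (SL2_diff X A w) (Z A) = bb (D X A w) (Z A) + bb (X A) (D Z A w)"
      using met[OF X Z w] SL2_metric_tangent[OF AS] tan[OF X w] tan[OF Z w] XA(2) ZA(2) by simp
    moreover have "bb A (X A) = 0" "bb A (Z A) = 0" using XA ZA by (simp_all add: tangent_iff bb_sym[of A])
    ultimately show ?thesis
      by (simp add: T_def bb_diff bb_add bb_scale bb_sym[of "X A"] algebra_simps)
  qed
  obtain V where V: "v = A ** V" "trace V = 0" using v by (auto simp: SL2_tangent_def)
  have "T Y v = 0"
  proof (rule bb_nondegenerate_tangent[OF AS TA[OF Y v]])
    fix z assume "z \<in> SL2_tangent A"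
    then obtain U where U: "z = A ** U" "trace U = 0" by (auto simp: SL2_tangent_def)
    \<comment> \<open>\<open>D\<close> differentiates fields, so the two tangent vectors at
      \<open>A\<close> are extended to left invariant fields.\<close>
    define X where "X = (\<lambda>B :: cmat. B ** V)"
    define Z where "Z = (\<lambda>B :: cmat. B ** U)"
    have X: "SL2_field W X" and Z: "SL2_field W Z"
      unfolding X_def Z_def using left_invariant_field[OF oW] V U by auto
    have tans: "X A \<in> SL2_tangent A" "Y A \<in> SL2_tangent A" "Z A \<in> SL2_tangent A"
      using SL2_fieldD(2) A X Y Z by blast+
    \<comment> \<open>Three skew exchanges alternate with three symmetric ones and restore the
      arrangement, with the sign reversed.\<close>
    have "bb (T Y (X A)) (Z A) = - bb (T Z (X A)) (Y A)" by (rule Tskew[OF Y Z tans(1)])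
    also have "\<dots> = - bb (T X (Z A)) (Y A)" by (simp only: Tsym[OF X Z])
    also have "\<dots> = bb (T Y (Z A)) (X A)" using Tskew[OF X Y tans(3)] by simp
    also have "\<dots> = bb (T Z (Y A)) (X A)" by (simp only: Tsym[OF Z Y])
    also have "\<dots> = - bb (T X (Y A)) (Z A)" by (rule Tskew[OF Z X tans(2)])
    also have "\<dots> = - bb (T Y (X A)) (Z A)" by (simp only: Tsym[OF X Y])
    finally have "bb (T Y (X A)) (Z A) = 0" by simp
    then show "bb (T Y v) z = 0" by (simp add: X_def Z_def V U)
  qed
  then show ?thesis by (simp add: T_def)
qed

text \<open>The action is linear in the matrix, hence its own differential, and it preserves
  \<open>bb\<close> because both factors have determinant 1.\<close>

lemma SL2_action_isometry:
  assumes A: "A \<in> SL2" and B: "B \<in> SL2"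
  shows "SL2_isometry (SL2_action A B)"
proof -
  have bl: "bounded_linear (SL2_action A B)" for A B
    unfolding SL2_action_def[abs_def]
    using bounded_linear_compose[OF bounded_linear_mult_left(1) bounded_linear_mult_left(2)] by (simp add: o_def)
  have maps: "SL2_action A B C \<in> SL2" if "A \<in> SL2" "B \<in> SL2" "C \<in> SL2" for A B C
    using that by (simp add: SL2_action_def SL2_matrix_inv SL2_mult adj2_SL2)
  have inv: "SL2_action (adj2 A) (adj2 B) (SL2_action A B C) = C" if "A \<in> SL2" "B \<in> SL2" for A B C
  proof -
    have "adj2 (adj2 B) = B" by (simp add: cmat_eq_iff)
    then have "SL2_action (adj2 A) (adj2 B) (SL2_action A B C) = (adj2 A ** A) ** C ** (adj2 B ** B)"
      using that by (simp add: SL2_action_def SL2_matrix_inv adj2_SL2 matrix_mul_assoc)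
    then show ?thesis using that by (simp add: adj2_inverse SL2_def)
  qed
  have inv2: "SL2_action A B (SL2_action (adj2 A) (adj2 B) C) = C" for C
  proof -
    have "adj2 (adj2 A) = A" "adj2 (adj2 B) = B" by (simp_all add: cmat_eq_iff)
    then show ?thesis using inv[OF adj2_SL2[OF A] adj2_SL2[OF B], of C] by simp
  qed
  have bij: "bij_betw (SL2_action A B) SL2 SL2"
    by (rule bij_betwI[of _ _ _ "SL2_action (adj2 A) (adj2 B)"])
      (use maps A B adj2_SL2 inv inv2 in auto)
  have so: "openin (top_of_set SL2) SL2" by simp
  have "SL2_smooth SL2 (inv_into SL2 (SL2_action A B))"
    unfolding SL2_smooth_def
  proof (intro conjI ballI so)
    fix C assume "C \<in> SL2"
    have "SL2_action (adj2 A) (adj2 B) C' = inv_into SL2 (SL2_action A B) C'" if "C' \<in> SL2" for C'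
      using inv_into_f_eq[OF bij_betw_imp_inj_on[OF bij], of "SL2_action (adj2 A) (adj2 B) C'" C'] inv2 maps A B adj2_SL2 that
      by simp
    then show "\<exists>N G. open N \<and> C \<in> N \<and> smooth_on G N \<and> (\<forall>B'\<in>N \<inter> SL2. G B' = inv_into SL2 (SL2_action A B) B')"
      using smooth_on_bounded_linear[OF open_UNIV bl]
      by (intro exI[of _ UNIV] exI[of _ "SL2_action (adj2 A) (adj2 B)"]) auto
  qed
  moreover have "SL2_metric (SL2_action A B C) (SL2_diff (SL2_action A B) C v) (SL2_diff (SL2_action A B) C w) = SL2_metric C v w"
    if C: "C \<in> SL2" and vw: "v \<in> SL2_tangent C" "w \<in> SL2_tangent C" for C v w
  proof -
    have d: "SL2_diff (SL2_action A B) C u = SL2_action A B u" if "u \<in> SL2_tangent C" for u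
      by (rule SL2_diffI[OF C bounded_linear_imp_has_derivative[OF bl] that])
    have pres: "bb (SL2_action A B x) (SL2_action A B y) = bb x y" for x y
      using A B by (simp add: SL2_action_def SL2_matrix_inv bb_mult_left bb_mult_right adj2_SL2[unfolded SL2_def mem_Collect_eq] SL2_def)
    show ?thesis
      unfolding d[OF vw(1)] d[OF vw(2)]
      using vw C maps[OF A B C] by (simp add: SL2_metric_bb pres tangent_iff)
  qed
  ultimately show ?thesis
    unfolding SL2_isometry_def using bij SL2_smooth_linear[OF so bl] by blast
qed

text \<open>A polynomial path in the group from the identity: four elementary matrices whose
  off-diagonal entries are scaled by \<open>t\<close>.\<close>

definition unipotents :: "complex \<Rightarrow> complex \<Rightarrow> complex \<Rightarrow> complex \<Rightarrow> real \<Rightarrow> cmat" where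
  "unipotents x y z w t = (mat 1 + t *\<^sub>R m2 0 x 0 0) ** (mat 1 + t *\<^sub>R m2 0 0 y 0) **
     ((mat 1 + t *\<^sub>R m2 0 z 0 0) ** (mat 1 + t *\<^sub>R m2 0 0 w 0))"

lemma unipotents_SL2: "unipotents x y z w t \<in> SL2"
  unfolding unipotents_def by (intro SL2_mult) (simp_all add: SL2_def det_2 mat_nth)

lemma unipotents_0: "unipotents x y z w 0 = mat 1"
  by (simp add: unipotents_def)

lemma continuous_on_unipotents: "continuous_on U (unipotents x y z w)"
  unfolding unipotents_def by (intro bounded_bilinear.continuous_on[OF bounded_bilinear_mm] continuous_intros)

text \<open>Gaussian elimination. If the lower left entry is nonzero, three elementary factors
  suffice; otherwise multiplication by a lower unipotent matrix makes it nonzero, and the fourth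
  factor undoes this.\<close>

lemma SL2_unipotents:
  assumes "A \<in> SL2"
  shows "\<exists>x y z w. A = unipotents x y z w 1"
proof -
  have d: "A$1$1 * A$2$2 = 1 + A$1$2 * A$2$1" using assms by (simp add: SL2_def det_2 algebra_simps)
  have main: "\<exists>x y z. B = unipotents x y z 0 1" if B: "B$1$1 * B$2$2 = 1 + B$1$2 * B$2$1" "B$2$1 \<noteq> 0" for B
    by (rule exI[of _ "(B$1$1 - 1) / B$2$1"], rule exI[of _ "B$2$1"], rule exI[of _ "(B$2$2 - 1) / B$2$1"])
      (use B in \<open>simp add: unipotents_def cmat_eq_iff mm_nth mat_nth field_simps\<close>)
  show ?thesis
  proof (cases "A$2$1 = 0")
    case False
    then show ?thesis using main[OF d] by blast
  next
    case True
    define B where "B = A ** m2 1 0 1 1"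
    have A22: "A$2$2 \<noteq> 0" using True d by auto
    have "B$1$1 * B$2$2 = 1 + B$1$2 * B$2$1" "B$2$1 \<noteq> 0"
      using d True A22 by (simp_all add: B_def mm_nth algebra_simps)
    then obtain x y z where xyz: "B = unipotents x y z 0 1" using main by blast
    have "A = B ** m2 1 0 (- 1) 1" by (simp add: B_def cmat_eq_iff mm_nth)
    also have "\<dots> = unipotents x y z (- 1) 1"
      unfolding xyz by (simp add: unipotents_def cmat_eq_iff mm_nth mat_nth algebra_simps)
    finally show ?thesis by blast
  qed
qed

text \<open>Both factors are joined to the identity within the group by \<open>unipotents\<close>;
  the actions along the two paths are a homotopy through isometries.\<close>

lemma SL2_action_Isom0:
  assumes "A \<in> SL2" "B \<in> SL2"
  shows "SL2_action A B \<in> Isom0_SL2"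
proof -
  obtain x y z w where A: "A = unipotents x y z w 1" using SL2_unipotents[OF assms(1)] by blast
  obtain x' y' z' w' where B: "B = unipotents x' y' z' w' 1" using SL2_unipotents[OF assms(2)] by blast
  define h where "h p = SL2_action (unipotents x y z w (fst p)) (unipotents x' y' z' w' (fst p)) (snd p)" for p
  have h_eq: "h p = unipotents x y z w (fst p) ** snd p ** adj2 (unipotents x' y' z' w' (fst p))" for p
    by (simp add: h_def SL2_action_def SL2_matrix_inv unipotents_SL2)
  have "continuous_on ({0..1} \<times> SL2) h"
    unfolding h_eq[abs_def]
    by (intro bounded_bilinear.continuous_on[OF bounded_bilinear_mm] bounded_linear.continuous_on[OF bounded_linear_adj2]
        continuous_on_compose2[OF continuous_on_unipotents] continuous_intros) auto
  moreover have "h \<in> ({0..1} \<times> SL2) \<rightarrow> SL2"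
    unfolding h_eq[abs_def] by (auto intro!: SL2_mult unipotents_SL2 adj2_SL2)
  ultimately have c: "continuous_map (prod_topology (top_of_set {0..1}) (top_of_set SL2)) (top_of_set SL2) h"
    by (simp add: prod_topology_subtopology_eu continuous_map_subtopology_eu)
  show ?thesis
    unfolding Isom0_SL2_def mem_Collect_eq homotopic_with_def
  proof (intro exI[of _ h] conjI c allI ballI)
    fix C
    have "adj2 (mat 1) = mat 1" by (simp add: cmat_eq_iff mat_nth)
    then show "h (0, C) = id C" by (simp add: h_eq unipotents_0)
    show "h (1, C) = SL2_action A B C" by (simp add: h_def A B)
  next
    fix t :: real
    have "(\<lambda>C. h (t, C)) = SL2_action (unipotents x y z w t) (unipotents x' y' z' w' t)" by (simp add: h_def fun_eq_iff)
    then show "SL2_isometry (\<lambda>C. h (t, C))" by (simp add: SL2_action_isometry unipotents_SL2)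
  qed
qed

section \<open>The pull-back connection\<close>

lemma bounded_linear_mat: "bounded_linear (\<lambda>c. mat c :: cmat)"
  unfolding linear_conv_bounded_linear[symmetric]
  by (intro linearI) (simp_all add: cmat_eq_iff mat_nth)

lemma mat_add_mult: "mat (a + b) ** X = mat a ** X + mat b ** X" for X :: cmat
  by (simp add: cmat_eq_iff mat_mult_nth algebra_simps)

lemma mat_of_real_mult: "mat (of_real r) ** X = r *\<^sub>R X" for X :: cmat
  unfolding cmat_eq_iff mat_mult_nth vector_scaleR_component by (simp add: scaleR_conv_of_real)

lemma pushforward_nth: "pushforward s v $ i $ j = v (\<lambda>q. s q $ i $ j)"
  by (simp add: pushforward_def)

lemma pushforward_vadd: "pushforward s (vadd v w) = pushforward s v + pushforward s w"
  by (simp add: cmat_eq_iff pushforward_nth vadd_def)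

lemma pushforward_vsub: "pushforward s (vsub v w) = pushforward s v - pushforward s w"
  by (simp add: cmat_eq_iff pushforward_nth vsub_def)

lemma pushforward_vscale: "pushforward s (vscale c v) = mat c ** pushforward s v"
  by (simp add: cmat_eq_iff pushforward_nth vscale_def mat_mult_nth)

context surface
begin

lemma smooth_near_nth: "smooth_near S \<A> p s \<Longrightarrow> smooth_near S \<A> p (\<lambda>q. s q $ i)"
  by (rule smooth_near_linear[OF _ bounded_linear_vec_nth])

lemma smooth_fun_mm: "smooth_fun S \<A> U s \<Longrightarrow> smooth_fun S \<A> U t \<Longrightarrow> smooth_fun S \<A> U (\<lambda>q. s q ** t q :: cmat)"
  for s t :: "'a \<Rightarrow> cmat"
  by (rule smooth_fun_bilinear[OF _ _ bounded_bilinear_mm])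

lemma smooth_fun_bb: "smooth_fun S \<A> U s \<Longrightarrow> smooth_fun S \<A> U t \<Longrightarrow> smooth_fun S \<A> U (\<lambda>q. bb (s q) (t q))"
  by (rule smooth_fun_bilinear[OF _ _ bounded_bilinear_bb])

lemma smooth_fun_mat: "smooth_fun S \<A> U f \<Longrightarrow> smooth_fun S \<A> U (\<lambda>q. mat (f q) :: cmat)"
  by (rule smooth_fun_linear[OF _ bounded_linear_mat])

lemma smooth_fun_pushforward:
  assumes "smooth_fun S \<A> U s" "cfield S \<A> U X"
  shows "smooth_fun S \<A> U (\<lambda>p. pushforward s (X p))"
proof (rule smooth_fun_vec, rule smooth_fun_vec)
  fix i j
  have "smooth_fun S \<A> U (\<lambda>q. s q $ i $ j)" by (rule smooth_fun_nth[OF smooth_fun_nth[OF assms(1)]])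
  then show "smooth_fun S \<A> U (\<lambda>p. pushforward s (X p) $ i $ j)"
    using assms(2) by (simp add: pushforward_nth cfield_def)
qed

lemma pushforward_add:
  assumes "p \<in> S" "v \<in> ctangent_space S \<A> p" "smooth_near S \<A> p s" "smooth_near S \<A> p t"
  shows "pushforward (\<lambda>q. s q + t q) v = pushforward s v + pushforward t v"
  using smooth_near_nth[OF smooth_near_nth[OF assms(3)]] smooth_near_nth[OF smooth_near_nth[OF assms(4)]]
  by (simp add: cmat_eq_iff pushforward_nth ctangent_add[OF assms(1,2)])

lemma pushforward_mm:
  assumes "p \<in> S" "v \<in> ctangent_space S \<A> p" "smooth_near S \<A> p s" "smooth_near S \<A> p t"
  shows "pushforward (\<lambda>q. s q ** t q) v = pushforward s v ** t p + s p ** pushforward t v"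
  using smooth_near_nth[OF smooth_near_nth[OF assms(3)]] smooth_near_nth[OF smooth_near_nth[OF assms(4)]]
  by (simp add: cmat_eq_iff pushforward_nth mm_nth ctangent_add[OF assms(1,2)] ctangent_mult[OF assms(1,2)] smooth_near_mult
      algebra_simps)

lemma pushforward_mat:
  assumes "p \<in> S" "v \<in> ctangent_space S \<A> p"
  shows "pushforward (\<lambda>q. mat (f q)) v = mat (v f)"
  by (simp add: cmat_eq_iff pushforward_nth mat_nth ctangent_const[OF assms])

lemma pushforward_const:
  assumes "p \<in> S" "v \<in> ctangent_space S \<A> p"
  shows "pushforward (\<lambda>q. C) v = 0"
  by (simp add: cmat_eq_iff pushforward_nth ctangent_const[OF assms])

lemma smooth_near_mat: "smooth_near S \<A> p f \<Longrightarrow> smooth_near S \<A> p (\<lambda>q. mat (f q) :: cmat)"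
  by (rule smooth_near_linear[OF _ bounded_linear_mat])

lemma pushforward_scale:
  assumes "p \<in> S" "v \<in> ctangent_space S \<A> p" "smooth_near S \<A> p f" "smooth_near S \<A> p s"
  shows "pushforward (\<lambda>q. mat (f q) ** s q) v = mat (v f) ** s p + mat (f p) ** pushforward s v"
  by (simp add: pushforward_mm[OF assms(1,2) smooth_near_mat[OF assms(3)] assms(4)] pushforward_mat[OF assms(1,2)])

lemma pushforward_mult_const:
  assumes "p \<in> S" "v \<in> ctangent_space S \<A> p" "smooth_near S \<A> p s"
  shows "pushforward (\<lambda>q. s q ** C) v = pushforward s v ** C" "pushforward (\<lambda>q. C ** s q) v = C ** pushforward s v"
  using pushforward_mm[OF assms smooth_near_const[OF assms(1), of C]]
    pushforward_mm[OF assms(1,2) smooth_near_const[OF assms(1), of C] assms(3)]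
  by (simp_all add: pushforward_const[OF assms(1,2)])

lemma smooth_near_diff:
  assumes "smooth_near S \<A> p f" "smooth_near S \<A> p h"
  shows "smooth_near S \<A> p (\<lambda>q. f q - h q)"
proof -
  obtain U where "p \<in> U" "smooth_fun S \<A> U f" "smooth_fun S \<A> U h" using smooth_near_both[OF assms] by blast
  then show ?thesis by (intro smooth_nearI[OF smooth_fun_diff])
qed

lemma ctangent_cmult:
  assumes "p \<in> S" "v \<in> ctangent_space S \<A> p" "smooth_near S \<A> p f"
  shows "v (\<lambda>q. c * f q) = c * v f"
  using ctangent_mult[OF assms(1,2) smooth_near_const[OF assms(1), of c] assms(3)] by (simp add: ctangent_const[OF assms(1,2)])

lemma ctangent_diff:
  assumes "p \<in> S" "v \<in> ctangent_space S \<A> p" "smooth_near S \<A> p f" "smooth_near S \<A> p h"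
  shows "v (\<lambda>q. f q - h q) = v f - v h"
  using ctangent_add[OF assms(1,2) smooth_near_diff[OF assms(3,4)] assms(4)] by simp

lemma pushforward_bb:
  assumes "p \<in> S" "v \<in> ctangent_space S \<A> p" "smooth_near S \<A> p s" "smooth_near S \<A> p t"
  shows "v (\<lambda>q. bb (s q) (t q)) = bb (pushforward s v) (t p) + bb (s p) (pushforward t v)"
proof -
  note s = smooth_near_nth[OF smooth_near_nth[OF assms(3)]] and t = smooth_near_nth[OF smooth_near_nth[OF assms(4)]]
  have bb: "bb X Y = (- 1 / 2) * ((X$1$1 * Y$2$2 + X$2$2 * Y$1$1) - (X$1$2 * Y$2$1 + X$2$1 * Y$1$2))" for X Y
    by (simp add: bb_def field_simps)
  show ?thesis
    unfolding bb
    by (simp only: ctangent_cmult[OF assms(1,2)] ctangent_diff[OF assms(1,2)] ctangent_add[OF assms(1,2)]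
        ctangent_mult[OF assms(1,2)] smooth_near_mult smooth_near_add smooth_near_diff s t pushforward_nth)
      (simp add: algebra_simps)
qed

lemma pushforward_germ:
  assumes "v \<in> ctangent_space S \<A> p" "smooth_fun S \<A> N s" "p \<in> N" "\<And>q. q \<in> N \<Longrightarrow> s q = t q"
  shows "pushforward s v = pushforward t v"
proof -
  have "v (\<lambda>q. s q $ i $ j) = v (\<lambda>q. t q $ i $ j)" for i j
    by (rule ctangent_germ[OF assms(1) smooth_fun_nth[OF smooth_fun_nth[OF assms(2)]] assms(3)]) (simp add: assms(4))
  then show ?thesis by (simp add: cmat_eq_iff pushforward_nth)
qed

lemma smooth_fun_preimage:
  assumes f: "smooth_fun S \<A> U f" and N: "open N"
  shows "openin (top_of_set S) {q \<in> U. f q \<in> N}"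
  unfolding openin_subopen[of _ "{q \<in> U. f q \<in> N}"]
proof
  fix p assume "p \<in> {q \<in> U. f q \<in> N}"
  then have p: "p \<in> U" "f p \<in> N" by auto
  note oU = smooth_fun_openin[OF f]
  have "p \<in> S" using oU p openin_imp_subset by blast
  then obtain V \<phi> where V: "(V, \<phi>) \<in> \<A>" "p \<in> V" using atlas_cover by blast
  note inj = chart_homeomorphism(1)[OF V(1)]
  define W where "W = (f \<circ> inv_into V \<phi>) -` N \<inter> \<phi> ` (U \<inter> V)"
  have "open W"
    unfolding W_def using continuous_on_open_vimage[OF open_chart_image[OF V(1) oU], THEN iffD1, rule_format,
        OF smooth_on_continuous[OF smooth_fun_chart[OF f V(1)]] N] .
  moreover have "W \<subseteq> \<phi> ` V" by (auto simp: W_def)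
  ultimately have "openin (top_of_set S) (inv_into V \<phi> ` W)" by (rule openin_chart_preimage[OF V(1)])
  moreover have "\<phi> p \<in> W" using p V(2) inj by (auto simp: W_def)
  then have "p \<in> inv_into V \<phi> ` W" using V(2) inj by (metis imageI inv_into_f_f)
  moreover have "inv_into V \<phi> ` W \<subseteq> {q \<in> U. f q \<in> N}" using inj by (auto simp: W_def)
  ultimately show "\<exists>T. openin (top_of_set S) T \<and> p \<in> T \<and> T \<subseteq> {q \<in> U. f q \<in> N}" by blast
qed

text \<open>The derivative of the relation
  \<open>bb (\<sigma> q) (\<sigma> q) = - 1\<close>.\<close>

lemma pushforward_tangent:
  assumes s: "smooth_fun S \<A> U \<sigma>" "\<And>q. q \<in> U \<Longrightarrow> bb (\<sigma> q) (\<sigma> q) = - 1" and p: "p \<in> U" and v: "v \<in> ctangent_space S \<A> p"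
  shows "bb (pushforward \<sigma> v) (\<sigma> p) = 0"
proof -
  have sn: "smooth_near S \<A> p \<sigma>" by (rule smooth_nearI[OF s(1) p])
  have pS: "p \<in> S" by (rule smooth_near_in[OF sn])
  have "v (\<lambda>q. bb (\<sigma> q) (\<sigma> q)) = v (\<lambda>q. - 1)"
    by (rule ctangent_germ[OF v smooth_fun_bb[OF s(1,1)] p s(2)])
  then have "bb (pushforward \<sigma> v) (\<sigma> p) + bb (\<sigma> p) (pushforward \<sigma> v) = 0"
    by (simp add: pushforward_bb[OF pS v sn sn] ctangent_const[OF pS v])
  then show ?thesis by (simp add: bb_sym[of "\<sigma> p"])
qed

end

context surface_chart
begin

lemma pd_nth: "smooth_near S \<A> p f \<Longrightarrow> p \<in> V \<Longrightarrow> pd i (\<lambda>q. f q $ j) p = pd i f p $ j"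
  by (rule pd_linear[OF _ _ bounded_linear_vec_nth])

lemma pushforward_dv:
  assumes "p \<in> V" "smooth_near S \<A> p s"
  shows "pushforward s (dv p a) = mat (a $ 1) ** pd 1 s p + mat (a $ 2) ** pd 2 s p"
  using smooth_near_nth[OF assms(2)] smooth_near_nth[OF smooth_near_nth[OF assms(2)]]
  by (simp add: cmat_eq_iff pushforward_nth mat_mult_nth dv_apply pd_nth assms)

lemma real_vec_rv: "p \<in> V \<Longrightarrow> real_vec S \<A> p (rv p x) = dv p (\<chi> i. of_real (x $ i))"
proof -
  assume p: "p \<in> V"
  have "rv p 0 = (\<lambda>_. 0)" by (simp add: rv_def fun_eq_iff)
  then show ?thesis using cplx_vec_rv[OF p, of x 0] by (simp add: complex_of_real_def)
qed

text \<open>Smoothness on the group means local extension to an open set of matrices, and the chain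
  rule is applied to the extension \<open>G\<close>. Its derivative is only real linear, whence the
  restriction to a real tangent vector.\<close>

lemma pushforward_SL2_compose:
  assumes F: "SL2_smooth W F" and s: "smooth_fun S \<A> U \<sigma>" "\<sigma> ` U \<subseteq> W" and p: "p \<in> U" "p \<in> V"
    and X: "X \<in> tangent_space S \<A> p"
  shows "pushforward (\<lambda>q. F (\<sigma> q)) (real_vec S \<A> p X) = SL2_diff F (\<sigma> p) (pushforward \<sigma> (real_vec S \<A> p X))"
proof -
  have "\<sigma> p \<in> W" using s(2) p by blast
  have WS: "W \<subseteq> SL2" using F openin_imp_subset unfolding SL2_smooth_def by blast
  have sp: "\<sigma> p \<in> SL2" using \<open>\<sigma> p \<in> W\<close> WS by blast
  have sn: "smooth_near S \<A> p \<sigma>" by (rule smooth_nearI[OF s(1) p(1)])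
  obtain N G where N: "open N" "\<sigma> p \<in> N" "smooth_on G N" "\<And>B. B \<in> N \<Longrightarrow> B \<in> W \<Longrightarrow> G B = F B"
    by (rule SL2_smooth_extension[OF F \<open>\<sigma> p \<in> W\<close>]) (rule that)
  let ?D = "frechet_derivative G (at (\<sigma> p))"
  have dG: "(G has_derivative ?D) (at (\<sigma> p))" by (rule smooth_on_has_derivative[OF N(1,3,2)])
  have l: "linear ?D" by (rule has_derivative_linear[OF dG])
  define U' where "U' = {q \<in> U. \<sigma> q \<in> N}"
  have sU': "smooth_fun S \<A> U' \<sigma>"
    by (rule smooth_fun_subset[OF s(1)]) (auto simp: U'_def smooth_fun_preimage[OF s(1) N(1)])
  have GU': "smooth_fun S \<A> U' (\<lambda>q. G (\<sigma> q))"
    by (rule smooth_fun_compose[OF sU' N(1) _ N(3)]) (auto simp: U'_def)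
  have pU': "p \<in> U'" using p N(2) by (simp add: U'_def)
  have pdG: "pd i (\<lambda>q. G (\<sigma> q)) p = ?D (pd i \<sigma> p)" for i
  proof -
    have "((\<lambda>z. \<sigma> (inv_into V \<phi> z)) has_derivative frechet_derivative (\<sigma> \<circ> inv_into V \<phi>) (at (\<phi> p))) (at (\<phi> p))"
      by (rule has_pd_differentiable[OF sn p(2)])
    then have "(G \<circ> (\<lambda>z. \<sigma> (inv_into V \<phi> z)) has_derivative ?D \<circ> frechet_derivative (\<sigma> \<circ> inv_into V \<phi>) (at (\<phi> p))) (at (\<phi> p))"
      by (rule diff_chain_at) (simp add: \<psi>\<phi>[OF p(2)] dG)
    then have "((\<lambda>q. G (\<sigma> q)) \<circ> inv_into V \<phi> has_derivative ?D \<circ> frechet_derivative (\<sigma> \<circ> inv_into V \<phi>) (at (\<phi> p))) (at (\<phi> p))"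
      by (simp add: o_def)
    from pdI[OF this] show ?thesis by (simp add: pd_def)
  qed
  define x where "x = (\<chi> i. X (\<lambda>q. \<phi> q $ i))"
  define v where "v = real_vec S \<A> p X"
  have v: "v = dv p (\<chi> i. of_real (x $ i))"
    unfolding v_def using tangent_eq_rv[OF X p(2)] real_vec_rv[OF p(2), of x] by (simp add: x_def)
  have vc: "v \<in> ctangent_space S \<A> p" unfolding v by (rule dv_ctangent[OF p(2)])
  have "pushforward (\<lambda>q. F (\<sigma> q)) v = pushforward (\<lambda>q. G (\<sigma> q)) v"
    by (rule pushforward_germ[OF vc GU' pU', symmetric]) (use N(4) s(2) in \<open>auto simp: U'_def\<close>)
  also have "\<dots> = x $ 1 *\<^sub>R ?D (pd 1 \<sigma> p) + x $ 2 *\<^sub>R ?D (pd 2 \<sigma> p)"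
    unfolding v pushforward_dv[OF p(2) smooth_nearI[OF GU' pU']] by (simp add: mat_of_real_mult pdG)
  also have "\<dots> = ?D (pushforward \<sigma> v)"
    unfolding v pushforward_dv[OF p(2) sn] by (simp add: mat_of_real_mult linear_add[OF l] linear_scale[OF l])
  also have "\<dots> = SL2_diff F (\<sigma> p) (pushforward \<sigma> v)"
  proof (rule SL2_diffI[OF sp, symmetric])
    have oW: "openin (top_of_set SL2) (W \<inter> N)"
      using F N(1) openin_Int_open unfolding SL2_smooth_def by blast
    show "(F has_derivative ?D) (at (\<sigma> p) within SL2)"
      by (rule SL2_has_derivative_transform[OF has_derivative_at_withinI[OF dG] oW]) (use N \<open>\<sigma> p \<in> W\<close> in auto)
    have "bb (pushforward \<sigma> v) (\<sigma> p) = 0"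
      by (rule pushforward_tangent[OF s(1) _ p(1) vc]) (use s(2) WS SL2_iff in blast)
    then show "pushforward \<sigma> v \<in> SL2_tangent (\<sigma> p)" by (simp add: tangent_iff[OF sp])
  qed
  finally show ?thesis by (simp add: v_def)
qed

end

section \<open>The pull-back connection as a projected flat derivative\<close>

locale SL2_map = surface S \<A> for S :: "'a::topological_space set" and \<A> :: "'a atlas" +
  fixes D :: SL2_conn and \<sigma> :: "'a \<Rightarrow> cmat"
  assumes D: "SL2_levi_civita D" and \<sigma>_smooth: "smooth_fun S \<A> S \<sigma>" and \<sigma>_SL2: "\<sigma> ` S \<subseteq> SL2"
begin

text \<open>The flat derivative of \<open>s\<close> minus its component along
  \<open>\<sigma>\<close>, which by the relation \<open>bb (s q) (\<sigma> q) = 0\<close> can be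
  expressed without differentiating \<open>s\<close>.\<close>

definition Db0 :: "'a conn_along" where
  "Db0 s p v = pushforward s v - mat (bb (pushforward \<sigma> v) (s p)) ** \<sigma> p"

lemma \<sigma>_in: "p \<in> S \<Longrightarrow> \<sigma> p \<in> SL2" using \<sigma>_SL2 by blast

lemma \<sigma>_near: "p \<in> S \<Longrightarrow> smooth_near S \<A> p \<sigma>" by (rule smooth_nearI[OF \<sigma>_smooth])

lemma \<sigma>_tangent: "p \<in> S \<Longrightarrow> v \<in> ctangent_space S \<A> p \<Longrightarrow> pushforward \<sigma> v \<in> SL2_tangent (\<sigma> p)"
  using pushforward_tangent[OF \<sigma>_smooth] \<sigma>_in SL2_iff tangent_iff by simp

lemma field_alongD:
  assumes "field_along S \<A> \<sigma> U s"
  shows "smooth_fun S \<A> U s" "openin (top_of_set S) U" "U \<subseteq> S" "\<And>p. p \<in> U \<Longrightarrow> bb (s p) (\<sigma> p) = 0"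
proof -
  show 1: "smooth_fun S \<A> U s" using assms by (simp add: field_along_def)
  show 2: "openin (top_of_set S) U" by (rule smooth_fun_openin[OF 1])
  show 3: "U \<subseteq> S" by (rule openin_imp_subset[OF 2])
  show "bb (s p) (\<sigma> p) = 0" if "p \<in> U" for p
  proof -
    have "s p \<in> SL2_tangent (\<sigma> p)" using assms that by (simp add: field_along_def)
    then show ?thesis using tangent_iff[OF \<sigma>_in[OF subsetD[OF 3 that]]] by blast
  qed
qed

lemma Db0_pull:
  assumes U: "openin (top_of_set S) U" "\<sigma> ` U \<subseteq> W" and Y: "SL2_field W Y" and p: "p \<in> U" and X: "X \<in> tangent_space S \<A> p"
  shows "Db0 (Y \<circ> \<sigma>) p (real_vec S \<A> p X) = D Y (\<sigma> p) (pushforward \<sigma> (real_vec S \<A> p X))"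
proof -
  have pS: "p \<in> S" using U(1) p openin_imp_subset by blast
  obtain V \<phi> where "surface_chart S \<A> V \<phi>" and pV: "p \<in> V" using chart_at[OF pS] .
  then interpret surface_chart S \<A> V \<phi> by simp
  have sU: "smooth_fun S \<A> U \<sigma>" by (rule smooth_fun_subset[OF \<sigma>_smooth U(1) openin_imp_subset[OF U(1)]])
  have Ys: "SL2_smooth W Y" using Y by (simp add: SL2_field_def)
  have "pushforward \<sigma> (real_vec S \<A> p X) \<in> SL2_tangent (\<sigma> p)"
    by (rule \<sigma>_tangent[OF pS real_vec_ctangent[OF X pS]])
  then have "D Y (\<sigma> p) (pushforward \<sigma> (real_vec S \<A> p X)) = SL2_diff Y (\<sigma> p) (pushforward \<sigma> (real_vec S \<A> p X)) -
     mat (bb (pushforward \<sigma> (real_vec S \<A> p X)) (Y (\<sigma> p))) ** \<sigma> p"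
    by (intro SL2_levi_civita_explicit[OF D Y]) (use U(2) p in blast)
  then show ?thesis
    using pushforward_SL2_compose[OF Ys sU U(2) p pV X] by (simp add: Db0_def o_def)
qed

text \<open>Tangency of the values is the derivative of \<open>bb (s q) (\<sigma> q) = 0\<close>,
  the last clause is \<open>Db0_pull\<close>, and the rest is linearity and the product rule.
  \<open>Db0\<close> is both the witness for existence and the normal form of every pull-back
  connection.\<close>

lemma Db0_pullback: "pullback_connection S \<A> D \<sigma> Db0"
  unfolding pullback_connection_def
proof (intro conjI allI impI ballI)
  fix U s p v assume fa: "field_along S \<A> \<sigma> U s" and p: "p \<in> U" and v: "v \<in> ctangent_space S \<A> p"
  note f = field_alongD[OF fa]
  have pS: "p \<in> S" using p f(3) by blast
  have sn: "smooth_near S \<A> p s" by (rule smooth_nearI[OF f(1) p])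
  have "v (\<lambda>q. bb (s q) (\<sigma> q)) = v (\<lambda>q. 0)"
    by (rule ctangent_germ[OF v smooth_fun_bb[OF f(1) smooth_fun_subset[OF \<sigma>_smooth f(2,3)]] p f(4)])
  then have "bb (pushforward s v) (\<sigma> p) + bb (s p) (pushforward \<sigma> v) = 0"
    by (simp add: pushforward_bb[OF pS v sn \<sigma>_near[OF pS]] ctangent_const[OF pS v])
  then show "Db0 s p v \<in> SL2_tangent (\<sigma> p)"
    using \<sigma>_in[OF pS] by (simp add: tangent_iff Db0_def bb_diff bb_scale SL2_iff bb_sym[of "pushforward \<sigma> v"])
  show "Db0 s p (vadd v w) = Db0 s p v + Db0 s p w" for w
    by (simp add: Db0_def pushforward_vadd bb_add mat_add_mult)
  show "Db0 s p (vscale c v) = mat c ** Db0 s p v" for c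
    by (simp add: Db0_def pushforward_vscale bb_scale cmat_eq_iff mat_mult_nth algebra_simps)
next
  fix U s X assume fa: "field_along S \<A> \<sigma> U s" and X: "cfield S \<A> U X"
  note f = field_alongD[OF fa]
  have sU: "smooth_fun S \<A> U \<sigma>" by (rule smooth_fun_subset[OF \<sigma>_smooth f(2,3)])
  have "smooth_fun S \<A> U (\<lambda>p. Db0 s p (X p))"
    unfolding Db0_def
    by (intro smooth_fun_diff smooth_fun_mm smooth_fun_mat smooth_fun_bb smooth_fun_pushforward[OF f(1) X]
        smooth_fun_pushforward[OF sU X] f(1) sU)
  moreover have "Db0 s p (X p) \<in> SL2_tangent (\<sigma> p)" if p: "p \<in> U" for p
  proof -
    have v: "X p \<in> ctangent_space S \<A> p" using X p by (simp add: cfield_def)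
    have pS: "p \<in> S" using p f(3) by blast
    have sn: "smooth_near S \<A> p s" by (rule smooth_nearI[OF f(1) p])
    have "X p (\<lambda>q. bb (s q) (\<sigma> q)) = X p (\<lambda>q. 0)"
      by (rule ctangent_germ[OF v smooth_fun_bb[OF f(1) sU] p f(4)])
    then have "bb (pushforward s (X p)) (\<sigma> p) + bb (s p) (pushforward \<sigma> (X p)) = 0"
      by (simp add: pushforward_bb[OF pS v sn \<sigma>_near[OF pS]] ctangent_const[OF pS v])
    then show ?thesis
      using \<sigma>_in[OF pS] by (simp add: tangent_iff Db0_def bb_diff bb_scale SL2_iff bb_sym[of "pushforward \<sigma> (X p)"])
  qed
  ultimately show "field_along S \<A> \<sigma> U (\<lambda>p. Db0 s p (X p))" by (simp add: field_along_def)
next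
  fix U s t p v
  assume fa: "field_along S \<A> \<sigma> U s" and t: "field_along S \<A> \<sigma> U t \<and> (\<forall>q\<in>U. t q = s q)" and p: "p \<in> U" and v: "v \<in> ctangent_space S \<A> p"
  have "pushforward t v = pushforward s v"
    by (rule pushforward_germ[OF v field_alongD(1)[of U] p]) (use t in auto)
  then show "Db0 t p v = Db0 s p v" using t p by (simp add: Db0_def)
next
  fix U s t p v
  assume fa: "field_along S \<A> \<sigma> U s" "field_along S \<A> \<sigma> U t" and p: "p \<in> U" and v: "v \<in> ctangent_space S \<A> p"
  note f = field_alongD[OF fa(1)] field_alongD[OF fa(2)]
  have pS: "p \<in> S" using p f(3) by blast
  show "Db0 (\<lambda>q. s q + t q) p v = Db0 s p v + Db0 t p v"
    by (simp add: Db0_def pushforward_add[OF pS v smooth_nearI[OF f(1) p] smooth_nearI[OF f(5) p]] bb_add mat_add_mult)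
next
  fix U s p v and f :: "'a \<Rightarrow> complex"
  assume fa: "field_along S \<A> \<sigma> U s" and g: "smooth_fun S \<A> U f" and p: "p \<in> U" and v: "v \<in> ctangent_space S \<A> p"
  note f = field_alongD[OF fa]
  have pS: "p \<in> S" using p f(3) by blast
  show "Db0 (\<lambda>q. mat (f q) ** s q) p v = mat (v f) ** s p + mat (f p) ** Db0 s p v"
    by (simp add: Db0_def pushforward_scale[OF pS v smooth_nearI[OF g p] smooth_nearI[OF f(1) p]] bb_scale
      cmat_eq_iff mat_mult_nth algebra_simps)
next
  fix U W Y p X
  assume "openin (top_of_set S) U \<and> \<sigma> ` U \<subseteq> W \<and> SL2_field W Y" "p \<in> U" "X \<in> tangent_space S \<A> p"
  then show "Db0 (Y \<circ> \<sigma>) p (real_vec S \<A> p X) = D Y (\<sigma> p) (pushforward \<sigma> (real_vec S \<A> p X))"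
    by (intro Db0_pull[of U W]) auto
qed

text \<open>A field along \<^term>\<open>\<sigma>\<close> is a combination, with function coefficients, of restrictions of left
  invariant fields, on which the pull-back is determined by \<^term>\<open>D\<close>.\<close>

lemma pullback_connection_explicit:
  assumes pb: "pullback_connection S \<A> D \<sigma> Db" and fa: "field_along S \<A> \<sigma> U s" and p: "p \<in> U" and v: "v \<in> ctangent_space S \<A> p"
  shows "Db s p v = Db0 s p v"
proof -
  note f = field_alongD[OF fa]
  have pS: "p \<in> S" using p f(3) by blast
  have sU: "smooth_fun S \<A> U \<sigma>" by (rule smooth_fun_subset[OF \<sigma>_smooth f(2,3)])
  have lin: "Db' r p (vadd x (vscale \<i> y)) = Db' r p x + mat \<i> ** Db' r p y"
    if "pullback_connection S \<A> D \<sigma> Db'" and r: "field_along S \<A> \<sigma> U r"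
      and x: "x \<in> ctangent_space S \<A> p" and y: "y \<in> ctangent_space S \<A> p" for Db' r x y
  proof -
    note d = conjunct1[OF conjunct1[OF that(1)[unfolded pullback_connection_def], THEN spec[of _ U], THEN spec, THEN mp, OF r], THEN bspec, OF p]
    obtain V \<phi> where "surface_chart S \<A> V \<phi>" and pV: "p \<in> V" using chart_at[OF pS] .
    then interpret surface_chart S \<A> V \<phi> by simp
    have iy: "vscale \<i> y \<in> ctangent_space S \<A> p"
      using y vscale_dv dv_ctangent[OF pV] by (auto simp: ctangent_eq[OF pV])
    show ?thesis using d[THEN bspec, OF x] d[THEN bspec, OF y] iy by simp
  qed
  have germ: "Db' t p v = Db' r p v"
    if "pullback_connection S \<A> D \<sigma> Db'" "field_along S \<A> \<sigma> U r" "field_along S \<A> \<sigma> U t" "\<And>q. q \<in> U \<Longrightarrow> t q = r q" for Db' r t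
    using conjunct1[OF that(1)[unfolded pullback_connection_def], THEN spec[of _ U], THEN spec, THEN mp, OF that(2)] that(3,4) p v
    by simp
  have add: "Db' (\<lambda>q. r q + t q) p v = Db' r p v + Db' t p v"
    if "pullback_connection S \<A> D \<sigma> Db'" "field_along S \<A> \<sigma> U r" "field_along S \<A> \<sigma> U t" for Db' r t
    using conjunct1[OF that(1)[unfolded pullback_connection_def], THEN spec[of _ U], THEN spec, THEN mp, OF that(2)] that(3) p v
    by simp
  have leib: "Db' (\<lambda>q. mat (h q) ** r q) p v = mat (v h) ** r p + mat (h p) ** Db' r p v"
    if "pullback_connection S \<A> D \<sigma> Db'" "field_along S \<A> \<sigma> U r" "smooth_fun S \<A> U h" for Db' r h
    using conjunct1[OF that(1)[unfolded pullback_connection_def], THEN spec[of _ U], THEN spec, THEN mp, OF that(2)] that(3) p v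
    by simp
  have pull: "Db (Y \<circ> \<sigma>) p (real_vec S \<A> p X) = D Y (\<sigma> p) (pushforward \<sigma> (real_vec S \<A> p X))"
    if "SL2_field SL2 Y" "X \<in> tangent_space S \<A> p" for Y X
    using conjunct2[OF pb[unfolded pullback_connection_def], THEN spec[of _ U], THEN spec[of _ SL2], THEN spec[of _ Y]]
      f(2,3) \<sigma>_SL2 that p by auto
  have sUS: "\<sigma> ` U \<subseteq> SL2" using f(3) \<sigma>_SL2 by blast
  define e where "e E q = \<sigma> q ** E" for E :: cmat and q
  have e_fa: "field_along S \<A> \<sigma> U (e E)" if "trace E = 0" for E
    unfolding field_along_def e_def using that
    by (auto simp: SL2_tangent_def intro: smooth_fun_linear[OF sU bounded_linear_mult_left(1)])
  have e: "Db (e E) p v = Db0 (e E) p v" if E: "trace E = 0" for E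
  proof -
    have Y: "SL2_field SL2 (\<lambda>B. B ** E)" by (rule left_invariant_field[OF _ E]) simp
    have comp: "(\<lambda>B. B ** E) \<circ> \<sigma> = e E" by (auto simp: e_def)
    \<comment> \<open>The property that ties the pull-back to \<open>D\<close> concerns real
      vectors; complex linearity extends the equality.\<close>
    obtain X X' where X: "v = cplx_vec S \<A> p X X'" "X \<in> tangent_space S \<A> p" "X' \<in> tangent_space S \<A> p"
      using v unfolding ctangent_space_def by blast
    have r: "Db (e E) p (real_vec S \<A> p Z) = Db0 (e E) p (real_vec S \<A> p Z)" if "Z \<in> tangent_space S \<A> p" for Z
      using pull[OF Y that] Db0_pull[OF f(2) sUS Y p that] by (simp add: comp)
    show ?thesis
      unfolding X(1) cplx_vec_real[OF X(2,3)]
      by (simp add: lin[OF pb e_fa[OF E]] lin[OF Db0_pullback e_fa[OF E]] real_vec_ctangent X pS r)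
  qed
  \<comment> \<open>Left translation to the identity. There \<open>s\<close> becomes a traceless
    matrix, whose coordinates in the basis \<open>E1\<close>, \<open>E2\<close>, \<open>E3\<close>
    are smooth functions.\<close>
  define y where "y q = adj2 (\<sigma> q) ** s q" for q
  have ys: "smooth_fun S \<A> U (\<lambda>q. y q $ i $ j)" for i j
    unfolding y_def by (intro smooth_fun_nth smooth_fun_mm smooth_fun_linear[OF sU bounded_linear_adj2] f(1))
  define E1 E2 E3 where "E1 = m2 1 0 0 (- 1)" and "E2 = m2 0 1 0 0" and "E3 = m2 0 0 1 0"
  have E: "trace E1 = 0" "trace E2 = 0" "trace E3 = 0" by (simp_all add: E1_def E2_def E3_def trace_2)
  define t1 where "t1 q = mat (y q $ 1 $ 1) ** e E1 q" for q
  define t2 where "t2 q = mat (y q $ 1 $ 2) ** e E2 q" for q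
  define t3 where "t3 q = mat (y q $ 2 $ 1) ** e E3 q" for q
  have scale_fa: "field_along S \<A> \<sigma> U (\<lambda>q. mat (h q) ** r q)" if "field_along S \<A> \<sigma> U r" "smooth_fun S \<A> U h" for r h
    using that field_alongD[OF that(1)] \<sigma>_in
    unfolding field_along_def by (auto intro!: smooth_fun_mm smooth_fun_mat simp: tangent_iff bb_scale subset_iff)
  have add_fa: "field_along S \<A> \<sigma> U (\<lambda>q. r q + t q)" if "field_along S \<A> \<sigma> U r" "field_along S \<A> \<sigma> U t" for r t
    using that field_alongD[OF that(1)] \<sigma>_in
    unfolding field_along_def by (auto intro!: smooth_fun_add simp: tangent_iff bb_add subset_iff)
  have t_fa: "field_along S \<A> \<sigma> U t1" "field_along S \<A> \<sigma> U t2" "field_along S \<A> \<sigma> U t3"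
    unfolding t1_def t2_def t3_def by (intro scale_fa e_fa E ys)+
  have s_eq: "s q = t1 q + (t2 q + t3 q)" if q: "q \<in> U" for q
  proof -
    have sq: "\<sigma> q \<in> SL2" using q f(3) \<sigma>_in by blast
    have "s q = \<sigma> q ** y q"
      using SL2_inv_mult(2)[OF sq, of "s q"] by (simp add: y_def SL2_matrix_inv[OF sq])
    moreover have "trace (y q) = 0" using f(4)[OF q] unfolding \<open>s q = \<sigma> q ** y q\<close> bb_trace using sq by (simp add: SL2_def)
    then have "y q $ 2 $ 2 = - y q $ 1 $ 1" by (simp add: trace_2 add_eq_0_iff)
    ultimately show ?thesis
      by (simp add: t1_def t2_def t3_def e_def E1_def E2_def E3_def cmat_eq_iff mm_nth mat_nth algebra_simps)
  qed
  have one: "Db t p v = Db0 t p v" if "t = (\<lambda>q. mat (h q) ** e E q)" "trace E = 0" "smooth_fun S \<A> U h" for t h E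
    unfolding that(1) using leib[OF pb e_fa[OF that(2)] that(3)] leib[OF Db0_pullback e_fa[OF that(2)] that(3)] e[OF that(2)] by simp
  note t23 = add_fa[OF t_fa(2,3)]
  note t123 = add_fa[OF t_fa(1) t23]
  have "Db s p v = Db (\<lambda>q. t1 q + (t2 q + t3 q)) p v"
    by (rule germ[OF pb t123 fa s_eq])
  also have "\<dots> = Db t1 p v + (Db t2 p v + Db t3 p v)"
    by (simp add: add[OF pb t_fa(1) t23] add[OF pb t_fa(2,3)])
  also have "\<dots> = Db0 t1 p v + (Db0 t2 p v + Db0 t3 p v)"
    using one[of t1] one[of t2] one[of t3] E ys by (simp add: t1_def[abs_def] t2_def[abs_def] t3_def[abs_def])
  also have "\<dots> = Db0 (\<lambda>q. t1 q + (t2 q + t3 q)) p v"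
    by (simp add: add[OF Db0_pullback t_fa(1) t23] add[OF Db0_pullback t_fa(2,3)])
  also have "\<dots> = Db0 s p v"
    by (rule germ[OF Db0_pullback t123 fa s_eq, symmetric])
  finally show ?thesis .
qed

end

section \<open>Metric, connection and curvature in a chart\<close>

lemma (in surface) cfield_subset:
  assumes "cfield S \<A> U X" "openin (top_of_set S) U'" "U' \<subseteq> U"
  shows "cfield S \<A> U' X"
  using assms unfolding cfield_def by auto

lemma (in surface) cfield_openin: "cfield S \<A> U X \<Longrightarrow> openin (top_of_set S) U"
  by (simp add: cfield_def)

section \<open>The axioms of the data as usable rules\<close>

locale gc_data = surface S \<A> for S :: "'a::topological_space set" and \<A> :: "'a atlas" +
  fixes g :: "'a cmetric" and nabla :: "'a cconn" and \<Psi> :: "'a \<Rightarrow> 'a cvec \<Rightarrow> 'a cvec"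
  assumes metric: "complex_metric S \<A> g" and levi: "levi_civita S \<A> g nabla"
    and endo: "bundle_endo S \<A> \<Psi>" and adjoint: "self_adjoint S \<A> g \<Psi>"
begin

lemma g_add:
  assumes "p \<in> S" "u \<in> ctangent_space S \<A> p" "v \<in> ctangent_space S \<A> p" "w \<in> ctangent_space S \<A> p"
  shows "g p u (vadd v w) = g p u v + g p u w"
  using metric assms unfolding complex_metric_def clinear_on_def by blast

lemma g_scale:
  assumes "p \<in> S" "u \<in> ctangent_space S \<A> p" "v \<in> ctangent_space S \<A> p"
  shows "g p u (vscale c v) = c * g p u v"
  using metric assms unfolding complex_metric_def clinear_on_def by blast

lemma g_sym:
  assumes "p \<in> S" "u \<in> ctangent_space S \<A> p" "v \<in> ctangent_space S \<A> p"
  shows "g p u v = g p v u"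
  using metric assms unfolding complex_metric_def by blast

lemma g_nondegenerate:
  assumes "p \<in> S" "u \<in> ctangent_space S \<A> p" "\<And>v. v \<in> ctangent_space S \<A> p \<Longrightarrow> g p u v = 0"
  shows "u = vzero"
  using metric assms unfolding complex_metric_def by blast

lemma g_smooth: "cfield S \<A> U X \<Longrightarrow> cfield S \<A> U Y \<Longrightarrow> smooth_fun S \<A> U (\<lambda>p. g p (X p) (Y p))"
  using metric unfolding complex_metric_def by simp

lemma \<Psi>_in: "p \<in> S \<Longrightarrow> v \<in> ctangent_space S \<A> p \<Longrightarrow> \<Psi> p v \<in> ctangent_space S \<A> p"
  using endo unfolding bundle_endo_def cendo_on_def by blast

lemma \<Psi>_add: "p \<in> S \<Longrightarrow> v \<in> ctangent_space S \<A> p \<Longrightarrow> w \<in> ctangent_space S \<A> p \<Longrightarrow> \<Psi> p (vadd v w) = vadd (\<Psi> p v) (\<Psi> p w)"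
  using endo unfolding bundle_endo_def cendo_on_def by blast

lemma \<Psi>_scale: "p \<in> S \<Longrightarrow> v \<in> ctangent_space S \<A> p \<Longrightarrow> \<Psi> p (vscale c v) = vscale c (\<Psi> p v)"
  using endo unfolding bundle_endo_def cendo_on_def by blast

lemma \<Psi>_field: "cfield S \<A> U X \<Longrightarrow> cfield S \<A> U (\<lambda>p. \<Psi> p (X p))"
  using endo unfolding bundle_endo_def by simp

lemma \<Psi>_adjoint: "p \<in> S \<Longrightarrow> v \<in> ctangent_space S \<A> p \<Longrightarrow> w \<in> ctangent_space S \<A> p \<Longrightarrow> g p (\<Psi> p v) w = g p v (\<Psi> p w)"
  using adjoint unfolding self_adjoint_def by blast

lemma nabla_connection: "cconnection S \<A> nabla"
  using levi by (simp add: levi_civita_def)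

lemmas nabla_connectionD = nabla_connection[unfolded cconnection_def, THEN spec, THEN spec, THEN mp]

lemma nabla_endo:
  assumes "cfield S \<A> U Y" "p \<in> U"
  shows "cendo_on (ctangent_space S \<A> p) (nabla Y p)"
  by (rule bspec[OF nabla_connectionD[OF assms(1), THEN conjunct1] assms(2)])

lemma nabla_field:
  assumes "cfield S \<A> U Y" "cfield S \<A> U X"
  shows "cfield S \<A> U (\<lambda>p. nabla Y p (X p))"
  by (rule nabla_connectionD[OF assms(1), THEN conjunct2, THEN conjunct1, THEN spec, THEN mp, OF assms(2)])

lemma nabla_germ:
  assumes "cfield S \<A> U Y" "cfield S \<A> U Z" "\<And>q. q \<in> U \<Longrightarrow> Z q = Y q" "p \<in> U" "v \<in> ctangent_space S \<A> p"
  shows "nabla Z p v = nabla Y p v"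
proof -
  have "\<forall>q\<in>U. Z q = Y q" using assms(3) by simp
  with assms(2) have "cfield S \<A> U Z \<and> (\<forall>q\<in>U. Z q = Y q)" by (rule conjI)
  from nabla_connectionD[OF assms(1), THEN conjunct2, THEN conjunct2, THEN conjunct1, THEN spec, THEN mp, OF this]
  show ?thesis using assms(4,5) by blast
qed

lemma nabla_add:
  assumes "cfield S \<A> U Y" "cfield S \<A> U Z" "p \<in> U" "v \<in> ctangent_space S \<A> p"
  shows "nabla (\<lambda>q. vadd (Y q) (Z q)) p v = vadd (nabla Y p v) (nabla Z p v)"
  by (rule nabla_connectionD[OF assms(1), THEN conjunct2, THEN conjunct2, THEN conjunct2, THEN conjunct1, THEN spec, THEN mp,
      OF assms(2), THEN bspec, OF assms(3), THEN bspec, OF assms(4)])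

lemma nabla_leibniz:
  assumes "cfield S \<A> U Y" "smooth_fun S \<A> U f" "p \<in> U" "v \<in> ctangent_space S \<A> p"
  shows "nabla (\<lambda>q. vscale (f q) (Y q)) p v = vadd (vscale (v f) (Y p)) (vscale (f p) (nabla Y p v))"
  by (rule nabla_connectionD[OF assms(1), THEN conjunct2, THEN conjunct2, THEN conjunct2, THEN conjunct2, THEN spec, THEN mp,
      OF assms(2), THEN bspec, OF assms(3), THEN bspec, OF assms(4)])

lemma nabla_torsion:
  assumes "cfield S \<A> U X" "cfield S \<A> U Y" "p \<in> U"
  shows "vsub (nabla Y p (X p)) (nabla X p (Y p)) = lie_bracket S \<A> X Y p"
  using levi assms unfolding levi_civita_def by simp

lemma nabla_metric:
  assumes "cfield S \<A> U Y" "cfield S \<A> U Z" "p \<in> U" "v \<in> ctangent_space S \<A> p"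
  shows "v (\<lambda>q. g q (Y q) (Z q)) = g p (nabla Y p v) (Z p) + g p (Y p) (nabla Z p v)"
  using levi assms unfolding levi_civita_def by simp

end

section \<open>Tensor components in a chart\<close>

locale gc_chart = gc_data S \<A> g nabla \<Psi> + surface_chart S \<A> V \<phi>
  for S :: "'a::topological_space set" and \<A> :: "'a atlas" and g :: "'a cmetric" and nabla :: "'a cconn"
    and \<Psi> :: "'a \<Rightarrow> 'a cvec \<Rightarrow> 'a cvec" and V :: "'a set" and \<phi> :: "'a \<Rightarrow> real^2"
begin

text \<open>Classical tensor notation: \<^term>\<open>fr i\<close> are the coordinate fields, \<^term>\<open>gg i j\<close> is $g_{ij}$, \<^term>\<open>Gam i j k\<close>
  is $\Gamma_{ij}^k$ with \<^term>\<open>i\<close> the direction of differentiation, and \<^term>\<open>PP i k\<close> is $\Psi_i^k$, the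
  component of index \<^term>\<open>k\<close> of the image of \<^term>\<open>fr i\<close>. Below, $h_{ij}$ (written hh) is the second fundamental form
  and dg the determinant of $g_{ij}$.\<close>

definition fr :: "2 \<Rightarrow> 'a \<Rightarrow> 'a cvec" where "fr i p = dv p (axis i 1)"
definition gg :: "2 \<Rightarrow> 2 \<Rightarrow> 'a \<Rightarrow> complex" where "gg i j p = g p (fr i p) (fr j p)"
definition Gam :: "2 \<Rightarrow> 2 \<Rightarrow> 2 \<Rightarrow> 'a \<Rightarrow> complex" where "Gam i j k p = crd (nabla (fr j) p (fr i p)) $ k"
definition PP :: "2 \<Rightarrow> 2 \<Rightarrow> 'a \<Rightarrow> complex" where "PP i k p = crd (\<Psi> p (fr i p)) $ k"

lemma in_S: "p \<in> V \<Longrightarrow> p \<in> S" using V_subset by blast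

lemma fr_field: "openin (top_of_set S) U \<Longrightarrow> U \<subseteq> V \<Longrightarrow> cfield S \<A> U (fr i)"
  unfolding fr_def[abs_def] by (rule cfield_dv[OF smooth_fun_const])

lemma fr_in: "p \<in> V \<Longrightarrow> fr i p \<in> ctangent_space S \<A> p"
  by (simp add: fr_def dv_ctangent)

lemma crd_fr: "p \<in> V \<Longrightarrow> crd (fr i p) = axis i 1"
  by (simp add: fr_def crd_dv)

lemma fr_apply: "smooth_near S \<A> p f \<Longrightarrow> fr i p f = pd i f p"
  using exhaust_2[of i] by (auto simp: fr_def dv_apply axis_def)

lemma dv_frame: "dv p a = vadd (vscale (a $ 1) (fr 1 p)) (vscale (a $ 2) (fr 2 p))"
  by (simp add: fr_def vscale_dv vadd_dv) (rule arg_cong[of _ _ "dv p"], simp add: vec_eq_iff forall_2 axis_def)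

lemma vscale_in: "p \<in> V \<Longrightarrow> v \<in> ctangent_space S \<A> p \<Longrightarrow> vscale c v \<in> ctangent_space S \<A> p"
  by (auto simp: ctangent_eq vscale_dv)

lemma vadd_in: "p \<in> V \<Longrightarrow> v \<in> ctangent_space S \<A> p \<Longrightarrow> w \<in> ctangent_space S \<A> p \<Longrightarrow> vadd v w \<in> ctangent_space S \<A> p"
  by (auto simp: ctangent_eq vadd_dv)

lemma gg_smooth: "smooth_fun S \<A> V (gg i j)"
  unfolding gg_def[abs_def] by (rule g_smooth[OF fr_field[OF V_openin order_refl] fr_field[OF V_openin order_refl]])

lemma Gam_smooth: "smooth_fun S \<A> V (Gam i j k)"
  unfolding Gam_def[abs_def]
  by (rule smooth_fun_nth[OF cfield_crd(1)[OF nabla_field[OF fr_field[OF V_openin order_refl] fr_field[OF V_openin order_refl]] order_refl]])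

lemma PP_smooth: "smooth_fun S \<A> V (PP i k)"
  unfolding PP_def[abs_def]
  by (rule smooth_fun_nth[OF cfield_crd(1)[OF \<Psi>_field[OF fr_field[OF V_openin order_refl]] order_refl]])

lemma gg_sym: "p \<in> V \<Longrightarrow> gg i j p = gg j i p"
  unfolding gg_def by (rule g_sym) (auto simp: in_S fr_in)

lemma g_dv:
  assumes p: "p \<in> V"
  shows "g p (dv p a) (dv p b) = a $ 1 * b $ 1 * gg 1 1 p + a $ 1 * b $ 2 * gg 1 2 p
     + a $ 2 * b $ 1 * gg 2 1 p + a $ 2 * b $ 2 * gg 2 2 p"
proof -
  have r: "g p u (dv p b) = b $ 1 * g p u (fr 1 p) + b $ 2 * g p u (fr 2 p)" if "u \<in> ctangent_space S \<A> p" for u b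
    unfolding dv_frame[of p b] using p that by (simp add: g_add g_scale in_S fr_in vscale_in)
  have "g p (dv p a) (fr i p) = a $ 1 * gg i 1 p + a $ 2 * gg i 2 p" for i
    using r[OF fr_in[OF p]] g_sym[OF in_S[OF p] dv_ctangent[OF p] fr_in[OF p]] by (simp add: gg_def)
  then show ?thesis using r[OF dv_ctangent[OF p]] gg_sym[OF p, of 1 2] by (simp add: algebra_simps)
qed

lemma \<Psi>_dv: "p \<in> V \<Longrightarrow> \<Psi> p (dv p a) = dv p (\<chi> k. a $ 1 * PP 1 k p + a $ 2 * PP 2 k p)"
proof -
  assume p: "p \<in> V"
  have f: "\<Psi> p (fr i p) = dv p (\<chi> k. PP i k p)" for i
    using dv_crd[OF p \<Psi>_in[OF in_S[OF p] fr_in[OF p]], of i] by (simp add: PP_def)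
  show ?thesis
    unfolding dv_frame[of p a] using p
    by (simp add: \<Psi>_add \<Psi>_scale in_S fr_in vscale_in f vscale_dv vadd_dv)
      (rule arg_cong[of _ _ "dv p"], simp add: vec_eq_iff)
qed

lemma nabla_fr_dv: "p \<in> V \<Longrightarrow> nabla (fr j) p (dv p a) = dv p (\<chi> k. a $ 1 * Gam 1 j k p + a $ 2 * Gam 2 j k p)"
proof -
  assume p: "p \<in> V"
  have e: "cendo_on (ctangent_space S \<A> p) (nabla (fr j) p)"
    by (rule nabla_endo[OF fr_field[OF V_openin order_refl] p])
  have f: "nabla (fr j) p (fr i p) = dv p (\<chi> k. Gam i j k p)" for i
    using dv_crd[OF p, of "nabla (fr j) p (fr i p)"] e fr_in[OF p] by (simp add: Gam_def cendo_on_def)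
  show ?thesis
    unfolding dv_frame[of p a] using p e
    by (simp add: cendo_on_def fr_in vscale_in f vscale_dv vadd_dv)
      (rule arg_cong[of _ _ "dv p"], simp add: vec_eq_iff)
qed

text \<open>The locality clause allows \<open>Y\<close> to be replaced by its expansion in the
  coordinate frame, to which additivity and the Leibniz rule apply.\<close>

lemma nabla_dv:
  assumes Y: "cfield S \<A> U Y" "U \<subseteq> V" and p: "p \<in> U"
  shows "nabla Y p (dv p a) = dv p (\<chi> k. a $ 1 * pd 1 (\<lambda>q. crd (Y q) $ k) p + a $ 2 * pd 2 (\<lambda>q. crd (Y q) $ k) p +
     (crd (Y p) $ 1 * (a $ 1 * Gam 1 1 k p + a $ 2 * Gam 2 1 k p) + crd (Y p) $ 2 * (a $ 1 * Gam 1 2 k p + a $ 2 * Gam 2 2 k p)))"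
proof -
  have pV: "p \<in> V" using p Y(2) by blast
  have oU: "openin (top_of_set S) U" by (rule cfield_openin[OF Y(1)])
  define b where "b k q = crd (Y q) $ k" for k q
  have b: "smooth_fun S \<A> U (b k)" for k
    unfolding b_def using smooth_fun_nth[OF cfield_crd(1)[OF Y]] .
  have bn: "smooth_near S \<A> p (b k)" for k by (rule smooth_nearI[OF b p])
  have F: "cfield S \<A> U (fr i)" for i by (rule fr_field[OF oU Y(2)])
  have v: "dv p a \<in> ctangent_space S \<A> p" by (rule dv_ctangent[OF pV])
  have sc: "cfield S \<A> U (\<lambda>q. vscale (b k q) (fr i q))" for k i
  proof -
    have "cfield S \<A> U (\<lambda>q. dv q (b k q *s axis i 1))"
      by (rule cfield_dv[OF smooth_fun_vec Y(2)])
        (use b[of k] smooth_fun_mult[OF b smooth_fun_const[OF oU]] in simp)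
    then show ?thesis by (simp add: fr_def vscale_dv)
  qed
  have Yeq: "Y q = vadd (vscale (b 1 q) (fr 1 q)) (vscale (b 2 q) (fr 2 q))" if "q \<in> U" for q
    using cfield_crd(2)[OF Y that] dv_frame[of q "crd (Y q)"] by (simp add: b_def)
  have ad: "cfield S \<A> U (\<lambda>q. vadd (vscale (b 1 q) (fr 1 q)) (vscale (b 2 q) (fr 2 q)))"
    using cfield_dv[OF cfield_crd(1)[OF Y] Y(2)] by (simp add: dv_frame[of _ "crd _"] b_def)
  have "nabla Y p (dv p a) = nabla (\<lambda>q. vadd (vscale (b 1 q) (fr 1 q)) (vscale (b 2 q) (fr 2 q))) p (dv p a)"
    by (rule nabla_germ[OF ad Y(1) Yeq p v])
  also have "\<dots> = vadd (vadd (vscale (dv p a (b 1)) (fr 1 p)) (vscale (b 1 p) (nabla (fr 1) p (dv p a))))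
     (vadd (vscale (dv p a (b 2)) (fr 2 p)) (vscale (b 2 p) (nabla (fr 2) p (dv p a))))"
    by (simp add: nabla_add[OF sc sc p v] nabla_leibniz[OF F b p v])
  also have "\<dots> = dv p (\<chi> k. a $ 1 * pd 1 (b k) p + a $ 2 * pd 2 (b k) p +
     (b 1 p * (a $ 1 * Gam 1 1 k p + a $ 2 * Gam 2 1 k p) + b 2 p * (a $ 1 * Gam 1 2 k p + a $ 2 * Gam 2 2 k p)))"
    unfolding fr_def nabla_fr_dv[OF pV, unfolded fr_def] vscale_dv vadd_dv dv_apply[OF bn]
    by (rule arg_cong[of _ _ "dv p"]) (simp add: vec_eq_iff forall_2 axis_def)
  finally show ?thesis by (simp add: b_def[abs_def])
qed

text \<open>Vanishing torsion writes the bracket as a difference of two tangent vectors, so it is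
  tangent and determined by its values on the coordinate functions.\<close>

lemma lie_bracket_dv:
  assumes X: "cfield S \<A> U X" and Y: "cfield S \<A> U Y" and U: "U \<subseteq> V" and p: "p \<in> U"
  shows "lie_bracket S \<A> X Y p = dv p (\<chi> k. X p (\<lambda>q. crd (Y q) $ k) - Y p (\<lambda>q. crd (X q) $ k))"
proof -
  have pV: "p \<in> V" using p U by blast
  have "X p \<in> ctangent_space S \<A> p" "Y p \<in> ctangent_space S \<A> p" using X Y p by (auto simp: cfield_def)
  then have "nabla Y p (X p) \<in> ctangent_space S \<A> p" "nabla X p (Y p) \<in> ctangent_space S \<A> p"
    using nabla_endo[OF X p] nabla_endo[OF Y p] by (auto simp: cendo_on_def)
  then have "lie_bracket S \<A> X Y p \<in> ctangent_space S \<A> p"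
    unfolding nabla_torsion[OF X Y p, symmetric] by (auto simp: ctangent_eq[OF pV] vsub_dv)
  moreover have "crd (lie_bracket S \<A> X Y p) = (\<chi> k. X p (\<lambda>q. crd (Y q) $ k) - Y p (\<lambda>q. crd (X q) $ k))"
    using smooth_nearI[OF smooth_fun_coord pV] by (simp add: crd_def lie_bracket_def)
  ultimately show ?thesis using dv_crd[OF pV] by metis
qed

lemma lie_bracket_fr:
  assumes p: "p \<in> V"
  shows "lie_bracket S \<A> (fr i) (fr j) p = vzero"
proof -
  have F: "cfield S \<A> V (fr i)" for i by (rule fr_field[OF V_openin order_refl])
  have "fr i p (\<lambda>q. crd (fr j q) $ k) = 0" for i j k
  proof -
    have "fr i p (\<lambda>q. axis j 1 $ k) = fr i p (\<lambda>q. crd (fr j q) $ k)"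
      by (rule ctangent_germ[OF fr_in[OF p] smooth_fun_const[OF V_openin] p]) (simp add: crd_fr)
    then show ?thesis using ctangent_const[OF in_S[OF p] fr_in[OF p]] by simp
  qed
  then show ?thesis
    unfolding lie_bracket_dv[OF F F order_refl p] vzero_dv[of p]
    by (intro arg_cong[of _ _ "dv p"]) (simp add: vec_eq_iff)
qed

text \<open>Partial derivatives commute because a torsion-free connection makes the bracket of coordinate
  fields a tangent vector, which then vanishes as its coordinates do.\<close>

lemma pd_commute:
  fixes f :: "'a \<Rightarrow> complex"
  assumes f: "smooth_fun S \<A> U f" and U: "U \<subseteq> V" and p: "p \<in> U"
  shows "pd i (pd j f) p = pd j (pd i f) p"
proof -
  have pV: "p \<in> V" using p U by blast
  have fn: "smooth_near S \<A> p f" by (rule smooth_nearI[OF f p])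
  have "fr i p (\<lambda>q. fr j q f) = pd i (pd j f) p" for i j
  proof -
    have s: "smooth_fun S \<A> U (pd j f)" by (rule smooth_fun_pd[OF f U])
    have "fr i p (\<lambda>q. fr j q f) = fr i p (pd j f)"
      by (rule ctangent_germ[OF fr_in[OF pV] s p, symmetric]) (simp add: fr_apply smooth_nearI[OF f])
    then show ?thesis by (simp add: fr_apply[OF smooth_nearI[OF s p]])
  qed
  moreover have "lie_bracket S \<A> (fr i) (fr j) p f = 0" by (simp add: lie_bracket_fr[OF pV] vzero_def)
  ultimately show ?thesis using fn by (simp add: lie_bracket_def)
qed

lemma pd_commute_cmat:
  fixes s :: "'a \<Rightarrow> cmat"
  assumes s: "smooth_fun S \<A> U s" and U: "U \<subseteq> V" and p: "p \<in> U"
  shows "pd i (pd j s) p = pd j (pd i s) p"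
proof -
  have pV: "p \<in> V" using p U by blast
  have "pd i (pd j s) p $ k $ l = pd i (pd j (\<lambda>q. s q $ k $ l)) p" for i j k l
  proof -
    have pj: "smooth_fun S \<A> U (pd j s)" by (rule smooth_fun_pd[OF s U])
    have pjn: "smooth_near S \<A> p (pd j s)" by (rule smooth_nearI[OF pj p])
    have "pd i (pd j s) p $ k $ l = pd i (\<lambda>q. pd j s q $ k $ l) p"
      by (simp add: pd_nth[OF pjn pV] pd_nth[OF smooth_near_nth[OF pjn] pV])
    also have "\<dots> = pd i (pd j (\<lambda>q. s q $ k $ l)) p"
    proof (rule pd_cong[OF smooth_fun_nth[OF smooth_fun_nth[OF pj]] p pV])
      fix q assume q: "q \<in> U"
      then have qV: "q \<in> V" using U by blast
      have sn: "smooth_near S \<A> q s" by (rule smooth_nearI[OF s q])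
      show "pd j s q $ k $ l = pd j (\<lambda>q. s q $ k $ l) q"
        by (simp add: pd_nth[OF sn qV] pd_nth[OF smooth_near_nth[OF sn] qV])
    qed
    finally show ?thesis .
  qed
  then show ?thesis
    using pd_commute[OF smooth_fun_nth[OF smooth_fun_nth[OF s]] U p] by (simp add: vec_eq_iff)
qed

lemma Gam_sym: "p \<in> V \<Longrightarrow> Gam i j k p = Gam j i k p"
proof -
  assume p: "p \<in> V"
  have F: "cfield S \<A> V (fr i)" for i by (rule fr_field[OF V_openin order_refl])
  have "vsub (nabla (fr j) p (fr i p)) (nabla (fr i) p (fr j p)) = vzero"
    using nabla_torsion[OF F F p] lie_bracket_fr[OF p] by simp
  then have "crd (nabla (fr j) p (fr i p)) = crd (nabla (fr i) p (fr j p))"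
    by (simp add: vsub_def vzero_def fun_eq_iff crd_def)
  then show ?thesis by (simp add: Gam_def)
qed

lemma pd_gg:
  assumes p: "p \<in> V"
  shows "pd l (gg i j) p = (Gam l i 1 p * gg 1 j p + Gam l i 2 p * gg 2 j p) + (Gam l j 1 p * gg i 1 p + Gam l j 2 p * gg i 2 p)"
proof -
  have F: "cfield S \<A> V (fr i)" for i by (rule fr_field[OF V_openin order_refl])
  have n: "nabla (fr j) p (fr l p) = dv p (\<chi> k. Gam l j k p)" for j
    using nabla_fr_dv[OF p, of j "axis l 1"] exhaust_2[of l] by (auto simp: fr_def axis_def)
  have e: "fr i p = dv p (axis i 1)" for i by (simp add: fr_def)
  have "pd l (gg i j) p = fr l p (\<lambda>q. g q (fr i q) (fr j q))"
    using fr_apply[OF smooth_nearI[OF gg_smooth p], of l i j] by (simp add: gg_def[abs_def])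
  also have "\<dots> = g p (nabla (fr i) p (fr l p)) (fr j p) + g p (fr i p) (nabla (fr j) p (fr l p))"
    by (rule nabla_metric[OF F F p fr_in[OF p]])
  also have "\<dots> = (Gam l i 1 p * gg 1 j p + Gam l i 2 p * gg 2 j p) + (Gam l j 1 p * gg i 1 p + Gam l j 2 p * gg i 2 p)"
    unfolding n unfolding e g_dv[OF p] using exhaust_2[of i] exhaust_2[of j] gg_sym[OF p] by (auto simp: axis_def)
  finally show ?thesis .
qed

definition hh :: "2 \<Rightarrow> 2 \<Rightarrow> 'a \<Rightarrow> complex" where "hh i j p = PP i 1 p * gg 1 j p + PP i 2 p * gg 2 j p"

lemma hh_sym: "p \<in> V \<Longrightarrow> hh i j p = hh j i p"
proof -
  assume p: "p \<in> V"
  have e: "fr i p = dv p (axis i 1)" for i by (simp add: fr_def)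
  have h: "hh i j p = g p (\<Psi> p (fr i p)) (fr j p)" for i j
    unfolding e \<Psi>_dv[OF p] g_dv[OF p] using exhaust_2[of i] exhaust_2[of j] by (auto simp: axis_def hh_def)
  have "g p (\<Psi> p (fr i p)) (fr j p) = g p (fr i p) (\<Psi> p (fr j p))"
    by (rule \<Psi>_adjoint[OF in_S[OF p] fr_in[OF p] fr_in[OF p]])
  also have "\<dots> = g p (\<Psi> p (fr j p)) (fr i p)"
    by (rule g_sym[OF in_S[OF p] fr_in[OF p] \<Psi>_in[OF in_S[OF p] fr_in[OF p]]])
  finally show ?thesis by (simp only: h)
qed

definition dg :: "'a \<Rightarrow> complex" where "dg p = gg 1 1 p * gg 2 2 p - gg 1 2 p * gg 1 2 p"

lemma gg_kernel:
  fixes a :: "complex^2"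
  assumes p: "p \<in> V" and "a $ 1 * gg 1 1 p + a $ 2 * gg 2 1 p = 0" "a $ 1 * gg 1 2 p + a $ 2 * gg 2 2 p = 0"
  shows "a = 0"
proof -
  have "dv p a = vzero"
  proof (rule g_nondegenerate[OF in_S[OF p] dv_ctangent[OF p]])
    fix v assume "v \<in> ctangent_space S \<A> p"
    then obtain b where "v = dv p b" by (auto simp: ctangent_eq[OF p])
    moreover have "g p (dv p a) (dv p b) = b $ 1 * (a $ 1 * gg 1 1 p + a $ 2 * gg 2 1 p) + b $ 2 * (a $ 1 * gg 1 2 p + a $ 2 * gg 2 2 p)"
      by (simp add: g_dv[OF p] algebra_simps)
    ultimately show "g p (dv p a) v = 0" using assms by simp
  qed
  then have "dv p a = dv p 0" using vzero_dv[of p] by metis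
  then show ?thesis using dv_inj[OF p] by simp
qed

text \<open>If the determinant were 0, the columns of the adjugate of the Gram matrix would lie in
  its kernel, which is trivial; then the Gram matrix itself would be 0.\<close>

lemma dg_nonzero: "p \<in> V \<Longrightarrow> dg p \<noteq> 0"
proof
  assume p: "p \<in> V" and d: "dg p = 0"
  note s = gg_sym[OF p, of 2 1]
  have "vector [gg 2 2 p, - gg 1 2 p] = (0 :: complex^2)"
    by (rule gg_kernel[OF p]) (use d s in \<open>simp_all add: dg_def algebra_simps\<close>)
  moreover have "vector [- gg 1 2 p, gg 1 1 p] = (0 :: complex^2)"
    by (rule gg_kernel[OF p]) (use d s in \<open>simp_all add: dg_def algebra_simps\<close>)
  ultimately have z: "gg 2 2 p = 0" "gg 1 2 p = 0" "gg 1 1 p = 0"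
    by (simp_all add: vec_eq_iff forall_2)
  have "vector [1, 0] = (0 :: complex^2)" by (rule gg_kernel[OF p]) (use z s in simp_all)
  then show False by (simp add: vec_eq_iff forall_2)
qed

end

section \<open>Curvature, Codazzi tensor and determinant in a chart\<close>

context gc_chart
begin

text \<open>\<^term>\<open>Rm j l\<close> is $R_{12j}{}^l$, \<^term>\<open>Rl j m\<close> is $R_{12jm}$, and \<^term>\<open>Cod l\<close> is the component of index
  \<^term>\<open>l\<close> of $(d^\nabla\Psi)(\partial_1,\partial_2)$.\<close>

definition Rm :: "2 \<Rightarrow> 2 \<Rightarrow> 'a \<Rightarrow> complex" where
  "Rm j l p = pd 1 (Gam 2 j l) p - pd 2 (Gam 1 j l) p
     + (Gam 2 j 1 p * Gam 1 1 l p + Gam 2 j 2 p * Gam 1 2 l p)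
     - (Gam 1 j 1 p * Gam 2 1 l p + Gam 1 j 2 p * Gam 2 2 l p)"

definition Rl :: "2 \<Rightarrow> 2 \<Rightarrow> 'a \<Rightarrow> complex" where
  "Rl j m p = Rm j 1 p * gg 1 m p + Rm j 2 p * gg 2 m p"

definition Cod :: "2 \<Rightarrow> 'a \<Rightarrow> complex" where
  "Cod l p = pd 1 (PP 2 l) p - pd 2 (PP 1 l) p
     + (PP 2 1 p * Gam 1 1 l p + PP 2 2 p * Gam 1 2 l p)
     - (PP 1 1 p * Gam 2 1 l p + PP 1 2 p * Gam 2 2 l p)"

definition PD :: "'a \<Rightarrow> complex" where "PD p = PP 1 1 p * PP 2 2 p - PP 1 2 p * PP 2 1 p"

lemma Gam_near: "p \<in> V \<Longrightarrow> smooth_near S \<A> p (Gam i j k)" by (rule smooth_nearI[OF Gam_smooth])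
lemma gg_near: "p \<in> V \<Longrightarrow> smooth_near S \<A> p (gg i j)" by (rule smooth_nearI[OF gg_smooth])
lemma PP_near: "p \<in> V \<Longrightarrow> smooth_near S \<A> p (PP i j)" by (rule smooth_nearI[OF PP_smooth])

lemma nabla_nabla_dv:
  assumes X: "cfield S \<A> U X" and Y: "cfield S \<A> U Y" and Z: "cfield S \<A> U Z" and U: "U \<subseteq> V" and p: "p \<in> U"
    and x: "x = (\<lambda>i q. crd (X q) $ i)" and y: "y = (\<lambda>i q. crd (Y q) $ i)" and z: "z = (\<lambda>i q. crd (Z q) $ i)"
    and w: "w = (\<lambda>k q. (y 1 q * pd 1 (z k) q + y 2 q * pd 2 (z k) q) +
       (z 1 q * (y 1 q * Gam 1 1 k q + y 2 q * Gam 2 1 k q) + z 2 q * (y 1 q * Gam 1 2 k q + y 2 q * Gam 2 2 k q)))"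
  shows "nabla (\<lambda>q. nabla Z q (Y q)) p (X p) = dv p (\<chi> k. x 1 p * pd 1 (w k) p + x 2 p * pd 2 (w k) p +
       (w 1 p * (x 1 p * Gam 1 1 k p + x 2 p * Gam 2 1 k p) + w 2 p * (x 1 p * Gam 1 2 k p + x 2 p * Gam 2 2 k p)))"
proof -
  have pV: "p \<in> V" using p U by blast
  have N: "cfield S \<A> U (\<lambda>q. nabla Z q (Y q))" by (rule nabla_field[OF Z Y])
  have cw: "crd (nabla Z q (Y q)) $ k = w k q" if q: "q \<in> U" for q k
  proof -
    have qV: "q \<in> V" using q U by blast
    show ?thesis
      using nabla_dv[OF Z U q, of "crd (Y q)"] cfield_crd(2)[OF Y U q] by (simp add: crd_dv[OF qV] w y z)
  qed
  have pc: "pd i (\<lambda>q. crd (nabla Z q (Y q)) $ k) p = pd i (w k) p" for i k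
    by (rule pd_cong[OF smooth_fun_nth[OF cfield_crd(1)[OF N U]] p pV cw])
  have Xp: "X p = dv p (crd (X p))" by (rule cfield_crd(2)[OF X U p])
  have "nabla (\<lambda>q. nabla Z q (Y q)) p (X p) = nabla (\<lambda>q. nabla Z q (Y q)) p (dv p (crd (X p)))" using Xp by simp
  then show ?thesis unfolding nabla_dv[OF N U p] cw[OF p] pc by (simp add: x)
qed

text \<open>Tensoriality by expansion: first derivatives of the coefficients cancel mutually and
  against the bracket term, second derivatives of those of \<open>Z\<close> cancel by
  \<open>pd_commute\<close>. What remains is the coordinate curvature times the wedge of
  \<open>X\<close> and \<open>Y\<close>.\<close>

lemma curv_dv:
  assumes X: "cfield S \<A> U X" and Y: "cfield S \<A> U Y" and Z: "cfield S \<A> U Z" and U: "U \<subseteq> V" and p: "p \<in> U"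
  shows "curv S \<A> nabla X Y Z p = dv p (\<chi> l. (crd (X p) $ 1 * crd (Y p) $ 2 - crd (X p) $ 2 * crd (Y p) $ 1) *
     (crd (Z p) $ 1 * Rm 1 l p + crd (Z p) $ 2 * Rm 2 l p))"
proof -
  have pV: "p \<in> V" using p U by blast
  define x y z where "x = (\<lambda>i q. crd (X q) $ i)" and "y = (\<lambda>i q. crd (Y q) $ i)" and "z = (\<lambda>i q. crd (Z q) $ i)"
  have xs: "smooth_fun S \<A> U (x i)" and ys: "smooth_fun S \<A> U (y i)" and zs: "smooth_fun S \<A> U (z i)" for i
    unfolding x_def y_def z_def
    using smooth_fun_nth[OF cfield_crd(1)[OF X U]] smooth_fun_nth[OF cfield_crd(1)[OF Y U]] smooth_fun_nth[OF cfield_crd(1)[OF Z U]]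
    by blast+
  have xn: "smooth_near S \<A> p (x i)" and yn: "smooth_near S \<A> p (y i)" and zn: "smooth_near S \<A> p (z i)" for i
    using smooth_nearI[OF xs p] smooth_nearI[OF ys p] smooth_nearI[OF zs p] by blast+
  have dzn: "smooth_near S \<A> p (pd i (z k))" for i k
    by (rule smooth_nearI[OF smooth_fun_pd[OF zs U] p])
  note gn = Gam_near[OF pV]
  define w where "w = (\<lambda>(y :: 2 \<Rightarrow> 'a \<Rightarrow> complex) k q. (y 1 q * pd 1 (z k) q + y 2 q * pd 2 (z k) q) +
       (z 1 q * (y 1 q * Gam 1 1 k q + y 2 q * Gam 2 1 k q) + z 2 q * (y 1 q * Gam 1 2 k q + y 2 q * Gam 2 2 k q)))"
  have pdw: "pd i (w t k) p = (pd i (t 1) p * pd 1 (z k) p + t 1 p * pd i (pd 1 (z k)) p + (pd i (t 2) p * pd 2 (z k) p + t 2 p * pd i (pd 2 (z k)) p)) +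
      (pd i (z 1) p * (t 1 p * Gam 1 1 k p + t 2 p * Gam 2 1 k p) +
       z 1 p * (pd i (t 1) p * Gam 1 1 k p + t 1 p * pd i (Gam 1 1 k) p + (pd i (t 2) p * Gam 2 1 k p + t 2 p * pd i (Gam 2 1 k) p)) +
      (pd i (z 2) p * (t 1 p * Gam 1 2 k p + t 2 p * Gam 2 2 k p) +
       z 2 p * (pd i (t 1) p * Gam 1 2 k p + t 1 p * pd i (Gam 1 2 k) p + (pd i (t 2) p * Gam 2 2 k p + t 2 p * pd i (Gam 2 2 k) p))))"
    if tn: "\<And>j. smooth_near S \<A> p (t j)" for t i k
    unfolding w_def using tn zn dzn gn pV
    by (simp only: pd_add pd_mult smooth_near_add smooth_near_mult)
  have nX: "nabla (\<lambda>q. nabla Z q (Y q)) p (X p) = dv p (\<chi> k. x 1 p * pd 1 (w y k) p + x 2 p * pd 2 (w y k) p +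
       (w y 1 p * (x 1 p * Gam 1 1 k p + x 2 p * Gam 2 1 k p) + w y 2 p * (x 1 p * Gam 1 2 k p + x 2 p * Gam 2 2 k p)))"
    by (rule nabla_nabla_dv[OF X Y Z U p x_def y_def z_def]) (simp add: w_def)
  have nY: "nabla (\<lambda>q. nabla Z q (X q)) p (Y p) = dv p (\<chi> k. y 1 p * pd 1 (w x k) p + y 2 p * pd 2 (w x k) p +
       (w x 1 p * (y 1 p * Gam 1 1 k p + y 2 p * Gam 2 1 k p) + w x 2 p * (y 1 p * Gam 1 2 k p + y 2 p * Gam 2 2 k p)))"
    by (rule nabla_nabla_dv[OF Y X Z U p y_def x_def z_def]) (simp add: w_def)
  have Xp: "X p = dv p (crd (X p))" and Yp: "Y p = dv p (crd (Y p))"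
    by (rule cfield_crd(2)[OF X U p], rule cfield_crd(2)[OF Y U p])
  have Xa: "X p f = x 1 p * pd 1 f p + x 2 p * pd 2 f p" and Ya: "Y p f = y 1 p * pd 1 f p + y 2 p * pd 2 f p"
    if "smooth_near S \<A> p f" for f
    using dv_apply[OF that, of "crd (X p)", folded Xp] dv_apply[OF that, of "crd (Y p)", folded Yp] by (simp_all add: x_def y_def)
  define L where "L k = (x 1 p * pd 1 (y k) p + x 2 p * pd 2 (y k) p) - (y 1 p * pd 1 (x k) p + y 2 p * pd 2 (x k) p)" for k
  have "X p (\<lambda>q. crd (Y q) $ k) - Y p (\<lambda>q. crd (X q) $ k) = L k" for k
    using Xa[OF yn[of k]] Ya[OF xn[of k]] by (simp add: x_def y_def L_def)
  then have "lie_bracket S \<A> X Y p = dv p (\<chi> k. L k)" by (simp add: lie_bracket_dv[OF X Y U p])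
  then have nL: "nabla Z p (lie_bracket S \<A> X Y p) = dv p (\<chi> k. L 1 * pd 1 (z k) p + L 2 * pd 2 (z k) p +
     (z 1 p * (L 1 * Gam 1 1 k p + L 2 * Gam 2 1 k p) + z 2 p * (L 1 * Gam 1 2 k p + L 2 * Gam 2 2 k p)))"
    by (simp add: nabla_dv[OF Z U p] z_def)
  have com: "pd 2 (pd 1 (z k)) p = pd 1 (pd 2 (z k)) p" for k by (rule pd_commute[OF zs U p])
  have xd: "crd (X p) $ i = x i p" "crd (Y p) $ i = y i p" "crd (Z p) $ i = z i p" for i
    by (simp_all add: x_def y_def z_def)
  show ?thesis
    unfolding curv_def nX nY nL vsub_dv
    apply (rule arg_cong[of _ _ "dv p"])
    unfolding vec_eq_iff vector_minus_component vec_lambda_beta pdw[OF xn] pdw[OF yn] com L_def Rm_def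
    unfolding w_def xd by (simp add: algebra_simps)
qed

text \<open>As for the curvature, derivatives of the coefficients of \<open>X\<close> and
  \<open>Y\<close> cancel against the bracket, and the value on the coordinate fields
  remains.\<close>

lemma d_nabla_dv:
  assumes X: "cfield S \<A> U X" and Y: "cfield S \<A> U Y" and U: "U \<subseteq> V" and p: "p \<in> U"
  shows "d_nabla S \<A> nabla \<Psi> X Y p = dv p (\<chi> l. (crd (X p) $ 1 * crd (Y p) $ 2 - crd (X p) $ 2 * crd (Y p) $ 1) * Cod l p)"
proof -
  have pV: "p \<in> V" using p U by blast
  define x y where "x = (\<lambda>i q. crd (X q) $ i)" and "y = (\<lambda>i q. crd (Y q) $ i)"
  have xs: "smooth_fun S \<A> U (x i)" and ys: "smooth_fun S \<A> U (y i)" for i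
    unfolding x_def y_def
    using smooth_fun_nth[OF cfield_crd(1)[OF X U]] smooth_fun_nth[OF cfield_crd(1)[OF Y U]] by blast+
  have xn: "smooth_near S \<A> p (x i)" and yn: "smooth_near S \<A> p (y i)" for i
    using smooth_nearI[OF xs p] smooth_nearI[OF ys p] by blast+
  note pn = PP_near[OF pV]
  define w where "w = (\<lambda>(y :: 2 \<Rightarrow> 'a \<Rightarrow> complex) k q. y 1 q * PP 1 k q + y 2 q * PP 2 k q)"
  have pdw: "pd i (w t k) p = pd i (t 1) p * PP 1 k p + t 1 p * pd i (PP 1 k) p + (pd i (t 2) p * PP 2 k p + t 2 p * pd i (PP 2 k) p)"
    if tn: "\<And>j. smooth_near S \<A> p (t j)" for t i k
    unfolding w_def using tn pn pV by (simp only: pd_add pd_mult smooth_near_add smooth_near_mult)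
  have main: "nabla (\<lambda>q. \<Psi> q (Y q)) p (X p) = dv p (\<chi> k. x 1 p * pd 1 (w y k) p + x 2 p * pd 2 (w y k) p +
       (w y 1 p * (x 1 p * Gam 1 1 k p + x 2 p * Gam 2 1 k p) + w y 2 p * (x 1 p * Gam 1 2 k p + x 2 p * Gam 2 2 k p)))"
    if X: "cfield S \<A> U X" and Y: "cfield S \<A> U Y" and x: "x = (\<lambda>i q. crd (X q) $ i)" and y: "y = (\<lambda>i q. crd (Y q) $ i)"
    for X Y x y
  proof -
    have N: "cfield S \<A> U (\<lambda>q. \<Psi> q (Y q))" by (rule \<Psi>_field[OF Y])
    have cw: "crd (\<Psi> q (Y q)) $ k = w y k q" if q: "q \<in> U" for q k
    proof -
      have qV: "q \<in> V" using q U by blast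
      show ?thesis
        using \<Psi>_dv[OF qV, of "crd (Y q)"] cfield_crd(2)[OF Y U q] by (simp add: crd_dv[OF qV] w_def y)
    qed
    have pc: "pd i (\<lambda>q. crd (\<Psi> q (Y q)) $ k) p = pd i (w y k) p" for i k
      by (rule pd_cong[OF smooth_fun_nth[OF cfield_crd(1)[OF N U]] p pV cw])
    have Xp: "X p = dv p (crd (X p))" by (rule cfield_crd(2)[OF X U p])
    have "nabla (\<lambda>q. \<Psi> q (Y q)) p (X p) = nabla (\<lambda>q. \<Psi> q (Y q)) p (dv p (crd (X p)))" using Xp by simp
    then show ?thesis unfolding nabla_dv[OF N U p] cw[OF p] pc by (simp add: x)
  qed
  have Xp: "X p = dv p (crd (X p))" and Yp: "Y p = dv p (crd (Y p))"
    by (rule cfield_crd(2)[OF X U p], rule cfield_crd(2)[OF Y U p])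
  have Xa: "X p f = x 1 p * pd 1 f p + x 2 p * pd 2 f p" and Ya: "Y p f = y 1 p * pd 1 f p + y 2 p * pd 2 f p"
    if "smooth_near S \<A> p f" for f
    using dv_apply[OF that, of "crd (X p)", folded Xp] dv_apply[OF that, of "crd (Y p)", folded Yp] by (simp_all add: x_def y_def)
  define L where "L k = (x 1 p * pd 1 (y k) p + x 2 p * pd 2 (y k) p) - (y 1 p * pd 1 (x k) p + y 2 p * pd 2 (x k) p)" for k
  have "X p (\<lambda>q. crd (Y q) $ k) - Y p (\<lambda>q. crd (X q) $ k) = L k" for k
    using Xa[OF yn[of k]] Ya[OF xn[of k]] by (simp add: x_def y_def L_def)
  then have "lie_bracket S \<A> X Y p = dv p (\<chi> k. L k)" by (simp add: lie_bracket_dv[OF X Y U p])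
  then have nL: "\<Psi> p (lie_bracket S \<A> X Y p) = dv p (\<chi> k. L 1 * PP 1 k p + L 2 * PP 2 k p)"
    by (simp add: \<Psi>_dv[OF pV])
  have xd: "crd (X p) $ i = x i p" "crd (Y p) $ i = y i p" for i
    by (simp_all add: x_def y_def)
  show ?thesis
    unfolding d_nabla_def main[OF X Y x_def y_def] main[OF Y X y_def x_def] nL vsub_dv
    apply (rule arg_cong[of _ _ "dv p"])
    unfolding vec_eq_iff vector_minus_component vec_lambda_beta pdw[OF xn] pdw[OF yn] L_def Cod_def
    unfolding w_def xd by (simp add: algebra_simps)
qed

text \<open>The mixed second derivatives of \<open>gg\<close>, computed twice by
  \<open>pd_gg\<close>, must agree. In dimension two this leaves the single component
  \<open>Rl 1 2\<close>.\<close>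

lemma Rl_antisym:
  assumes p: "p \<in> V"
  shows "Rl j m p + Rl m j p = 0"
proof -
  note gn = Gam_near[OF p] and mn = gg_near[OF p]
  define E where "E = (\<lambda>l q. (Gam l j 1 q * gg 1 m q + Gam l j 2 q * gg 2 m q) + (Gam l m 1 q * gg j 1 q + Gam l m 2 q * gg j 2 q))"
  have "pd i (pd l (gg j m)) p = pd i (E l) p" for i l
    by (rule pd_cong[OF smooth_fun_pd[OF gg_smooth order_refl] p p]) (simp add: E_def pd_gg)
  moreover have "pd 1 (pd 2 (gg j m)) p = pd 2 (pd 1 (gg j m)) p" by (rule pd_commute[OF gg_smooth order_refl p])
  ultimately have "pd 1 (E 2) p = pd 2 (E 1) p" by metis
  then show ?thesis
    unfolding E_def using gn mn p
    by (simp only: pd_add pd_mult smooth_near_add smooth_near_mult pd_gg)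
      (simp add: Rl_def Rm_def gg_sym[OF p, of _ j] gg_sym[OF p, of m] gg_sym[OF p, of 2 1] algebra_simps)
qed

lemma cbasis_wedge:
  assumes p: "p \<in> V" and b: "cbasis (ctangent_space S \<A> p) (dv p a) (dv p b)"
  shows "a $ 1 * b $ 2 - a $ 2 * b $ 1 \<noteq> 0"
proof
  assume w: "a $ 1 * b $ 2 - a $ 2 * b $ 1 = 0"
  have comb: "vadd (vscale c (dv p a)) (vscale d (dv p b)) = dv p (c *s a + d *s b)" for c d
    by (simp add: vscale_dv vadd_dv)
  have "vzero \<in> ctangent_space S \<A> p" using dv_ctangent[OF p, of 0] by (simp add: vzero_dv[of p])
  then have "\<exists>!c. vzero = vadd (vscale (fst c) (dv p a)) (vscale (snd c) (dv p b))"
    using b unfolding cbasis_def by blast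
  then have uq: "c = 0 \<and> d = 0" if "c *s a + d *s b = 0" for c d
    using that unfolding comb vzero_dv[of p] dv_inj[OF p]
    by (metis add.right_neutral fst_conv snd_conv vector_smult_lzero)
  \<comment> \<open>If the wedge vanishes, then \<open>b $ i\<close> times \<open>a\<close> equals
    \<open>a $ i\<close> times \<open>b\<close>, and uniqueness of the expansion of 0 forces both
    coefficients to vanish.\<close>
  have "b $ i = 0 \<and> - a $ i = 0" for i
    using uq[of "b $ i" "- a $ i"] w exhaust_2[of i] by (auto simp: vec_eq_iff forall_2 algebra_simps)
  then have "a = 0" by (simp add: vec_eq_iff)
  then show False using uq[of 1 0] by simp
qed

lemma cbasis_fr: "p \<in> V \<Longrightarrow> cbasis (ctangent_space S \<A> p) (fr 1 p) (fr 2 p)"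
  unfolding cbasis_def
proof (intro conjI ballI fr_in)
  assume p: "p \<in> V"
  show "p \<in> V" "p \<in> V" by (rule p)+
  fix u assume "u \<in> ctangent_space S \<A> p"
  then obtain a where u: "u = dv p a" by (auto simp: ctangent_eq[OF p])
  have eq: "vadd (vscale (fst c) (fr 1 p)) (vscale (snd c) (fr 2 p)) = dv p (\<chi> i. if i = 1 then fst c else snd c)" for c
    using dv_frame[of p "\<chi> i. if i = 1 then fst c else snd c"] by simp
  show "\<exists>!c. u = vadd (vscale (fst c) (fr 1 p)) (vscale (snd c) (fr 2 p))"
    unfolding eq u dv_inj[OF p]
    by (rule ex1I[of _ "(a $ 1, a $ 2)"]) (auto simp: vec_eq_iff forall_2)
qed

text \<open>A definite description needs independence of the basis: multiplied by the wedge of the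
  basis, either determinant is the wedge of the image vectors. The coordinate frame then pins down
  the value.\<close>

lemma endo_det_PD:
  assumes p: "p \<in> V"
  shows "endo_det (ctangent_space S \<A> p) (\<Psi> p) = PD p"
  unfolding endo_det_def
proof (rule the_equality, intro allI impI)
  fix v w and M :: "complex^2^2"
  assume h: "cbasis (ctangent_space S \<A> p) v w \<and>
       \<Psi> p v = vadd (vscale (M $ 1 $ 1) v) (vscale (M $ 2 $ 1) w) \<and>
       \<Psi> p w = vadd (vscale (M $ 1 $ 2) v) (vscale (M $ 2 $ 2) w)"
  then obtain a b where vw: "v = dv p a" "w = dv p b" by (auto simp: ctangent_eq[OF p] cbasis_def)
  have w0: "a $ 1 * b $ 2 - a $ 2 * b $ 1 \<noteq> 0" using cbasis_wedge[OF p] h vw by blast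
  have "(\<chi> k. a $ 1 * PP 1 k p + a $ 2 * PP 2 k p) = M $ 1 $ 1 *s a + M $ 2 $ 1 *s b"
    "(\<chi> k. b $ 1 * PP 1 k p + b $ 2 * PP 2 k p) = M $ 1 $ 2 *s a + M $ 2 $ 2 *s b"
    using h by (simp_all add: vw \<Psi>_dv[OF p] vscale_dv vadd_dv dv_inj[OF p])
  then have e: "a $ 1 * PP 1 1 p + a $ 2 * PP 2 1 p = M $ 1 $ 1 * a $ 1 + M $ 2 $ 1 * b $ 1"
    "a $ 1 * PP 1 2 p + a $ 2 * PP 2 2 p = M $ 1 $ 1 * a $ 2 + M $ 2 $ 1 * b $ 2"
    "b $ 1 * PP 1 1 p + b $ 2 * PP 2 1 p = M $ 1 $ 2 * a $ 1 + M $ 2 $ 2 * b $ 1"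
    "b $ 1 * PP 1 2 p + b $ 2 * PP 2 2 p = M $ 1 $ 2 * a $ 2 + M $ 2 $ 2 * b $ 2"
    by (simp_all add: vec_eq_iff forall_2)
  have "(a $ 1 * b $ 2 - a $ 2 * b $ 1) * PD p =
    (a $ 1 * PP 1 1 p + a $ 2 * PP 2 1 p) * (b $ 1 * PP 1 2 p + b $ 2 * PP 2 2 p) -
    (a $ 1 * PP 1 2 p + a $ 2 * PP 2 2 p) * (b $ 1 * PP 1 1 p + b $ 2 * PP 2 1 p)"
    by (simp add: PD_def algebra_simps)
  also have "\<dots> = (a $ 1 * b $ 2 - a $ 2 * b $ 1) * det M"
    unfolding e by (simp add: det_2 algebra_simps)
  finally show "PD p = det M" using w0 by simp
next
  fix d
  assume h: "\<forall>v w. \<forall>M :: complex^2^2. cbasis (ctangent_space S \<A> p) v w \<and>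
       \<Psi> p v = vadd (vscale (M $ 1 $ 1) v) (vscale (M $ 2 $ 1) w) \<and>
       \<Psi> p w = vadd (vscale (M $ 1 $ 2) v) (vscale (M $ 2 $ 2) w) \<longrightarrow> d = det M"
  define M where "M = m2 (PP 1 1 p) (PP 2 1 p) (PP 1 2 p) (PP 2 2 p)"
  have "\<Psi> p (fr 1 p) = vadd (vscale (M $ 1 $ 1) (fr 1 p)) (vscale (M $ 2 $ 1) (fr 2 p))"
    "\<Psi> p (fr 2 p) = vadd (vscale (M $ 1 $ 2) (fr 1 p)) (vscale (M $ 2 $ 2) (fr 2 p))"
    by (simp_all add: fr_def \<Psi>_dv[OF p] vscale_dv vadd_dv dv_inj[OF p] M_def vec_eq_iff forall_2 axis_def)
  then have "d = det M" using h cbasis_fr[OF p] by blast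
  then show "d = PD p" by (simp add: det_2 M_def PD_def algebra_simps)
qed

text \<open>By \<open>curv_dv\<close> and \<open>Rl_antisym\<close>, numerator and denominator both
  scale with the square of the wedge of \<open>X p\<close> and \<open>Y p\<close>, so the quotient
  is the same for all bases.\<close>

lemma gauss_curvature_Rl:
  assumes p: "p \<in> V"
  shows "gauss_curvature S \<A> g nabla p = - Rl 1 2 p / dg p"
  unfolding gauss_curvature_def
proof (rule the_equality, intro allI impI)
  have main: "- Rl 1 2 p / dg p = - g p (curv S \<A> nabla X Y X p) (Y p) / (g p (X p) (X p) * g p (Y p) (Y p) - (g p (X p) (Y p))\<^sup>2)"
    if h: "p \<in> U" "cfield S \<A> U X" "cfield S \<A> U Y" "cbasis (ctangent_space S \<A> p) (X p) (Y p)" for U X Y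
  proof -
    define U' where "U' = U \<inter> V"
    have U': "openin (top_of_set S) U'" "U' \<subseteq> V" "p \<in> U'"
      unfolding U'_def using openin_Int[OF cfield_openin[OF h(2)] V_openin] h(1) p by auto
    have X: "cfield S \<A> U' X" and Y: "cfield S \<A> U' Y"
      using cfield_subset[OF h(2) U'(1)] cfield_subset[OF h(3) U'(1)] by (auto simp: U'_def)
    define a b where "a = crd (X p)" and "b = crd (Y p)"
    have Xp: "X p = dv p a" and Yp: "Y p = dv p b"
      unfolding a_def b_def by (rule cfield_crd(2)[OF X U'(2,3)], rule cfield_crd(2)[OF Y U'(2,3)])
    define w where "w = a $ 1 * b $ 2 - a $ 2 * b $ 1"
    have w: "w \<noteq> 0" unfolding w_def using cbasis_wedge[OF p] h(4) Xp Yp by simp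
    have r: "Rl 1 1 p = 0" "Rl 2 2 p = 0" "Rl 2 1 p = - Rl 1 2 p"
      using Rl_antisym[OF p, of 1 1] Rl_antisym[OF p, of 2 2] Rl_antisym[OF p, of 1 2] by (simp_all add: add_eq_0_iff)
    have "g p (curv S \<A> nabla X Y X p) (Y p) = w * (a $ 1 * b $ 1 * Rl 1 1 p + a $ 1 * b $ 2 * Rl 1 2 p + a $ 2 * b $ 1 * Rl 2 1 p + a $ 2 * b $ 2 * Rl 2 2 p)"
      unfolding curv_dv[OF X Y X U'(2,3)] Yp g_dv[OF p] crd_dv[OF p]
      unfolding a_def[symmetric] w_def Rl_def by (simp add: algebra_simps)
    also have "\<dots> = w * w * Rl 1 2 p" by (simp add: r w_def algebra_simps)
    finally have n: "g p (curv S \<A> nabla X Y X p) (Y p) = w * w * Rl 1 2 p" .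
    have d: "g p (X p) (X p) * g p (Y p) (Y p) - (g p (X p) (Y p))\<^sup>2 = w * w * dg p"
      unfolding Xp Yp g_dv[OF p] by (simp add: w_def dg_def gg_sym[OF p, of 2 1] power2_eq_square algebra_simps)
    show ?thesis unfolding n d using w dg_nonzero[OF p] by simp
  qed
  show "- Rl 1 2 p / dg p = - g p (curv S \<A> nabla X Y X p) (Y p) / (g p (X p) (X p) * g p (Y p) (Y p) - (g p (X p) (Y p))\<^sup>2)"
    if "p \<in> U \<and> cfield S \<A> U X \<and> cfield S \<A> U Y \<and> cbasis (ctangent_space S \<A> p) (X p) (Y p)" for U X Y
    using main that by blast
  fix k
  assume "\<forall>U X Y. p \<in> U \<and> cfield S \<A> U X \<and> cfield S \<A> U Y \<and> cbasis (ctangent_space S \<A> p) (X p) (Y p) \<longrightarrow>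
     k = - g p (curv S \<A> nabla X Y X p) (Y p) / (g p (X p) (X p) * g p (Y p) (Y p) - (g p (X p) (Y p))\<^sup>2)"
  from this[THEN spec[of _ V], THEN spec[of _ "fr 1"], THEN spec[of _ "fr 2"]]
  show "k = - Rl 1 2 p / dg p"
    using main[OF p fr_field[OF V_openin order_refl] fr_field[OF V_openin order_refl] cbasis_fr[OF p]]
      p fr_field[OF V_openin order_refl] cbasis_fr[OF p] by simp
qed

lemma d_nabla_zero:
  assumes "p \<in> V" "\<And>l. Cod l p = 0" "cfield S \<A> U X" "cfield S \<A> U Y" "p \<in> U"
  shows "d_nabla S \<A> nabla \<Psi> X Y p = vzero"
proof -
  have U': "openin (top_of_set S) (U \<inter> V)" "U \<inter> V \<subseteq> V" "p \<in> U \<inter> V"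
    using openin_Int[OF cfield_openin[OF assms(3)] V_openin] assms(1,5) by auto
  have X: "cfield S \<A> (U \<inter> V) X" and Y: "cfield S \<A> (U \<inter> V) Y"
    using cfield_subset[OF assms(3) U'(1)] cfield_subset[OF assms(4) U'(1)] by auto
  show ?thesis unfolding d_nabla_dv[OF X Y U'(2,3)] assms(2) vzero_dv[of p]
    by (rule arg_cong[of _ _ "dv p"]) (simp add: vec_eq_iff)
qed

lemma Cod_zero:
  assumes p: "p \<in> V" and d: "d_nabla S \<A> nabla \<Psi> (fr 1) (fr 2) p = vzero"
  shows "Cod l p = 0"
proof -
  have "dv p (\<chi> l. Cod l p) = dv p 0"
    using d unfolding d_nabla_dv[OF fr_field[OF V_openin order_refl] fr_field[OF V_openin order_refl] order_refl p]
      crd_fr[OF p] vzero_dv[of p] by (simp add: axis_def)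
  then show ?thesis by (simp add: dv_inj[OF p] vec_eq_iff)
qed

end

section \<open>The structure equations\<close>

text \<open>The four vectors have an invertible Gram matrix, hence are independent and span the
  four-dimensional space of matrices; there \<open>bb\<close> is nondegenerate.\<close>

lemma bb_orthogonal_zero:
  assumes A: "bb A A = - 1" and N: "bb N N = 1" "bb N A = 0"
    and s: "bb s1 A = 0" "bb s2 A = 0" "bb s1 N = 0" "bb s2 N = 0"
    and d: "bb s1 s1 * bb s2 s2 - bb s1 s2 * bb s1 s2 \<noteq> 0"
    and X: "bb X A = 0" "bb X N = 0" "bb X s1 = 0" "bb X s2 = 0"
  shows "X = 0"
proof -
  define e where "e k = (if k = 1 then A else if k = 2 then N else if k = 3 then s1 else s2)" for k :: 4
  define cf where "cf k Y = (if k = 1 then Y$1$1 else if k = 2 then Y$1$2 else if k = 3 then Y$2$1 else Y$2$2)" for k :: 4 and Y :: cmat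
  \<comment> \<open>Its columns list the entries of the four vectors. A trivial kernel yields a left
    inverse, which for a square matrix is a right inverse, and that is spanning.\<close>
  define M where "M = (\<chi> i k. cf i (e k))"
  define lc where "lc c = (\<Sum>k\<in>UNIV. mat (c $ k) ** e k)" for c :: "complex^4"
  have lc: "lc c = mat (c $ 1) ** A + mat (c $ 2) ** N + mat (c $ 3) ** s1 + mat (c $ 4) ** s2" for c
    by (simp add: lc_def sum_4 e_def)
  have Mv: "(M *v c) $ i = cf i (lc c)" for c i
    unfolding lc M_def by (simp add: matrix_vector_mult_def sum_4 cf_def e_def mat_mult_nth mult.commute)
  have "c = 0" if "M *v c = 0" for c
  proof -
    have "cf i (lc c) = 0" for i using Mv[of c i] that by simp
    from this[of 1] this[of 2] this[of 3] this[of 4] have lc0: "lc c = 0"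
      by (simp add: cf_def cmat_eq_iff)
    have "bb (lc c) Y = c $ 1 * bb A Y + c $ 2 * bb N Y + c $ 3 * bb s1 Y + c $ 4 * bb s2 Y" for Y
      unfolding lc by (simp add: bb_add bb_scale)
    then have e: "c $ 1 * bb A Y + c $ 2 * bb N Y + c $ 3 * bb s1 Y + c $ 4 * bb s2 Y = 0" for Y
      unfolding lc0 by (simp add: bb_zero)
    have sy: "bb A N = 0" "bb A s1 = 0" "bb A s2 = 0" "bb N s1 = 0" "bb N s2 = 0"
      using N(2) s by (simp_all add: bb_sym[of A s1] bb_sym[of A s2] bb_sym[of N s1] bb_sym[of N s2] bb_sym[of A N])
    have c12: "c $ 1 = 0" "c $ 2 = 0"
      using e[of A] e[of N] A N s sy by simp_all
    have c34: "c $ 3 * bb s1 s1 + c $ 4 * bb s1 s2 = 0" "c $ 3 * bb s1 s2 + c $ 4 * bb s2 s2 = 0"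
      using e[of s1] e[of s2] c12 bb_sym[of s2 s1] by simp_all
    have "c $ 3 * (bb s1 s1 * bb s2 s2 - bb s1 s2 * bb s1 s2) =
        (c $ 3 * bb s1 s1 + c $ 4 * bb s1 s2) * bb s2 s2 - (c $ 3 * bb s1 s2 + c $ 4 * bb s2 s2) * bb s1 s2"
      "c $ 4 * (bb s1 s1 * bb s2 s2 - bb s1 s2 * bb s1 s2) =
        (c $ 3 * bb s1 s2 + c $ 4 * bb s2 s2) * bb s1 s1 - (c $ 3 * bb s1 s1 + c $ 4 * bb s1 s2) * bb s1 s2"
      by (simp_all add: algebra_simps)
    then have "c $ 3 = 0" "c $ 4 = 0" unfolding c34 using d by simp_all
    then show "c = 0" using c12 by (simp add: vec_eq_iff forall_4)
  qed
  then obtain B where "B ** M = mat 1" using matrix_left_invertible_ker[of M] by blast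
  then have MB: "M ** B = mat 1" using matrix_left_right_inverse[of M B] by simp
  show ?thesis
  proof (rule bb_nondegenerate)
    fix Z
    define z :: "complex^4" where "z = (\<chi> i. cf i Z)"
    have "M *v (B *v z) = z" using MB by (simp add: matrix_vector_mul_assoc)
    then have "cf i (lc (B *v z)) = cf i Z" for i using Mv[of "B *v z" i] by (simp add: z_def)
    from this[of 1] this[of 2] this[of 3] this[of 4] have "Z = lc (B *v z)"
      by (simp add: cf_def cmat_eq_iff)
    then show "bb X Z = 0" using X by (simp add: lc bb_add bb_scale)
  qed
qed

context gc_data
begin

text \<open>Isometric immersions with normal and shape operator, in terms of the ambient space of matrices. The
  flat derivative of \<^term>\<open>\<nu>\<close> needs no projection, since it is already tangent to the quadric.\<close>

definition gsol :: "'a set \<Rightarrow> ('a \<Rightarrow> cmat) \<Rightarrow> ('a \<Rightarrow> cmat) \<Rightarrow> bool" where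
  "gsol U \<sigma> \<nu> \<longleftrightarrow> smooth_fun S \<A> U \<sigma> \<and> smooth_fun S \<A> U \<nu> \<and>
     (\<forall>p\<in>U. bb (\<sigma> p) (\<sigma> p) = - 1 \<and> bb (\<nu> p) (\<nu> p) = 1 \<and> bb (\<nu> p) (\<sigma> p) = 0 \<and>
        (\<forall>v\<in>ctangent_space S \<A> p. bb (\<nu> p) (pushforward \<sigma> v) = 0 \<and> pushforward \<nu> v = pushforward \<sigma> (\<Psi> p v)) \<and>
        (\<forall>v\<in>ctangent_space S \<A> p. \<forall>w\<in>ctangent_space S \<A> p. bb (pushforward \<sigma> v) (pushforward \<sigma> w) = g p v w))"

lemma gsolD:
  assumes "gsol U \<sigma> \<nu>"
  shows "smooth_fun S \<A> U \<sigma>" "smooth_fun S \<A> U \<nu>" "openin (top_of_set S) U" "U \<subseteq> S"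
    "\<And>p. p \<in> U \<Longrightarrow> bb (\<sigma> p) (\<sigma> p) = - 1" "\<And>p. p \<in> U \<Longrightarrow> bb (\<nu> p) (\<nu> p) = 1" "\<And>p. p \<in> U \<Longrightarrow> bb (\<nu> p) (\<sigma> p) = 0"
    "\<And>p v. p \<in> U \<Longrightarrow> v \<in> ctangent_space S \<A> p \<Longrightarrow> bb (\<nu> p) (pushforward \<sigma> v) = 0"
    "\<And>p v. p \<in> U \<Longrightarrow> v \<in> ctangent_space S \<A> p \<Longrightarrow> pushforward \<nu> v = pushforward \<sigma> (\<Psi> p v)"
    "\<And>p v w. p \<in> U \<Longrightarrow> v \<in> ctangent_space S \<A> p \<Longrightarrow> w \<in> ctangent_space S \<A> p \<Longrightarrow>
       bb (pushforward \<sigma> v) (pushforward \<sigma> w) = g p v w"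
proof -
  show s: "smooth_fun S \<A> U \<sigma>" "smooth_fun S \<A> U \<nu>" using assms by (simp_all add: gsol_def)
  show o: "openin (top_of_set S) U" by (rule smooth_fun_openin[OF s(1)])
  show "U \<subseteq> S" by (rule openin_imp_subset[OF o])
qed (use assms in \<open>auto simp: gsol_def\<close>)

text \<open>A vector killed by the differential is \<open>g\<close>-orthogonal to the whole tangent
  space. This is the source of the immersion property.\<close>

lemma gsol_pushforward_inj:
  assumes s: "gsol U \<sigma> \<nu>" and p: "p \<in> U" and v: "v \<in> ctangent_space S \<A> p" and w: "w \<in> ctangent_space S \<A> p"
    and eq: "pushforward \<sigma> v = pushforward \<sigma> w"
  shows "v = w"
proof -
  note d = gsolD[OF s]
  have pS: "p \<in> S" using p d(4) by blast
  obtain V \<phi> where "surface_chart S \<A> V \<phi>" and pV: "p \<in> V" using chart_at[OF pS] .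
  then interpret surface_chart S \<A> V \<phi> by simp
  have u: "vsub v w \<in> ctangent_space S \<A> p" using v w by (auto simp: ctangent_eq[OF pV] vsub_dv)
  have "vsub v w = vzero"
  proof (rule g_nondegenerate[OF pS u])
    fix x assume x: "x \<in> ctangent_space S \<A> p"
    show "g p (vsub v w) x = 0"
      using d(10)[OF p u x] by (simp add: pushforward_vsub eq bb_zero)
  qed
  then show ?thesis by (simp add: vsub_def vzero_def fun_eq_iff)
qed

text \<open>Forwards, whatever pull-back connection is given equals \<open>Db0\<close>, whose
  projection term for \<open>\<nu>\<close> vanishes because \<open>\<nu>\<close> is orthogonal to
  the image of the differential. Backwards, \<open>Db0\<close> itself is the connection
  required.\<close>

lemma gsol_iff:
  assumes D: "SL2_levi_civita D"
  shows "isometric_immersion S \<A> g \<sigma> \<and> shape_operator S \<A> D \<sigma> \<nu> \<Psi> \<longleftrightarrow> gsol S \<sigma> \<nu>"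
proof
  assume h: "isometric_immersion S \<A> g \<sigma> \<and> shape_operator S \<A> D \<sigma> \<nu> \<Psi>"
  then have im: "\<sigma> ` S \<subseteq> SL2" "smooth_fun S \<A> S \<sigma>"
    and iso: "\<And>p v w. p \<in> S \<Longrightarrow> v \<in> ctangent_space S \<A> p \<Longrightarrow> w \<in> ctangent_space S \<A> p \<Longrightarrow>
        SL2_metric (\<sigma> p) (pushforward \<sigma> v) (pushforward \<sigma> w) = g p v w"
    by (simp_all add: isometric_immersion_def immersion_def)
  interpret SL2_map S \<A> D \<sigma> by unfold_locales (use D im in auto)
  have un: "unit_normal S \<A> \<sigma> S \<nu>" using h by (simp add: shape_operator_def)
  obtain Db where Db: "pullback_connection S \<A> D \<sigma> Db"
    "\<And>p v. p \<in> S \<Longrightarrow> v \<in> ctangent_space S \<A> p \<Longrightarrow> pushforward \<sigma> (\<Psi> p v) = Db \<nu> p v"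
    using h unfolding shape_operator_def by blast
  have fa: "field_along S \<A> \<sigma> S \<nu>" using un by (simp add: unit_normal_def)
  have nt: "\<nu> p \<in> SL2_tangent (\<sigma> p)" if "p \<in> S" for p using fa that by (simp add: field_along_def)
  have nb: "bb (\<nu> p) (pushforward \<sigma> v) = 0" if "p \<in> S" "v \<in> ctangent_space S \<A> p" for p v
    using un that SL2_metric_tangent[OF \<sigma>_in \<sigma>_tangent nt] by (simp add: unit_normal_def bb_sym)
  show "gsol S \<sigma> \<nu>"
    unfolding gsol_def
  proof (intro conjI ballI)
    show "smooth_fun S \<A> S \<sigma>" by (rule im(2))
    show "smooth_fun S \<A> S \<nu>" by (rule field_alongD(1)[OF fa])
    fix p assume p: "p \<in> S"
    show "bb (\<sigma> p) (\<sigma> p) = - 1" using \<sigma>_in[OF p] by (simp add: SL2_iff)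
    show "bb (\<nu> p) (\<nu> p) = 1" using un p SL2_metric_tangent[OF \<sigma>_in[OF p] nt[OF p] nt[OF p]] by (simp add: unit_normal_def)
    show "bb (\<nu> p) (\<sigma> p) = 0" by (rule field_alongD(4)[OF fa p])
    fix v assume v: "v \<in> ctangent_space S \<A> p"
    show "bb (\<nu> p) (pushforward \<sigma> v) = 0" by (rule nb[OF p v])
    have "pushforward \<sigma> (\<Psi> p v) = Db0 \<nu> p v"
      using Db(2)[OF p v] pullback_connection_explicit[OF Db(1) fa p v] by simp
    then show "pushforward \<nu> v = pushforward \<sigma> (\<Psi> p v)"
      using nb[OF p v] by (simp add: Db0_def bb_sym[of "pushforward \<sigma> v"])
    fix w assume w: "w \<in> ctangent_space S \<A> p"
    show "bb (pushforward \<sigma> v) (pushforward \<sigma> w) = g p v w"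
      using iso[OF p v w] SL2_metric_tangent[OF \<sigma>_in[OF p] \<sigma>_tangent[OF p v] \<sigma>_tangent[OF p w]] by simp
  qed
next
  assume s: "gsol S \<sigma> \<nu>"
  note d = gsolD[OF s]
  have im: "\<sigma> ` S \<subseteq> SL2" using d(5) by (auto simp: SL2_iff)
  interpret SL2_map S \<A> D \<sigma> by unfold_locales (use D im d(1) in auto)
  have nt: "\<nu> p \<in> SL2_tangent (\<sigma> p)" if "p \<in> S" for p using d(7)[OF that] tangent_iff[OF \<sigma>_in[OF that]] by simp
  have "inj_on (\<lambda>X. pushforward \<sigma> (real_vec S \<A> p X)) (tangent_space S \<A> p)" if p: "p \<in> S" for p
  proof (rule inj_onI)
    fix X Y assume X: "X \<in> tangent_space S \<A> p" and Y: "Y \<in> tangent_space S \<A> p"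
      and eq: "pushforward \<sigma> (real_vec S \<A> p X) = pushforward \<sigma> (real_vec S \<A> p Y)"
    have "real_vec S \<A> p X = real_vec S \<A> p Y"
      by (rule gsol_pushforward_inj[OF s p real_vec_ctangent[OF X p] real_vec_ctangent[OF Y p] eq])
    then show "X = Y" by (rule real_vec_inj[OF X Y])
  qed
  then have "isometric_immersion S \<A> g \<sigma>"
    unfolding isometric_immersion_def immersion_def
    using im d(1,10) SL2_metric_tangent[OF \<sigma>_in \<sigma>_tangent \<sigma>_tangent] by simp
  moreover have fa: "field_along S \<A> \<sigma> S \<nu>" using d(2) nt by (simp add: field_along_def)
  have "unit_normal S \<A> \<sigma> S \<nu>"
    unfolding unit_normal_def
    using fa d(6,8) SL2_metric_tangent[OF \<sigma>_in nt nt] SL2_metric_tangent[OF \<sigma>_in \<sigma>_tangent nt] by (simp add: bb_sym)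
  moreover have "pushforward \<sigma> (\<Psi> p v) = Db0 \<nu> p v" if "p \<in> S" "v \<in> ctangent_space S \<A> p" for p v
    using d(8,9)[OF that] by (simp add: Db0_def bb_sym[of "pushforward \<sigma> v"])
  ultimately show "isometric_immersion S \<A> g \<sigma> \<and> shape_operator S \<A> D \<sigma> \<nu> \<Psi>"
    unfolding shape_operator_def using Db0_pullback by blast
qed

end

section \<open>From an immersion to the Gauss and Codazzi equations\<close>

context gc_chart
begin

lemma pushforward_fr: "p \<in> V \<Longrightarrow> smooth_near S \<A> p s \<Longrightarrow> pushforward s (fr i p) = pd i s p"
  using exhaust_2[of i] by (auto simp: fr_def pushforward_dv axis_def)

lemma pd_zero_fun:
  assumes "openin (top_of_set S) U" "p \<in> U" "p \<in> V" "\<And>q. q \<in> U \<Longrightarrow> f q = c"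
  shows "pd i f p = 0"
  using pd_cong[OF smooth_fun_const[OF assms(1), of c] assms(2,3), of f i] assms(4) by (simp add: pd_const)

context
  fixes U :: "'a set" and \<sigma> \<nu> :: "'a \<Rightarrow> cmat"
  assumes sol: "gsol U \<sigma> \<nu>" and UV: "U \<subseteq> V"
begin

lemma sol_in: "p \<in> U \<Longrightarrow> p \<in> V" using UV by blast

lemma sol_near: "p \<in> U \<Longrightarrow> smooth_near S \<A> p \<sigma>" "p \<in> U \<Longrightarrow> smooth_near S \<A> p \<nu>"
  "p \<in> U \<Longrightarrow> smooth_near S \<A> p (pd i \<sigma>)"
  by (rule smooth_nearI[OF gsolD(1)[OF sol]], assumption, rule smooth_nearI[OF gsolD(2)[OF sol]], assumption,
      rule smooth_nearI[OF smooth_fun_pd[OF gsolD(1)[OF sol] UV]], assumption)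

lemma sol_pd_\<sigma>: "p \<in> U \<Longrightarrow> pushforward \<sigma> (fr i p) = pd i \<sigma> p"
  using pushforward_fr[OF sol_in sol_near(1)] .

lemma sol_gram:
  assumes p: "p \<in> U"
  shows "bb (pd i \<sigma> p) (\<sigma> p) = 0" "bb (\<nu> p) (pd i \<sigma> p) = 0" "bb (pd i \<sigma> p) (pd j \<sigma> p) = gg i j p"
proof -
  note f = fr_in[OF sol_in[OF p]]
  show "bb (pd i \<sigma> p) (\<sigma> p) = 0"
    using pushforward_tangent[OF gsolD(1,5)[OF sol] p f] by (simp add: sol_pd_\<sigma>[OF p])
  show "bb (\<nu> p) (pd i \<sigma> p) = 0" using gsolD(8)[OF sol p f] by (simp add: sol_pd_\<sigma>[OF p])
  show "bb (pd i \<sigma> p) (pd j \<sigma> p) = gg i j p" using gsolD(10)[OF sol p f f] by (simp add: sol_pd_\<sigma>[OF p] gg_def)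
qed

lemma sol_pd_\<nu>: "p \<in> U \<Longrightarrow> pd i \<nu> p = mat (PP i 1 p) ** pd 1 \<sigma> p + mat (PP i 2 p) ** pd 2 \<sigma> p"
proof -
  assume p: "p \<in> U"
  have "pd i \<nu> p = pushforward \<nu> (fr i p)" by (rule pushforward_fr[OF sol_in[OF p] sol_near(2)[OF p], symmetric])
  also have "\<dots> = pushforward \<sigma> (\<Psi> p (fr i p))" by (rule gsolD(9)[OF sol p fr_in[OF sol_in[OF p]]])
  also have "\<dots> = pushforward \<sigma> (dv p (\<chi> k. PP i k p))"
    using exhaust_2[of i] by (auto simp: fr_def \<Psi>_dv[OF sol_in[OF p]] axis_def)
  finally show ?thesis by (simp add: pushforward_dv[OF sol_in[OF p] sol_near(1)[OF p]])
qed

lemma sol_gram_zero: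
  assumes p: "p \<in> U" and X: "bb X (\<sigma> p) = 0" "bb X (\<nu> p) = 0" "\<And>k. bb X (pd k \<sigma> p) = 0"
  shows "X = 0"
proof (rule bb_orthogonal_zero[of "\<sigma> p" "\<nu> p" "pd 1 \<sigma> p" "pd 2 \<sigma> p"])
  show "bb (pd 1 \<sigma> p) (pd 1 \<sigma> p) * bb (pd 2 \<sigma> p) (pd 2 \<sigma> p) - bb (pd 1 \<sigma> p) (pd 2 \<sigma> p) * bb (pd 1 \<sigma> p) (pd 2 \<sigma> p) \<noteq> 0"
    using dg_nonzero[OF sol_in[OF p]] by (simp add: sol_gram[OF p] dg_def)
  show "bb (pd 1 \<sigma> p) (\<nu> p) = 0" "bb (pd 2 \<sigma> p) (\<nu> p) = 0" using sol_gram(2)[OF p] by (simp_all add: bb_sym)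
qed (use gsolD(5-7)[OF sol p] sol_gram[OF p] X in simp_all)

text \<open>The components along \<open>\<sigma>\<close> and \<open>\<nu>\<close> come from
  differentiating the Gram relations. The tangential ones agree with the Christoffel symbols by the
  symmetric-and-skew argument, and \<open>sol_gram_zero\<close> says that there are no
  others.\<close>

lemma sol_pd_pd:
  assumes p: "p \<in> U"
  shows "pd i (pd j \<sigma>) p = mat (Gam i j 1 p) ** pd 1 \<sigma> p + mat (Gam i j 2 p) ** pd 2 \<sigma> p
     - mat (hh i j p) ** \<nu> p + mat (gg i j p) ** \<sigma> p"
proof -
  note pV = sol_in[OF p] and oU = gsolD(3)[OF sol]
  note bbpd = pd_bilinear[OF _ _ pV bounded_bilinear_bb]
  have 0: "bb (pd i (pd j \<sigma>) p) (\<sigma> p) = - gg i j p" for i j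
  proof -
    have "pd i (\<lambda>q. bb (pd j \<sigma> q) (\<sigma> q)) p = 0"
      by (rule pd_zero_fun[OF oU p pV]) (rule sol_gram(1))
    then have "bb (pd i (pd j \<sigma>) p) (\<sigma> p) + gg j i p = 0"
      unfolding bbpd[OF sol_near(3)[OF p] sol_near(1)[OF p]] by (simp add: sol_gram[OF p])
    then show ?thesis using gg_sym[OF pV, of i j] by (simp add: add_eq_0_iff2)
  qed
  have 3: "bb (pd i (pd j \<sigma>) p) (\<nu> p) = - hh i j p" for i j
  proof -
    have "pd i (\<lambda>q. bb (\<nu> q) (pd j \<sigma> q)) p = 0"
      by (rule pd_zero_fun[OF oU p pV]) (rule sol_gram(2))
    then have "hh i j p + bb (\<nu> p) (pd i (pd j \<sigma>) p) = 0"
      unfolding bbpd[OF sol_near(2)[OF p] sol_near(3)[OF p]] sol_pd_\<nu>[OF p]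
      by (simp add: bb_add bb_scale sol_gram[OF p] hh_def)
    then show ?thesis using bb_sym[of "pd i (pd j \<sigma>) p" "\<nu> p"] by (simp add: add_eq_0_iff)
  qed
  \<comment> \<open>Symmetric in \<open>i\<close>, \<open>j\<close> because partial derivatives
    commute and \<open>nabla\<close> has no torsion; skew in \<open>j\<close>, \<open>k\<close>
    because both terms reproduce the derivative of the metric.\<close>
  define T where "T i j k = bb (pd i (pd j \<sigma>) p) (pd k \<sigma> p) - (Gam i j 1 p * gg 1 k p + Gam i j 2 p * gg 2 k p)" for i j k
  have Tsym: "T i j k = T j i k" for i j k
    unfolding T_def using pd_commute_cmat[OF gsolD(1)[OF sol] UV p, of i j] Gam_sym[OF pV, of i j] by simp
  have Tskew: "T i j k = - T i k j" for i j k
  proof -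
    have "pd i (gg j k) p = pd i (\<lambda>q. bb (pd j \<sigma> q) (pd k \<sigma> q)) p"
      by (rule pd_cong[OF smooth_fun_subset[OF gg_smooth oU UV] p pV]) (simp add: sol_gram)
    also have "\<dots> = bb (pd i (pd j \<sigma>) p) (pd k \<sigma> p) + bb (pd i (pd k \<sigma>) p) (pd j \<sigma> p)"
      unfolding bbpd[OF sol_near(3)[OF p] sol_near(3)[OF p]] by (simp add: bb_sym)
    finally show ?thesis
      unfolding pd_gg[OF pV] T_def by (simp add: gg_sym[OF pV, of j] algebra_simps)
  qed
  have "T i j k = 0" for i j k
  proof -
    have "T i j k = - T i k j" by (rule Tskew)
    also have "\<dots> = - T k i j" by (simp only: Tsym[of i k])
    also have "\<dots> = T k j i" by (simp only: Tskew[of k i j]) simp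
    also have "\<dots> = T j k i" by (rule Tsym)
    also have "\<dots> = - T j i k" by (rule Tskew)
    also have "\<dots> = - T i j k" by (simp only: Tsym[of j i])
    finally show ?thesis by simp
  qed
  then have K: "bb (pd i (pd j \<sigma>) p) (pd k \<sigma> p) = Gam i j 1 p * gg 1 k p + Gam i j 2 p * gg 2 k p" for i j k
    by (simp add: T_def)
  have "pd i (pd j \<sigma>) p - (mat (Gam i j 1 p) ** pd 1 \<sigma> p + mat (Gam i j 2 p) ** pd 2 \<sigma> p
     - mat (hh i j p) ** \<nu> p + mat (gg i j p) ** \<sigma> p) = 0"
  proof (rule sol_gram_zero[OF p])
    have n: "bb (pd k \<sigma> p) (\<nu> p) = 0" "bb (\<sigma> p) (\<nu> p) = 0" "bb (\<sigma> p) (pd k \<sigma> p) = 0" for k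
      using sol_gram[OF p] gsolD(7)[OF sol p] by (simp_all add: bb_sym)
    show "bb (pd i (pd j \<sigma>) p - (mat (Gam i j 1 p) ** pd 1 \<sigma> p + mat (Gam i j 2 p) ** pd 2 \<sigma> p
       - mat (hh i j p) ** \<nu> p + mat (gg i j p) ** \<sigma> p)) (\<sigma> p) = 0"
      by (simp add: bb_diff bb_add bb_scale 0 sol_gram[OF p] gsolD(5,7)[OF sol p])
    show "bb (pd i (pd j \<sigma>) p - (mat (Gam i j 1 p) ** pd 1 \<sigma> p + mat (Gam i j 2 p) ** pd 2 \<sigma> p
       - mat (hh i j p) ** \<nu> p + mat (gg i j p) ** \<sigma> p)) (\<nu> p) = 0"
      by (simp add: bb_diff bb_add bb_scale 3 n gsolD(6)[OF sol p])
    show "bb (pd i (pd j \<sigma>) p - (mat (Gam i j 1 p) ** pd 1 \<sigma> p + mat (Gam i j 2 p) ** pd 2 \<sigma> p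
       - mat (hh i j p) ** \<nu> p + mat (gg i j p) ** \<sigma> p)) (pd k \<sigma> p) = 0" for k
      by (simp add: bb_diff bb_add bb_scale K n sol_gram[OF p])
  qed
  then show ?thesis by simp
qed

text \<open>Commuting mixed derivatives: those of \<open>\<nu>\<close>, paired with tangent vectors,
  give Codazzi; those of \<open>pd 1 \<sigma>\<close>, paired with \<open>pd 2 \<sigma>\<close>,
  give Gauss. The multiple of \<open>\<sigma>\<close> in \<open>sol_pd_pd\<close> produces the term
  \<open>- 1\<close>.\<close>

lemma sol_codazzi_gauss:
  assumes p: "p \<in> U"
  shows "Cod l p = 0" "- Rl 1 2 p = (- 1 + PD p) * dg p"
proof -
  note pV = sol_in[OF p] and oU = gsolD(3)[OF sol]
  have matpd: "pd i (\<lambda>q. mat (f q) ** s q) p = mat (pd i f p) ** s p + mat (f p) ** pd i s p"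
    if "smooth_near S \<A> p f" "smooth_near S \<A> p s" for f i and s :: "'a \<Rightarrow> cmat"
    using pd_bilinear[OF smooth_near_mat[OF that(1)] that(2) pV bounded_bilinear_mm] pd_linear[OF that(1) pV bounded_linear_mat]
    by simp
  have near: "smooth_near S \<A> p (\<lambda>q. mat (f q) ** s q)"
    if "smooth_near S \<A> p f" "smooth_near S \<A> p s" for f and s :: "'a \<Rightarrow> cmat"
  proof -
    note fs = smooth_near_both[OF smooth_near_mat[OF that(1)] that(2)]
    obtain N where "p \<in> N" "smooth_fun S \<A> N (\<lambda>q. mat (f q) :: cmat)" "smooth_fun S \<A> N s"
      using fs by blast
    then show ?thesis by (intro smooth_nearI[OF smooth_fun_mm])
  qed
  have hn: "smooth_near S \<A> p (hh i j)" for i j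
    unfolding hh_def[abs_def] by (intro smooth_near_add smooth_near_mult PP_near gg_near pV)
  note nears = Gam_near[OF pV] gg_near[OF pV] PP_near[OF pV] hn sol_near[OF p]
  have n: "bb (pd k \<sigma> p) (\<nu> p) = 0" "bb (\<sigma> p) (\<nu> p) = 0" "bb (\<sigma> p) (pd k \<sigma> p) = 0" for k
    using sol_gram[OF p] gsolD(7)[OF sol p] by (simp_all add: bb_sym)
  have "bb (pd i (pd j \<nu>) p) (pd m \<sigma> p) = (pd i (PP j 1) p * gg 1 m p + pd i (PP j 2) p * gg 2 m p) +
      (PP j 1 p * (Gam i 1 1 p * gg 1 m p + Gam i 1 2 p * gg 2 m p) + PP j 2 p * (Gam i 2 1 p * gg 1 m p + Gam i 2 2 p * gg 2 m p))" for i j m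
  proof -
    have "pd i (pd j \<nu>) p = pd i (\<lambda>q. mat (PP j 1 q) ** pd 1 \<sigma> q + mat (PP j 2 q) ** pd 2 \<sigma> q) p"
      by (rule pd_cong[OF smooth_fun_pd[OF gsolD(2)[OF sol] UV] p pV]) (rule sol_pd_\<nu>)
    also have "\<dots> = (mat (pd i (PP j 1) p) ** pd 1 \<sigma> p + mat (PP j 1 p) ** pd i (pd 1 \<sigma>) p) +
       (mat (pd i (PP j 2) p) ** pd 2 \<sigma> p + mat (PP j 2 p) ** pd i (pd 2 \<sigma>) p)"
      by (simp add: pd_add matpd near nears pV)
    also note e = calculation
    show ?thesis unfolding e sol_pd_pd[OF p]
      by (simp add: bb_add bb_diff bb_scale sol_gram[OF p] n algebra_simps)
  qed
  then have c: "(pd 1 (PP 2 1) p * gg 1 m p + pd 1 (PP 2 2) p * gg 2 m p) +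
      (PP 2 1 p * (Gam 1 1 1 p * gg 1 m p + Gam 1 1 2 p * gg 2 m p) + PP 2 2 p * (Gam 1 2 1 p * gg 1 m p + Gam 1 2 2 p * gg 2 m p)) =
     (pd 2 (PP 1 1) p * gg 1 m p + pd 2 (PP 1 2) p * gg 2 m p) +
      (PP 1 1 p * (Gam 2 1 1 p * gg 1 m p + Gam 2 1 2 p * gg 2 m p) + PP 1 2 p * (Gam 2 2 1 p * gg 1 m p + Gam 2 2 2 p * gg 2 m p))" for m
    using pd_commute_cmat[OF gsolD(2)[OF sol] UV p, of 1 2] by metis
  have "(\<chi> l. Cod l p) = 0"
  proof (rule gg_kernel[OF pV])
    show "(\<chi> l. Cod l p) $ 1 * gg 1 1 p + (\<chi> l. Cod l p) $ 2 * gg 2 1 p = 0"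
      using c[of 1] by (simp add: Cod_def algebra_simps)
    show "(\<chi> l. Cod l p) $ 1 * gg 1 2 p + (\<chi> l. Cod l p) $ 2 * gg 2 2 p = 0"
      using c[of 2] by (simp add: Cod_def algebra_simps)
  qed
  then show "Cod l p = 0" by (simp add: vec_eq_iff)
  have "bb (pd l (pd i (pd j \<sigma>)) p) (pd m \<sigma> p) = (pd l (Gam i j 1) p * gg 1 m p + pd l (Gam i j 2) p * gg 2 m p) +
      (Gam i j 1 p * (Gam l 1 1 p * gg 1 m p + Gam l 1 2 p * gg 2 m p) + Gam i j 2 p * (Gam l 2 1 p * gg 1 m p + Gam l 2 2 p * gg 2 m p))
      - hh i j p * hh l m p + gg i j p * gg l m p" for l i j m
  proof -
    have "pd l (pd i (pd j \<sigma>)) p = pd l (\<lambda>q. ((mat (Gam i j 1 q) ** pd 1 \<sigma> q + mat (Gam i j 2 q) ** pd 2 \<sigma> q)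
     - mat (hh i j q) ** \<nu> q) + mat (gg i j q) ** \<sigma> q) p"
      by (rule pd_cong[OF smooth_fun_pd[OF smooth_fun_pd[OF gsolD(1)[OF sol] UV] UV] p pV]) (rule sol_pd_pd)
    also have "\<dots> = ((mat (pd l (Gam i j 1) p) ** pd 1 \<sigma> p + mat (Gam i j 1 p) ** pd l (pd 1 \<sigma>) p) +
       (mat (pd l (Gam i j 2) p) ** pd 2 \<sigma> p + mat (Gam i j 2 p) ** pd l (pd 2 \<sigma>) p) -
       (mat (pd l (hh i j) p) ** \<nu> p + mat (hh i j p) ** pd l \<nu> p)) +
       (mat (pd l (gg i j) p) ** \<sigma> p + mat (gg i j p) ** pd l \<sigma> p)"
      by (simp add: pd_add pd_diff matpd near nears pV smooth_near_add smooth_near_diff)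
    also note e = calculation
    show ?thesis unfolding e sol_pd_pd[OF p] sol_pd_\<nu>[OF p]
      by (simp add: bb_add bb_diff bb_scale sol_gram[OF p] n hh_def algebra_simps)
  qed
  then have "(pd 1 (Gam 2 1 1) p * gg 1 2 p + pd 1 (Gam 2 1 2) p * gg 2 2 p) +
      (Gam 2 1 1 p * (Gam 1 1 1 p * gg 1 2 p + Gam 1 1 2 p * gg 2 2 p) + Gam 2 1 2 p * (Gam 1 2 1 p * gg 1 2 p + Gam 1 2 2 p * gg 2 2 p))
      - hh 2 1 p * hh 1 2 p + gg 2 1 p * gg 1 2 p =
      (pd 2 (Gam 1 1 1) p * gg 1 2 p + pd 2 (Gam 1 1 2) p * gg 2 2 p) +
      (Gam 1 1 1 p * (Gam 2 1 1 p * gg 1 2 p + Gam 2 1 2 p * gg 2 2 p) + Gam 1 1 2 p * (Gam 2 2 1 p * gg 1 2 p + Gam 2 2 2 p * gg 2 2 p))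
      - hh 1 1 p * hh 2 2 p + gg 1 1 p * gg 2 2 p"
    using pd_commute_cmat[OF smooth_fun_pd[OF gsolD(1)[OF sol] UV] UV p, of 1 2] by metis
  then have 1: "Rl 1 2 p + (hh 1 1 p * hh 2 2 p - hh 2 1 p * hh 1 2 p) - dg p = 0"
    by (simp add: Rl_def Rm_def dg_def gg_sym[OF pV, of 2 1] algebra_simps)
  have 2: "hh 1 1 p * hh 2 2 p - hh 2 1 p * hh 1 2 p = PD p * dg p"
    by (simp add: hh_def PD_def dg_def gg_sym[OF pV, of 2 1] algebra_simps)
  have "(- 1 + PD p) * dg p + Rl 1 2 p = 0" using 1 unfolding 2 by (simp add: algebra_simps)
  then show "- Rl 1 2 p = (- 1 + PD p) * dg p" by (simp add: eq_neg_iff_add_eq_0[symmetric])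
qed

end

end

text \<open>Bootstrapping: the derivative is bilinear in the smooth coefficients and
  \<open>F\<close>, so each degree of smoothness of \<open>F\<close> yields the next.\<close>

lemma smooth_on_linear_system:
  fixes om :: "'z::euclidean_space \<Rightarrow> 'z \<Rightarrow> 'm::real_normed_vector"
  assumes U: "open U" and om: "\<And>w. smooth_on (\<lambda>z. om z w) U" and act: "bounded_bilinear act"
    and F: "\<And>z. z \<in> U \<Longrightarrow> (F has_derivative (\<lambda>w. act (om z w) (F z))) (at z)"
  shows "smooth_on F U"
proof -
  have "Ck_on k F U" for k
  proof (induction k)
    case 0
    then show ?case using has_derivative_continuous[OF F] by (simp add: continuous_at_imp_continuous_on)
  next
    case (Suc k)
    show ?case
      by (rule Ck_on_SucI[OF U F], assumption, rule Ck_on_bilinear[OF U act _ Suc]) (use om in \<open>simp add: smooth_on_def\<close>)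
  qed
  then show ?thesis by (simp add: smooth_on_def)
qed

text \<open>Coefficient matrices acting on frames: quadruples of matrices are combined linearly with
  complex scalars.\<close>

definition actc :: "complex^4^4 \<Rightarrow> cmat^4 \<Rightarrow> cmat^4" where
  "actc m X = (\<chi> \<alpha>. \<Sum>\<beta>\<in>UNIV. mat (m $ \<alpha> $ \<beta>) ** X $ \<beta>)"

lemma actc_nth: "actc m X $ \<alpha> $ i $ j = (\<Sum>\<beta>\<in>UNIV. m $ \<alpha> $ \<beta> * X $ \<beta> $ i $ j)"
  by (simp add: actc_def mat_mult_nth)

lemma actc_4: "actc m X $ \<alpha> = mat (m $ \<alpha> $ 1) ** X $ 1 + mat (m $ \<alpha> $ 2) ** X $ 2 + mat (m $ \<alpha> $ 3) ** X $ 3 + mat (m $ \<alpha> $ 4) ** X $ 4"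
  by (simp add: actc_def sum_4)

lemma bounded_bilinear_actc: "bounded_bilinear actc"
  unfolding bilinear_conv_bounded_bilinear[symmetric] bilinear_def
  by (intro conjI allI linearI) (simp_all add: vec_eq_iff actc_nth sum.distrib scaleR_sum_right algebra_simps)

lemma actc_mult: "actc m (actc n X) = actc (m ** n) X"
  by (simp add: vec_eq_iff actc_nth matrix_matrix_mult_def sum_4 algebra_simps)

text \<open>The action induced on Gram matrices: if a frame has derivative given by
  \<open>actc m\<close>, its Gram matrix for a bilinear form has derivative given by
  \<open>actt m\<close>.\<close>

definition actt :: "complex^4^4 \<Rightarrow> complex^4^4 \<Rightarrow> complex^4^4" where
  "actt m X = m ** X + X ** transpose m"

lemma bounded_bilinear_actt: "bounded_bilinear actt"
  unfolding bilinear_conv_bounded_bilinear[symmetric] bilinear_def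
  by (intro conjI allI linearI)
    (simp_all add: vec_eq_iff actt_def matrix_matrix_mult_def transpose_def sum.distrib scaleR_sum_right algebra_simps)

section \<open>The linear system of the moving frame and its flatness\<close>

context gc_chart
begin

text \<open>The structure equations: \<^term>\<open>CC i\<close> is the coefficient matrix of the derivative of the frame
  $(\sigma, \partial_1\sigma, \partial_2\sigma, \nu)$ along the coordinate of index \<^term>\<open>i\<close>, and HH, below, is the
  Gram matrix that this frame should have.\<close>

definition CC :: "2 \<Rightarrow> 'a \<Rightarrow> complex^4^4" where
  "CC i p = (\<chi> \<alpha> \<beta>.
     if \<alpha> = 1 then (if \<beta> = 1 then 0 else if \<beta> = 2 then (if i = 1 then 1 else 0) else if \<beta> = 3 then (if i = 2 then 1 else 0) else 0)
     else if \<alpha> = 2 then (if \<beta> = 1 then gg i 1 p else if \<beta> = 2 then Gam i 1 1 p else if \<beta> = 3 then Gam i 1 2 p else - hh i 1 p)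
     else if \<alpha> = 3 then (if \<beta> = 1 then gg i 2 p else if \<beta> = 2 then Gam i 2 1 p else if \<beta> = 3 then Gam i 2 2 p else - hh i 2 p)
     else (if \<beta> = 1 then 0 else if \<beta> = 2 then PP i 1 p else if \<beta> = 3 then PP i 2 p else 0))"

lemma CC_nth:
  "CC i p $ 1 $ 1 = 0" "CC i p $ 1 $ 2 = (if i = 1 then 1 else 0)" "CC i p $ 1 $ 3 = (if i = 2 then 1 else 0)" "CC i p $ 1 $ 4 = 0"
  "CC i p $ 2 $ 1 = gg i 1 p" "CC i p $ 2 $ 2 = Gam i 1 1 p" "CC i p $ 2 $ 3 = Gam i 1 2 p" "CC i p $ 2 $ 4 = - hh i 1 p"
  "CC i p $ 3 $ 1 = gg i 2 p" "CC i p $ 3 $ 2 = Gam i 2 1 p" "CC i p $ 3 $ 3 = Gam i 2 2 p" "CC i p $ 3 $ 4 = - hh i 2 p"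
  "CC i p $ 4 $ 1 = 0" "CC i p $ 4 $ 2 = PP i 1 p" "CC i p $ 4 $ 3 = PP i 2 p" "CC i p $ 4 $ 4 = 0"
  by (simp_all add: CC_def)

definition HH :: "'a \<Rightarrow> complex^4^4" where
  "HH p = (\<chi> \<alpha> \<beta>.
     if \<alpha> = 1 then (if \<beta> = 1 then - 1 else 0)
     else if \<alpha> = 2 then (if \<beta> = 1 then 0 else if \<beta> = 2 then gg 1 1 p else if \<beta> = 3 then gg 1 2 p else 0)
     else if \<alpha> = 3 then (if \<beta> = 1 then 0 else if \<beta> = 2 then gg 2 1 p else if \<beta> = 3 then gg 2 2 p else 0)
     else (if \<beta> = 1 then 0 else if \<beta> = 2 then 0 else if \<beta> = 3 then 0 else 1))"

lemma HH_nth: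
  "HH p $ 1 $ 1 = - 1" "HH p $ 1 $ 2 = 0" "HH p $ 1 $ 3 = 0" "HH p $ 1 $ 4 = 0"
  "HH p $ 2 $ 1 = 0" "HH p $ 2 $ 2 = gg 1 1 p" "HH p $ 2 $ 3 = gg 1 2 p" "HH p $ 2 $ 4 = 0"
  "HH p $ 3 $ 1 = 0" "HH p $ 3 $ 2 = gg 2 1 p" "HH p $ 3 $ 3 = gg 2 2 p" "HH p $ 3 $ 4 = 0"
  "HH p $ 4 $ 1 = 0" "HH p $ 4 $ 2 = 0" "HH p $ 4 $ 3 = 0" "HH p $ 4 $ 4 = 1"
  by (simp_all add: HH_def)

lemma hh_smooth: "smooth_fun S \<A> V (hh i j)"
  unfolding hh_def[abs_def] by (intro smooth_fun_add smooth_fun_mult PP_smooth gg_smooth)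

lemma hh_near: "p \<in> V \<Longrightarrow> smooth_near S \<A> p (hh i j)"
  by (rule smooth_nearI[OF hh_smooth])

lemma CC_smooth: "smooth_fun S \<A> V (CC i)"
proof (rule smooth_fun_vec, rule smooth_fun_vec)
  fix \<alpha> \<beta>
  show "smooth_fun S \<A> V (\<lambda>q. CC i q $ \<alpha> $ \<beta>)"
    using exhaust_4[of \<alpha>] exhaust_4[of \<beta>]
    by (elim disjE) (simp_all add: CC_nth smooth_fun_const[OF V_openin] gg_smooth Gam_smooth PP_smooth smooth_fun_minus hh_smooth)
qed

lemma HH_smooth: "smooth_fun S \<A> V HH"
proof (rule smooth_fun_vec, rule smooth_fun_vec)
  fix \<alpha> \<beta>
  show "smooth_fun S \<A> V (\<lambda>q. HH q $ \<alpha> $ \<beta>)"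
    using exhaust_4[of \<alpha>] exhaust_4[of \<beta>]
    by (elim disjE) (simp_all add: HH_nth smooth_fun_const[OF V_openin] gg_smooth)
qed

lemma pd_minus: "smooth_near S \<A> p f \<Longrightarrow> p \<in> V \<Longrightarrow> pd i (\<lambda>q. - f q) p = - pd i f p"
  by (rule pd_linear[OF _ _ bounded_linear_minus[OF bounded_linear_ident]])

lemma pd_nth_nth: "smooth_fun S \<A> V f \<Longrightarrow> p \<in> V \<Longrightarrow> pd i f p $ \<alpha> $ \<beta> = pd i (\<lambda>q. f q $ \<alpha> $ \<beta>) p"
  for f :: "'a \<Rightarrow> complex^4^4"
  using pd_nth[OF smooth_nearI[OF smooth_fun_nth[of V f \<alpha>]], of p i \<beta>] pd_nth[OF smooth_nearI[of V f p], of i \<alpha>] by simp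

text \<open>The prescribed Gram matrix obeys the equation satisfied by the Gram matrix of any
  solution: \<open>pd_gg\<close> for the metric block, and for the mixed entries the definition of
  \<open>hh\<close> and the symmetry of \<open>gg\<close>.\<close>

lemma HH_derivative:
  assumes p: "p \<in> V"
  shows "pd i HH p = actt (CC i p) (HH p)"
  unfolding vec_eq_iff forall_4 pd_nth_nth[OF HH_smooth p] actt_def vector_add_component matrix_matrix_mult_def transpose_def
    vec_lambda_beta sum_4 HH_nth CC_nth pd_const pd_gg[OF p]
  using exhaust_2[of i]
  by (auto simp: hh_def gg_sym[OF p, of 2 1] algebra_simps)

context
  assumes codazzi: "\<And>p l. p \<in> V \<Longrightarrow> Cod l p = 0"
    and gauss: "\<And>p. p \<in> V \<Longrightarrow> - Rl 1 2 p = (- 1 + PD p) * dg p"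
begin

text \<open>With the index \<open>l\<close> lowered, the deviation \<open>Q\<close> is skew in its
  two indices, so the one scalar Gauss equation annihilates it; \<open>gg_kernel\<close> raises the
  index again.\<close>

lemma gauss_full:
  assumes p: "p \<in> V"
  shows "Rm j l p = hh 2 j p * PP 1 l p - hh 1 j p * PP 2 l p - gg 2 j p * (if l = 1 then 1 else 0) + gg 1 j p * (if l = 2 then 1 else 0)"
proof -
  define Q where "Q j l = Rm j l p - hh 2 j p * PP 1 l p + hh 1 j p * PP 2 l p + gg 2 j p * (if l = 1 then 1 else 0) - gg 1 j p * (if l = 2 then 1 else 0)" for j l
  have low: "Q j 1 * gg 1 m p + Q j 2 * gg 2 m p = Rl j m p - hh 2 j p * hh 1 m p + hh 1 j p * hh 2 m p + gg 2 j p * gg 1 m p - gg 1 j p * gg 2 m p" for j m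
    by (simp add: Q_def Rl_def hh_def algebra_simps)
  have r: "Rl 1 1 p = 0" "Rl 2 2 p = 0" "Rl 2 1 p = - Rl 1 2 p"
    using Rl_antisym[OF p, of 1 1] Rl_antisym[OF p, of 2 2] Rl_antisym[OF p, of 1 2] by (simp_all add: add_eq_0_iff)
  have hd: "hh 1 1 p * hh 2 2 p - hh 2 1 p * hh 1 2 p = PD p * dg p"
    by (simp add: hh_def PD_def dg_def gg_sym[OF p, of 2 1] algebra_simps)
  have "Rl 1 2 p - hh 2 1 p * hh 1 2 p + hh 1 1 p * hh 2 2 p + gg 2 1 p * gg 1 2 p - gg 1 1 p * gg 2 2 p
     = Rl 1 2 p + (hh 1 1 p * hh 2 2 p - hh 2 1 p * hh 1 2 p) - dg p"
    by (simp add: dg_def gg_sym[OF p, of 2 1] algebra_simps)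
  also have "\<dots> = 0" unfolding hd using gauss[OF p] by (simp add: algebra_simps eq_neg_iff_add_eq_0 neg_eq_iff_add_eq_0)
  finally have l12: "Q 1 1 * gg 1 2 p + Q 1 2 * gg 2 2 p = 0" by (simp only: low)
  have l21: "Q 2 1 * gg 1 1 p + Q 2 2 * gg 2 1 p = - (Q 1 1 * gg 1 2 p + Q 1 2 * gg 2 2 p)"
    unfolding low by (simp add: r hh_sym[OF p, of 2 1] gg_sym[OF p, of 2 1] algebra_simps)
  have l11: "Q 1 1 * gg 1 1 p + Q 1 2 * gg 2 1 p = 0" "Q 2 1 * gg 1 2 p + Q 2 2 * gg 2 2 p = 0"
    unfolding low by (simp_all add: r hh_sym[OF p, of 2 1] gg_sym[OF p, of 2 1])
  have "(\<chi> l. Q 1 l) = 0" by (rule gg_kernel[OF p]) (use l11 l12 in simp_all)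
  moreover have "(\<chi> l. Q 2 l) = 0" by (rule gg_kernel[OF p]) (use l11 l12 l21 in simp_all)
  ultimately have "Q j l = 0" using exhaust_2[of j] by (auto simp: vec_eq_iff)
  then show ?thesis by (simp add: Q_def algebra_simps)
qed

text \<open>Codazzi solved for one derivative, oriented as a rewrite rule. \<open>pd_hh\<close> is
  the same equation with the index lowered, and \<open>pd_Gam\<close> does this for Gauss.\<close>

lemma pd_PP: "p \<in> V \<Longrightarrow> pd 1 (PP 2 l) p = pd 2 (PP 1 l) p
     - (PP 2 1 p * Gam 1 1 l p + PP 2 2 p * Gam 1 2 l p)
     + (PP 1 1 p * Gam 2 1 l p + PP 1 2 p * Gam 2 2 l p)"
  using codazzi[of p l] by (simp add: Cod_def algebra_simps)

lemma pd_hh: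
  assumes p: "p \<in> V"
  shows "pd 1 (hh 2 j) p = pd 2 (hh 1 j) p + (Gam 1 j 1 p * hh 2 1 p + Gam 1 j 2 p * hh 2 2 p)
     - (Gam 2 j 1 p * hh 1 1 p + Gam 2 j 2 p * hh 1 2 p)"
proof -
  have e: "pd i (hh k j) p = (pd i (PP k 1) p * gg 1 j p + PP k 1 p * pd i (gg 1 j) p) + (pd i (PP k 2) p * gg 2 j p + PP k 2 p * pd i (gg 2 j) p)" for i k
    unfolding hh_def[abs_def] using p by (simp add: pd_add pd_mult smooth_near_mult PP_near gg_near)
  show ?thesis
    unfolding e pd_PP[OF p] pd_gg[OF p] by (simp add: hh_def gg_sym[OF p, of 2 1] algebra_simps)
qed

lemma pd_Gam:
  assumes p: "p \<in> V"
  shows "pd 1 (Gam 2 j l) p = pd 2 (Gam 1 j l) p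
     - (Gam 2 j 1 p * Gam 1 1 l p + Gam 2 j 2 p * Gam 1 2 l p)
     + (Gam 1 j 1 p * Gam 2 1 l p + Gam 1 j 2 p * Gam 2 2 l p)
     + (hh 2 j p * PP 1 l p - hh 1 j p * PP 2 l p - gg 2 j p * (if l = 1 then 1 else 0) + gg 1 j p * (if l = 2 then 1 else 0))"
  using gauss_full[OF p, of j l] unfolding Rm_def by (simp add: algebra_simps)

text \<open>The block of Christoffel symbols is the Gauss equation; the last column and the last row
  are Codazzi in its two forms. The remaining entries hold by vanishing torsion, compatibility with
  the metric, and self-adjointness of \<open>\<Psi>\<close>.\<close>

lemma CC_flat:
  assumes p: "p \<in> V"
  shows "pd 1 (CC 2) p - pd 2 (CC 1) p = CC 1 p ** CC 2 p - CC 2 p ** CC 1 p"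
proof -
  have ph: "PP 1 1 p * hh 2 1 p + PP 1 2 p * hh 2 2 p = PP 2 1 p * hh 1 1 p + PP 2 2 p * hh 1 2 p"
    by (simp add: hh_def gg_sym[OF p, of 2 1] algebra_simps)
  have h21: "PP 1 1 p * gg 2 1 p + PP 1 2 p * gg 2 2 p = PP 2 1 p * gg 1 1 p + PP 2 2 p * gg 1 2 p"
    using hh_sym[OF p, of 1 2] by (simp add: hh_def gg_sym[OF p, of 2 1])
  have pm: "pd i (\<lambda>q. - hh k j q) p = - pd i (hh k j) p" for i k j by (rule pd_minus[OF hh_near[OF p] p])
  show ?thesis
    unfolding vec_eq_iff forall_4 vector_minus_component pd_nth_nth[OF CC_smooth p] matrix_matrix_mult_def
      vec_lambda_beta sum_4 CC_nth pd_const pm pd_gg[OF p] pd_Gam[OF p] pd_hh[OF p] pd_PP[OF p]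
    using ph h21
    by (simp add: gg_sym[OF p, of 2 1] hh_sym[OF p, of 2 1] Gam_sym[OF p, of 2 1] algebra_simps)
qed

end

end

section \<open>Local existence and uniqueness\<close>

context gc_data
begin

text \<open>The value 0 outside the tangent space makes equality of jets the equality of first-order data, in a
  form independent of charts.\<close>

definition jet :: "('a \<Rightarrow> cmat) \<Rightarrow> ('a \<Rightarrow> cmat) \<Rightarrow> 'a \<Rightarrow> cmat \<times> ('a cvec \<Rightarrow> cmat) \<times> cmat" where
  "jet \<sigma> \<nu> p = (\<sigma> p, (\<lambda>v. if v \<in> ctangent_space S \<A> p then pushforward \<sigma> v else 0), \<nu> p)"

text \<open>The fibre of the covering: the algebraic relations satisfied by the jet of a solution at
  \<open>p\<close>. \<open>L\<close> is 0 off the tangent space, as in \<open>jet\<close>, because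
  members are compared as functions.\<close>

definition adapted_frames :: "'a \<Rightarrow> (cmat \<times> ('a cvec \<Rightarrow> cmat) \<times> cmat) set" where
  "adapted_frames p = {(A, L, N). bb A A = - 1 \<and> bb N N = 1 \<and> bb N A = 0 \<and> (\<forall>v. v \<notin> ctangent_space S \<A> p \<longrightarrow> L v = 0) \<and>
     (\<forall>v\<in>ctangent_space S \<A> p. bb (L v) A = 0 \<and> bb N (L v) = 0 \<and> (\<forall>c. L (vscale c v) = mat c ** L v) \<and>
        (\<forall>w\<in>ctangent_space S \<A> p. L (vadd v w) = L v + L w \<and> bb (L v) (L w) = g p v w))}"

lemma jet_eq_iff:
  "jet \<sigma> \<nu> p = jet \<sigma>' \<nu>' p \<longleftrightarrow>
     \<sigma> p = \<sigma>' p \<and> \<nu> p = \<nu>' p \<and> (\<forall>v\<in>ctangent_space S \<A> p. pushforward \<sigma> v = pushforward \<sigma>' v)"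
  by (auto simp: jet_def fun_eq_iff)

lemma jet_adapted:
  assumes s: "gsol U \<sigma> \<nu>" and p: "p \<in> U"
  shows "jet \<sigma> \<nu> p \<in> adapted_frames p"
proof -
  note d = gsolD[OF s]
  have pS: "p \<in> S" using p d(4) by blast
  obtain V \<phi> where "surface_chart S \<A> V \<phi>" and pV: "p \<in> V" using chart_at[OF pS] .
  then interpret surface_chart S \<A> V \<phi> by simp
  have cl: "vadd v w \<in> ctangent_space S \<A> p" "vscale c v \<in> ctangent_space S \<A> p"
    if "v \<in> ctangent_space S \<A> p" "w \<in> ctangent_space S \<A> p" for v w c
    using that by (auto simp: ctangent_eq[OF pV] vadd_dv vscale_dv)
  show ?thesis
    unfolding adapted_frames_def jet_def
    using d(5-8,10)[OF p] pushforward_tangent[OF d(1,5) p] cl by (simp add: pushforward_vadd pushforward_vscale)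
qed

lemma gsol_subset:
  assumes s: "gsol U \<sigma> \<nu>" and U': "openin (top_of_set S) U'" "U' \<subseteq> U"
  shows "gsol U' \<sigma> \<nu>"
proof -
  have "smooth_fun S \<A> U' \<sigma>" "smooth_fun S \<A> U' \<nu>"
    by (rule smooth_fun_subset[OF gsolD(1)[OF s] U'], rule smooth_fun_subset[OF gsolD(2)[OF s] U'])
  then show ?thesis unfolding gsol_def using gsolD(5-10)[OF s] U'(2) by blast
qed

lemma gsol_cong:
  assumes s: "gsol U \<sigma> \<nu>" and eq: "\<And>q. q \<in> U \<Longrightarrow> \<sigma> q = \<sigma>' q" "\<And>q. q \<in> U \<Longrightarrow> \<nu> q = \<nu>' q"
  shows "gsol U \<sigma>' \<nu>'"
proof -
  note d = gsolD[OF s]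
  have "pushforward \<sigma>' v = pushforward \<sigma> v" "pushforward \<nu>' v = pushforward \<nu> v"
    if "p \<in> U" "v \<in> ctangent_space S \<A> p" for p v
    by (rule pushforward_germ[OF that(2) d(1) that(1) eq(1), symmetric], assumption,
        rule pushforward_germ[OF that(2) d(2) that(1) eq(2), symmetric], assumption)
  moreover have "\<Psi> p v \<in> ctangent_space S \<A> p" if "p \<in> U" "v \<in> ctangent_space S \<A> p" for p v
    using \<Psi>_in that d(4) by blast
  ultimately show ?thesis
    unfolding gsol_def using smooth_fun_cong[OF d(1) eq(1)] smooth_fun_cong[OF d(2) eq(2)] d(5-10) eq by simp
qed

lemma gsol_local:
  assumes U: "openin (top_of_set S) U" and loc: "\<And>p. p \<in> U \<Longrightarrow> \<exists>N. p \<in> N \<and> gsol N \<sigma> \<nu>"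
  shows "gsol U \<sigma> \<nu>"
proof -
  have "smooth_fun S \<A> U \<sigma>" "smooth_fun S \<A> U \<nu>"
    by (rule smooth_fun_local[OF U], use loc gsolD(1) in metis, rule smooth_fun_local[OF U], use loc gsolD(2) in metis)
  then show ?thesis
    unfolding gsol_def using loc gsolD(5-10) by metis
qed

end

context gc_chart
begin

lemma adapted_dv:
  assumes p: "p \<in> V" and f: "(A, L, N) \<in> adapted_frames p"
  shows "L (dv p a) = mat (a $ 1) ** L (fr 1 p) + mat (a $ 2) ** L (fr 2 p)"
proof -
  note c = f[unfolded adapted_frames_def mem_Collect_eq prod.case]
  have ad: "L (vadd v w) = L v + L w" if "v \<in> ctangent_space S \<A> p" "w \<in> ctangent_space S \<A> p" for v w
    using c that by simp
  have sc: "L (vscale c v) = mat c ** L v" if "v \<in> ctangent_space S \<A> p" for v c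
    using c that by simp
  show ?thesis unfolding dv_frame[of p a] by (simp add: ad sc vscale_in fr_in p)
qed

text \<open>The connection form of the system as a matrix-valued one-form on the chart
  image.\<close>

definition om :: "real^2 \<Rightarrow> real^2 \<Rightarrow> complex^4^4" where
  "om z w = w $ 1 *\<^sub>R CC 1 (inv_into V \<phi> z) + w $ 2 *\<^sub>R CC 2 (inv_into V \<phi> z)"

definition fv :: "('a \<Rightarrow> cmat) \<Rightarrow> ('a \<Rightarrow> cmat) \<Rightarrow> 'a \<Rightarrow> cmat^4" where
  "fv \<sigma> \<nu> p = (\<chi> \<alpha>. if \<alpha> = 1 then \<sigma> p else if \<alpha> = 2 then pd 1 \<sigma> p else if \<alpha> = 3 then pd 2 \<sigma> p else \<nu> p)"

lemma fv_nth: "fv \<sigma> \<nu> p $ 1 = \<sigma> p" "fv \<sigma> \<nu> p $ 2 = pd 1 \<sigma> p" "fv \<sigma> \<nu> p $ 3 = pd 2 \<sigma> p" "fv \<sigma> \<nu> p $ 4 = \<nu> p"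
  by (simp_all add: fv_def)

lemma linear_om: "linear (om z)"
  by (rule linearI) (simp_all add: om_def algebra_simps)

lemma smooth_on_CC: "smooth_on (\<lambda>z. CC i (inv_into V \<phi> z)) (\<phi> ` V)"
  using smooth_fun_on_chart[OF CC_smooth order_refl] by (simp add: o_def)

lemma smooth_on_om: "W \<subseteq> \<phi> ` V \<Longrightarrow> open W \<Longrightarrow> smooth_on (\<lambda>z. om z w) W"
proof -
  assume W: "W \<subseteq> \<phi> ` V" "open W"
  have "smooth_on (\<lambda>z. CC i (inv_into V \<phi> z)) W" for i by (rule smooth_on_subset[OF smooth_on_CC W(1)])
  then show ?thesis
    unfolding om_def
    by (intro smooth_on_add[OF W(2)] smooth_on_linear_compose[OF W(2) bounded_linear_scaleR_right])
qed

lemma om_derivative: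
  assumes z: "z \<in> \<phi> ` V"
  shows "((\<lambda>x. om x w) has_derivative (\<lambda>h. w $ 1 *\<^sub>R (h $ 1 *\<^sub>R pd 1 (CC 1) (inv_into V \<phi> z) + h $ 2 *\<^sub>R pd 2 (CC 1) (inv_into V \<phi> z))
     + w $ 2 *\<^sub>R (h $ 1 *\<^sub>R pd 1 (CC 2) (inv_into V \<phi> z) + h $ 2 *\<^sub>R pd 2 (CC 2) (inv_into V \<phi> z)))) (at z)"
proof -
  define p where "p = inv_into V \<phi> z"
  have p: "p \<in> V" "\<phi> p = z" using z by (simp_all add: p_def inv_into_into f_inv_into_f)
  have "((\<lambda>x. CC i (inv_into V \<phi> x)) has_derivative (\<lambda>w. w $ 1 *\<^sub>R pd 1 (CC i) p + w $ 2 *\<^sub>R pd 2 (CC i) p)) (at z)" for i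
    using has_pd[OF smooth_nearI[OF CC_smooth p(1)] p(1)] by (simp add: p(2) o_def)
  then show ?thesis
    unfolding om_def p_def[symmetric]
    by (intro has_derivative_add has_derivative_scaleR_right)
qed

lemma fv_derivative:
  assumes s: "gsol U \<sigma> \<nu>" and U: "U \<subseteq> V" and p: "p \<in> U"
  shows "((\<lambda>z. fv \<sigma> \<nu> (inv_into V \<phi> z)) has_derivative (\<lambda>w. actc (om (\<phi> p) w) (fv \<sigma> \<nu> p))) (at (\<phi> p))"
proof (rule has_derivative_vecI)
  have pV: "p \<in> V" using p U by blast
  note near = sol_near[OF s U p]
  define F where "F \<alpha> = (if \<alpha> = 1 then \<sigma> else if \<alpha> = 2 then pd 1 \<sigma> else if \<alpha> = 3 then pd 2 \<sigma> else \<nu>)" for \<alpha> :: 4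
  fix \<alpha> :: 4
  have "((F \<alpha> \<circ> inv_into V \<phi>) has_derivative (\<lambda>w. w $ 1 *\<^sub>R pd 1 (F \<alpha>) p + w $ 2 *\<^sub>R pd 2 (F \<alpha>) p)) (at (\<phi> p))"
    by (rule has_pd[OF _ pV]) (use near in \<open>simp add: F_def\<close>)
  moreover have "F \<alpha> \<circ> inv_into V \<phi> = (\<lambda>z. fv \<sigma> \<nu> (inv_into V \<phi> z) $ \<alpha>)"
    by (simp add: fun_eq_iff F_def fv_def)
  moreover have "w $ 1 *\<^sub>R pd 1 (F \<alpha>) p + w $ 2 *\<^sub>R pd 2 (F \<alpha>) p = actc (om (\<phi> p) w) (fv \<sigma> \<nu> p) $ \<alpha>" for w
  proof -
    have c: "X = Y \<longleftrightarrow> (\<forall>i j. X $ i $ j = Y $ i $ j)" for X Y :: cmat by (simp add: vec_eq_iff)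
    show ?thesis
      unfolding c
      using exhaust_4[of \<alpha>]
      by (elim disjE) (simp_all add: F_def actc_nth sum_4 om_def \<psi>\<phi>[OF pV] fv_nth CC_nth sol_pd_pd[OF s U p] sol_pd_\<nu>[OF s U p]
          mat_mult_nth scaleR_conv_of_real[where 'a = complex] algebra_simps)
  qed
  ultimately show "((\<lambda>z. fv \<sigma> \<nu> (inv_into V \<phi> z) $ \<alpha>) has_derivative (\<lambda>w. actc (om (\<phi> p) w) (fv \<sigma> \<nu> p) $ \<alpha>)) (at (\<phi> p))"
    by simp
qed

lemma jet_eq_fv:
  assumes p: "p \<in> V" and n: "smooth_near S \<A> p \<sigma>" "smooth_near S \<A> p \<sigma>'"
  shows "jet \<sigma> \<nu> p = jet \<sigma>' \<nu>' p \<longleftrightarrow> fv \<sigma> \<nu> p = fv \<sigma>' \<nu>' p"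
proof
  assume "jet \<sigma> \<nu> p = jet \<sigma>' \<nu>' p"
  then have j: "\<sigma> p = \<sigma>' p" "\<nu> p = \<nu>' p" "pushforward \<sigma> (fr i p) = pushforward \<sigma>' (fr i p)" for i
    using fr_in[OF p] by (simp_all add: jet_eq_iff)
  show "fv \<sigma> \<nu> p = fv \<sigma>' \<nu>' p"
    using j(1,2) j(3)[of 1] j(3)[of 2] by (simp add: vec_eq_iff[where 'b = 4] forall_4 fv_nth pushforward_fr[OF p] n)
next
  assume e: "fv \<sigma> \<nu> p = fv \<sigma>' \<nu>' p"
  have "fv \<sigma> \<nu> p $ \<alpha> = fv \<sigma>' \<nu>' p $ \<alpha>" for \<alpha> using e by simp
  from this[of 1] this[of 2] this[of 3] this[of 4]
  show "jet \<sigma> \<nu> p = jet \<sigma>' \<nu>' p"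
    by (auto simp: jet_eq_iff ctangent_eq[OF p] fv_nth pushforward_dv[OF p] n)
qed

text \<open>The difference of the two frames solves the same linear system and vanishes at
  \<open>q\<close>; convexity of \<open>W\<close> supplies the segments for
  \<open>linear_system_zero\<close>.\<close>

lemma gsol_unique:
  assumes W: "open W" "convex W" "W \<subseteq> \<phi> ` V"
    and s: "gsol (inv_into V \<phi> ` W) \<sigma> \<nu>" "gsol (inv_into V \<phi> ` W) \<sigma>' \<nu>'"
    and q: "q \<in> inv_into V \<phi> ` W" "jet \<sigma> \<nu> q = jet \<sigma>' \<nu>' q" and x: "x \<in> inv_into V \<phi> ` W"
  shows "jet \<sigma> \<nu> x = jet \<sigma>' \<nu>' x"
proof -
  let ?U = "inv_into V \<phi> ` W"
  have UV: "?U \<subseteq> V" using W(3) by (auto simp: inv_into_into subset_iff)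
  have mem: "inv_into V \<phi> z \<in> ?U" "\<phi> (inv_into V \<phi> z) = z" if "z \<in> W" for z
    using that W(3) by (auto simp: f_inv_into_f subset_iff)
  obtain z0 where z0: "z0 \<in> W" "q = inv_into V \<phi> z0" using q(1) by blast
  obtain z where z: "z \<in> W" "x = inv_into V \<phi> z" using x by blast
  have jf: "jet \<sigma> \<nu> y = jet \<sigma>' \<nu>' y \<longleftrightarrow> fv \<sigma> \<nu> y = fv \<sigma>' \<nu>' y" if "y \<in> ?U" for y
    by (rule jet_eq_fv[OF subsetD[OF UV that] sol_near(1)[OF s(1) UV that] sol_near(1)[OF s(2) UV that]])
  define u where "u z = fv \<sigma> \<nu> (inv_into V \<phi> z) - fv \<sigma>' \<nu>' (inv_into V \<phi> z)" for z
  have "u z = 0"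
  proof (rule linear_system_zero[OF bounded_bilinear_actc W(2) z0(1) z(1)])
    show "continuous_on W (\<lambda>z. om z w)" for w by (rule smooth_on_continuous[OF smooth_on_om[OF W(3,1)]])
    show "u z0 = 0" using q(2) jf[OF q(1)] by (simp add: u_def z0(2))
    fix y assume y: "y \<in> W"
    have "(u has_derivative (\<lambda>w. actc (om y w) (fv \<sigma> \<nu> (inv_into V \<phi> y)) - actc (om y w) (fv \<sigma>' \<nu>' (inv_into V \<phi> y)))) (at y)"
      unfolding u_def[abs_def]
      using has_derivative_diff[OF fv_derivative[OF s(1) UV mem(1)[OF y]] fv_derivative[OF s(2) UV mem(1)[OF y]]] mem(2)[OF y] by simp
    then show "(u has_derivative (\<lambda>w. actc (om y w) (u y))) (at y)"
      by (simp add: u_def bounded_bilinear.diff_right[OF bounded_bilinear_actc])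
  qed
  then show ?thesis using jf[OF x] by (simp add: u_def z(2))
qed

context
  assumes codazzi: "\<And>p l. p \<in> V \<Longrightarrow> Cod l p = 0"
    and gauss: "\<And>p. p \<in> V \<Longrightarrow> - Rl 1 2 p = (- 1 + PD p) * dg p"
begin

text \<open>Flatness yields a frame \<open>F\<close> with the initial value encoded in
  \<open>b\<close>. Two things remain: that it keeps its Gram matrix, and that its two middle
  entries really are the derivatives of the first.\<close>

lemma gsol_exists:
  assumes W: "open W" "convex W" "W \<subseteq> \<phi> ` V" and q: "q \<in> inv_into V \<phi> ` W" and b: "b \<in> adapted_frames q"
  shows "\<exists>\<sigma> \<nu>. gsol (inv_into V \<phi> ` W) \<sigma> \<nu> \<and> jet \<sigma> \<nu> q = b"
proof -
  let ?U = "inv_into V \<phi> ` W"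
  have UV: "?U \<subseteq> V" using W(3) by (auto simp: inv_into_into subset_iff)
  have mem: "inv_into V \<phi> z \<in> ?U" "\<phi> (inv_into V \<phi> z) = z" "inv_into V \<phi> z \<in> V" if "z \<in> W" for z
    using that W(3) by (auto simp: f_inv_into_f inv_into_into subset_iff)
  obtain z0 where z0: "z0 \<in> W" "q = inv_into V \<phi> z0" using q(1) by blast
  have qV: "q \<in> V" using q UV by blast
  obtain A L N where bd: "b = (A, L, N)" by (cases b)
  note fc = b[unfolded bd adapted_frames_def mem_Collect_eq prod.case]
  have Ldv: "L (dv q a) = mat (a $ 1) ** L (fr 1 q) + mat (a $ 2) ** L (fr 2 q)" for a
    by (rule adapted_dv[OF qV b[unfolded bd]])
  have gr: "bb A A = - 1" "bb N N = 1" "bb N A = 0" "bb (L (fr i q)) A = 0" "bb N (L (fr i q)) = 0"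
    "bb (L (fr i q)) (L (fr j q)) = gg i j q" for i j
    using fc fr_in[OF qV] by (simp_all add: gg_def)
  have gr': "bb A N = 0" "bb A (L (fr i q)) = 0" "bb (L (fr i q)) N = 0" for i using gr(3-5) by (simp_all add: bb_sym)
  define x0 :: "cmat^4" where "x0 = (\<chi> \<alpha>. if \<alpha> = 1 then A else if \<alpha> = 2 then L (fr 1 q) else if \<alpha> = 3 then L (fr 2 q) else N)"
  have x0: "x0 $ 1 = A" "x0 $ 2 = L (fr 1 q)" "x0 $ 3 = L (fr 2 q)" "x0 $ 4 = N" by (simp_all add: x0_def)
  define omd where "omd z w h = w $ 1 *\<^sub>R (h $ 1 *\<^sub>R pd 1 (CC 1) (inv_into V \<phi> z) + h $ 2 *\<^sub>R pd 2 (CC 1) (inv_into V \<phi> z))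
     + w $ 2 *\<^sub>R (h $ 1 *\<^sub>R pd 1 (CC 2) (inv_into V \<phi> z) + h $ 2 *\<^sub>R pd 2 (CC 2) (inv_into V \<phi> z))" for z w h :: "real^2"
  have "\<exists>F. F z0 = x0 \<and> (\<forall>z\<in>W. (F has_derivative (\<lambda>w. actc (om z w) (F z))) (at z))"
  proof (rule linear_flat_system[OF bounded_bilinear_actc W(1,2) z0(1) linear_om])
    fix z w assume z: "z \<in> W"
    show "((\<lambda>x. om x w) has_derivative omd z w) (at z)"
      unfolding omd_def[abs_def] by (rule om_derivative) (use z W(3) in blast)
  next
    fix w h
    have "smooth_on (\<lambda>z. pd i (CC j) (inv_into V \<phi> z)) W" for i j
      using smooth_on_subset[OF smooth_fun_on_chart[OF smooth_fun_pd[OF CC_smooth order_refl] order_refl] W(3)] by (simp add: o_def)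
    then have "continuous_on W (\<lambda>z. pd i (CC j) (inv_into V \<phi> z))" for i j by (rule smooth_on_continuous)
    then show "continuous_on W (\<lambda>z. omd z w h)" unfolding omd_def by (intro continuous_intros)
  next
    fix z w h x assume z: "z \<in> W"
    let ?p = "inv_into V \<phi> z"
    have f: "pd 1 (CC 2) ?p = pd 2 (CC 1) ?p + CC 1 ?p ** CC 2 ?p - CC 2 ?p ** CC 1 ?p"
      using CC_flat[OF codazzi gauss mem(3)[OF z]] by (simp add: algebra_simps)
    have s: "(r *\<^sub>R X) ** Y = r *\<^sub>R (X ** Y)" "Y ** (r *\<^sub>R X) = r *\<^sub>R (Y ** X)" for r and X Y :: "complex^4^4"
      by (simp_all add: matrix_matrix_mult_def vec_eq_iff scaleR_sum_right)
    have rdist: "(X + Y) ** Z = X ** Z + Y ** Z" for X Y Z :: "complex^4^4"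
      by (simp add: matrix_matrix_mult_def vec_eq_iff sum.distrib distrib_right)
    have "omd z w h - omd z h w = om z h ** om z w - om z w ** om z h"
      unfolding omd_def om_def f
      by (simp add: s matrix_add_ldistrib rdist algebra_simps)
    then have "actc (omd z w h - omd z h w) x = actc (om z h ** om z w - om z w ** om z h) x" by simp
    then show "actc (omd z w h) x - actc (omd z h w) x = actc (om z h) (actc (om z w) x) - actc (om z w) (actc (om z h) x)"
      by (simp add: bounded_bilinear.diff_left[OF bounded_bilinear_actc] actc_mult)
  qed
  then obtain F where F0: "F z0 = x0" and F: "\<And>z. z \<in> W \<Longrightarrow> (F has_derivative (\<lambda>w. actc (om z w) (F z))) (at z)" by blast
  have Fs: "smooth_on F W" by (rule smooth_on_linear_system[OF W(1) smooth_on_om[OF W(3,1)] bounded_bilinear_actc F])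
  \<comment> \<open>The error of the Gram relations. It starts at 0 and satisfies the linear
    equation with \<open>actt\<close>, as both terms of the difference do.\<close>
  define E where "E z = (\<chi> \<alpha> \<beta>. bb (F z $ \<alpha>) (F z $ \<beta>)) - HH (inv_into V \<phi> z)" for z
  have E0: "E z = 0" if z: "z \<in> W" for z
  proof (rule linear_system_zero[OF bounded_bilinear_actt W(2) z0(1) z])
    show "continuous_on W (\<lambda>z. om z w)" for w by (rule smooth_on_continuous[OF smooth_on_om[OF W(3,1)]])
    show "E z0 = 0"
      using gg_sym[OF qV, of 2 1] by (simp add: E_def vec_eq_iff forall_4 HH_nth F0 x0 gr gr' z0(2)[symmetric])
    fix y assume y: "y \<in> W"
    have dF: "((\<lambda>z. F z $ \<alpha>) has_derivative (\<lambda>w. actc (om y w) (F y) $ \<alpha>)) (at y)" for \<alpha>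
      by (rule bounded_linear.has_derivative[OF bounded_linear_vec_nth F[OF y]])
    have dH: "((\<lambda>z. HH (inv_into V \<phi> z)) has_derivative (\<lambda>w. actt (om y w) (HH (inv_into V \<phi> y)))) (at y)"
    proof -
      have "((HH \<circ> inv_into V \<phi>) has_derivative (\<lambda>w. w $ 1 *\<^sub>R pd 1 HH (inv_into V \<phi> y) + w $ 2 *\<^sub>R pd 2 HH (inv_into V \<phi> y))) (at y)"
        using has_pd[OF smooth_nearI[OF HH_smooth mem(3)[OF y]] mem(3)[OF y]] by (simp add: mem(2)[OF y])
      then show ?thesis
        by (simp add: o_def HH_derivative[OF mem(3)[OF y]] om_def bounded_bilinear.add_left[OF bounded_bilinear_actt]
            bounded_bilinear.scaleR_left[OF bounded_bilinear_actt])
    qed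
    have dG: "((\<lambda>z. (\<chi> \<alpha> \<beta>. bb (F z $ \<alpha>) (F z $ \<beta>)) :: complex^4^4) has_derivative
        (\<lambda>w. actt (om y w) (\<chi> \<alpha> \<beta>. bb (F y $ \<alpha>) (F y $ \<beta>)))) (at y)"
    proof (rule has_derivative_vecI, rule has_derivative_vecI)
      fix \<alpha> \<beta>
      have "((\<lambda>z. bb (F z $ \<alpha>) (F z $ \<beta>)) has_derivative
          (\<lambda>w. bb (F y $ \<alpha>) (actc (om y w) (F y) $ \<beta>) + bb (actc (om y w) (F y) $ \<alpha>) (F y $ \<beta>))) (at y)"
        by (rule bounded_bilinear.FDERIV[OF bounded_bilinear_bb dF dF])
      moreover have "bb (F y $ \<alpha>) (actc (om y w) (F y) $ \<beta>) + bb (actc (om y w) (F y) $ \<alpha>) (F y $ \<beta>) =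
          actt (om y w) (\<chi> \<alpha> \<beta>. bb (F y $ \<alpha>) (F y $ \<beta>)) $ \<alpha> $ \<beta>" for w
        unfolding actc_4 bb_add bb_scale actt_def vector_add_component
        by (simp add: matrix_matrix_mult_def transpose_def sum_4 algebra_simps)
      ultimately show "((\<lambda>z. ((\<chi> \<alpha> \<beta>. bb (F z $ \<alpha>) (F z $ \<beta>)) :: complex^4^4) $ \<alpha> $ \<beta>) has_derivative
          (\<lambda>w. actt (om y w) (\<chi> \<alpha> \<beta>. bb (F y $ \<alpha>) (F y $ \<beta>)) $ \<alpha> $ \<beta>)) (at y)" by simp
    qed
    show "(E has_derivative (\<lambda>w. actt (om y w) (E y))) (at y)"
      unfolding E_def[abs_def] bounded_bilinear.diff_right[OF bounded_bilinear_actt]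
      by (rule has_derivative_diff[OF dG dH])
  qed
  have gram: "bb (F z $ \<alpha>) (F z $ \<beta>) = HH (inv_into V \<phi> z) $ \<alpha> $ \<beta>" if "z \<in> W" for z \<alpha> \<beta>
  proof -
    have "E z $ \<alpha> $ \<beta> = 0" using E0[OF that] by simp
    then show ?thesis by (simp add: E_def)
  qed
  have Fn: "smooth_on (\<lambda>z. F z $ \<alpha>) W" for \<alpha> by (rule smooth_on_nth[OF W(1) Fs])
  define \<sigma> \<nu> where "\<sigma> p = F (\<phi> p) $ 1" and "\<nu> p = F (\<phi> p) $ 4" for p
  have sm: "smooth_fun S \<A> ?U \<sigma>" "smooth_fun S \<A> ?U \<nu>"
    unfolding \<sigma>_def \<nu>_def by (rule smooth_fun_of_chart[OF W(1,3) Fn])+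
  have pdF: "pd i (\<lambda>q. F (\<phi> q) $ \<alpha>) p = actc (CC i p) (F (\<phi> p)) $ \<alpha>" if p: "p \<in> ?U" for i \<alpha> p
  proof -
    have pW: "\<phi> p \<in> W" using p mem(2) by auto
    have pV: "p \<in> V" using p UV by blast
    have "((\<lambda>z. F z $ \<alpha>) has_derivative (\<lambda>w. actc (om (\<phi> p) w) (F (\<phi> p)) $ \<alpha>)) (at (\<phi> p))"
      by (rule bounded_linear.has_derivative[OF bounded_linear_vec_nth F[OF pW]])
    then have "((\<lambda>q. F (\<phi> q) $ \<alpha>) \<circ> inv_into V \<phi> has_derivative (\<lambda>w. actc (om (\<phi> p) w) (F (\<phi> p)) $ \<alpha>)) (at (\<phi> p))"
      by (rule has_derivative_transform_within_open[OF _ W(1) pW]) (simp add: mem(2))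
    from pdI[OF this, of i] show ?thesis
      using exhaust_2[of i] by (auto simp: om_def \<psi>\<phi>[OF pV] axis_def)
  qed
  \<comment> \<open>The first row of \<open>CC i\<close> is a unit vector, so the two middle entries
    of \<open>F\<close> are the partial derivatives of \<open>\<sigma>\<close>.\<close>
  have pd\<sigma>: "pd 1 \<sigma> p = F (\<phi> p) $ 2" "pd 2 \<sigma> p = F (\<phi> p) $ 3"
    and pd\<nu>: "pd i \<nu> p = mat (PP i 1 p) ** F (\<phi> p) $ 2 + mat (PP i 2 p) ** F (\<phi> p) $ 3" if "p \<in> ?U" for p i
    unfolding \<sigma>_def[abs_def] \<nu>_def[abs_def] pdF[OF that]
    by (simp_all add: actc_4 CC_nth cmat_eq_iff mat_mult_nth)
  have "gsol ?U \<sigma> \<nu>"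
    unfolding gsol_def
  proof (intro conjI sm ballI)
    fix p assume p: "p \<in> ?U"
    have pW: "\<phi> p \<in> W" using p mem(2) by auto
    have pV: "p \<in> V" using p UV by blast
    note near = smooth_nearI[OF sm(1) p] smooth_nearI[OF sm(2) p]
    have G: "bb (F (\<phi> p) $ \<alpha>) (F (\<phi> p) $ \<beta>) = HH p $ \<alpha> $ \<beta>" for \<alpha> \<beta>
      using gram[OF pW] by (simp add: \<psi>\<phi>[OF pV])
    show "bb (\<sigma> p) (\<sigma> p) = - 1" "bb (\<nu> p) (\<nu> p) = 1" "bb (\<nu> p) (\<sigma> p) = 0"
      by (simp_all add: \<sigma>_def \<nu>_def G HH_nth)
    have push: "pushforward \<sigma> (dv p a) = mat (a $ 1) ** F (\<phi> p) $ 2 + mat (a $ 2) ** F (\<phi> p) $ 3" for a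
      by (simp add: pushforward_dv[OF pV near(1)] pd\<sigma>[OF p])
    fix v assume "v \<in> ctangent_space S \<A> p"
    then obtain a where a: "v = dv p a" using ctangent_eq[OF pV] by blast
    show "bb (\<nu> p) (pushforward \<sigma> v) = 0"
      by (simp add: a push bb_add bb_scale \<nu>_def G HH_nth)
    show "pushforward \<nu> v = pushforward \<sigma> (\<Psi> p v)"
      unfolding a \<Psi>_dv[OF pV] push pushforward_dv[OF pV near(2)] pd\<nu>[OF p]
      by (simp add: cmat_eq_iff mat_mult_nth algebra_simps)
    fix w assume "w \<in> ctangent_space S \<A> p"
    then obtain c where c: "w = dv p c" using ctangent_eq[OF pV] by blast
    show "bb (pushforward \<sigma> v) (pushforward \<sigma> w) = g p v w"
      unfolding a c push g_dv[OF pV] by (simp add: bb_add bb_scale G HH_nth algebra_simps)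
  qed
  moreover have "jet \<sigma> \<nu> q = b"
  proof -
    have qz: "\<phi> q = z0" using mem(2)[OF z0(1)] z0(2) by simp
    have "pushforward \<sigma> v = L v" if "v \<in> ctangent_space S \<A> q" for v
    proof -
      obtain a where a: "v = dv q a" using ctangent_eq[OF qV] \<open>v \<in> _\<close> by blast
      show ?thesis unfolding a Ldv by (simp add: pushforward_dv[OF qV smooth_nearI[OF sm(1) q]] pd\<sigma>[OF q] qz F0 x0)
    qed
    moreover have "L v = 0" if "v \<notin> ctangent_space S \<A> q" for v using fc that by blast
    ultimately show ?thesis by (auto simp: jet_def bd \<sigma>_def \<nu>_def qz F0 x0 fun_eq_iff)
  qed
  ultimately show ?thesis by blast
qed

end

end

section \<open>Congruence of frames\<close>

text \<open>Over the complex numbers a nondegenerate form is a sum of two squares: completing the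
  square if \<open>a\<close> is nonzero, and starting from the isotropic pair 1, \<open>\<i>\<close>
  if it is 0.\<close>

lemma symmetric_form_square_root:
  assumes "a * d - b * b \<noteq> (0::complex)"
  shows "\<exists>x1 y1 x2 y2. a = x1 * x1 + y1 * y1 \<and> b = x1 * x2 + y1 * y2 \<and> d = x2 * x2 + y2 * y2"
proof (cases "a = 0")
  case True
  \<comment> \<open>With \<open>x1 = 1\<close> and \<open>y1 = \<i>\<close>, the value
    \<open>x2 + \<i> * y2\<close> has to be \<open>b\<close>, and its product with
    \<open>x2 - \<i> * y2\<close> has to be \<open>d\<close>; so the latter is
    \<open>d / b\<close>.\<close>
  define t where "t = d / b"
  have b: "b \<noteq> 0" using assms True by auto
  have "a = 1 * 1 + \<i> * \<i>" using True by simp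
  moreover have "b = 1 * ((b + t) / 2) + \<i> * ((b - t) / (2 * \<i>))" by (simp add: field_simps)
  moreover have "d = (b + t) / 2 * ((b + t) / 2) + (b - t) / (2 * \<i>) * ((b - t) / (2 * \<i>))"
  proof -
    have "(b + t) / 2 * ((b + t) / 2) + (b - t) / (2 * \<i>) * ((b - t) / (2 * \<i>)) = b * t"
      by (simp add: field_simps)
    then show ?thesis using b by (simp add: t_def)
  qed
  ultimately show ?thesis by blast
next
  case False
  define x1 y2 where "x1 = csqrt a" and "y2 = csqrt (d - b * b / a)"
  have x: "x1 * x1 = a" "y2 * y2 = d - b * b / a"
    using power2_csqrt[of a] power2_csqrt[of "d - b * b / a"] by (simp_all add: x1_def y2_def power2_eq_square)
  have x0: "x1 \<noteq> 0" using False by (simp add: x1_def)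
  have "a = x1 * x1 + 0 * 0" "b = x1 * (b / x1) + 0 * y2" using x x0 by simp_all
  moreover have "d = b / x1 * (b / x1) + y2 * y2" by (simp add: x)
  ultimately show ?thesis by blast
qed

lemma mm_distrib: "(X + Y) ** Z = X ** Z + Y ** Z" "Z ** (X + Y) = Z ** X + Z ** Y" for X Y Z :: cmat
  by (simp_all add: cmat_eq_iff mm_nth algebra_simps)

lemma mat_mult_pull: "X ** (mat c ** Y) = mat c ** (X ** Y)" "(mat c ** X) ** Y = mat c ** (X ** Y)" for X Y :: cmat
  by (simp_all add: cmat_eq_iff mm_nth mat_nth algebra_simps)

text \<open>Cayley-Hamilton, as \<open>bb X X\<close> is minus the determinant. The next lemma is
  its polarization for orthogonal matrices.\<close>

lemma traceless_square: "trace X = 0 \<Longrightarrow> X ** X = mat (bb X X)"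
  by (simp add: trace_2 cmat_eq_iff mm_nth mat_nth bb_def field_simps add_eq_0_iff)

lemma traceless_anticommute:
  assumes "trace X = 0" "trace Y = 0" "bb X Y = 0"
  shows "Y ** X = mat (- 1) ** (X ** Y)"
proof -
  have t: "X$2$2 = - X$1$1" "Y$2$2 = - Y$1$1" using assms(1,2) by (simp_all add: trace_2 add_eq_0_iff)
  have "X$1$2 * Y$2$1 + X$2$1 * Y$1$2 = - 2 * (X$1$1 * Y$1$1)" using assms(3) by (simp add: bb_def t field_simps add_eq_0_iff)
  then show ?thesis by (simp add: cmat_eq_iff mm_nth mat_nth t algebra_simps)
qed

text \<open>Triples with the multiplication table of the Pauli matrices. The volume \<open>c\<close>
  records the orientation: by \<open>c2\<close> below it is a square root of
  \<open>- 1\<close>.\<close>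

locale pauli =
  fixes x1 x2 x3 :: cmat and c :: complex
  assumes tr: "trace x1 = 0" "trace x2 = 0" "trace x3 = 0"
    and unit: "bb x1 x1 = 1" "bb x2 x2 = 1" "bb x3 x3 = 1"
    and orth: "bb x1 x2 = 0" "bb x1 x3 = 0" "bb x2 x3 = 0"
    and vol: "trace (x1 ** x2 ** x3) = 2 * c"
begin

lemma bb_one: "bb X (mat 1) = - trace X / 2" "bb (mat 1) X = - trace X / 2"
  by (simp_all add: bb_def mat_nth trace_2 field_simps)

lemma zero:
  assumes "bb X (mat 1) = 0" "bb X x1 = 0" "bb X x2 = 0" "bb X x3 = 0"
  shows "X = 0"
proof (rule bb_orthogonal_zero[of "mat 1" x3 x1 x2])
  show "bb (mat 1) (mat 1) = - 1" by (simp add: bb_one trace_2 mat_nth)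
qed (use assms in \<open>simp_all add: tr unit orth bb_one\<close>)

lemma expand: "X = mat (trace X / 2) + mat (bb X x1) ** x1 + mat (bb X x2) ** x2 + mat (bb X x3) ** x3"
proof -
  have s: "bb x2 x1 = 0" "bb x3 x1 = 0" "bb x3 x2 = 0" using orth by (simp_all add: bb_sym)
  define Y where "Y = mat (trace X / 2) ** mat 1 + mat (bb X x1) ** x1 + mat (bb X x2) ** x2 + mat (bb X x3) ** x3"
  have "X - Y = 0"
  proof (rule zero)
    show "bb (X - Y) (mat 1) = 0"
      unfolding Y_def bb_diff bb_add bb_scale unfolding bb_one tr by (simp add: trace_2 mat_nth field_simps)
    show "bb (X - Y) x1 = 0" "bb (X - Y) x2 = 0" "bb (X - Y) x3 = 0"
      unfolding Y_def bb_diff bb_add bb_scale unfolding bb_one tr unit orth s by simp_all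
  qed
  then show ?thesis by (simp add: Y_def)
qed

lemma sq: "x1 ** x1 = mat 1" "x2 ** x2 = mat 1" "x3 ** x3 = mat 1"
  using tr unit by (simp_all add: traceless_square)

text \<open>The product is traceless and, by cyclicity of the trace, orthogonal to both factors; so
  it is a multiple of \<open>x3\<close>, and the volume tells which.\<close>

lemma x12: "x1 ** x2 = mat c ** x3"
proof -
  have t: "trace (x1 ** x2) = 0" using bb_traceless[OF tr(1,2)] orth by simp
  have a: "x2 ** x1 = mat (- 1) ** (x1 ** x2)" by (rule traceless_anticommute[OF tr(1,2) orth(1)])
  have cyc: "trace (X ** Y) = trace (Y ** X)" for X Y :: cmat by (simp add: trace_2 mm_nth algebra_simps)
  have "trace (x1 ** x2 ** x1) = trace (x1 ** (x1 ** x2))" by (rule cyc)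
  also have "\<dots> = trace x2" by (simp add: matrix_mul_assoc sq)
  finally have 1: "bb (x1 ** x2) x1 = 0" using bb_traceless[OF t tr(1)] tr by simp
  have "trace (x1 ** x2 ** x2) = trace x1" by (simp add: matrix_mul_assoc[symmetric] sq)
  then have 2: "bb (x1 ** x2) x2 = 0" using bb_traceless[OF t tr(2)] tr by simp
  have 3: "bb (x1 ** x2) x3 = c" using bb_traceless[OF t tr(3)] vol by simp
  have "x1 ** x2 = mat 0 + mat 0 ** x1 + mat 0 ** x2 + mat c ** x3"
    by (rule expand[of "x1 ** x2", unfolded t 1 2 3 div_0])
  also have "\<dots> = mat c ** x3" by (simp add: cmat_eq_iff mat_mult_nth mat_nth)
  finally show ?thesis .
qed

lemma anti: "x2 ** x1 = mat (- 1) ** (x1 ** x2)" "x3 ** x1 = mat (- 1) ** (x1 ** x3)" "x3 ** x2 = mat (- 1) ** (x2 ** x3)"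
  by (rule traceless_anticommute[OF _ _ orth(1)] traceless_anticommute[OF _ _ orth(2)] traceless_anticommute[OF _ _ orth(3)]; rule tr)+

lemma c2: "c * c = - 1"
proof -
  have "(x1 ** x2) ** (x1 ** x2) = x1 ** (x2 ** x1) ** x2" by (simp add: matrix_mul_assoc)
  also have "\<dots> = mat (- 1) ** (x1 ** x1 ** (x2 ** x2))" unfolding anti by (simp only: mat_mult_pull matrix_mul_assoc[symmetric])
  also have "\<dots> = mat (- 1)" by (simp add: sq)
  finally have "(mat c ** x3) ** (mat c ** x3) = mat (- 1)" unfolding x12 .
  moreover have "(mat c ** x3) ** (mat c ** x3) = mat (c * c) ** (x3 ** x3)"
    by (simp add: cmat_eq_iff mm_nth mat_nth algebra_simps)
  ultimately have "mat (c * c) ** (x3 ** x3) = mat (- 1)" by simp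
  then show ?thesis unfolding sq by (simp add: cmat_eq_iff mat_mult_nth mat_nth)
qed

lemma x13: "x1 ** x3 = mat (- c) ** x2"
proof -
  have "x1 ** (x1 ** x2) = mat c ** (x1 ** x3)" unfolding x12 by (simp only: mat_mult_pull)
  then have "x2 = mat c ** (x1 ** x3)" by (simp add: matrix_mul_assoc sq)
  then have "mat (- c) ** x2 = mat (- c) ** (mat c ** (x1 ** x3))" by simp
  also have "\<dots> = mat (- (c * c)) ** (x1 ** x3)" by (simp add: cmat_eq_iff mat_mult_nth)
  finally show ?thesis by (simp add: c2)
qed

lemma x23: "x2 ** x3 = mat c ** x1"
proof -
  have "(x2 ** x1) ** x2 = mat (- 1) ** (x1 ** x2 ** x2)" unfolding anti by (simp add: mat_mult_pull)
  also have "\<dots> = mat (- 1) ** x1" by (simp add: matrix_mul_assoc[symmetric] sq)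
  finally have "x2 ** (x1 ** x2) = mat (- 1) ** x1" by (simp add: matrix_mul_assoc)
  then have "mat c ** (x2 ** x3) = mat (- 1) ** x1" unfolding x12 by (simp only: mat_mult_pull)
  then have "mat (- c) ** (mat c ** (x2 ** x3)) = mat (- c) ** (mat (- 1) ** x1)" by simp
  moreover have "mat (- c) ** (mat c ** (x2 ** x3)) = mat (- (c * c)) ** (x2 ** x3)" "mat (- c) ** (mat (- 1) ** x1) = mat c ** x1"
    by (simp_all add: cmat_eq_iff mat_mult_nth)
  ultimately show ?thesis by (simp add: c2)
qed

end

text \<open>The average of a matrix over the group generated by the two frames intertwines them.\<close>

lemma pauli_conjugate:
  assumes x: "pauli x1 x2 x3 c" and y: "pauli y1 y2 y3 c"
  shows "\<exists>P\<in>SL2. P ** x1 = y1 ** P \<and> P ** x2 = y2 ** P \<and> P ** x3 = y3 ** P"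
proof -
  interpret x: pauli x1 x2 x3 c by (rule x)
  interpret y: pauli y1 y2 y3 c by (rule y)
  \<comment> \<open>Each \<open>x\<close> is its own inverse, so every term conjugates
    \<open>M\<close> from one frame to the other. Scalars of the two groups cancel as both tables
    have the same \<open>c\<close>, which leaves four terms of the average.\<close>
  define T where "T M = M + y1 ** M ** x1 + y2 ** M ** x2 + y3 ** M ** x3" for M
  have T: "T M ** x1 = y1 ** T M" "T M ** x2 = y2 ** T M" "T M ** x3 = y3 ** T M" for M
  proof -
    have xr: "x2 ** x1 = mat (- c) ** x3" "x3 ** x1 = mat c ** x2" "x1 ** x2 = mat c ** x3" "x3 ** x2 = mat (- c) ** x1"
      "x1 ** x3 = mat (- c) ** x2" "x2 ** x3 = mat c ** x1"
      unfolding x.anti x.x12 x.x13 x.x23 by (simp_all add: cmat_eq_iff mat_mult_nth)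
    have yr: "y2 ** y1 = mat (- c) ** y3" "y3 ** y1 = mat c ** y2" "y1 ** y2 = mat c ** y3" "y3 ** y2 = mat (- c) ** y1"
      "y1 ** y3 = mat (- c) ** y2" "y2 ** y3 = mat c ** y1"
      unfolding y.anti y.x12 y.x13 y.x23 by (simp_all add: cmat_eq_iff mat_mult_nth)
    have yr': "a ** (b ** X) = Z ** X" if "a ** b = Z" for a b X Z :: cmat
      using that by (simp add: matrix_mul_assoc)
    note e = mm_distrib matrix_mul_assoc[symmetric] xr x.sq yr[THEN yr'] y.sq[THEN yr'] mat_mult_pull
    show "T M ** x1 = y1 ** T M" "T M ** x2 = y2 ** T M" "T M ** x3 = y3 ** T M"
      unfolding T_def e by (simp_all add: cmat_eq_iff mat_mult_nth)
  qed
  have "\<exists>M. T M \<noteq> 0"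
  proof (rule ccontr)
    assume "\<not> (\<exists>M. T M \<noteq> 0)"
    \<comment> \<open>Summing these entries over the matrix units of the first column turns the
      three frame terms into multiples of the traces of the \<open>y\<close>, which vanish, while
      the term \<open>M\<close> contributes 2.\<close>
    then have "T (m2 1 0 0 0) $ 1 $ 1 + T (m2 0 0 1 0) $ 2 $ 1 = 0" by simp
    moreover have "T (m2 1 0 0 0) $ 1 $ 1 + T (m2 0 0 1 0) $ 2 $ 1 = 2 + trace y1 * x1$1$1 + trace y2 * x2$1$1 + trace y3 * x3$1$1"
      by (simp add: T_def mm_nth trace_2 algebra_simps)
    ultimately show False by (simp add: y.tr)
  qed
  then obtain M where M: "T M \<noteq> 0" by blast
  define P where "P = T M"
  have d: "det P \<noteq> 0"
  proof
    assume d: "det P = 0"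
    \<comment> \<open>For singular \<open>P\<close> the product of \<open>P\<close> with its
      adjugate is 0, and moving \<open>x1\<close>, \<open>x2\<close>, \<open>x3\<close> through
      \<open>P\<close> shows that \<open>P ** X ** Q\<close> is 0 on a basis. Applied to matrix
      units, this kills every entry of \<open>P\<close>.\<close>
    define Q where "Q = adj2 P"
    have PQ: "P ** Q = 0" using adj2_inverse(1)[of P] by (simp add: Q_def d cmat_eq_iff mat_nth)
    have z: "P ** x1 ** Q = 0" "P ** x2 ** Q = 0" "P ** x3 ** Q = 0"
      unfolding P_def T by (simp_all add: matrix_mul_assoc[symmetric] PQ[unfolded P_def])
    have "P ** X ** Q = 0" for X
    proof -
      have m: "P ** mat t ** Q = mat t ** (P ** Q)" for t by (simp add: cmat_eq_iff mm_nth mat_nth algebra_simps)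
      have "P ** X ** Q = P ** (mat (trace X / 2) + mat (bb X x1) ** x1 + mat (bb X x2) ** x2 + mat (bb X x3) ** x3) ** Q"
        by (rule arg_cong[OF x.expand[of X], of "\<lambda>X. P ** X ** Q"])
      also have "\<dots> = 0" unfolding mm_distrib mat_mult_pull m PQ using z by simp
      finally show ?thesis .
    qed
    from this[of "m2 1 0 0 0"] this[of "m2 0 1 0 0"] this[of "m2 0 0 1 0"] this[of "m2 0 0 0 1"]
    have "P = 0" by (auto simp: Q_def cmat_eq_iff mm_nth)
    then show False using M by (simp add: P_def)
  qed
  define r where "r = csqrt (det P)"
  have r: "r \<noteq> 0" "r * r = det P" using d power2_csqrt[of "det P"] by (simp_all add: r_def power2_eq_square)
  have "det (mat (1 / r) ** P) = 1 / r * (1 / r) * det P" by (simp add: det_2 mat_mult_nth algebra_simps)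
  also have "\<dots> = 1" unfolding r(2)[symmetric] using r(1) by simp
  finally have "mat (1 / r) ** P \<in> SL2" by (simp add: SL2_def)
  moreover have "(mat (1 / r) ** P) ** x1 = y1 ** (mat (1 / r) ** P)" "(mat (1 / r) ** P) ** x2 = y2 ** (mat (1 / r) ** P)"
    "(mat (1 / r) ** P) ** x3 = y3 ** (mat (1 / r) ** P)"
    unfolding mat_mult_pull P_def T by (rule refl)+
  ultimately show ?thesis by blast
qed

section \<open>Global existence and rigidity\<close>

context gc_chart
begin

lemma orthonormal_frame:
  assumes p: "p \<in> V"
  shows "\<exists>u\<in>ctangent_space S \<A> p. \<exists>w\<in>ctangent_space S \<A> p. g p u u = 1 \<and> g p w w = 1 \<and> g p u w = 0 \<and>
     (\<forall>v\<in>ctangent_space S \<A> p. v = vadd (vscale (g p u v) u) (vscale (g p w v) w))"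
proof -
  have "gg 1 1 p * gg 2 2 p - gg 1 2 p * gg 1 2 p \<noteq> 0"
    using dg_nonzero[OF p] by (simp add: dg_def gg_sym[OF p, of 2 1])
  from symmetric_form_square_root[OF this] obtain x1 y1 x2 y2 where
    G: "gg 1 1 p = x1 * x1 + y1 * y1" "gg 1 2 p = x1 * x2 + y1 * y2" "gg 2 2 p = x2 * x2 + y2 * y2" by blast
  have G21: "gg 2 1 p = x1 * x2 + y1 * y2" using G(2) gg_sym[OF p, of 2 1] by simp
  define D where "D = x1 * y2 - x2 * y1"
  have "dg p = D * D" by (simp add: dg_def G G21 D_def algebra_simps)
  then have D: "D \<noteq> 0" using dg_nonzero[OF p] by auto
  \<comment> \<open>The columns of the inverse of the square root with rows \<open>(x1, x2)\<close>
    and \<open>(y1, y2)\<close>, hence an orthonormal frame.\<close>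
  define b c :: "complex^2" where "b = vector [y2 / D, - y1 / D]" and "c = vector [- x2 / D, x1 / D]"
  have xy: "x1 * b$1 + x2 * b$2 = 1" "y1 * b$1 + y2 * b$2 = 0" "x1 * c$1 + x2 * c$2 = 0" "y1 * c$1 + y2 * c$2 = 1"
    using D by (simp_all add: b_def c_def diff_divide_distrib[symmetric] add_divide_distrib[symmetric] mult.commute) (simp_all add: D_def algebra_simps)
  have gdv: "g p (dv p a) (dv p a') = (x1 * a$1 + x2 * a$2) * (x1 * a'$1 + x2 * a'$2) + (y1 * a$1 + y2 * a$2) * (y1 * a'$1 + y2 * a'$2)" for a a'
    by (simp add: g_dv[OF p] G G21 algebra_simps)
  have span: "dv p a = vadd (vscale (g p (dv p b) (dv p a)) (dv p b)) (vscale (g p (dv p c) (dv p a)) (dv p c))" for a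
  proof -
    define s t where "s = x1 * a$1 + x2 * a$2" and "t = y1 * a$1 + y2 * a$2"
    have "s * y2 - t * x2 = a $ 1 * D" "t * x1 - s * y1 = a $ 2 * D" by (simp_all add: s_def t_def D_def algebra_simps)
    then have "(s * y2 - t * x2) / D = a $ 1" "(t * x1 - s * y1) / D = a $ 2" using D by simp_all
    then have "a = s *s b + t *s c" using D by (simp add: vec_eq_iff forall_2 b_def c_def diff_divide_distrib)
    moreover have "g p (dv p b) (dv p a) = s" "g p (dv p c) (dv p a) = t"
      unfolding gdv xy by (simp_all add: s_def t_def)
    ultimately show ?thesis by (simp add: vadd_dv vscale_dv)
  qed
  show ?thesis
  proof (rule bexI[of _ "dv p b"], rule bexI[of _ "dv p c"], intro conjI ballI)
    show "g p (dv p b) (dv p b) = 1" "g p (dv p c) (dv p c) = 1" "g p (dv p b) (dv p c) = 0"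
      unfolding gdv xy by simp_all
    show "v = vadd (vscale (g p (dv p b) v) (dv p b)) (vscale (g p (dv p c) v) (dv p c))" if v: "v \<in> ctangent_space S \<A> p" for v
    proof -
      obtain a where "v = dv p a" using v ctangent_eq[OF p] by blast
      then show ?thesis using span[of a] by simp
    qed
  qed (rule dv_ctangent[OF p])+
qed

text \<open>The model frame at the identity: the orthonormal vectors \<open>u\<close>,
  \<open>w\<close> go to the two off-diagonal Pauli matrices, and the diagonal one is the
  normal.\<close>

lemma adapted_frame_exists:
  assumes p: "p \<in> V"
  shows "\<exists>b. b \<in> adapted_frames p"
proof -
  obtain u w where uw: "u \<in> ctangent_space S \<A> p" "w \<in> ctangent_space S \<A> p"
    "g p u u = 1" "g p w w = 1" "g p u w = 0"
    and span: "\<And>v. v \<in> ctangent_space S \<A> p \<Longrightarrow> v = vadd (vscale (g p u v) u) (vscale (g p w v) w)"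
    using orthonormal_frame[OF p] by blast
  have gs: "g p v v' = g p u v * g p u v' + g p w v * g p w v'"
    if v: "v \<in> ctangent_space S \<A> p" and v': "v' \<in> ctangent_space S \<A> p" for v v'
  proof -
    have "g p v v' = g p v' v" by (rule g_sym[OF in_S[OF p] v v'])
    also have "\<dots> = g p v' (vadd (vscale (g p u v) u) (vscale (g p w v) w))" using span[OF v] by simp
    also have "\<dots> = g p u v * g p v' u + g p w v * g p v' w"
      by (simp add: g_add[OF in_S[OF p] v'] g_scale[OF in_S[OF p] v'] vscale_in p uw)
    finally show ?thesis by (simp add: g_sym[OF in_S[OF p] v' uw(1)] g_sym[OF in_S[OF p] v' uw(2)])
  qed
  define L where "L v = (if v \<in> ctangent_space S \<A> p then m2 0 (g p u v - \<i> * g p w v) (g p u v + \<i> * g p w v) 0 else 0)" for v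
  have "(mat 1, L, m2 1 0 0 (- 1)) \<in> adapted_frames p"
    unfolding adapted_frames_def mem_Collect_eq prod.case
  proof (intro conjI ballI allI impI)
    show "bb (mat 1) (mat 1) = - 1" "bb (m2 1 0 0 (- 1)) (m2 1 0 0 (- 1)) = 1" "bb (m2 1 0 0 (- 1)) (mat 1) = 0"
      by (simp_all add: bb_def mat_nth)
    show "L v = 0" if "v \<notin> ctangent_space S \<A> p" for v using that by (simp add: L_def)
    fix v assume v: "v \<in> ctangent_space S \<A> p"
    show "bb (L v) (mat 1) = 0" "bb (m2 1 0 0 (- 1)) (L v) = 0" using v by (simp_all add: L_def bb_def mat_nth)
    show "L (vscale c v) = mat c ** L v" for c
      using v vscale_in[OF p v, of c] by (simp add: L_def g_scale[OF in_S[OF p]] uw cmat_eq_iff mat_mult_nth algebra_simps)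
    fix v' assume v': "v' \<in> ctangent_space S \<A> p"
    show "L (vadd v v') = L v + L v'"
      using v v' vadd_in[OF p v v'] by (simp add: L_def g_add[OF in_S[OF p]] uw cmat_eq_iff algebra_simps)
    show "bb (L v) (L v') = g p v v'"
      unfolding gs[OF v v'] using v v' by (simp add: L_def bb_def field_simps)
  qed
  then show ?thesis by blast
qed

lemma gauss_codazzi_in_chart:
  assumes "\<And>U X Y p. cfield S \<A> U X \<Longrightarrow> cfield S \<A> U Y \<Longrightarrow> p \<in> U \<Longrightarrow> d_nabla S \<A> nabla \<Psi> X Y p = vzero"
    and "\<And>p. p \<in> S \<Longrightarrow> gauss_curvature S \<A> g nabla p = - 1 + endo_det (ctangent_space S \<A> p) (\<Psi> p)"
    and p: "p \<in> V"
  shows "Cod l p = 0" "- Rl 1 2 p = (- 1 + PD p) * dg p"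
proof -
  show "Cod l p = 0"
    by (rule Cod_zero[OF p assms(1)[OF fr_field[OF V_openin order_refl] fr_field[OF V_openin order_refl] p]])
  have "- Rl 1 2 p / dg p = - 1 + PD p"
    using assms(2)[OF in_S[OF p]] unfolding gauss_curvature_Rl[OF p] endo_det_PD[OF p] .
  then show "- Rl 1 2 p = (- 1 + PD p) * dg p" using dg_nonzero[OF p] by (simp only: divide_eq_eq) simp
qed

end

context gc_data
begin

lemma gc_chartI: "(V, \<phi>) \<in> \<A> \<Longrightarrow> gc_chart S \<A> g nabla \<Psi> V \<phi>"
  using gc_data_axioms surface_axioms by (simp add: gc_chart_def surface_chart_def surface_chart_axioms_def)

lemma gc_chart_at:
  assumes "p \<in> S"
  obtains V \<phi> where "gc_chart S \<A> g nabla \<Psi> V \<phi>" "p \<in> V"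
proof -
  obtain V \<phi> where "(V, \<phi>) \<in> \<A>" "p \<in> V" using atlas_cover[OF assms] by blast
  then show ?thesis using that gc_chartI by blast
qed

lemma gsol_gauss:
  assumes s: "gsol S \<sigma> \<nu>" and pS: "p \<in> S"
  shows "gauss_curvature S \<A> g nabla p = - 1 + endo_det (ctangent_space S \<A> p) (\<Psi> p)"
proof -
  obtain V \<phi> where c: "gc_chart S \<A> g nabla \<Psi> V \<phi>" and p: "p \<in> V" by (rule gc_chart_at[OF pS])
  interpret gc_chart S \<A> g nabla \<Psi> V \<phi> by (rule c)
  show ?thesis
    unfolding gauss_curvature_Rl[OF p] endo_det_PD[OF p] sol_codazzi_gauss(2)[OF gsol_subset[OF s V_openin V_subset] order_refl p]
    using dg_nonzero[OF p] by simp
qed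

lemma gsol_codazzi:
  assumes s: "gsol S \<sigma> \<nu>" and XY: "cfield S \<A> U X" "cfield S \<A> U Y" "p \<in> U"
  shows "d_nabla S \<A> nabla \<Psi> X Y p = vzero"
proof -
  have "p \<in> S" using cfield_openin[OF XY(1)] XY(3) openin_imp_subset by blast
  then obtain V \<phi> where c: "gc_chart S \<A> g nabla \<Psi> V \<phi>" and p: "p \<in> V" by (rule gc_chart_at)
  interpret gc_chart S \<A> g nabla \<Psi> V \<phi> by (rule c)
  show ?thesis
    by (rule d_nabla_zero[OF p sol_codazzi_gauss(1)[OF gsol_subset[OF s V_openin V_subset] order_refl p] XY])
qed

text \<open>On a coordinate ball inside both domains, \<open>gsol_unique\<close> propagates
  agreement from any point to any other. This form makes agreement open for the continuation, and
  locally constant for rigidity.\<close>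

lemma jets_agree_near:
  assumes s: "gsol U \<sigma> \<nu>" "gsol U' \<sigma>' \<nu>'" and p: "p \<in> U" "p \<in> U'"
  shows "\<exists>N. openin (top_of_set S) N \<and> p \<in> N \<and>
     (\<forall>x\<in>N. \<forall>y\<in>N. jet \<sigma> \<nu> x = jet \<sigma>' \<nu>' x \<longrightarrow> jet \<sigma> \<nu> y = jet \<sigma>' \<nu>' y)"
proof -
  have pS: "p \<in> S" using p gsolD(4)[OF s(1)] by blast
  obtain V \<phi> where c: "gc_chart S \<A> g nabla \<Psi> V \<phi>" and pV: "p \<in> V" by (rule gc_chart_at[OF pS])
  interpret gc_chart S \<A> g nabla \<Psi> V \<phi> by (rule c)
  have o: "openin (top_of_set S) (U \<inter> U' \<inter> V)"
    by (intro openin_Int gsolD(3)[OF s(1)] gsolD(3)[OF s(2)] V_openin)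
  have "open (\<phi> ` (U \<inter> U' \<inter> V))" by (rule open_image[OF o]) simp
  moreover have "\<phi> p \<in> \<phi> ` (U \<inter> U' \<inter> V)" using p pV by blast
  ultimately obtain r where r: "0 < r" "ball (\<phi> p) r \<subseteq> \<phi> ` (U \<inter> U' \<inter> V)" by (rule openE)
  have bV: "ball (\<phi> p) r \<subseteq> \<phi> ` V" using r(2) by blast
  define N where "N = inv_into V \<phi> ` ball (\<phi> p) r"
  have oN: "openin (top_of_set S) N" unfolding N_def by (rule openin_chart_preimage[OF chart open_ball bV])
  have pN: "p \<in> N" unfolding N_def using \<psi>\<phi>[OF pV] r(1) by (metis centre_in_ball imageI)
  have sub: "N \<subseteq> U \<inter> U'"
  proof
    fix x assume "x \<in> N"
    then obtain z where z: "z \<in> ball (\<phi> p) r" "x = inv_into V \<phi> z" unfolding N_def by blast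
    then obtain y where "y \<in> U \<inter> U' \<inter> V" "z = \<phi> y" using r(2) by blast
    then show "x \<in> U \<inter> U'" using z(2) \<psi>\<phi> by auto
  qed
  have sN: "gsol N \<sigma> \<nu>" "gsol N \<sigma>' \<nu>'"
    by (rule gsol_subset[OF s(1) oN], use sub in blast, rule gsol_subset[OF s(2) oN], use sub in blast)
  have "jet \<sigma> \<nu> y = jet \<sigma>' \<nu>' y" if "x \<in> N" "y \<in> N" "jet \<sigma> \<nu> x = jet \<sigma>' \<nu>' x" for x y
    by (rule gsol_unique[OF open_ball convex_ball bV sN[unfolded N_def] that(1)[unfolded N_def] that(3) that(2)[unfolded N_def]])
  then show ?thesis using oN pN by blast
qed


end

context gc_data
begin

text \<open>Monodromy with jets as sheets over preimages of coordinate balls: convexity gives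
  connected members and local existence, and jets determine solutions without reference to a
  chart.\<close>

theorem gsol_exists_global:
  assumes S: "simply_connected S"
    and codazzi: "\<And>U X Y p. cfield S \<A> U X \<Longrightarrow> cfield S \<A> U Y \<Longrightarrow> p \<in> U \<Longrightarrow> d_nabla S \<A> nabla \<Psi> X Y p = vzero"
    and gauss: "\<And>p. p \<in> S \<Longrightarrow> gauss_curvature S \<A> g nabla p = - 1 + endo_det (ctangent_space S \<A> p) (\<Psi> p)"
  shows "\<exists>\<sigma> \<nu>. gsol S \<sigma> \<nu>"
proof (cases "S = {}")
  case True
  \<comment> \<open>The empty set satisfies \<open>simply_connected\<close> but offers no base
    point.\<close>
  have "openin (top_of_set S) S" by simp
  then have "gsol S (\<lambda>_. 0) (\<lambda>_. 0)"
    unfolding gsol_def by (intro conjI smooth_fun_const ballI; simp add: True)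
  then show ?thesis by blast
next
  case False
  then obtain p0 where p0: "p0 \<in> S" by blast
  define \<U> where "\<U> = {inv_into V \<phi> ` ball z r | V \<phi> z r. (V, \<phi>) \<in> \<A> \<and> ball z r \<subseteq> \<phi> ` V}"
  define sols where "sols U = {jet \<sigma> \<nu> | \<sigma> \<nu>. gsol U \<sigma> \<nu>}" for U
  have \<U>E: "\<exists>V \<phi> z r. gc_chart S \<A> g nabla \<Psi> V \<phi> \<and> (V, \<phi>) \<in> \<A> \<and> ball z r \<subseteq> \<phi> ` V \<and> U = inv_into V \<phi> ` ball z r" if U: "U \<in> \<U>" for U
  proof -
    obtain V \<phi> z r where "(V, \<phi>) \<in> \<A>" "ball z r \<subseteq> \<phi> ` V" "U = inv_into V \<phi> ` ball z r"
      using U unfolding \<U>_def mem_Collect_eq by (elim exE conjE)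
    with gc_chartI show ?thesis by (intro exI[of _ V] exI[of _ \<phi>] exI[of _ z] exI[of _ r]) simp
  qed
  interpret monodromy S \<U> sols adapted_frames
  proof
    fix p assume "p \<in> S"
    then obtain V \<phi> where c: "gc_chart S \<A> g nabla \<Psi> V \<phi>" and pV: "p \<in> V" by (rule gc_chart_at)
    interpret gc_chart S \<A> g nabla \<Psi> V \<phi> by (rule c)
    obtain r where r: "0 < r" "ball (\<phi> p) r \<subseteq> \<phi> ` V"
      using openE[OF open_image[OF V_openin order_refl] imageI[OF pV]] by blast
    have "p \<in> inv_into V \<phi> ` ball (\<phi> p) r" using \<psi>\<phi>[OF pV] r(1) by (metis centre_in_ball imageI)
    then show "\<exists>U\<in>\<U>. p \<in> U" using r(2) chart unfolding \<U>_def by blast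
  next
    fix U assume "U \<in> \<U>"
    from \<U>E[OF this] obtain V \<phi> z r where c: "gc_chart S \<A> g nabla \<Psi> V \<phi>" "(V, \<phi>) \<in> \<A>" "ball z r \<subseteq> \<phi> ` V"
      and U: "U = inv_into V \<phi> ` ball z r" by blast
    show "openin (top_of_set S) U" unfolding U by (rule openin_chart_preimage[OF c(2) open_ball c(3)])
    show "path_connected U"
      unfolding U
      by (rule path_connected_continuous_image[OF continuous_on_subset[OF _ c(3)] convex_imp_path_connected[OF convex_ball]])
        (use chart_homeomorphism(2)[OF c(2)] in \<open>simp add: homeomorphism_def\<close>)
    { fix f h q x assume fh: "f \<in> sols U" "h \<in> sols U" "q \<in> U" "f q = h q" "x \<in> U"
      obtain \<sigma> \<nu> \<sigma>' \<nu>' where f: "f = jet \<sigma> \<nu>" "gsol U \<sigma> \<nu>" and h: "h = jet \<sigma>' \<nu>'" "gsol U \<sigma>' \<nu>'"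
        using fh(1,2) unfolding sols_def by blast
      show "f x = h x" unfolding f(1) h(1)
        by (rule gc_chart.gsol_unique[OF c(1) open_ball convex_ball c(3) f(2)[unfolded U] h(2)[unfolded U] fh(3)[unfolded U]
              fh(4)[unfolded f(1) h(1)] fh(5)[unfolded U]]) }
    { fix q b assume q: "q \<in> U" and b: "b \<in> adapted_frames q"
      have "\<exists>\<sigma> \<nu>. gsol (inv_into V \<phi> ` ball z r) \<sigma> \<nu> \<and> jet \<sigma> \<nu> q = b"
        by (rule gc_chart.gsol_exists[OF c(1) gc_chart.gauss_codazzi_in_chart(1)[OF c(1) codazzi gauss]
              gc_chart.gauss_codazzi_in_chart(2)[OF c(1) codazzi gauss] open_ball convex_ball c(3) q[unfolded U] b])
      then show "\<exists>f\<in>sols U. f q = b" unfolding sols_def U[symmetric] by blast }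
  next
    fix U f q assume "U \<in> \<U>" "f \<in> sols U" "q \<in> U"
    then show "f q \<in> adapted_frames q" unfolding sols_def using jet_adapted by blast
  next
    fix U U' f h q assume "U \<in> \<U>" "U' \<in> \<U>" and fh: "f \<in> sols U" "h \<in> sols U'" "q \<in> U" "q \<in> U'" "f q = h q"
    obtain \<sigma> \<nu> \<sigma>' \<nu>' where f: "f = jet \<sigma> \<nu>" "gsol U \<sigma> \<nu>" and h: "h = jet \<sigma>' \<nu>'" "gsol U' \<sigma>' \<nu>'"
      using fh(1,2) unfolding sols_def by blast
    obtain N where "openin (top_of_set S) N" "q \<in> N" "\<forall>x\<in>N. \<forall>y\<in>N. f x = h x \<longrightarrow> f y = h y"
      using jets_agree_near[OF f(2) h(2) fh(3,4)] unfolding f(1) h(1) by blast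
    then show "\<exists>N. openin (top_of_set S) N \<and> q \<in> N \<and> (\<forall>x\<in>N. f x = h x)" using fh(5) by blast
  qed
  obtain V0 \<phi>0 where c0: "gc_chart S \<A> g nabla \<Psi> V0 \<phi>0" and p0V: "p0 \<in> V0" by (rule gc_chart_at[OF p0])
  obtain b0 where b0: "b0 \<in> adapted_frames p0" using gc_chart.adapted_frame_exists[OF c0 p0V] by blast
  obtain F where F: "\<And>U. U \<in> \<U> \<Longrightarrow> U \<noteq> {} \<Longrightarrow> \<exists>f\<in>sols U. \<forall>x\<in>U. F x = f x"
    using global_solution[OF S p0 b0] by blast
  define \<sigma> \<nu> where "\<sigma> p = fst (F p)" and "\<nu> p = snd (snd (F p))" for p
  have "gsol S \<sigma> \<nu>"
  proof (rule gsol_local)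
    fix p assume "p \<in> S"
    then obtain U where U: "U \<in> \<U>" "p \<in> U" using cover by blast
    then obtain f where f: "f \<in> sols U" "\<And>x. x \<in> U \<Longrightarrow> F x = f x" using F[OF U(1)] by blast
    obtain \<sigma>' \<nu>' where s: "f = jet \<sigma>' \<nu>'" "gsol U \<sigma>' \<nu>'" using f(1) unfolding sols_def by blast
    have "gsol U \<sigma> \<nu>"
      by (rule gsol_cong[OF s(2)]) (simp_all add: \<sigma>_def \<nu>_def f(2) s(1) jet_def)
    then show "\<exists>N. p \<in> N \<and> gsol N \<sigma> \<nu>" using U(2) by blast
  qed simp
  then show ?thesis by blast
qed

text \<open>Multiplication from both sides is linear and, for determinant 1, preserves
  \<open>bb\<close>; so it passes through every condition of \<open>gsol\<close>.\<close>

lemma gsol_action: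
  assumes s: "gsol U \<sigma> \<nu>" and d: "det A = 1" "det C = 1"
  shows "gsol U (\<lambda>p. A ** \<sigma> p ** C) (\<lambda>p. A ** \<nu> p ** C)"
    and "p \<in> U \<Longrightarrow> v \<in> ctangent_space S \<A> p \<Longrightarrow> pushforward (\<lambda>p. A ** \<sigma> p ** C) v = A ** pushforward \<sigma> v ** C"
proof -
  note e = gsolD[OF s]
  have b: "bb (A ** X ** C) (A ** Y ** C) = bb X Y" for X Y by (simp add: bb_mult_left bb_mult_right d)
  have sm: "smooth_fun S \<A> U (\<lambda>p. A ** s p ** C)" if "smooth_fun S \<A> U s" for s :: "'a \<Rightarrow> cmat"
    by (intro smooth_fun_mm smooth_fun_const[OF e(3)] that)
  have push: "pushforward (\<lambda>p. A ** s p ** C) v = A ** pushforward s v ** C"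
    if "smooth_fun S \<A> U s" "p \<in> U" "v \<in> ctangent_space S \<A> p" for s :: "'a \<Rightarrow> cmat" and p v
  proof -
    have pS: "p \<in> S" using that(2) e(4) by blast
    have As: "smooth_fun S \<A> U (\<lambda>p. A ** s p)" by (intro smooth_fun_mm smooth_fun_const[OF e(3)] that)
    show ?thesis
      unfolding pushforward_mult_const(1)[OF pS that(3) smooth_nearI[OF As that(2)]]
        pushforward_mult_const(2)[OF pS that(3) smooth_nearI[OF that(1,2)]] ..
  qed
  have Pin: "\<Psi> p v \<in> ctangent_space S \<A> p" if "p \<in> U" "v \<in> ctangent_space S \<A> p" for p v
    using \<Psi>_in that e(4) by blast
  show "p \<in> U \<Longrightarrow> v \<in> ctangent_space S \<A> p \<Longrightarrow> pushforward (\<lambda>p. A ** \<sigma> p ** C) v = A ** pushforward \<sigma> v ** C"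
    by (rule push[OF e(1)])
  show "gsol U (\<lambda>p. A ** \<sigma> p ** C) (\<lambda>p. A ** \<nu> p ** C)"
    unfolding gsol_def using sm[OF e(1)] sm[OF e(2)] e(5-10) by (simp add: b push[OF e(1)] push[OF e(2)] Pin)
qed

text \<open>Left translation to the identity makes the frame traceless and keeps it orthonormal. The
  factor \<open>\<i>\<close> converts the normalization of \<open>SL2_volume\<close> into that of
  \<open>pauli\<close>.\<close>

lemma gsol_pauli:
  assumes s: "gsol U \<sigma> \<nu>" and p: "p \<in> U" and u: "u \<in> ctangent_space S \<A> p" and w: "w \<in> ctangent_space S \<A> p"
    and g: "g p u u = 1" "g p w w = 1" "g p u w = 0"
  shows "pauli (matrix_inv (\<sigma> p) ** pushforward \<sigma> u) (matrix_inv (\<sigma> p) ** pushforward \<sigma> w) (matrix_inv (\<sigma> p) ** \<nu> p)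
     (\<i> * SL2_volume (\<sigma> p) (pushforward \<sigma> u) (pushforward \<sigma> w) (\<nu> p))"
proof -
  note d = gsolD[OF s]
  have A: "\<sigma> p \<in> SL2" using d(5)[OF p] by (simp add: SL2_iff)
  then have Ai: "det (matrix_inv (\<sigma> p)) = 1" using adj2_SL2 by (simp add: SL2_matrix_inv SL2_def)
  have b: "bb (matrix_inv (\<sigma> p) ** X) (matrix_inv (\<sigma> p) ** Y) = bb X Y" for X Y by (simp add: bb_mult_left Ai)
  have t: "trace (matrix_inv (\<sigma> p) ** X) = 0" if "bb X (\<sigma> p) = 0" for X
    using bb_trace[of "\<sigma> p" "matrix_inv (\<sigma> p) ** X"] that A by (simp add: SL2_inv_mult SL2_def)
  have n: "bb (pushforward \<sigma> v) (\<nu> p) = 0" if "v \<in> ctangent_space S \<A> p" for v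
    using d(8)[OF p that] bb_sym[of "pushforward \<sigma> v" "\<nu> p"] by simp
  show ?thesis
  proof
    show "trace (matrix_inv (\<sigma> p) ** pushforward \<sigma> u) = 0" "trace (matrix_inv (\<sigma> p) ** pushforward \<sigma> w) = 0"
      "trace (matrix_inv (\<sigma> p) ** \<nu> p) = 0"
      using pushforward_tangent[OF d(1,5) p] u w d(7)[OF p] by (simp_all add: t)
  qed (simp_all add: b d(10)[OF p] d(6)[OF p] n u w g SL2_volume_def)
qed

text \<open>Corresponding normals give the two translated frames at \<open>p0\<close> the same
  \<open>c\<close>, which is what \<open>pauli_conjugate\<close> needs. Once the jets match at
  \<open>p0\<close>, connectedness spreads the agreement.\<close>

theorem gsol_congruent:
  assumes S: "simply_connected S" and s: "gsol S \<sigma> \<nu>" "gsol S \<sigma>' \<nu>'"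
    and cn: "corresponding_normals S \<A> \<sigma> \<nu> \<sigma>' \<nu>'"
  shows "\<exists>A\<in>SL2. \<exists>B\<in>SL2. \<forall>p\<in>S. \<sigma>' p = SL2_action A B (\<sigma> p)"
proof (cases "S = {}")
  case True
  then show ?thesis using mat1_SL2 by blast
next
  case False
  then obtain p0 where p0: "p0 \<in> S" by blast
  obtain V \<phi> where c: "gc_chart S \<A> g nabla \<Psi> V \<phi>" and pV: "p0 \<in> V" by (rule gc_chart_at[OF p0])
  obtain u w where uw: "u \<in> ctangent_space S \<A> p0" "w \<in> ctangent_space S \<A> p0"
    and gu: "g p0 u u = 1" "g p0 w w = 1" "g p0 u w = 0"
    and span: "\<And>v. v \<in> ctangent_space S \<A> p0 \<Longrightarrow> v = vadd (vscale (g p0 u v) u) (vscale (g p0 w v) w)"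
    using gc_chart.orthonormal_frame[OF c pV] by blast
  have vol: "SL2_volume (\<sigma> p0) (pushforward \<sigma> u) (pushforward \<sigma> w) (\<nu> p0) =
      SL2_volume (\<sigma>' p0) (pushforward \<sigma>' u) (pushforward \<sigma>' w) (\<nu>' p0)"
    using cn p0 uw unfolding corresponding_normals_def by blast
  have A0: "\<sigma> p0 \<in> SL2" "\<sigma>' p0 \<in> SL2" using gsolD(5)[OF s(1) p0] gsolD(5)[OF s(2) p0] by (simp_all add: SL2_iff)
  obtain P where P: "P \<in> SL2"
    "P ** (matrix_inv (\<sigma> p0) ** pushforward \<sigma> u) = (matrix_inv (\<sigma>' p0) ** pushforward \<sigma>' u) ** P"
    "P ** (matrix_inv (\<sigma> p0) ** pushforward \<sigma> w) = (matrix_inv (\<sigma>' p0) ** pushforward \<sigma>' w) ** P"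
    "P ** (matrix_inv (\<sigma> p0) ** \<nu> p0) = (matrix_inv (\<sigma>' p0) ** \<nu>' p0) ** P"
    using pauli_conjugate[OF gsol_pauli[OF s(1) p0 uw gu] gsol_pauli[OF s(2) p0 uw gu, folded vol]] by blast
  \<comment> \<open>Chosen so that the action of \<open>A\<close> and \<open>P\<close> sends
    \<open>\<sigma> p0 ** V\<close> to \<open>\<sigma>' p0\<close> times the conjugate of
    \<open>V\<close> by \<open>P\<close>.\<close>
  define A where "A = \<sigma>' p0 ** P ** matrix_inv (\<sigma> p0)"
  have inv: "matrix_inv X \<in> SL2" "X ** matrix_inv X = mat 1" "matrix_inv X ** X = mat 1" if "X \<in> SL2" for X
    using adj2_SL2[OF that] adj2_inverse[of X] that by (simp_all add: SL2_matrix_inv SL2_def)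
  have A: "A \<in> SL2" unfolding A_def by (intro SL2_mult A0 P(1) inv)
  have move: "A ** X ** matrix_inv P = X'" if "P ** (matrix_inv (\<sigma> p0) ** X) = (matrix_inv (\<sigma>' p0) ** X') ** P" for X X'
  proof -
    have "A ** X ** matrix_inv P = \<sigma>' p0 ** (P ** (matrix_inv (\<sigma> p0) ** X)) ** matrix_inv P"
      by (simp add: A_def matrix_mul_assoc)
    also have "\<dots> = (\<sigma>' p0 ** (matrix_inv (\<sigma>' p0) ** X')) ** (P ** matrix_inv P)"
      unfolding that by (simp only: matrix_mul_assoc)
    finally show ?thesis by (simp add: inv(2)[OF P(1)] SL2_inv_mult(2)[OF A0(2)])
  qed
  define \<tau> \<mu> where "\<tau> p = A ** \<sigma> p ** matrix_inv P" and "\<mu> p = A ** \<nu> p ** matrix_inv P" for p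
  have dets: "det A = 1" "det (matrix_inv P) = 1" using A inv(1)[OF P(1)] by (simp_all add: SL2_def)
  have st: "gsol S \<tau> \<mu>" and pt: "pushforward \<tau> v = A ** pushforward \<sigma> v ** matrix_inv P" if "v \<in> ctangent_space S \<A> p0" for v
    unfolding \<tau>_def[abs_def] \<mu>_def[abs_def] by (rule gsol_action[OF s(1) dets], rule gsol_action(2)[OF s(1) dets p0 that])
  have "P ** (matrix_inv (\<sigma> p0) ** \<sigma> p0) = (matrix_inv (\<sigma>' p0) ** \<sigma>' p0) ** P"
    by (simp add: inv(3)[OF A0(1)] inv(3)[OF A0(2)])
  then have j1: "\<tau> p0 = \<sigma>' p0" unfolding \<tau>_def by (rule move)
  have j2: "\<mu> p0 = \<nu>' p0" unfolding \<mu>_def by (rule move[OF P(4)])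
  have "pushforward \<tau> v = pushforward \<sigma>' v" if v: "v \<in> ctangent_space S \<A> p0" for v
  proof -
    have "pushforward \<tau> u = pushforward \<sigma>' u" "pushforward \<tau> w = pushforward \<sigma>' w"
      unfolding pt[OF uw(1)] pt[OF uw(2)] by (rule move[OF P(2)], rule move[OF P(3)])
    then have "pushforward \<tau> (vadd (vscale a u) (vscale b w)) = pushforward \<sigma>' (vadd (vscale a u) (vscale b w))" for a b
      by (simp add: pushforward_vadd pushforward_vscale)
    then show ?thesis by (subst (1 2) span[OF v])
  qed
  then have j: "jet \<tau> \<mu> p0 = jet \<sigma>' \<nu>' p0" using j1 j2 by (simp add: jet_eq_iff)
  have stt: "gsol S \<tau> \<mu>" by (rule st[OF uw(1)])
  have conn: "connected S" by (rule path_connected_imp_connected[OF simply_connected_path_connected[OF S]])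
  have "\<sigma>' p = SL2_action A P (\<sigma> p)" if p: "p \<in> S" for p
  proof -
    define R where "R x y \<longleftrightarrow> (jet \<tau> \<mu> x = jet \<sigma>' \<nu>' x \<longleftrightarrow> jet \<tau> \<mu> y = jet \<sigma>' \<nu>' y)" for x y
    have "R p0 p"
    proof (rule connected_equivalence_relation[OF conn p0 p])
      fix a assume a: "a \<in> S"
      obtain N where N: "openin (top_of_set S) N" "a \<in> N"
        "\<And>x y. x \<in> N \<Longrightarrow> y \<in> N \<Longrightarrow> jet \<tau> \<mu> x = jet \<sigma>' \<nu>' x \<Longrightarrow> jet \<tau> \<mu> y = jet \<sigma>' \<nu>' y"
        using jets_agree_near[OF stt s(2) a a] by blast
      have "R a x" if "x \<in> N" for x unfolding R_def using N(3)[OF N(2) that] N(3)[OF that N(2)] by (rule iffI)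
      then show "\<exists>T. openin (top_of_set S) T \<and> a \<in> T \<and> (\<forall>x\<in>T. R a x)" using N(1,2) by blast
    qed (simp_all add: R_def)
    then have "jet \<tau> \<mu> p = jet \<sigma>' \<nu>' p" using j by (simp add: R_def)
    then have "\<tau> p = \<sigma>' p" by (simp add: jet_eq_iff)
    then show ?thesis by (simp add: \<tau>_def SL2_action_def)
  qed
  then show ?thesis using A P(1) by blast
qed

end

theorem theorem1:
  fixes S :: "'a::topological_space set" and \<A> :: "'a atlas"
    and g :: "'a cmetric" and nabla :: "'a cconn"
    and \<Psi> :: "'a \<Rightarrow> 'a cvec \<Rightarrow> 'a cvec" and D :: SL2_conn
  assumes "smooth_surface S \<A>" and "simply_connected S"
    and "complex_metric S \<A> g" and "levi_civita S \<A> g nabla"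
    and "bundle_endo S \<A> \<Psi>" and "self_adjoint S \<A> g \<Psi>"
    and "SL2_levi_civita D"
  shows "(((\<forall>U X Y. cfield S \<A> U X \<and> cfield S \<A> U Y \<longrightarrow>
              (\<forall>p\<in>U. d_nabla S \<A> nabla \<Psi> X Y p = vzero)) \<and>
           (\<forall>p\<in>S. gauss_curvature S \<A> g nabla p =
              - 1 + endo_det (ctangent_space S \<A> p) (\<Psi> p)))
          \<longleftrightarrow> (\<exists>\<sigma> \<nu>. isometric_immersion S \<A> g \<sigma> \<and> shape_operator S \<A> D \<sigma> \<nu> \<Psi>))
       \<and> (\<forall>\<sigma> \<nu> \<sigma>' \<nu>'.
            isometric_immersion S \<A> g \<sigma> \<and> shape_operator S \<A> D \<sigma> \<nu> \<Psi> \<and>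
            isometric_immersion S \<A> g \<sigma>' \<and> shape_operator S \<A> D \<sigma>' \<nu>' \<Psi> \<and>
            corresponding_normals S \<A> \<sigma> \<nu> \<sigma>' \<nu>' \<longrightarrow>
            (\<exists>A\<in>SL2. \<exists>B\<in>SL2. SL2_action A B \<in> Isom0_SL2 \<and>
               (\<forall>p\<in>S. \<sigma>' p = SL2_action A B (\<sigma> p))))"
proof -
  interpret gc_data S \<A> g nabla \<Psi> by unfold_locales (use assms in auto)
  note iff = gsol_iff[OF assms(7)]
  show ?thesis
  proof (intro conjI iffI)
    assume h: "(\<forall>U X Y. cfield S \<A> U X \<and> cfield S \<A> U Y \<longrightarrow> (\<forall>p\<in>U. d_nabla S \<A> nabla \<Psi> X Y p = vzero)) \<and>
      (\<forall>p\<in>S. gauss_curvature S \<A> g nabla p = - 1 + endo_det (ctangent_space S \<A> p) (\<Psi> p))"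
    have "\<exists>\<sigma> \<nu>. gsol S \<sigma> \<nu>"
    proof (rule gsol_exists_global[OF assms(2)])
      fix U X Y p assume "cfield S \<A> U X" "cfield S \<A> U Y" "p \<in> U"
      then show "d_nabla S \<A> nabla \<Psi> X Y p = vzero"
        using h[THEN conjunct1, THEN spec[of _ U], THEN spec[of _ X], THEN spec[of _ Y]] by simp
    next
      fix p assume "p \<in> S"
      then show "gauss_curvature S \<A> g nabla p = - 1 + endo_det (ctangent_space S \<A> p) (\<Psi> p)"
        by (rule bspec[OF h[THEN conjunct2]])
    qed
    then show "\<exists>\<sigma> \<nu>. isometric_immersion S \<A> g \<sigma> \<and> shape_operator S \<A> D \<sigma> \<nu> \<Psi>" unfolding iff .
  next
    assume "\<exists>\<sigma> \<nu>. isometric_immersion S \<A> g \<sigma> \<and> shape_operator S \<A> D \<sigma> \<nu> \<Psi>"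
    then obtain \<sigma> \<nu> where s: "gsol S \<sigma> \<nu>" unfolding iff by blast
    show "\<forall>U X Y. cfield S \<A> U X \<and> cfield S \<A> U Y \<longrightarrow> (\<forall>p\<in>U. d_nabla S \<A> nabla \<Psi> X Y p = vzero)"
      by (intro allI impI ballI) (elim conjE, rule gsol_codazzi[OF s])
    show "\<forall>p\<in>S. gauss_curvature S \<A> g nabla p = - 1 + endo_det (ctangent_space S \<A> p) (\<Psi> p)"
      by (intro ballI) (rule gsol_gauss[OF s])
  next
    show "\<forall>\<sigma> \<nu> \<sigma>' \<nu>'.
       isometric_immersion S \<A> g \<sigma> \<and> shape_operator S \<A> D \<sigma> \<nu> \<Psi> \<and>
       isometric_immersion S \<A> g \<sigma>' \<and> shape_operator S \<A> D \<sigma>' \<nu>' \<Psi> \<and>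
       corresponding_normals S \<A> \<sigma> \<nu> \<sigma>' \<nu>' \<longrightarrow>
       (\<exists>A\<in>SL2. \<exists>B\<in>SL2. SL2_action A B \<in> Isom0_SL2 \<and> (\<forall>p\<in>S. \<sigma>' p = SL2_action A B (\<sigma> p)))"
    proof (intro allI impI, elim conjE)
      fix \<sigma> \<nu> \<sigma>' \<nu>'
      assume h: "isometric_immersion S \<A> g \<sigma>" "shape_operator S \<A> D \<sigma> \<nu> \<Psi>"
        "isometric_immersion S \<A> g \<sigma>'" "shape_operator S \<A> D \<sigma>' \<nu>' \<Psi>" and cn: "corresponding_normals S \<A> \<sigma> \<nu> \<sigma>' \<nu>'"
      have s: "gsol S \<sigma> \<nu>" "gsol S \<sigma>' \<nu>'" unfolding iff[symmetric] by (rule conjI[OF h(1,2)], rule conjI[OF h(3,4)])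
      show "\<exists>A\<in>SL2. \<exists>B\<in>SL2. SL2_action A B \<in> Isom0_SL2 \<and> (\<forall>p\<in>S. \<sigma>' p = SL2_action A B (\<sigma> p))"
        using gsol_congruent[OF assms(2) s cn] SL2_action_Isom0 by blast
    qed
  qed
qed

end
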